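(* Let $A$ be an irreducible affine Cartan matrix which is not of type $B_n^{(1)}, C_n^{(1)}, F_4^{(1)}, G_2^{(1)}$, and let $\mathcal A_{\tilde W}$ be the associated double affine Artin group, with elements $T_{01}=T_0$, $T_{02}=T_0^{-1}X_{\alpha_0}$, $T_{03}=X_{a_0^{-1}\theta}T_{s_\theta}^{-1}$. Let $\underline{\mathfrak a}$, $\underline{\mathfrak b}$ be the automorphisms of $\mathcal A_{\tilde W}$ which fix all $T_i$, $i\ne0$, and satisfy $$\underline{\mathfrak a}:\ T_{03}\mapsto T_{03},\quad T_{01}\mapsto T_{02},\quad T_{02}\mapsto T_{02}^{-1}T_{01}T_{02},$$ $$\underline{\mathfrak b}:\ T_{01}\mapsto T_{01},\quad T_{02}\mapsto T_{03},\quad T_{03}\mapsto T_{03}^{-1}T_{02}T_{03}.$$ Then the map sending $\mathfrak a$ and $\mathfrak b$ to $\underline{\mathfrak a}$ and $\underline{\mathfrak b}$, respectively, defines a group morphism $$\Upsilon:B_3\to\mathfrak G(\mathcal A_{\tilde W}),$$ where $B_3=\langle\mathfrak a,\mathfrak b\mid\mathfrak a\mathfrak b\mathfrak a=\mathfrak b\mathfrak a\mathfrak b\rangle$ is the braid group on three letters.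
   Context: $A=(a_{jk})_{0\le j,k\le n}$ is an irreducible affine Cartan matrix, labelled as in Kac's book, node $0$ being the affine node; types $B_n^{(1)}, C_n^{(1)}, F_4^{(1)}, G_2^{(1)}$ are excluded. In the Dynkin diagram distinct nodes $i,j$ are connected by $a_{ij}a_{ji}$ laces. The braid relation between elements $x,y$ attached to distinct nodes $i,j$ is $xyx\cdots=yxy\cdots$ with $m_{ij}$ factors on each side, $m_{ij}=2,3,4,6$ for $0,1,2,3$ laces (no relation for $4$ laces, which happens only when $n=1$). Root data. $(a_0,\dots,a_n)$, $(a_0^\vee,\dots,a_n^\vee)$ are Kac's numerical labels of $S(A)$ and $S(A^t)$ ($a_0=1$ except $a_0=2$ for $A_{2n}^{(2)}$). Let $\alpha_0,\dots,\alpha_n$ be the simple roots, $\delta=\sum_j a_j\alpha_j$, $\theta=\delta-a_0\alpha_0$, $d_j=a_j/a_j^\vee$; on the real span of the $\alpha_j$ take the form $(\alpha_j,\alpha_k)=d_j^{-1}a_{jk}$, and put $\alpha_j^\vee=d_j\alpha_j$, $s_j(x)=x-(x,\alpha_j^\vee)\alpha_j$. The affine Weyl group $W$ is generated by $s_0,\dots,s_n$, the finite Weyl group $\mathring W$ by $s_1,\dots,s_n$; $s_\theta\in\mathring W$ is the reflection in $\theta$, and $T_{s_\theta}=T_{j_1}\cdots T_{j_m}$ for a reduced decomposition $s_\theta=s_{j_1}\cdots s_{j_m}$. The lattice $\mathring Q$ is $\bigoplus_{j=1}^n\mathbb Z\alpha_j$, except for $A_{2n}^{(2)}$ where it is $\bigoplus_{j=1}^{n-1}\mathbb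 Z\alpha_j\oplus\mathbb Z\tfrac12\alpha_n$ (the weight lattice of the finite root system); $Q=\mathring Q\oplus\mathbb Z a_0^{-1}\delta$. Put $\hat\alpha_i^\vee=\alpha_i^\vee$ for all $i$, except $\hat\alpha_n^\vee=2\alpha_n^\vee$ (the coroot of $\frac12\alpha_n$) for $A_{2n}^{(2)}$. Groups. The affine Artin group $\mathcal A_W$ has generators $T_0,\dots,T_n$ and the braid relations for all pairs of distinct nodes. The double affine Artin group $\mathcal A_{\tilde W}$ is generated by $\mathcal A_W$, the lattice $\{X_\beta:\beta\in\mathring Q\}$ (with $X_\beta X_\gamma=X_{\beta+\gamma}$) and an element $X_{a_0^{-1}\delta}$, with $X_{\beta+k a_0^{-1}\delta}:=X_\beta X_{a_0^{-1}\delta}^k$, subject to, for all $0\le i\le n$ and $\beta\in\mathring Q$: (i) $X_{a_0^{-1}\delta}$ is central; (ii) $T_iX_\beta=X_\beta T_i$ if $(\beta,\hat\alpha_i^\vee)=0$; (iii) $T_iX_\beta T_i=X_{s_i(\beta)}$ if $(\beta,\hat\alpha_i^\vee)=-1$. The group $\mathcal A_{\tilde W}$ is generated by the $T_i$ ($i\neq0$) and $T_{01},T_{02},T_{03}$. The double affine Weyl group is $\tilde W=W\ltimes Q$ ($Q$ written as $\{\tau_\beta\}$, $w\tau_\beta w^{-1}=\tau_{w(\beta)}$), a quotient of $\mathcal A_{\tilde W}$ via $T_i\mapsto s_i$, $X_\beta\mapsto\tau_\beta$. $\mathrm{Aut}(\mathcal A_{\tilde W};\tilde W)$ is the group of automorphisms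 of $\mathcal A_{\tilde W}$ which descend to automorphisms of $\tilde W$, and $$\mathfrak G(\mathcal A_{\tilde W})=\{f\in\mathrm{Aut}(\mathcal A_{\tilde W};\tilde W)\mid f(T_i)=T_i\ (i\ne0),\ f(X_{a_0^{-1}\delta})=X_{a_0^{-1}\delta}\}.$$ *)

theory Defs
  imports Complex_Main "HOL-Algebra.Bij" "HOL-Algebra.Elementary_Groups"
begin

section \<open>Groups given by generators and relations\<close>

text \<open>A word is a list of signed generators: \<open>(g, True)\<close> is the letter \<open>g\<close> and
  \<open>(g, False)\<close> the letter \<open>g\<^sup>-\<^sup>1\<close>. A relation is a pair of words, read as an equation.\<close>

type_synonym 'g word = "('g \<times> bool) list"

inductive pres_eq :: "'g set \<Rightarrow> ('g word \<times> 'g word) set \<Rightarrow> 'g word \<Rightarrow> 'g word \<Rightarrow> bool"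
  for S :: "'g set" and R :: "('g word \<times> 'g word) set" where
  refl: "u \<in> lists (S \<times> UNIV) \<Longrightarrow> pres_eq S R u u"
| rel: "(u, v) \<in> R \<Longrightarrow> u \<in> lists (S \<times> UNIV) \<Longrightarrow> v \<in> lists (S \<times> UNIV) \<Longrightarrow> pres_eq S R u v"
| cancel: "g \<in> S \<Longrightarrow> pres_eq S R [(g, e), (g, \<not> e)] []"
| sym: "pres_eq S R u v \<Longrightarrow> pres_eq S R v u"
| trans: "pres_eq S R u v \<Longrightarrow> pres_eq S R v w \<Longrightarrow> pres_eq S R u w"
| append: "pres_eq S R u u' \<Longrightarrow> pres_eq S R v v' \<Longrightarrow> pres_eq S R (u @ v) (u' @ v')"

definition pres_class :: "'g set \<Rightarrow> ('g word \<times> 'g word) set \<Rightarrow> 'g word \<Rightarrow> 'g word set" where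
  "pres_class S R u = {v. pres_eq S R u v}"

definition presented_group :: "'g set \<Rightarrow> ('g word \<times> 'g word) set \<Rightarrow> 'g word set monoid" where
  "presented_group S R =
    \<lparr> carrier = pres_class S R ` lists (S \<times> UNIV),
      monoid.mult = (\<lambda>U V. {w. \<exists>u\<in>U. \<exists>v\<in>V. pres_eq S R (u @ v) w}),
      one = pres_class S R [] \<rparr>"

definition word_eval :: "('a, 'b) monoid_scheme \<Rightarrow> ('g \<Rightarrow> 'a) \<Rightarrow> 'g word \<Rightarrow> 'a" where
  "word_eval G \<phi> w =
    foldr (\<lambda>(g, e) y. (if e then \<phi> g else inv\<^bsub>G\<^esub> (\<phi> g)) \<otimes>\<^bsub>G\<^esub> y) w \<one>\<^bsub>G\<^esub>"

text \<open>The map out of a presented group induced by \<open>\<phi>\<close>; it is meaningful when the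
  relations hold in \<open>G\<close>, so that all words in a class have the same value.\<close>

definition pres_lift :: "('a, 'b) monoid_scheme \<Rightarrow> ('g \<Rightarrow> 'a) \<Rightarrow> 'g word set \<Rightarrow> 'a" where
  "pres_lift G \<phi> C = the_elem (word_eval G \<phi> ` C)"

datatype braid3_gen = Gen_a | Gen_b

definition B3_rels :: "(braid3_gen word \<times> braid3_gen word) set" where
  "B3_rels = {([(Gen_a, True), (Gen_b, True), (Gen_a, True)],
               [(Gen_b, True), (Gen_a, True), (Gen_b, True)])}"

definition B3 :: "braid3_gen word set monoid" where
  "B3 = presented_group UNIV B3_rels"

definition B3_a :: "braid3_gen word set" where
  "B3_a = pres_class UNIV B3_rels [(Gen_a, True)]"

definition B3_b :: "braid3_gen word set" where
  "B3_b = pres_class UNIV B3_rels [(Gen_b, True)]"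


section \<open>Affine Cartan matrices\<close>

text \<open>Matrices \<open>(A i j)\<close> with \<open>0 \<le> i, j \<le> n\<close>; entries outside this range are irrelevant.\<close>

definition generalized_cartan :: "nat \<Rightarrow> (nat \<Rightarrow> nat \<Rightarrow> int) \<Rightarrow> bool" where
  "generalized_cartan n A \<longleftrightarrow>
    (\<forall>i\<le>n. A i i = 2) \<and>
    (\<forall>i\<le>n. \<forall>j\<le>n. i \<noteq> j \<longrightarrow> A i j \<le> 0 \<and> (A i j = 0 \<longrightarrow> A j i = 0))"

definition irreducible_matrix :: "nat \<Rightarrow> (nat \<Rightarrow> nat \<Rightarrow> int) \<Rightarrow> bool" where
  "irreducible_matrix n A \<longleftrightarrow>
    (\<forall>J. J \<subseteq> {..n} \<and> J \<noteq> {} \<and> J \<noteq> {..n} \<longrightarrow> (\<exists>i\<in>J. \<exists>j\<in>{..n} - J. A i j \<noteq> 0))"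

definition mat_apply :: "nat \<Rightarrow> (nat \<Rightarrow> nat \<Rightarrow> int) \<Rightarrow> (nat \<Rightarrow> real) \<Rightarrow> nat \<Rightarrow> real" where
  "mat_apply n A v i = (\<Sum>j\<le>n. of_int (A i j) * v j)"

text \<open>Kac's definition of affine type: corank one, a positive null vector, and
  \<open>A v \<ge> 0\<close> only if \<open>A v = 0\<close>. The first two say that the kernel is the line
  spanned by a positive vector \<open>u\<close>.\<close>

definition affine_matrix :: "nat \<Rightarrow> (nat \<Rightarrow> nat \<Rightarrow> int) \<Rightarrow> bool" where
  "affine_matrix n A \<longleftrightarrow>
    (\<exists>u. (\<forall>j\<le>n. u j > 0) \<and> (\<forall>i\<le>n. mat_apply n A u i = 0) \<and>
         (\<forall>v. (\<forall>i\<le>n. mat_apply n A v i = 0) \<longrightarrow> (\<exists>c. \<forall>j\<le>n. v j = c * u j))) \<and>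
    (\<forall>v. (\<forall>i\<le>n. mat_apply n A v i \<ge> 0) \<longrightarrow> (\<forall>i\<le>n. mat_apply n A v i = 0))"

definition irreducible_affine_cartan :: "nat \<Rightarrow> (nat \<Rightarrow> nat \<Rightarrow> int) \<Rightarrow> bool" where
  "irreducible_affine_cartan n A \<longleftrightarrow>
    generalized_cartan n A \<and> irreducible_matrix n A \<and> affine_matrix n A"

text \<open>Kac's tables Aff 1--3. The argument \<open>n\<close> is always the rank, so that there are \<open>n + 1\<close> nodes:
  \<open>Aff1_X n\<close> is $X_n^{(1)}$, \<open>Aff2_A_even n\<close> is $A_{2n}^{(2)}$, \<open>Aff2_A_odd n\<close> is
  $A_{2n-1}^{(2)}$, \<open>Aff2_D n\<close> is $D_{n+1}^{(2)}$, and \<open>Aff2_E\<close>, \<open>Aff3_D\<close> are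
  $E_6^{(2)}$, $D_4^{(3)}$.\<close>

datatype affine_type =
    Aff1_A nat | Aff1_B nat | Aff1_C nat | Aff1_D nat | Aff1_E nat | Aff1_F | Aff1_G
  | Aff2_A_even nat | Aff2_A_odd nat | Aff2_D nat | Aff2_E | Aff3_D

fun type_rank :: "affine_type \<Rightarrow> nat" where
  "type_rank (Aff1_A n) = n"
| "type_rank (Aff1_B n) = n"
| "type_rank (Aff1_C n) = n"
| "type_rank (Aff1_D n) = n"
| "type_rank (Aff1_E n) = n"
| "type_rank Aff1_F = 4"
| "type_rank Aff1_G = 2"
| "type_rank (Aff2_A_even n) = n"
| "type_rank (Aff2_A_odd n) = n"
| "type_rank (Aff2_D n) = n"
| "type_rank Aff2_E = 4"
| "type_rank Aff3_D = 2"

fun valid_type :: "affine_type \<Rightarrow> bool" where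
  "valid_type (Aff1_A n) \<longleftrightarrow> n \<ge> 1"
| "valid_type (Aff1_B n) \<longleftrightarrow> n \<ge> 3"
| "valid_type (Aff1_C n) \<longleftrightarrow> n \<ge> 2"
| "valid_type (Aff1_D n) \<longleftrightarrow> n \<ge> 4"
| "valid_type (Aff1_E n) \<longleftrightarrow> n \<in> {6, 7, 8}"
| "valid_type Aff1_F \<longleftrightarrow> True"
| "valid_type Aff1_G \<longleftrightarrow> True"
| "valid_type (Aff2_A_even n) \<longleftrightarrow> n \<ge> 1"
| "valid_type (Aff2_A_odd n) \<longleftrightarrow> n \<ge> 3"
| "valid_type (Aff2_D n) \<longleftrightarrow> n \<ge> 2"
| "valid_type Aff2_E \<longleftrightarrow> True"
| "valid_type Aff3_D \<longleftrightarrow> True"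

text \<open>A bond \<open>(i, j, p, q)\<close> of the Dynkin diagram stands for \<open>A i j = - p\<close> and \<open>A j i = - q\<close>.
  If \<open>p > 1\<close>, the arrow points towards \<open>i\<close> (the shorter root).\<close>

definition chain :: "nat \<Rightarrow> nat \<Rightarrow> (nat \<times> nat \<times> int \<times> int) set" where
  "chain k l = {(i, Suc i, 1, 1) | i. k \<le> i \<and> i < l}"

fun bonds :: "affine_type \<Rightarrow> (nat \<times> nat \<times> int \<times> int) set" where
  "bonds (Aff1_A n) = (if n = 1 then {(0, 1, 2, 2)} else insert (0, n, 1, 1) (chain 0 n))"
| "bonds (Aff1_B n) = chain 1 (n - 1) \<union> {(0, 2, 1, 1), (n - 1, n, 1, 2)}"
| "bonds (Aff1_C n) = chain 1 (n - 1) \<union> {(0, 1, 1, 2), (n - 1, n, 2, 1)}"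
| "bonds (Aff1_D n) = chain 1 (n - 1) \<union> {(0, 2, 1, 1), (n - 2, n, 1, 1)}"
| "bonds (Aff1_E n) =
    (if n = 6 then chain 1 5 \<union> {(3, 6, 1, 1), (0, 6, 1, 1)}
     else if n = 7 then chain 0 6 \<union> {(3, 7, 1, 1)}
     else chain 0 7 \<union> {(5, 8, 1, 1)})"
| "bonds Aff1_F = {(0, 1, 1, 1), (1, 2, 1, 1), (2, 3, 1, 2), (3, 4, 1, 1)}"
| "bonds Aff1_G = {(0, 1, 1, 1), (1, 2, 1, 3)}"
| "bonds (Aff2_A_even n) =
    (if n = 1 then {(0, 1, 4, 1)} else chain 1 (n - 1) \<union> {(0, 1, 2, 1), (n - 1, n, 2, 1)})"
| "bonds (Aff2_A_odd n) = chain 1 (n - 1) \<union> {(0, 2, 1, 1), (n - 1, n, 2, 1)}"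
| "bonds (Aff2_D n) = chain 1 (n - 1) \<union> {(0, 1, 2, 1), (n - 1, n, 1, 2)}"
| "bonds Aff2_E = {(0, 1, 1, 1), (1, 2, 1, 1), (2, 3, 2, 1), (3, 4, 1, 1)}"
| "bonds Aff3_D = {(0, 1, 1, 1), (1, 2, 3, 1)}"

definition kac_labelled :: "affine_type \<Rightarrow> nat \<Rightarrow> (nat \<Rightarrow> nat \<Rightarrow> int) \<Rightarrow> bool" where
  "kac_labelled X n A \<longleftrightarrow> valid_type X \<and> n = type_rank X \<and>
    (\<forall>i\<le>n. A i i = 2) \<and>
    (\<forall>(i, j, p, q) \<in> bonds X. A i j = - p \<and> A j i = - q) \<and>
    (\<forall>i\<le>n. \<forall>j\<le>n. i \<noteq> j \<and> (\<nexists>p q. (i, j, p, q) \<in> bonds X \<or> (j, i, p, q) \<in> bonds X) \<longrightarrow> A i j = 0)"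

definition is_A2n_twisted :: "nat \<Rightarrow> (nat \<Rightarrow> nat \<Rightarrow> int) \<Rightarrow> bool" where
  "is_A2n_twisted n A \<longleftrightarrow> kac_labelled (Aff2_A_even n) n A"

text \<open>Kac's numerical labels: the coprime positive integers \<open>a\<^sub>0, \<dots>, a\<^sub>n\<close> with \<open>A a = 0\<close>
  (put \<open>a\<^sub>j = 0\<close> for \<open>j > n\<close>).\<close>

definition num_labels :: "nat \<Rightarrow> (nat \<Rightarrow> nat \<Rightarrow> int) \<Rightarrow> nat \<Rightarrow> nat" where
  "num_labels n A = (THE a. (\<forall>j\<le>n. a j > 0) \<and> (\<forall>j>n. a j = 0) \<and> Gcd (a ` {..n}) = 1 \<and>
     (\<forall>i\<le>n. (\<Sum>j\<le>n. A i j * int (a j)) = 0))"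

definition dual_labels :: "nat \<Rightarrow> (nat \<Rightarrow> nat \<Rightarrow> int) \<Rightarrow> nat \<Rightarrow> nat" where
  "dual_labels n A = num_labels n (\<lambda>i j. A j i)"


section \<open>Roots, lattices and Weyl groups\<close>

text \<open>A vector \<open>x\<close> stands for \<open>\<Sum>\<^sub>j x\<^sub>j \<alpha>\<^sub>j\<close>.\<close>

type_synonym vec = "nat \<Rightarrow> real"

definition root_space :: "nat \<Rightarrow> vec set" where
  "root_space n = {x. \<forall>j>n. x j = 0}"

definition vadd :: "vec \<Rightarrow> vec \<Rightarrow> vec" where
  "vadd x y = (\<lambda>j. x j + y j)"

definition vscale :: "real \<Rightarrow> vec \<Rightarrow> vec" where
  "vscale c x = (\<lambda>j. c * x j)"

definition simple_root :: "nat \<Rightarrow> vec" where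
  "simple_root i = (\<lambda>j. if j = i then 1 else 0)"

definition d_coeff :: "nat \<Rightarrow> (nat \<Rightarrow> nat \<Rightarrow> int) \<Rightarrow> nat \<Rightarrow> real" where
  "d_coeff n A j = real (num_labels n A j) / real (dual_labels n A j)"

definition form :: "nat \<Rightarrow> (nat \<Rightarrow> nat \<Rightarrow> int) \<Rightarrow> vec \<Rightarrow> vec \<Rightarrow> real" where
  "form n A x y = (\<Sum>j\<le>n. \<Sum>k\<le>n. x j * y k * (inverse (d_coeff n A j) * of_int (A j k)))"

definition simple_coroot :: "nat \<Rightarrow> (nat \<Rightarrow> nat \<Rightarrow> int) \<Rightarrow> nat \<Rightarrow> vec" where
  "simple_coroot n A j = vscale (d_coeff n A j) (simple_root j)"

definition hat_coroot :: "nat \<Rightarrow> (nat \<Rightarrow> nat \<Rightarrow> int) \<Rightarrow> nat \<Rightarrow> vec" where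
  "hat_coroot n A i =
    (if is_A2n_twisted n A \<and> i = n then vscale 2 (simple_coroot n A i) else simple_coroot n A i)"

definition delta_scaled :: "nat \<Rightarrow> (nat \<Rightarrow> nat \<Rightarrow> int) \<Rightarrow> vec" \<comment> \<open>\<open>a\<^sub>0\<^sup>-\<^sup>1 \<delta>\<close>\<close> where
  "delta_scaled n A = (\<lambda>j. real (num_labels n A j) / real (num_labels n A 0))"

definition theta :: "nat \<Rightarrow> (nat \<Rightarrow> nat \<Rightarrow> int) \<Rightarrow> vec" where
  "theta n A = (\<lambda>j. real (num_labels n A j) - real (num_labels n A 0) * simple_root 0 j)"

definition s_refl :: "nat \<Rightarrow> (nat \<Rightarrow> nat \<Rightarrow> int) \<Rightarrow> nat \<Rightarrow> vec \<Rightarrow> vec" where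
  "s_refl n A j = (\<lambda>x \<in> root_space n.
     vadd x (vscale (- form n A x (simple_coroot n A j)) (simple_root j)))"

definition s_theta :: "nat \<Rightarrow> (nat \<Rightarrow> nat \<Rightarrow> int) \<Rightarrow> vec \<Rightarrow> vec" where
  "s_theta n A = (\<lambda>x \<in> root_space n.
     vadd x (vscale (- (2 * form n A x (theta n A) / form n A (theta n A) (theta n A))) (theta n A)))"

definition affine_weyl :: "nat \<Rightarrow> (nat \<Rightarrow> nat \<Rightarrow> int) \<Rightarrow> (vec \<Rightarrow> vec) monoid" where
  "affine_weyl n A = subgroup_generated (BijGroup (root_space n)) (s_refl n A ` {0..n})"

definition s_prod :: "nat \<Rightarrow> (nat \<Rightarrow> nat \<Rightarrow> int) \<Rightarrow> nat list \<Rightarrow> vec \<Rightarrow> vec" where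
  "s_prod n A js = foldr (\<lambda>j w. s_refl n A j \<otimes>\<^bsub>affine_weyl n A\<^esub> w) js \<one>\<^bsub>affine_weyl n A\<^esub>"

text \<open>Reduced decompositions are taken in the finite Weyl group, generated by \<open>s\<^sub>1, \<dots>, s\<^sub>n\<close>.\<close>

definition reduced_decomposition ::
  "nat \<Rightarrow> (nat \<Rightarrow> nat \<Rightarrow> int) \<Rightarrow> nat list \<Rightarrow> (vec \<Rightarrow> vec) \<Rightarrow> bool" where
  "reduced_decomposition n A js w \<longleftrightarrow>
    js \<in> lists {1..n} \<and> s_prod n A js = w \<and>
    (\<forall>ks \<in> lists {1..n}. s_prod n A ks = w \<longrightarrow> length js \<le> length ks)"

definition Q_fin :: "nat \<Rightarrow> (nat \<Rightarrow> nat \<Rightarrow> int) \<Rightarrow> vec set" where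
  "Q_fin n A = {x \<in> root_space n. x 0 = 0 \<and>
     (\<forall>j\<in>{1..n}. (if is_A2n_twisted n A \<and> j = n then 2 * x j else x j) \<in> \<int>)}"

definition Q_aff :: "nat \<Rightarrow> (nat \<Rightarrow> nat \<Rightarrow> int) \<Rightarrow> vec set" where
  "Q_aff n A = {vadd \<beta> (vscale (of_int k) (delta_scaled n A)) | \<beta> k. \<beta> \<in> Q_fin n A}"

text \<open>The pair \<open>(\<beta>, w)\<close> is the element \<open>\<tau>\<^sub>\<beta> w\<close> of \<open>W \<ltimes> Q\<close>.\<close>

definition double_affine_weyl :: "nat \<Rightarrow> (nat \<Rightarrow> nat \<Rightarrow> int) \<Rightarrow> (vec \<times> (vec \<Rightarrow> vec)) monoid" where
  "double_affine_weyl n A =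
    \<lparr> carrier = Q_aff n A \<times> carrier (affine_weyl n A),
      monoid.mult = (\<lambda>(\<beta>, w) (\<gamma>, v). (vadd \<beta> (w \<gamma>), w \<otimes>\<^bsub>affine_weyl n A\<^esub> v)),
      one = (\<lambda>_. 0, \<one>\<^bsub>affine_weyl n A\<^esub>) \<rparr>"


section \<open>The double affine Artin group\<close>

text \<open>\<open>GT i\<close>, \<open>GX \<beta>\<close> and \<open>GD\<close> are the generators $T_i$, $X_\beta$ with \<open>\<beta>\<close> in the
  finite lattice, and $X_{a_0^{-1}\delta}$.\<close>

datatype daag_gen = GT nat | GX vec | GD

definition daag_gens :: "nat \<Rightarrow> (nat \<Rightarrow> nat \<Rightarrow> int) \<Rightarrow> daag_gen set" where
  "daag_gens n A = GT ` {0..n} \<union> GX ` Q_fin n A \<union> {GD}"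

fun alt_word :: "nat \<Rightarrow> nat \<Rightarrow> nat \<Rightarrow> daag_gen word" where
  "alt_word 0 i j = []"
| "alt_word (Suc m) i j = (GT i, True) # alt_word m j i"

definition braid_rels :: "nat \<Rightarrow> (nat \<Rightarrow> nat \<Rightarrow> int) \<Rightarrow> (daag_gen word \<times> daag_gen word) set" where
  "braid_rels n A = {(alt_word m i j, alt_word m j i) | m i j.
     i \<le> n \<and> j \<le> n \<and> i \<noteq> j \<and> (A i j * A j i, m) \<in> {(0, 2), (1, 3), (2, 4), (3, 6)}}"

text \<open>The word $X_\beta X_{a_0^{-1}\delta}^k$ for \<open>\<mu> = \<beta> + k a\<^sub>0\<^sup>-\<^sup>1 \<delta>\<close> in \<open>Q\<close>. As \<open>\<beta>\<close> has no
  \<open>\<alpha>\<^sub>0\<close>-component and that of \<open>a\<^sub>0\<^sup>-\<^sup>1 \<delta>\<close> is 1, we have \<open>k = \<mu> 0\<close>.\<close>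

definition X_word :: "nat \<Rightarrow> (nat \<Rightarrow> nat \<Rightarrow> int) \<Rightarrow> vec \<Rightarrow> daag_gen word" where
  "X_word n A \<mu> = (let k = \<lfloor>\<mu> 0\<rfloor> in
     (GX (vadd \<mu> (vscale (- of_int k) (delta_scaled n A))), True)
       # replicate (nat \<bar>k\<bar>) (GD, k \<ge> 0))"

definition daag_rels :: "nat \<Rightarrow> (nat \<Rightarrow> nat \<Rightarrow> int) \<Rightarrow> (daag_gen word \<times> daag_gen word) set" where
  "daag_rels n A = braid_rels n A
    \<union> {([(GX \<beta>, True), (GX \<gamma>, True)], [(GX (vadd \<beta> \<gamma>), True)]) | \<beta> \<gamma>.
         \<beta> \<in> Q_fin n A \<and> \<gamma> \<in> Q_fin n A}
    \<union> {([(GD, True), (g, True)], [(g, True), (GD, True)]) | g. g \<in> daag_gens n A}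
    \<union> {([(GT i, True), (GX \<beta>, True)], [(GX \<beta>, True), (GT i, True)]) | i \<beta>.
         i \<le> n \<and> \<beta> \<in> Q_fin n A \<and> form n A \<beta> (hat_coroot n A i) = 0}
    \<union> {([(GT i, True), (GX \<beta>, True), (GT i, True)], X_word n A (s_refl n A i \<beta>)) | i \<beta>.
         i \<le> n \<and> \<beta> \<in> Q_fin n A \<and> form n A \<beta> (hat_coroot n A i) = - 1}"

definition DAAG :: "nat \<Rightarrow> (nat \<Rightarrow> nat \<Rightarrow> int) \<Rightarrow> daag_gen word set monoid" where
  "DAAG n A = presented_group (daag_gens n A) (daag_rels n A)"

definition T_elt :: "nat \<Rightarrow> (nat \<Rightarrow> nat \<Rightarrow> int) \<Rightarrow> nat \<Rightarrow> daag_gen word set" where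
  "T_elt n A i = pres_class (daag_gens n A) (daag_rels n A) [(GT i, True)]"

definition X_elt :: "nat \<Rightarrow> (nat \<Rightarrow> nat \<Rightarrow> int) \<Rightarrow> vec \<Rightarrow> daag_gen word set" where
  "X_elt n A \<mu> = pres_class (daag_gens n A) (daag_rels n A) (X_word n A \<mu>)"

definition T_prod :: "nat \<Rightarrow> (nat \<Rightarrow> nat \<Rightarrow> int) \<Rightarrow> nat list \<Rightarrow> daag_gen word set" where
  "T_prod n A js = foldr (\<lambda>j g. T_elt n A j \<otimes>\<^bsub>DAAG n A\<^esub> g) js \<one>\<^bsub>DAAG n A\<^esub>"

definition T01 :: "nat \<Rightarrow> (nat \<Rightarrow> nat \<Rightarrow> int) \<Rightarrow> daag_gen word set" where
  "T01 n A = T_elt n A 0"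

definition T02 :: "nat \<Rightarrow> (nat \<Rightarrow> nat \<Rightarrow> int) \<Rightarrow> daag_gen word set" where
  "T02 n A = inv\<^bsub>DAAG n A\<^esub> (T_elt n A 0) \<otimes>\<^bsub>DAAG n A\<^esub> X_elt n A (simple_root 0)"

text \<open>Here \<open>js\<close> is a reduced decomposition of the reflection in \<open>\<theta>\<close>.\<close>

definition T03 :: "nat \<Rightarrow> (nat \<Rightarrow> nat \<Rightarrow> int) \<Rightarrow> nat list \<Rightarrow> daag_gen word set" where
  "T03 n A js = X_elt n A (vscale (1 / real (num_labels n A 0)) (theta n A))
     \<otimes>\<^bsub>DAAG n A\<^esub> inv\<^bsub>DAAG n A\<^esub> (T_prod n A js)"

fun weyl_image :: "nat \<Rightarrow> (nat \<Rightarrow> nat \<Rightarrow> int) \<Rightarrow> daag_gen \<Rightarrow> vec \<times> (vec \<Rightarrow> vec)" where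
  "weyl_image n A (GT i) = (\<lambda>_. 0, s_refl n A i)"
| "weyl_image n A (GX \<beta>) = (\<beta>, \<one>\<^bsub>affine_weyl n A\<^esub>)"
| "weyl_image n A GD = (delta_scaled n A, \<one>\<^bsub>affine_weyl n A\<^esub>)"

definition weyl_proj :: "nat \<Rightarrow> (nat \<Rightarrow> nat \<Rightarrow> int) \<Rightarrow> daag_gen word set \<Rightarrow> vec \<times> (vec \<Rightarrow> vec)" where
  "weyl_proj n A = pres_lift (double_affine_weyl n A) (weyl_image n A)"


section \<open>Automorphisms\<close>

definition Aut_descending ::
  "nat \<Rightarrow> (nat \<Rightarrow> nat \<Rightarrow> int) \<Rightarrow> (daag_gen word set \<Rightarrow> daag_gen word set) set" where
  "Aut_descending n A = {f \<in> auto (DAAG n A).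
     \<exists>g \<in> auto (double_affine_weyl n A).
       \<forall>x \<in> carrier (DAAG n A). weyl_proj n A (f x) = g (weyl_proj n A x)}"

definition frakG ::
  "nat \<Rightarrow> (nat \<Rightarrow> nat \<Rightarrow> int) \<Rightarrow> (daag_gen word set \<Rightarrow> daag_gen word set) monoid" where
  "frakG n A = (AutoGroup (DAAG n A))
     \<lparr>carrier := {f \<in> Aut_descending n A. (\<forall>i\<in>{1..n}. f (T_elt n A i) = T_elt n A i) \<and>
                   f (X_elt n A (delta_scaled n A)) = X_elt n A (delta_scaled n A)}\<rparr>"

definition is_aut_a :: "nat \<Rightarrow> (nat \<Rightarrow> nat \<Rightarrow> int) \<Rightarrow> nat list \<Rightarrow>
    (daag_gen word set \<Rightarrow> daag_gen word set) \<Rightarrow> bool" where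
  "is_aut_a n A js f \<longleftrightarrow>
    f \<in> auto (DAAG n A) \<and> (\<forall>i\<in>{1..n}. f (T_elt n A i) = T_elt n A i) \<and>
    f (T03 n A js) = T03 n A js \<and>
    f (T01 n A) = T02 n A \<and>
    f (T02 n A) = inv\<^bsub>DAAG n A\<^esub> (T02 n A) \<otimes>\<^bsub>DAAG n A\<^esub> T01 n A \<otimes>\<^bsub>DAAG n A\<^esub> T02 n A"

definition is_aut_b :: "nat \<Rightarrow> (nat \<Rightarrow> nat \<Rightarrow> int) \<Rightarrow> nat list \<Rightarrow>
    (daag_gen word set \<Rightarrow> daag_gen word set) \<Rightarrow> bool" where
  "is_aut_b n A js f \<longleftrightarrow>
    f \<in> auto (DAAG n A) \<and> (\<forall>i\<in>{1..n}. f (T_elt n A i) = T_elt n A i) \<and>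
    f (T01 n A) = T01 n A \<and>
    f (T02 n A) = T03 n A js \<and>
    f (T03 n A js) = inv\<^bsub>DAAG n A\<^esub> (T03 n A js) \<otimes>\<^bsub>DAAG n A\<^esub> T02 n A \<otimes>\<^bsub>DAAG n A\<^esub> T03 n A js"

end

theory Submission
  imports Defs "HOL-Library.Function_Algebras"
begin

text \<open>Both automorphisms come from new elements which satisfy the defining relations in place of
  the old generators. Put $W = T_{02}$ and $\varphi = a_0^{-1}\theta$.

  For $\underline{\mathfrak a}$, computations in rank two show that $W$ has with the $T_i$ and the
  $X_\beta$ the same relations as $T_0$. Hence $T_0 \mapsto W$, with all other generators fixed, is
  an endomorphism.

  For $\underline{\mathfrak b}$, apply Bernstein's presentation to $T_1, \dots, T_n$ and $W$ in the
  role of $T_0$. It yields commuting elements $Y_\beta$ with $Y_\varphi = W T_{s_\theta}$ that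
  satisfy the relations of the $X_\beta$ with $T_1, \dots, T_n$. The relations of $Y_\beta$ with
  $T_0$ hold as well. Indeed the lattice is generated from $\varphi$ by the steps
  $\beta \mapsto s_k(\beta)$ at pairing $-1$, and what remains is a braid relation between $T_i$ and
  $Z_\beta = T_{s_\beta}^{-1} X_\beta$ for a short positive root $\beta$, which follows by lowering
  $\beta$ to a simple root. The map $T_i \mapsto T_i$, $X_\beta \mapsto Y_\beta$ is the inverse of
  $\underline{\mathfrak b}$.

  The same constructions in the opposite group give the inverse endomorphisms. The relation
  $\mathfrak a \mathfrak b \mathfrak a = \mathfrak b \mathfrak a \mathfrak b$ needs to be checked
  only on $T_{01}, T_{02}, T_{03}$.\<close>

section \<open>Roots as lattice vectors of given norm\<close>

text \<open>The normalisation \<open>e 0 = 1\<close>, with every other \<open>e i\<close> equal to 1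
  or \<open>r\<close>, makes alpha_0 a shortest root, so that phi is a short root of norm 2. In the
  four excluded types alpha_0 is long, and this is where they drop out.

  The relations of the presentation, stated for elements of an arbitrary group, form one notion
  (\<open>double_sys\<close>), which is stable under replacing T_0 by W, under replacing the X_beta
  by the Y_beta, and under passing to the opposite group. Homomorphisms out of the double affine
  Artin group are read off from such systems. The obstacle is the second replacement: apart from
  Y_phi, the new elements are known only through reduced words, so their properties have to be
  propagated from phi.

  That the automorphisms descend is shown by explicit maps of the double affine Weyl group: for the
  first a cocycle, obtained by the same replacement inside that group, for the second a quadratic
  correction by half the norm. Integer coordinates are used throughout; the real root space enters
  through the linear map \<open>io\<close>.\<close>

type_synonym ivec = "nat \<Rightarrow> int"

definition sc :: "int \<Rightarrow> ivec \<Rightarrow> ivec" where "sc k x = (\<lambda>j. k * x j)"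
definition unitv :: "nat \<Rightarrow> ivec" where "unitv i = (\<lambda>j. if j = i then 1 else 0)"
definition posv :: "ivec \<Rightarrow> bool" where "posv x \<longleftrightarrow> (\<forall>j. 0 \<le> x j)"
definition negv :: "ivec \<Rightarrow> bool" where "negv x \<longleftrightarrow> (\<forall>j. x j \<le> 0)"

lemma sc_apply [simp]: "sc k x j = k * x j" by (simp add: sc_def)
lemma unitv_apply: "unitv i j = (if j = i then 1 else 0)" by (simp add: unitv_def)
lemma unitv_same [simp]: "unitv i i = 1" by (simp add: unitv_def)
lemma unitv_neq [simp]: "j \<noteq> i \<Longrightarrow> unitv i j = 0" by (simp add: unitv_def)
lemma sc_simps [simp]: "sc 0 x = 0" "sc 1 x = x" "sc k 0 = 0" "sc (-1) x = - x"
  by (auto simp: fun_eq_iff)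
lemma posv_unitv [simp]: "posv (unitv i)" by (simp add: posv_def unitv_def)
lemma posv_uminus [simp]: "posv (- x) \<longleftrightarrow> negv x" "negv (- x) \<longleftrightarrow> posv x"
  by (auto simp: posv_def negv_def)
lemma posv_add: "posv x \<Longrightarrow> posv y \<Longrightarrow> posv (x + y)" by (simp add: posv_def)
lemma posv_sc: "posv x \<Longrightarrow> 0 \<le> k \<Longrightarrow> posv (sc k x)" by (simp add: posv_def)
lemma pos_neg_zero: "posv x \<Longrightarrow> negv x \<Longrightarrow> x = 0"
  by (simp add: posv_def negv_def fun_eq_iff order_antisym)

text \<open>Off-diagonal entries occur in equal pairs, each pair giving a multiple of
  \<open>2 * q\<close>, and the diagonal is divisible by hypothesis. It is applied with
  \<open>q = 1\<close> and \<open>q = r\<close> to the terms of a norm.\<close>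

lemma even_double_sum:
  fixes N :: "nat \<Rightarrow> nat \<Rightarrow> int"
  assumes "\<And>i j. i \<le> m \<Longrightarrow> j \<le> m \<Longrightarrow> N i j = N j i"
    and "\<And>i. i \<le> m \<Longrightarrow> 2 * q dvd N i i" and "\<And>i j. i \<le> m \<Longrightarrow> j \<le> m \<Longrightarrow> q dvd N i j"
  shows "2 * q dvd (\<Sum>i\<le>m. \<Sum>j\<le>m. N i j)"
  using assms
proof (induction m)
  case 0
  show ?case using "0.prems"(2)[of 0] by simp
next
  case (Suc m)
  have IH: "2 * q dvd (\<Sum>i\<le>m. \<Sum>j\<le>m. N i j)"
    by (rule Suc.IH) (use Suc.prems in \<open>blast intro: le_SucI\<close>)+
  have sw: "(\<Sum>i\<le>m. N i (Suc m)) = (\<Sum>i\<le>m. N (Suc m) i)"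
    using Suc.prems(1) by (intro sum.cong) (blast intro: le_SucI)+
  have "(\<Sum>i\<le>Suc m. \<Sum>j\<le>Suc m. N i j) = (\<Sum>i\<le>m. \<Sum>j\<le>m. N i j) + 2 * (\<Sum>j\<le>m. N (Suc m) j) + N (Suc m) (Suc m)"
    using sw by (simp add: sum.distrib)
  moreover have "q dvd (\<Sum>j\<le>m. N (Suc m) j)" by (rule dvd_sum) (simp add: Suc.prems(3))
  ultimately show ?case using IH Suc.prems(2)[of "Suc m"] by (simp add: dvd_add mult_dvd_mono)
qed

text \<open>\<open>c i j\<close> is the pairing of the \<open>j\<close>-th basis vector with the \<open>i\<close>-th hat coroot, and \<open>2 * e i\<close>
  is the norm of the \<open>i\<close>-th basis vector. The map \<open>par\<close> orients the diagram towards the node 0.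
  Either alternative in \<open>shape\<close> ensures that the lattice is generated from \<open>phi\<close> by the steps
  \<open>b \<mapsto> s k b\<close> at pairing -1; the second one is the double-laced chain $D_{n+1}^{(2)}$
  (for \<open>n = 1\<close> this is $A_1^{(1)}$).\<close>
locale affine_data =
  fixes n :: nat and c :: "nat \<Rightarrow> nat \<Rightarrow> int" and a e :: "nat \<Rightarrow> int" and r :: int
    and par rk :: "nat \<Rightarrow> nat"
  assumes n_pos: "1 \<le> n"
    and c_diag: "i \<le> n \<Longrightarrow> c i i = 2"
    and c_off: "i \<le> n \<Longrightarrow> j \<le> n \<Longrightarrow> i \<noteq> j \<Longrightarrow> c i j \<le> 0"
    and c_sym: "i \<le> n \<Longrightarrow> j \<le> n \<Longrightarrow> e i * c i j = e j * c j i"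
    and r_cases: "r \<in> {1, 2, 3}"
    and e_cases: "i \<le> n \<Longrightarrow> e i = 1 \<or> e i = r"
    and e_0: "e 0 = 1"
    and a_pos: "i \<le> n \<Longrightarrow> 0 < a i"
    and a_0: "a 0 = 1"
    and a_null: "i \<le> n \<Longrightarrow> (\<Sum>j\<le>n. c i j * a j) = 0"
    and c_prod: "i \<le> n \<Longrightarrow> j \<le> n \<Longrightarrow> i \<noteq> j \<Longrightarrow> 2 \<le> n \<Longrightarrow> c i j * c j i \<le> 3"
    and par: "k \<in> {1..n} \<Longrightarrow> par k \<le> n \<and> rk (par k) < rk k \<and> c k (par k) < 0"
    and shape: "(\<forall>k\<in>{1..n}. c k (par k) = -1 \<and> c 0 k \<in> {0, -1}) \<or>
      ((\<forall>k\<le>n. a k = 1) \<and> (\<forall>k\<in>{1..<n}. c k (k - 1) = -1) \<and> c 0 1 = -2 \<and> c n (n - 1) = -2 \<and>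
       (\<forall>i\<le>n. \<forall>j\<le>n. i + 2 \<le> j \<longrightarrow> c i j = 0 \<and> c j i = 0))"
begin

definition pr :: "ivec \<Rightarrow> nat \<Rightarrow> int" where "pr x i = (\<Sum>j\<le>n. c i j * x j)"
definition s :: "nat \<Rightarrow> ivec \<Rightarrow> ivec" where "s i x = x - sc (pr x i) (unitv i)"
definition B :: "ivec \<Rightarrow> ivec \<Rightarrow> int" where "B x y = (\<Sum>i\<le>n. e i * x i * pr y i)"
text \<open>\<open>dl\<close> is delta / a_0 and \<open>phi\<close> is theta / a_0 in the chosen
  basis; \<open>lat\<close> and \<open>fin\<close> are the lattice Q and its finite part, cut out of
  all integer sequences by vanishing coordinates.\<close>

definition dl :: ivec where "dl = (\<lambda>j. if j \<le> n then a j else 0)"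
definition phi :: ivec where "phi = dl - unitv 0"
definition lat :: "ivec set" where "lat = {x. \<forall>j>n. x j = 0}"
definition fin :: "ivec set" where "fin = {x \<in> lat. x 0 = 0}"
text \<open>The real roots: short ones have norm 2, and a vector of norm \<open>2 * r\<close> is a root if its
  coefficients at the short nodes are divisible by \<open>r\<close>.\<close>
definition R :: "ivec set" where
  "R = {x \<in> lat. B x x = 2} \<union> {x \<in> lat. B x x = 2 * r \<and> (\<forall>k\<le>n. e k = 1 \<longrightarrow> r dvd x k)}"

section \<open>Pairings, the invariant form and simple reflections\<close>

lemma e_pos: "i \<le> n \<Longrightarrow> 0 < e i" using e_cases[of i] r_cases by auto
lemma r_pos: "0 < r" using r_cases by auto

lemma pr_add [simp]: "pr (x + y) i = pr x i + pr y i"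
  by (simp add: pr_def sum.distrib ring_distribs)
lemma pr_diff [simp]: "pr (x - y) i = pr x i - pr y i"
  by (simp add: pr_def sum_subtractf ring_distribs)
lemma pr_minus [simp]: "pr (- x) i = - pr x i" by (simp add: pr_def sum_negf)
lemma pr_zero [simp]: "pr 0 i = 0" by (simp add: pr_def)
lemma pr_sc [simp]: "pr (sc k x) i = k * pr x i" by (simp add: pr_def sum_distrib_left mult_ac)
lemma pr_unitv [simp]: "j \<le> n \<Longrightarrow> pr (unitv j) i = c i j"
  by (simp add: pr_def unitv_def if_distrib cong: if_cong)
lemma pr_dl [simp]: "i \<le> n \<Longrightarrow> pr dl i = 0"
proof -
  assume "i \<le> n"
  have "pr dl i = (\<Sum>j\<le>n. c i j * a j)" unfolding pr_def dl_def by (rule sum.cong) auto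
  then show ?thesis using a_null[OF \<open>i \<le> n\<close>] by simp
qed

lemma B_add [simp]: "B (x + y) z = B x z + B y z" "B z (x + y) = B z x + B z y"
  by (simp_all add: B_def sum.distrib ring_distribs)
lemma B_diff [simp]: "B (x - y) z = B x z - B y z" "B z (x - y) = B z x - B z y"
  by (simp_all add: B_def sum_subtractf ring_distribs)
lemma B_minus [simp]: "B (- x) z = - B x z" "B z (- x) = - B z x"
  by (simp_all add: B_def sum_negf)
lemma B_zero [simp]: "B 0 z = 0" "B z 0 = 0" by (simp_all add: B_def)
lemma B_sc [simp]: "B (sc k x) z = k * B x z" "B z (sc k x) = k * B z x"
  by (simp_all add: B_def sum_distrib_left mult_ac)

lemma B_double: "B x y = (\<Sum>i\<le>n. \<Sum>j\<le>n. e i * c i j * x i * y j)"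
  by (simp add: B_def pr_def sum_distrib_left mult_ac)

lemma B_sym: "B x y = B y x"
proof -
  have "B x y = (\<Sum>j\<le>n. \<Sum>i\<le>n. e i * c i j * x i * y j)"
    unfolding B_double by (rule sum.swap)
  also have "\<dots> = (\<Sum>j\<le>n. \<Sum>i\<le>n. e j * c j i * y j * x i)"
    by (intro sum.cong) (auto simp: c_sym mult_ac)
  finally show ?thesis by (simp add: B_double)
qed

lemma B_unitv [simp]: "i \<le> n \<Longrightarrow> B (unitv i) x = e i * pr x i"
  by (simp add: B_def unitv_def if_distrib if_distribR cong: if_cong)
lemma B_unitv2 [simp]: "i \<le> n \<Longrightarrow> B x (unitv i) = e i * pr x i"
  by (subst B_sym) simp
lemma B_dl [simp]: "B x dl = 0" "B dl x = 0"
proof -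
  show "B x dl = 0" by (simp add: B_def)
  then show "B dl x = 0" by (simp add: B_sym[of dl])
qed
lemma B_phi [simp]: "B x phi = - pr x 0" "B phi x = - pr x 0"
  by (simp_all add: phi_def e_0)
lemma pr_phi [simp]: "i \<le> n \<Longrightarrow> pr phi i = - c i 0" by (simp add: phi_def)
lemma pr_phi_0: "pr phi 0 = -2" by (simp add: c_diag)
lemma B_phi_phi: "B phi phi = 2" by (simp add: pr_phi_0)

lemma s_s [simp]: "i \<le> n \<Longrightarrow> s i (s i x) = x"
  by (simp add: s_def fun_eq_iff c_diag)
lemma s_add [simp]: "s i (x + y) = s i x + s i y" by (simp add: s_def fun_eq_iff algebra_simps)
lemma s_diff [simp]: "s i (x - y) = s i x - s i y" by (simp add: s_def fun_eq_iff algebra_simps)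
lemma s_minus [simp]: "s i (- x) = - s i x" by (simp add: s_def fun_eq_iff)
lemma s_zero [simp]: "s i 0 = 0" by (simp add: s_def)
lemma s_sc [simp]: "s i (sc k x) = sc k (s i x)" by (simp add: s_def fun_eq_iff algebra_simps)
lemma s_dl [simp]: "i \<le> n \<Longrightarrow> s i dl = dl" by (simp add: s_def)
lemma s_unitv: "i \<le> n \<Longrightarrow> j \<le> n \<Longrightarrow> s i (unitv j) = unitv j - sc (c i j) (unitv i)"
  by (simp add: s_def)
lemma s_unitv_same [simp]: "i \<le> n \<Longrightarrow> s i (unitv i) = - unitv i"
  by (simp add: s_unitv c_diag fun_eq_iff)
lemma s_other [simp]: "j \<noteq> i \<Longrightarrow> s i x j = x j" by (simp add: s_def)
lemma s_pr0: "pr x i = 0 \<Longrightarrow> s i x = x" by (simp add: s_def)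
lemma s_prm1: "pr x i = -1 \<Longrightarrow> s i x = x + unitv i" by (simp add: s_def)
lemma s_pr1: "pr x i = 1 \<Longrightarrow> s i x = x - unitv i" by (simp add: s_def)
lemma pr_s_same: "i \<le> n \<Longrightarrow> pr (s i x) i = - pr x i" by (simp add: s_def c_diag)

lemma B_s [simp]: "i \<le> n \<Longrightarrow> B (s i x) (s i y) = B x y"
  by (simp add: s_def c_diag algebra_simps)
lemma B_s_left: "i \<le> n \<Longrightarrow> B (s i x) y = B x (s i y)"
  using B_s[of i x "s i y"] by simp

lemma unitv_lat [simp]: "i \<le> n \<Longrightarrow> unitv i \<in> lat" by (auto simp: lat_def)
lemma unitv_fin [simp]: "i \<in> {1..n} \<Longrightarrow> unitv i \<in> fin" by (auto simp: lat_def fin_def)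
lemma dl_lat [simp]: "dl \<in> lat" by (simp add: lat_def dl_def)
lemma dl_0 [simp]: "dl 0 = 1" by (simp add: dl_def a_0)
lemma phi_fin [simp]: "phi \<in> fin" by (auto simp: phi_def fin_def lat_def dl_def a_0)
lemma fin_lat: "x \<in> fin \<Longrightarrow> x \<in> lat" by (simp add: fin_def)
lemma lat_closed [simp]: "0 \<in> lat" "x \<in> lat \<Longrightarrow> y \<in> lat \<Longrightarrow> x + y \<in> lat"
  "x \<in> lat \<Longrightarrow> y \<in> lat \<Longrightarrow> x - y \<in> lat" "x \<in> lat \<Longrightarrow> - x \<in> lat" "x \<in> lat \<Longrightarrow> sc k x \<in> lat"
  "x \<in> lat \<Longrightarrow> i \<le> n \<Longrightarrow> s i x \<in> lat"
  by (auto simp: lat_def s_def)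
lemma fin_closed [simp]: "0 \<in> fin" "x \<in> fin \<Longrightarrow> y \<in> fin \<Longrightarrow> x + y \<in> fin"
  "x \<in> fin \<Longrightarrow> y \<in> fin \<Longrightarrow> x - y \<in> fin" "x \<in> fin \<Longrightarrow> - x \<in> fin" "x \<in> fin \<Longrightarrow> sc k x \<in> fin"
  "x \<in> fin \<Longrightarrow> i \<in> {1..n} \<Longrightarrow> s i x \<in> fin"
  by (auto simp: fin_def)

text \<open>The rows of the symmetric matrix \<open>e i * c i j * a i * a j\<close> sum to zero and
  its off-diagonal entries are nonpositive, so in the coordinates \<open>x i / a i\<close> the form
  is a nonnegative combination of squares of differences. It vanishes only if the coordinates agree
  along all bonds, and \<open>par\<close> connects every node to 0.\<close>

lemma B_semidefinite: "0 \<le> B x x" and B_zero_imp: "B x x = 0 \<Longrightarrow> x \<in> lat \<Longrightarrow> x = sc (x 0) dl"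
proof -
  define y where "y i = real_of_int (x i) / a i" for i
  define M where "M i j = real_of_int (e i * c i j * a i * a j)" for i j
  have xy: "real_of_int (x i) = a i * y i" if "i \<le> n" for i
    using a_pos[OF that] by (simp add: y_def)
  have M_sym: "M i j = M j i" if "i \<le> n" "j \<le> n" for i j
    unfolding M_def using c_sym[OF that] by (simp add: mult_ac)
  have row: "(\<Sum>j\<le>n. M i j) = 0" if "i \<le> n" for i
  proof -
    have "(\<Sum>j\<le>n. M i j) = real_of_int (e i * a i * (\<Sum>j\<le>n. c i j * a j))"
      by (simp add: M_def sum_distrib_left mult_ac)
    then show ?thesis using a_null[OF that] by simp
  qed
  have t1: "(\<Sum>i\<le>n. \<Sum>j\<le>n. M i j * (y i)\<^sup>2) = 0"
    using row by (simp add: sum_distrib_right[symmetric])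
  have "(\<Sum>i\<le>n. \<Sum>j\<le>n. M i j * (y j)\<^sup>2) = (\<Sum>j\<le>n. \<Sum>i\<le>n. M i j * (y j)\<^sup>2)"
    by (rule sum.swap)
  also have "\<dots> = (\<Sum>j\<le>n. \<Sum>i\<le>n. M j i * (y j)\<^sup>2)"
    by (intro sum.cong) (auto simp: M_sym)
  finally have t2: "(\<Sum>i\<le>n. \<Sum>j\<le>n. M i j * (y j)\<^sup>2) = 0" using t1 by simp
  have "real_of_int (B x x) = (\<Sum>i\<le>n. \<Sum>j\<le>n. M i j * (y i * y j))"
    unfolding B_double of_int_sum by (intro sum.cong) (auto simp: M_def xy)
  also have "-2 * \<dots> = (\<Sum>i\<le>n. \<Sum>j\<le>n. M i j * (y i - y j)\<^sup>2)"
    using t1 t2 by (simp add: power2_diff algebra_simps sum.distrib sum_subtractf sum_distrib_left sum_negf)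
  finally have main: "2 * real_of_int (B x x) = (\<Sum>i\<le>n. \<Sum>j\<le>n. - M i j * (y i - y j)\<^sup>2)"
    by (simp add: sum_negf)
  have nn: "0 \<le> - M i j * (y i - y j)\<^sup>2" if "i \<le> n" "j \<le> n" for i j
  proof (cases "i = j")
    case False
    have "e i * c i j * a i * a j \<le> 0"
      using c_off[OF that False] e_pos[OF that(1)] a_pos that
      by (simp add: mult_nonneg_nonpos mult_nonpos_nonneg order_less_imp_le)
    then have "M i j \<le> 0" unfolding M_def by (simp only: of_int_le_0_iff)
    then show ?thesis by (simp add: mult_nonpos_nonneg)
  qed simp
  show "0 \<le> B x x" using main nn
    by (smt (verit) of_int_nonneg sum_nonneg atMost_iff of_int_0_le_iff)
  assume B0: "B x x = 0" and xl: "x \<in> lat"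
  then have "(\<Sum>i\<le>n. \<Sum>j\<le>n. - M i j * (y i - y j)\<^sup>2) = 0" using main by simp
  then have "\<forall>i\<in>{..n}. (\<Sum>j\<le>n. - M i j * (y i - y j)\<^sup>2) = 0"
    by (subst (asm) sum_nonneg_eq_0_iff) (auto intro!: sum_nonneg nn simp del: mult_minus_left)
  then have z: "- M i j * (y i - y j)\<^sup>2 = 0" if "i \<le> n" "j \<le> n" for i j
    using that nn sum_nonneg_eq_0_iff[of "{..n}" "\<lambda>j. - M i j * (y i - y j)\<^sup>2"] by auto
  have yk: "y k = y 0" if "k \<le> n" for k
    using that
  proof (induction "rk k" arbitrary: k rule: less_induct)
    case less
    show ?case
    proof (cases "k = 0")
      case False
      then have p: "par k \<le> n" "rk (par k) < rk k" "c k (par k) < 0" using par[of k] less.prems by auto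
      then have "M k (par k) \<noteq> 0"
        using e_pos[of k] a_pos[of k] a_pos[of "par k"] less.prems by (simp add: M_def)
      then have "y k = y (par k)" using z[OF less.prems p(1)] by simp
      then show ?thesis using less.hyps[OF p(2,1)] by simp
    qed simp
  qed
  define x0 where "x0 = x 0"
  have xj: "x j = x0 * a j" if "j \<le> n" for j
  proof -
    have "real_of_int (x j) = of_int (x0 * a j)"
      using xy[OF that] yk[OF that] xy[of 0] a_0 by (simp add: mult_ac x0_def)
    then show ?thesis by (simp only: of_int_eq_iff)
  qed
  have "x j = sc x0 dl j" for j
    using xl xj[of j] by (cases "j \<le> n") (simp_all add: dl_def lat_def)
  then have "x = sc x0 dl" by (rule ext)
  then show "x = sc (x 0) dl" by (simp only: x0_def)
qed

lemma B_even: "2 dvd B x x"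
proof -
  have "2 * 1 dvd B x x" unfolding B_double
  proof (rule even_double_sum)
    fix i j assume ij: "i \<le> n" "j \<le> n"
    show "e i * c i j * x i * x j = e j * c j i * x j * x i" using c_sym[OF ij] by simp
  qed (simp_all add: c_diag)
  then show ?thesis by simp
qed

text \<open>The vectors with short coordinates divisible by \<open>r\<close> form a sublattice with
  all norms divisible by \<open>2 * r\<close>. Long roots thus have the least positive norm in it,
  as short roots do in \<open>lat\<close>; the sign argument for roots rests on this
  minimality.\<close>

lemma B_even_r:
  assumes "\<forall>k\<le>n. e k = 1 \<longrightarrow> r dvd x k"
  shows "2 * r dvd B x x"
  unfolding B_double
proof (rule even_double_sum)
  fix i j assume ij: "i \<le> n" "j \<le> n"
  show "e i * c i j * x i * x j = e j * c j i * x j * x i" using c_sym[OF ij] by simp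
  show "r dvd e i * c i j * x i * x j"
  proof (cases "e i = 1")
    case True
    then have "r dvd x i" using assms ij by blast
    then show ?thesis by (simp add: dvd_mult dvd_mult2)
  next
    case False
    then show ?thesis using e_cases[OF ij(1)] by (simp add: dvd_mult2)
  qed
next
  fix i assume "i \<le> n"
  have "r dvd e i * x i * x i"
  proof (cases "e i = 1")
    case True
    then have "r dvd x i" using assms \<open>i \<le> n\<close> by blast
    then show ?thesis by (simp add: dvd_mult dvd_mult2)
  next
    case False
    then show ?thesis using e_cases[OF \<open>i \<le> n\<close>] by (simp add: dvd_mult2)
  qed
  moreover have "e i * c i i * x i * x i = 2 * (e i * x i * x i)" using \<open>i \<le> n\<close> by (simp add: c_diag)
  ultimately show "2 * r dvd e i * c i i * x i * x i" by (simp only:) (rule mult_dvd_mono, simp_all)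
qed

section \<open>Real roots: signs and simple reflections\<close>

lemma R_lat: "x \<in> R \<Longrightarrow> x \<in> lat" by (auto simp: R_def)
lemma R_nonzero: "x \<in> R \<Longrightarrow> x \<noteq> 0" using r_pos by (auto simp: R_def)

text \<open>Split a mixed vector as \<open>x = p - m\<close> with disjoint supports. Then
  \<open>B p m\<close> is nonpositive, so the norms of \<open>p\<close> and \<open>m\<close> add up
  to at most that of \<open>x\<close>. Neither part is isotropic, since a nonzero multiple of
  \<open>dl\<close> has full support, so each alone has norm at least that of \<open>x\<close>,
  which is minimal.\<close>

lemma R_dichotomy: assumes "x \<in> R" shows "posv x \<or> negv x"
proof (rule ccontr)
  assume no: "\<not> ?thesis"
  define p m where "p = (\<lambda>j. max (x j) 0)" and "m = (\<lambda>j. max (- x j) 0)"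
  have x: "x = p - m" by (auto simp: p_def m_def fun_eq_iff)
  have pl: "p \<in> lat" "m \<in> lat" using R_lat[OF assms] by (auto simp: lat_def p_def m_def)
  obtain u v where "x u > 0" "x v < 0" using no by (auto simp: posv_def negv_def not_le)
  then have u: "p u > 0" and v: "m v > 0" by (auto simp: p_def m_def)
  have disj: "p j = 0 \<or> m j = 0" for j by (auto simp: p_def m_def)
  have "B p p \<noteq> 0"
  proof
    assume "B p p = 0"
    then have "p = sc (p 0) dl" using B_zero_imp pl by blast
    then have *: "p j = p 0 * dl j" for j by (metis sc_apply)
    then have "p 0 \<noteq> 0" using u by (metis less_irrefl mult_zero_left)
    moreover have "v \<le> n" using v pl(2) by (auto simp: lat_def not_le[symmetric])
    ultimately have "p v \<noteq> 0" using *[of v] a_pos[of v] by (simp add: dl_def)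
    then show False using disj[of v] v by simp
  qed
  moreover have "B m m \<noteq> 0"
  proof
    assume "B m m = 0"
    then have "m = sc (m 0) dl" using B_zero_imp pl by blast
    then have *: "m j = m 0 * dl j" for j by (metis sc_apply)
    then have "m 0 \<noteq> 0" using v by (metis less_irrefl mult_zero_left)
    moreover have "u \<le> n" using u pl(1) by (auto simp: lat_def not_le[symmetric])
    ultimately have "m u \<noteq> 0" using *[of u] a_pos[of u] by (simp add: dl_def)
    then show False using disj[of u] u by simp
  qed
  ultimately have pp: "0 < B p p" "0 < B m m" using B_semidefinite by (auto simp: order_less_le)
  have pm: "B p m \<le> 0" unfolding B_double
  proof (intro sum_nonpos)
    fix i j assume "i \<in> {..n}" "j \<in> {..n}"
    then show "e i * c i j * p i * m j \<le> 0"
      using disj[of i] c_off[of i j] e_pos[of i]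
      by (cases "i = j") (auto simp: p_def m_def mult_nonneg_nonpos mult_nonpos_nonneg)
  qed
  have tot: "B x x = B p p + B m m - 2 * B p m" by (simp add: x B_sym[of m p])
  consider "B x x = 2" | "B x x = 2 * r" "\<forall>k\<le>n. e k = 1 \<longrightarrow> r dvd x k" using assms by (auto simp: R_def)
  then show False
  proof cases
    case 1
    have "2 \<le> B p p" "2 \<le> B m m" using pp B_even[of p] B_even[of m] by (auto dest: zdvd_imp_le)
    then show False using tot pm 1 by linarith
  next
    case 2
    have "\<forall>k\<le>n. e k = 1 \<longrightarrow> r dvd p k" "\<forall>k\<le>n. e k = 1 \<longrightarrow> r dvd m k"
      using 2(2) by (auto simp: p_def m_def max_def)
    then have "2 * r \<le> B p p" "2 * r \<le> B m m" using pp B_even_r by (auto dest: zdvd_imp_le)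
    then show False using tot pm 2(1) r_pos by linarith
  qed
qed

lemma R_neg_iff: "x \<in> R \<Longrightarrow> negv x \<longleftrightarrow> \<not> posv x"
  using R_dichotomy R_nonzero pos_neg_zero by blast

lemma R_uminus [simp]: "- x \<in> R \<longleftrightarrow> x \<in> R"
proof -
  have "- x \<in> lat \<longleftrightarrow> x \<in> lat" by (simp add: lat_def)
  then show ?thesis by (simp add: R_def)
qed

lemma unitv_R [simp]: "i \<le> n \<Longrightarrow> unitv i \<in> R"
  using e_cases[of i] by (auto simp: R_def c_diag unitv_apply)

lemma s_R [simp]: assumes "i \<le> n" "x \<in> R" shows "s i x \<in> R"
proof -
  have "r dvd s i x k" if x: "\<forall>k\<le>n. e k = 1 \<longrightarrow> r dvd x k" and k: "k \<le> n" "e k = 1" for k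
  proof (cases "k = i")
    case True
    have "r dvd c i j * x j" if "j \<le> n" for j
    proof (cases "e j = 1")
      case False
      \<comment> \<open>Only short coordinates of \<open>x\<close> are known to be divisible; at a
        long node the matrix entry itself supplies the factor \<open>r\<close>, by the symmetry of
        \<open>e i * c i j\<close>.\<close>
      then have "c i j = r * c j i" using e_cases[OF that] c_sym[OF assms(1) that] k True by simp
      then show ?thesis by simp
    qed (use x that in simp)
    then have "r dvd pr x i" unfolding pr_def by (intro dvd_sum) auto
    then show ?thesis using x k True by (simp add: s_def)
  qed (use x k in simp)
  then show ?thesis using assms by (auto simp: R_def)
qed

text \<open>A simple reflection changes one coordinate only, so a positive root that it makes negative
  is a multiple of the simple root; the norms leave the multiple 1.\<close>
lemma pos_to_neg:
  assumes "i \<le> n" "x \<in> R" "posv x" "\<not> posv (s i x)"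
  shows "x = unitv i"
proof -
  have neg: "negv (s i x)" using R_neg_iff assms by simp
  have z: "x j = 0" if "j \<noteq> i" for j
    using assms(3) neg s_other[OF that, of x] by (metis negv_def order_antisym posv_def)
  define k where "k = x i"
  have x: "x = sc k (unitv i)" using z by (auto simp: fun_eq_iff unitv_apply k_def)
  have k0: "0 \<le> k" using assms(3) by (simp add: posv_def k_def)
  have N: "B x x = 2 * e i * k * k" by (simp add: x assms(1) c_diag)
  have "k * k = 1"
  proof -
    have "(B x x = 2) \<or> (B x x = 2 * r \<and> (e i = 1 \<longrightarrow> r dvd k))"
      using assms(1,2) unfolding R_def k_def by blast
    then consider "e i * (k * k) = 1" | "e i * (k * k) = r" "e i = 1 \<longrightarrow> r dvd k"
      unfolding N by (auto simp: mult.assoc)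
    then show ?thesis
    proof cases
      case 1
      then show ?thesis using zmult_eq_1_iff[of "e i" "k * k"] e_pos[OF assms(1)] by auto
    next
      case 2
      show ?thesis
      proof (cases "e i = 1")
        case True
        then obtain q where q: "k = r * q" using 2 by auto
        have "r * (r * (q * q)) = r * 1" using 2 True by (simp add: q mult_ac)
        then have "r * (q * q) = 1" using r_pos by simp
        then have "r = 1" using r_pos zmult_eq_1_iff[of r "q * q"] by auto
        then show ?thesis using 2 True by simp
      next
        case False
        then show ?thesis using 2 e_cases[OF assms(1)] r_pos by auto
      qed
    qed
  qed
  then have "k = 1" using k0 zmult_eq_1_iff[of k k] by auto
  then show ?thesis using x by simp
qed

lemma posv_s: "i \<le> n \<Longrightarrow> x \<in> R \<Longrightarrow> posv x \<Longrightarrow> x \<noteq> unitv i \<Longrightarrow> posv (s i x)"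
  using pos_to_neg by blast

end

section \<open>Words and reduced words\<close>

primrec alt :: "nat \<Rightarrow> 'i \<Rightarrow> 'i \<Rightarrow> 'i list" where
  "alt 0 i j = []"
| "alt (Suc m) i j = i # alt m j i"

lemma alt_add: "alt (k + m) i j = alt k i j @ (if even k then alt m i j else alt m j i)"
  by (induction k arbitrary: i j) auto
lemma length_alt [simp]: "length (alt m i j) = m" by (induction m arbitrary: i j) auto
lemma set_alt: "set (alt m i j) \<subseteq> {i, j}" by (induction m arbitrary: i j) auto

context affine_data
begin

primrec act :: "nat list \<Rightarrow> ivec \<Rightarrow> ivec" where
  "act [] x = x"
| "act (i # js) x = s i (act js x)"
text \<open>\<open>V js\<close> inverts \<open>act js\<close>. As a recursion of its own it follows
  a root from the left end of the word, which is how sign changes are located.\<close>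

primrec V :: "nat list \<Rightarrow> ivec \<Rightarrow> ivec" where
  "V [] x = x"
| "V (i # js) x = V js (s i x)"

definition wd :: "nat list \<Rightarrow> bool" where "wd js \<longleftrightarrow> set js \<subseteq> {..n}"
definition red :: "nat list \<Rightarrow> bool" where
  "red js \<longleftrightarrow> wd js \<and> (\<forall>ks. wd ks \<and> act ks = act js \<longrightarrow> length js \<le> length ks)"

lemma wd_simps [simp]: "wd []" "wd (i # js) \<longleftrightarrow> i \<le> n \<and> wd js" "wd (js @ ks) \<longleftrightarrow> wd js \<and> wd ks"
  "wd (rev js) \<longleftrightarrow> wd js"
  by (auto simp: wd_def)
lemma act_append [simp]: "act (js @ ks) x = act js (act ks x)" by (induction js) auto
lemma V_append [simp]: "V (js @ ks) x = V ks (V js x)" by (induction js arbitrary: x) auto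
lemma act_Cons: "act (i # js) = (\<lambda>x. s i (act js x))" by (rule ext) simp
lemma act_comp: "act (js @ ks) = act js \<circ> act ks" by (rule ext) simp
lemma act_rev: "act (rev js) = V js" by (rule ext, induction js) auto
lemma V_rev: "V (rev js) = act js" using act_rev[of "rev js"] by simp
lemma V_act [simp]: "wd js \<Longrightarrow> V js (act js x) = x" by (induction js) auto
lemma act_V [simp]: "wd js \<Longrightarrow> act js (V js x) = x" by (induction js arbitrary: x) auto

lemma act_lin [simp]: "act js (x + y) = act js x + act js y" "act js (x - y) = act js x - act js y"
  "act js (- x) = - act js x" "act js (sc k x) = sc k (act js x)" "act js 0 = 0"
  by (induction js) auto
lemma act_dl [simp]: "wd js \<Longrightarrow> act js dl = dl" by (induction js) auto
lemma act_B [simp]: "wd js \<Longrightarrow> B (act js x) (act js y) = B x y" by (induction js) auto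
lemma act_R [simp]: "wd js \<Longrightarrow> x \<in> R \<Longrightarrow> act js x \<in> R" by (induction js) auto
lemma act_lat [simp]: "wd js \<Longrightarrow> x \<in> lat \<Longrightarrow> act js x \<in> lat" by (induction js) auto
lemma V_lin [simp]: "V js (x + y) = V js x + V js y" "V js (x - y) = V js x - V js y"
  "V js (- x) = - V js x" "V js (sc k x) = sc k (V js x)" "V js 0 = 0"
  unfolding act_rev[symmetric] by simp_all
lemma V_dl [simp]: "wd js \<Longrightarrow> V js dl = dl" by (simp flip: act_rev)
lemma V_R [simp]: "wd js \<Longrightarrow> x \<in> R \<Longrightarrow> V js x \<in> R" by (simp flip: act_rev)
lemma B_act_V: "wd js \<Longrightarrow> B (act js x) y = B x (V js y)"
  by (metis act_B act_V)
lemma V_cong: assumes "wd js" "wd ks" "act js = act ks" shows "V js = V ks"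
proof
  fix x show "V js x = V ks x" using assms by (metis V_act act_V)
qed
text \<open>The first letter that turns the image of a positive root negative acts on its own simple
  root, by \<open>pos_to_neg\<close>; this identifies the letter to be deleted.\<close>

lemma first_negative:
  assumes "wd js" "x \<in> R" "posv x" "\<not> posv (V js x)"
  shows "\<exists>p k q. js = p @ k # q \<and> V p x = unitv k"
  using assms
proof (induction js arbitrary: x)
  case (Cons k js)
  show ?case
  proof (cases "posv (s k x)")
    case True
    then obtain p k' q where "js = p @ k' # q" "V p (s k x) = unitv k'"
      using Cons.IH[of "s k x"] Cons.prems by auto
    then show ?thesis by (intro exI[of _ "k # p"]) auto
  next
    case False
    then show ?thesis using pos_to_neg[of k x] Cons.prems by (intro exI[of _ "[]"]) auto
  qed
qed simp

text \<open>The exchange condition. With \<open>V p (unitv i) = unitv k\<close> the prefix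
  \<open>p\<close> conjugates s_k to s_i, so multiplication by s_i on the left removes the letter
  \<open>k\<close>. Pairings are taken with coroots, so the conjugation requires
  \<open>e i = e k\<close>, which invariance of the norm provides.\<close>

lemma deletion:
  assumes "wd js" "i \<le> n" "\<not> posv (V js (unitv i))"
  shows "\<exists>ks. set ks \<subseteq> set js \<and> length js = Suc (length ks) \<and> act ks = act (i # js)"
proof -
  obtain p k q where js: "js = p @ k # q" and k: "V p (unitv i) = unitv k"
    using first_negative[OF assms(1), of "unitv i"] assms by auto
  have w: "wd p" "k \<le> n" "wd q" using assms(1) js by auto
  have i: "act p (unitv k) = unitv i" using act_V[OF w(1)] k by metis
  have "2 * e i = 2 * e k" using act_B[OF w(1), of "unitv k" "unitv k"] i w assms(2)
    by (simp add: c_diag)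
  then have ek: "e i = e k" by simp
  have "pr (act p y) i = pr y k" for y
    using B_act_V[OF w(1), of y "unitv i"] e_pos[OF w(2)] by (simp add: k ek assms(2) w(2))
  then have *: "s i (act p y) = act p (s k y)" for y by (simp add: s_def i)
  have "act (p @ q) = act (i # js)" by (rule ext) (simp add: js * w)
  then show ?thesis using js by (intro exI[of _ "p @ q"]) auto
qed

lemma red_wd: "red js \<Longrightarrow> wd js" by (simp add: red_def)
lemma red_length: "red js \<Longrightarrow> red ks \<Longrightarrow> act js = act ks \<Longrightarrow> length js = length ks"
  by (metis order_antisym red_def)
lemma red_of_length: "red js \<Longrightarrow> wd ks \<Longrightarrow> act ks = act js \<Longrightarrow> length ks \<le> length js \<Longrightarrow> red ks"
  unfolding red_def by (metis le_trans)
lemma red_exists: assumes "wd js" shows "\<exists>ks. red ks \<and> act ks = act js"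
proof -
  obtain ks where "wd ks \<and> act ks = act js" "\<forall>ls. wd ls \<and> act ls = act js \<longrightarrow> length ks \<le> length ls"
    using ex_has_least_nat[of "\<lambda>ks. wd ks \<and> act ks = act js" js length] assms by blast
  then show ?thesis unfolding red_def by metis
qed

lemma red_tail: assumes "red (i # js)" shows "red js"
proof -
  have "length js \<le> length ks" if "wd ks" "act ks = act js" for ks
  proof -
    have "act (i # ks) = act (i # js)" using that by (simp add: act_Cons)
    then have "length (i # js) \<le> length (i # ks)" using assms that(1) unfolding red_def
      by (metis wd_simps(2))
    then show ?thesis by simp
  qed
  then show ?thesis using assms by (auto simp: red_def)
qed

text \<open>The length criterion: left multiplication by s_i lengthens w exactly when the inverse of
  w keeps alpha_i positive. It turns reducedness into a recursive test of signs. For the converse,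
  the exchange condition is applied to a reduced word of s_i w, which shortens to a word of
  w.\<close>

lemma red_Cons: "red (i # js) \<longleftrightarrow> i \<le> n \<and> red js \<and> posv (V js (unitv i))"
proof
  assume r: "red (i # js)"
  then have w: "i \<le> n" "wd js" by (auto simp: red_def)
  have "posv (V js (unitv i))"
  proof (rule ccontr)
    assume "\<not> ?thesis"
    then obtain ks where ks: "set ks \<subseteq> set js" "length js = Suc (length ks)" "act ks = act (i # js)"
      using deletion w by blast
    then have "length (i # js) \<le> length ks" using r w unfolding red_def wd_def by blast
    then show False using ks by simp
  qed
  then show "i \<le> n \<and> red js \<and> posv (V js (unitv i))" using w red_tail[OF r] by simp
next
  assume *: "i \<le> n \<and> red js \<and> posv (V js (unitv i))"
  then have w: "wd js" by (simp add: red_def)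
  obtain ks where ks: "red ks" "act ks = act (i # js)" using red_exists[of "i # js"] * w by auto
  have kw: "wd ks" using ks by (simp add: red_def)
  have "V ks = V (i # js)" using V_cong[OF kw _ ks(2)] * w by simp
  then have "V ks (unitv i) = - V js (unitv i)" using * by simp
  moreover have "V js (unitv i) \<noteq> 0" using R_nonzero[of "V js (unitv i)"] * w by simp
  ultimately have "\<not> posv (V ks (unitv i))" using * pos_neg_zero by auto
  then obtain ls where ls: "set ls \<subseteq> set ks" "length ks = Suc (length ls)" "act ls = act (i # ks)"
    using deletion kw * by blast
  have "act ls = act js" using ls(3) ks(2) * by (simp add: act_Cons)
  then have "length js \<le> length ls" using * kw ls(1) unfolding red_def wd_def by blast
  then show "red (i # js)" using red_of_length[OF ks(1), of "i # js"] ls ks * w by simp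
qed

lemma red_append: "red (p @ q) \<Longrightarrow> red q" by (induction p) (auto simp: red_Cons)

lemma red_rev: assumes "red js" shows "red (rev js)"
proof -
  have w: "wd js" using assms by (simp add: red_def)
  have "length (rev js) \<le> length ks" if "wd ks" "act ks = act (rev js)" for ks
  proof -
    have "V ks = V (rev js)" by (rule V_cong) (use that w in auto)
    then have "act (rev ks) = act js" by (simp add: act_rev V_rev)
    then show ?thesis using assms that(1) unfolding red_def by (metis length_rev wd_simps(4))
  qed
  then show ?thesis using w by (auto simp: red_def)
qed

lemma red_append1: assumes "red (p @ q)" shows "red p"
proof -
  have "red (rev q @ rev p)" using red_rev[OF assms] by simp
  then have "red (rev p)" by (rule red_append)
  then show ?thesis using red_rev[of "rev p"] by simp
qed

text \<open>Deletion only drops letters, so a non-reduced word in the letters \<open>J\<close> can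
  be shortened inside \<open>J\<close>. Minimal length in the parabolic subgroup is therefore
  minimal length in the whole group; reduced decompositions of s_theta are given in the finite Weyl
  group.\<close>

lemma red_of_parabolic:
  assumes "set js \<subseteq> J" "J \<subseteq> {..n}"
    and "\<And>ks. set ks \<subseteq> J \<Longrightarrow> act ks = act js \<Longrightarrow> length js \<le> length ks"
  shows "red js"
  using assms
proof (induction js)
  case Nil
  then show ?case by (simp add: red_def)
next
  case (Cons i js)
  have w: "i \<le> n" "wd js" using Cons.prems by (auto simp: wd_def)
  have "length js \<le> length ks" if "set ks \<subseteq> J" "act ks = act js" for ks
    using Cons.prems(1) Cons.prems(3)[of "i # ks"] that by (simp add: act_Cons)
  then have r: "red js" using Cons by simp
  have "posv (V js (unitv i))"
  proof (rule ccontr)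
    assume "\<not> ?thesis"
    then obtain ks where ks: "set ks \<subseteq> set js" "length js = Suc (length ks)" "act ks = act (i # js)"
      using deletion w by blast
    then have "length (i # js) \<le> length ks" using Cons.prems(1) by (intro Cons.prems(3)) auto
    then show False using ks by simp
  qed
  then show ?case using r w by (simp add: red_Cons)
qed

section \<open>Rank two and Matsumoto's theorem\<close>

text \<open>A relation, not a function: between nodes joined by four laces there is no
  \<open>m\<close> and no braid relation.\<close>

definition bm :: "nat \<Rightarrow> nat \<Rightarrow> nat \<Rightarrow> bool" where
  "bm i j m \<longleftrightarrow> (c i j * c j i, m) \<in> {(0, 2), (1, 3), (2, 4), (3, 6)}"

lemma c_zero_iff: assumes "i \<le> n" "j \<le> n" shows "c i j = 0 \<longleftrightarrow> c j i = 0"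
  using c_sym[OF assms] e_pos[OF assms(1)] e_pos[OF assms(2)] by auto

lemma c_rank2:
  assumes "i \<le> n" "j \<le> n" "i \<noteq> j" "c i j * c j i \<le> 3"
  shows "(c i j, c j i) \<in> {(0, 0), (-1, -1), (-1, -2), (-2, -1), (-1, -3), (-3, -1)}"
proof -
  define p q where "p = - c i j" and "q = - c j i"
  have pq: "0 \<le> p" "0 \<le> q" "p * q \<le> 3" "p = 0 \<longleftrightarrow> q = 0"
    using assms c_off[of i j] c_off[of j i] c_zero_iff[of i j] by (auto simp: p_def q_def)
  have "(p, q) \<in> {(0, 0), (1, 1), (1, 2), (2, 1), (1, 3), (3, 1)}"
  proof (cases "p = 0")
    case False
    then have "1 \<le> p" "1 \<le> q" using pq by auto
    moreover have "p \<le> p * q" "q \<le> p * q"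
      using calculation mult_left_mono[of 1 q p] mult_right_mono[of 1 p q] by simp_all
    ultimately have "p = 1 \<or> p = 2 \<or> p = 3" "q = 1 \<or> q = 2 \<or> q = 3" using pq(3) by linarith+
    then show ?thesis using pq(3) by auto
  qed (use pq in auto)
  then show ?thesis by (auto simp: p_def q_def)
qed

lemma bm_rank2: assumes "i \<le> n" "j \<le> n" "i \<noteq> j" "bm i j m"
  shows "(c i j, c j i, m) \<in> {(0, 0, 2), (-1, -1, 3), (-1, -2, 4), (-2, -1, 4), (-1, -3, 6), (-3, -1, 6)}"
proof -
  have b: "c i j * c j i = 0 \<and> m = 2 \<or> c i j * c j i = 1 \<and> m = 3 \<or>
    c i j * c j i = 2 \<and> m = 4 \<or> c i j * c j i = 3 \<and> m = 6"
    using assms(4) by (simp only: bm_def insert_iff empty_iff prod.inject simp_thms)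
  then have "c i j * c j i \<le> 3" by linarith
  from c_rank2[OF assms(1-3) this]
  consider "c i j = 0" "c j i = 0" | "c i j = -1" "c j i = -1" | "c i j = -1" "c j i = -2"
    | "c i j = -2" "c j i = -1" | "c i j = -1" "c j i = -3" | "c i j = -3" "c j i = -1"
    by (simp only: insert_iff empty_iff prod.inject simp_thms) blast
  then show ?thesis using b by cases simp_all
qed

lemma bm_exists: assumes "i \<le> n" "j \<le> n" "i \<noteq> j" "2 \<le> n" shows "\<exists>m. bm i j m"
proof -
  from c_rank2[OF assms(1-3) c_prod[OF assms]]
  consider "c i j = 0" "c j i = 0" | "c i j = -1" "c j i = -1" | "c i j = -1" "c j i = -2"
    | "c i j = -2" "c j i = -1" | "c i j = -1" "c j i = -3" | "c i j = -3" "c j i = -1"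
    by (simp only: insert_iff empty_iff prod.inject simp_thms) blast
  then show ?thesis by cases (simp_all add: bm_def)
qed

lemma bm_sym: "bm i j m \<longleftrightarrow> bm j i m" by (simp add: bm_def mult.commute)

text \<open>Coordinates on the coset of \<open>x\<close> modulo the span of two simple roots. Both
  reflections act by integer substitutions, so rank-two identities reduce to evaluation for each
  possible bond.\<close>

definition cmb :: "nat \<Rightarrow> nat \<Rightarrow> ivec \<Rightarrow> int \<Rightarrow> int \<Rightarrow> ivec" where
  "cmb i j x p q = x + sc p (unitv i) + sc q (unitv j)"

lemma cmb_step:
  assumes "i \<le> n" "j \<le> n"
  shows "s i (cmb i j x p q) = cmb i j x (- p - pr x i - c i j * q) q"
    and "s j (cmb i j x p q) = cmb i j x p (- q - pr x j - c j i * p)"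
  using assms by (simp_all add: cmb_def s_def c_diag fun_eq_iff algebra_simps)

lemma act_alt:
  assumes "i \<le> n" "j \<le> n" "i \<noteq> j" "bm i j m"
  shows "act (alt m i j) = act (alt m j i)"
proof
  fix x
  have "x = cmb i j x 0 0" by (simp add: cmb_def)
  moreover have "act (alt m i j) (cmb i j x 0 0) = act (alt m j i) (cmb i j x 0 0)"
    using bm_rank2[OF assms]
    by (auto simp: eval_nat_numeral cmb_step[OF assms(1,2)] intro!: arg_cong2[of _ _ _ _ "cmb i j x"])
  ultimately show "act (alt m i j) x = act (alt m j i) x" by metis
qed

text \<open>An alternating word with fewer than \<open>m\<close> letters keeps one of the two simple
  roots positive, so it cannot have both nodes as descents. As \<open>m\<close> is at most 6, all
  cases are evaluated.\<close>

lemma alt_pos: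
  assumes "i \<le> n" "j \<le> n" "i \<noteq> j" "bm i j m" "k < m"
  shows "posv (V (alt k i j) (unitv j))"
proof -
  have u: "unitv j = cmb i j 0 0 1" by (simp add: cmb_def)
  have pos: "posv (cmb i j 0 p q)" if "0 \<le> p" "0 \<le> q" for p q
    using that by (simp add: cmb_def posv_add posv_sc)
  have m: "m \<le> 6" using bm_rank2[OF assms(1-4)] by auto
  have "k = 0 \<or> k = 1 \<or> k = 2 \<or> k = 3 \<or> k = 4 \<or> k = 5" using assms(5) m by linarith
  then show ?thesis
    using bm_rank2[OF assms(1-4)] assms(5) unfolding u
    by (elim disjE insertE) (simp_all add: eval_nat_numeral cmb_step[OF assms(1,2)] pos)
qed

lemma red_alternating:
  assumes "red u" "set u \<subseteq> {i, j}"
  shows "\<exists>k. u = alt k i j \<or> u = alt k j i"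
  using assms
proof (induction u)
  case Nil
  then show ?case by (intro exI[of _ 0]) simp
next
  case (Cons x u)
  then obtain k where k: "u = alt k i j \<or> u = alt k j i" using red_tail by auto
  have ne: "u \<noteq> x # u'" for u'
  proof
    assume "u = x # u'"
    then have "V u (unitv x) = - V u' (unitv x)" and "red (x # u')" using Cons.prems
      by (auto simp: red_Cons)
    then have "posv (- V u' (unitv x))" "posv (V u' (unitv x))" "V u' (unitv x) \<in> R"
      using Cons.prems by (auto simp: red_Cons red_wd)
    then show False using R_nonzero pos_neg_zero by auto
  qed
  show ?case
  proof (cases k)
    case 0
    then show ?thesis using k Cons.prems by (intro exI[of _ 1]) auto
  next
    case (Suc k')
    then have "u = alt k i j \<and> x = j \<or> u = alt k j i \<and> x = i"
      using k ne Cons.prems(2) by auto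
    then show ?thesis by (intro exI[of _ "Suc k"]) auto
  qed
qed

text \<open>Applying the braid relation to the last \<open>m\<close> of \<open>m + 1\<close> letters
  brings two equal letters together, and they cancel.\<close>

lemma alt_too_long:
  assumes "i \<le> n" "j \<le> n" "i \<noteq> j" "bm i j m" "m < k"
  shows "\<not> red (alt k i j)"
proof
  assume r: "red (alt k i j)"
  have "alt k i j = alt (Suc m) i j @ (if even (Suc m) then alt (k - Suc m) i j else alt (k - Suc m) j i)"
    using assms(5) alt_add[of "Suc m" "k - Suc m" i j] by simp
  then have "red (alt (Suc m) i j)" using r red_append1 by metis
  moreover obtain m' where m': "m = Suc m'" using assms(4) by (cases m) (auto simp: bm_def)
  have "act (alt (Suc m) i j) x = act (alt m' j i) x" for x
  proof -
    have "act (alt (Suc m) i j) x = s i (act (alt m i j) x)"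
      unfolding act_alt[OF assms(1-4)] by simp
    then show ?thesis using assms(1) by (simp add: m')
  qed
  then have "act (alt (Suc m) i j) = act (alt m' j i)" by (rule ext)
  moreover have "wd (alt m' j i)" using set_alt[of m' j i] assms by (auto simp: wd_def)
  ultimately have "length (alt (Suc m) i j) \<le> length (alt m' j i)" unfolding red_def by metis
  then show False by (simp add: m')
qed

text \<open>The factorisation into an element of a rank-two parabolic subgroup and a shortest coset
  representative: descents in \<open>{i, j}\<close> are moved to the front one at a time.\<close>

lemma strip:
  assumes "red js" "i \<le> n" "j \<le> n"
  shows "\<exists>u v. set u \<subseteq> {i, j} \<and> red (u @ v) \<and> act (u @ v) = act js \<and> posv (V v (unitv i)) \<and> posv (V v (unitv j))"
  using assms(1)
proof (induction "length js" arbitrary: js rule: less_induct)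
  case less
  show ?case
  proof (cases "posv (V js (unitv i)) \<and> posv (V js (unitv j))")
    case True
    then show ?thesis using less.prems by (intro exI[of _ "[]"] exI[of _ js]) auto
  next
    case False
    then obtain k where k: "k \<in> {i, j}" "\<not> posv (V js (unitv k))" by auto
    then have kn: "k \<le> n" using assms by auto
    obtain ks where ks: "set ks \<subseteq> set js" "length js = Suc (length ks)" "act ks = act (k # js)"
      using deletion[OF red_wd[OF less.prems] kn k(2)] by blast
    have eq: "act (k # ks) = act js" using ks(3) kn by (simp add: act_Cons)
    have wk: "wd (k # ks)" using kn ks(1) red_wd[OF less.prems] by (auto simp: wd_def)
    then have "red (k # ks)" using red_of_length[OF less.prems _ eq] ks(2) by simp
    then have "red ks" by (rule red_tail)
    then obtain u v where uv: "set u \<subseteq> {i, j}" "red (u @ v)" "act (u @ v) = act ks"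
      "posv (V v (unitv i))" "posv (V v (unitv j))"
      using less.hyps[of ks] ks(2) by auto
    have "length (u @ v) = length ks" using red_length uv(2,3) \<open>red ks\<close> by blast
    moreover have "act ((k # u) @ v) = act js" using uv(3) eq by (simp add: act_Cons)
    moreover have "wd ((k # u) @ v)" using red_wd[OF uv(2)] kn by simp
    ultimately have "red ((k # u) @ v)" using red_of_length[OF less.prems] ks(2) by simp
    then show ?thesis using uv \<open>act ((k # u) @ v) = act js\<close> k(1)
      by (intro exI[of _ "k # u"] exI[of _ v]) auto
  qed
qed

lemma rank2_image:
  assumes "set u \<subseteq> {i, j}" "i \<le> n" "j \<le> n"
  shows "\<exists>p' q'. V u (cmb i j 0 p q) = cmb i j 0 p' q'"
  using assms(1)
proof (induction u arbitrary: p q)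
  case Nil
  show ?case by (intro exI[of _ p] exI[of _ q]) simp
next
  case (Cons k u)
  have "\<exists>p1 q1. s k (cmb i j 0 p q) = cmb i j 0 p1 q1"
    using cmb_step[OF assms(2,3), of 0 p q] Cons.prems by fastforce
  then show ?case using Cons.IH Cons.prems by (metis V.simps(2) insert_subset list.simps(15))
qed

text \<open>The rank-two factor \<open>u\<close> makes both simple roots negative. It is
  alternating, and the two bounds on alternating words force its length to be exactly
  \<open>m\<close>: it is the longest element of a finite dihedral group.\<close>

lemma two_descents:
  assumes "red js" "i \<le> n" "j \<le> n" "i \<noteq> j"
    and "\<not> posv (V js (unitv i))" "\<not> posv (V js (unitv j))"
  shows "\<exists>m v. bm i j m \<and> red (alt m i j @ v) \<and> act (alt m i j @ v) = act js"
proof -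
  obtain u v where uv: "set u \<subseteq> {i, j}" "red (u @ v)" "act (u @ v) = act js"
    "posv (V v (unitv i))" "posv (V v (unitv j))"
    using strip[OF assms(1-3)] by blast
  have w: "wd u" "wd v" "wd js" using red_wd[OF uv(2)] red_wd[OF assms(1)] by auto
  have Veq: "V js x = V v (V u x)" for x
    using V_cong[of "u @ v" js] w uv(3) by (metis V_append wd_simps(3))
  have neg: "negv (V u (unitv k))" if k: "k \<in> {i, j}" for k
  proof -
    have kn: "k \<le> n" using k assms by auto
    have "\<not> posv (V u (unitv k))"
    proof
      assume p: "posv (V u (unitv k))"
      have "unitv k = cmb i j 0 (if k = i then 1 else 0) (if k = i then 0 else 1)"
        using k by (auto simp: cmb_def)
      then obtain p' q' where pq: "V u (unitv k) = cmb i j 0 p' q'"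
        using rank2_image[OF uv(1) assms(2,3)] by metis
      have "0 \<le> p'" "0 \<le> q'" using p assms(4) unfolding pq posv_def cmb_def
        by (auto dest: spec[of _ i] spec[of _ j])
      then have "posv (V v (V u (unitv k)))" using uv(4,5) by (simp add: pq cmb_def posv_add posv_sc)
      then show False using assms(5,6) k Veq by auto
    qed
    then show ?thesis using R_neg_iff[of "V u (unitv k)"] w kn by simp
  qed
  \<comment> \<open>If \<open>n = 1\<close>, a positive combination of the two simple roots is
    \<open>dl\<close>, which every word fixes, so they cannot both become negative. This excludes
    the infinite dihedral group.\<close>
  have n2: "2 \<le> n"
  proof (rule ccontr)
    assume "\<not> 2 \<le> n"
    then have n1: "n = 1" using n_pos by simp
    then have ij: "i = 0 \<and> j = 1 \<or> i = 1 \<and> j = 0" using assms(2-4) by linarith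
    have "dl = sc (a i) (unitv i) + sc (a j) (unitv j)"
    proof
      fix k show "dl k = (sc (a i) (unitv i) + sc (a j) (unitv j)) k"
        unfolding dl_def using ij n1 by (auto simp: unitv_apply le_Suc_eq)
    qed
    then have "dl = sc (a i) (V u (unitv i)) + sc (a j) (V u (unitv j))"
      using V_dl[OF w(1)] by simp
    moreover have "negv (V u (unitv i))" "negv (V u (unitv j))" using neg by auto
    ultimately have "dl 0 \<le> 0" using a_pos[OF assms(2)] a_pos[OF assms(3)]
      by (simp add: negv_def add_nonpos_nonpos mult_nonneg_nonpos)
    then show False by simp
  qed
  obtain m where m: "bm i j m" using bm_exists[OF assms(2-4) n2] by blast
  have ru: "red u" using red_append1[OF uv(2)] .
  then obtain k where k: "u = alt k i j \<or> u = alt k j i" using red_alternating uv(1) by blast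
  have npos: "\<not> posv (V u (unitv i))" "\<not> posv (V u (unitv j))"
    using neg R_neg_iff[of "V u (unitv i)"] R_neg_iff[of "V u (unitv j)"] w assms by auto
  have "k = m"
  proof (rule linorder_cases[of k m])
    assume "k < m"
    then show ?thesis using k npos alt_pos[OF assms(2-4) m] alt_pos[OF assms(3,2) _ m[unfolded bm_sym[of i j]]] assms(4) by auto
  next
    assume "m < k"
    then show ?thesis using k ru alt_too_long[OF assms(2-4) m] alt_too_long[OF assms(3,2) _ m[unfolded bm_sym[of i j]]] assms(4) by auto
  qed
  have eq: "act (alt m i j @ v) = act js"
    using uv(3) k \<open>k = m\<close> act_alt[OF assms(2-4) m] by (auto simp: act_comp)
  have "red (alt m i j @ v)"
  proof (rule red_of_length[OF assms(1) _ eq])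
    show "wd (alt m i j @ v)" using set_alt[of m i j] assms w by (auto simp: wd_def)
    show "length (alt m i j @ v) \<le> length js"
      using red_length[OF uv(2) assms(1) uv(3)] k \<open>k = m\<close> by auto
  qed
  then show ?thesis using m eq by blast
qed

section \<open>The affine Weyl group as a set of lattice maps\<close>

definition Wg :: "(ivec \<Rightarrow> ivec) set" where "Wg = act ` {js. wd js}"

lemma Wg_act [simp]: "wd js \<Longrightarrow> act js \<in> Wg" by (auto simp: Wg_def)
lemma Wg_s [simp]: "i \<le> n \<Longrightarrow> s i \<in> Wg"
proof -
  assume "i \<le> n"
  moreover have "s i = act [i]" by (rule ext) simp
  ultimately show ?thesis by (metis Wg_act wd_simps(1,2))
qed
lemma Wg_id [simp]: "(\<lambda>x. x) \<in> Wg"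
proof -
  have "(\<lambda>x. x) = act []" by (rule ext) simp
  then show ?thesis by (metis Wg_act wd_simps(1))
qed
lemma Wg_comp [simp]: "f \<in> Wg \<Longrightarrow> g \<in> Wg \<Longrightarrow> f \<circ> g \<in> Wg"
  unfolding Wg_def using act_comp by (auto simp: image_iff) (metis wd_simps(3))
lemma Wg_R [simp]: "f \<in> Wg \<Longrightarrow> x \<in> R \<Longrightarrow> f x \<in> R" by (auto simp: Wg_def)
lemma Wg_lin: "f \<in> Wg \<Longrightarrow> f (x + y) = f x + f y" "f \<in> Wg \<Longrightarrow> f (x - y) = f x - f y"
  "f \<in> Wg \<Longrightarrow> f (- x) = - f x" "f \<in> Wg \<Longrightarrow> f (sc k x) = sc k (f x)" "f \<in> Wg \<Longrightarrow> f 0 = 0"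
  by (auto simp: Wg_def)
lemma Wg_dl: "f \<in> Wg \<Longrightarrow> f dl = dl" by (auto simp: Wg_def)
lemma Wg_B: "f \<in> Wg \<Longrightarrow> B (f x) (f y) = B x y" by (auto simp: Wg_def)
lemma Wg_lat: "f \<in> Wg \<Longrightarrow> x \<in> lat \<Longrightarrow> f x \<in> lat" by (auto simp: Wg_def)
lemma Wg_inverse: assumes "f \<in> Wg" obtains g where "g \<in> Wg" "\<And>x. g (f x) = x" "\<And>x. f (g x) = x"
proof -
  obtain js where js: "wd js" "f = act js" using assms by (auto simp: Wg_def)
  have "V js \<in> Wg" using Wg_act[of "rev js"] js(1) by (simp add: act_rev)
  then show ?thesis using that[of "V js"] js by simp
qed

end

section \<open>Canonical lifts of Weyl group elements to a group with braid relations\<close>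

locale affine_braid = affine_data + G: group G for G (structure) +
  fixes T :: "nat \<Rightarrow> 'b"
  assumes T_closed [simp]: "T i \<in> carrier G"
    and braid: "i \<le> n \<Longrightarrow> j \<le> n \<Longrightarrow> i \<noteq> j \<Longrightarrow> bm i j m \<Longrightarrow>
      foldr (\<lambda>k g. T k \<otimes> g) (alt m i j) \<one> = foldr (\<lambda>k g. T k \<otimes> g) (alt m j i) \<one>"
begin

definition tp :: "nat list \<Rightarrow> 'b" where "tp js = foldr (\<lambda>k g. T k \<otimes> g) js \<one>"

lemma tp_simps [simp]: "tp [] = \<one>" "tp (i # js) = T i \<otimes> tp js" by (simp_all add: tp_def)
lemma tp_closed [simp]: "tp js \<in> carrier G" by (induction js) auto
lemma tp_append [simp]: "tp (js @ ks) = tp js \<otimes> tp ks"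
  by (induction js) (auto simp: G.m_assoc)

text \<open>Matsumoto's theorem, by induction on the length. Words with the same first letter are
  compared through their tails. If the first letters differ, both are descents, so the element also
  has two reduced words that begin with the alternating words of \<open>two_descents\<close>; each
  given word shares its first letter with one of them, and these two differ by one braid
  relation.\<close>

lemma tp_red: "red js \<Longrightarrow> red ks \<Longrightarrow> act js = act ks \<Longrightarrow> tp js = tp ks"
proof (induction "length js" arbitrary: js ks rule: less_induct)
  case less
  have len: "length js = length ks" using red_length less.prems by blast
  show ?case
  proof (cases js)
    case Nil
    then show ?thesis using len by simp
  next
    case (Cons i js')
    then obtain j ks' where ks: "ks = j # ks'" using len by (cases ks) auto
    note js = Cons
    have same: "tp (k # p) = tp (k # q)"
      if "red (k # p)" "red (k # q)" "act (k # p) = act (k # q)" "length (k # p) = length js" for k p q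
    proof -
      have "act p = act q"
      proof
        fix x
        have "s k (act p x) = s k (act q x)" using fun_cong[OF that(3), of x] by simp
        then show "act p x = act q x" using s_s that(1) by (metis red_Cons)
      qed
      then show ?thesis using less.hyps[of p q] that red_tail by auto
    qed
    show ?thesis
    proof (cases "i = j")
      case True
      then show ?thesis using same less.prems js ks by metis
    next
      case False
      have ij: "i \<le> n" "j \<le> n" using less.prems js ks by (auto simp: red_Cons)
      have neg: "\<not> posv (V ls (unitv k))" if "red ls" "act ls = act (k # p)" "red (k # p)" for ls k p
      proof -
        have k: "k \<le> n" "red p" "posv (V p (unitv k))" using that(3) by (auto simp: red_Cons)
        have "V ls = V (k # p)" using V_cong that red_wd by blast
        then have "V ls (unitv k) = - V p (unitv k)" using k by simp
        moreover have "V p (unitv k) \<noteq> 0" using R_nonzero[of "V p (unitv k)"] k red_wd by simp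
        ultimately show ?thesis using k pos_neg_zero by auto
      qed
      have "\<not> posv (V js (unitv i))" "\<not> posv (V js (unitv j))"
        using neg[of js i js'] neg[of js j ks'] less.prems js ks by auto
      then obtain m v where mv: "bm i j m" "red (alt m i j @ v)" "act (alt m i j @ v) = act js"
        using two_descents[OF less.prems(1) ij False] by blast
      have eq': "act (alt m j i @ v) = act js"
        using mv(3) act_alt[OF ij False mv(1)] by (auto simp: act_comp)
      have "red (alt m j i @ v)"
      proof (rule red_of_length[OF mv(2)])
        show "wd (alt m j i @ v)" using red_wd[OF mv(2)] set_alt[of m j i] ij by (auto simp: wd_def)
      qed (use eq' mv in auto)
      obtain m' where m': "m = Suc m'" using mv(1) by (cases m) (auto simp: bm_def)
      have l1: "length (alt m i j @ v) = length js" using red_length[OF mv(2) less.prems(1) mv(3)] .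
      have "tp js = tp (alt m i j @ v)"
        using same[of i js' "alt m' j i @ v"] less.prems(1) mv js by (simp add: m')
      also have "\<dots> = tp (alt m j i @ v)"
        using braid[OF ij False mv(1)] by (simp add: tp_def[symmetric])
      also have "\<dots> = tp ks"
        using same[of j "alt m' i j @ v" ks'] less.prems l1 \<open>red (alt m j i @ v)\<close> eq' ks
        by (simp add: m')
      finally show ?thesis .
    qed
  qed
qed

definition TW :: "(ivec \<Rightarrow> ivec) \<Rightarrow> 'b" where "TW f = tp (SOME js. red js \<and> act js = f)"

lemma TW_red: assumes "red js" shows "TW (act js) = tp js"
proof -
  have "red (SOME ks. red ks \<and> act ks = act js) \<and> act (SOME ks. red ks \<and> act ks = act js) = act js"
    using someI[of "\<lambda>ks. red ks \<and> act ks = act js" js] assms by simp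
  then show ?thesis using assms tp_red unfolding TW_def by blast
qed

lemma TW_closed [simp]: "TW f \<in> carrier G" by (simp add: TW_def)

lemma red_Wg: "f \<in> Wg \<Longrightarrow> \<exists>js. red js \<and> act js = f"
  unfolding Wg_def using red_exists by blast

text \<open>The last hypothesis says that lengths add: no positive root made negative by
  \<open>g\<close> is made positive again by \<open>f\<close>. The concatenation of reduced words is
  then reduced, by the sign test of \<open>red_Cons\<close> along the first word.\<close>

lemma TW_mult:
  assumes "f \<in> Wg" "g \<in> Wg"
    and "\<And>x. x \<in> R \<Longrightarrow> posv x \<Longrightarrow> \<not> posv (g x) \<Longrightarrow> \<not> posv (f (g x))"
  shows "TW (f \<circ> g) = TW f \<otimes> TW g"
proof -
  obtain js ks where js: "red js" "act js = f" and ks: "red ks" "act ks = g"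
    using red_Wg assms by metis
  have "red (js @ ks)"
    using js(1) assms(3) unfolding js(2)[symmetric] ks(2)[symmetric]
  proof (induction js)
    case (Cons i js)
    have i: "i \<le> n" "red js" "posv (V js (unitv i))" using Cons.prems(1) by (auto simp: red_Cons)
    have w: "wd js" "wd ks" using i ks red_wd by auto
    define y where "y = V js (unitv i)"
    have yR: "y \<in> R" using w i by (simp add: y_def)
    have "red (js @ ks)"
    proof (rule Cons.IH[OF i(2)])
      fix x assume x: "x \<in> R" "posv x" "\<not> posv (act ks x)"
      show "\<not> posv (act js (act ks x))"
      proof
        assume p: "posv (act js (act ks x))"
        have "act js (act ks x) = unitv i"
          using pos_to_neg[OF i(1) _ p] Cons.prems(2)[OF x] w x by simp
        then have "act ks x = y" using V_act[OF w(1)] unfolding y_def by metis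
        then show False using x i y_def by simp
      qed
    qed
    moreover have "posv (V ks y)"
    proof (rule ccontr)
      \<comment> \<open>Otherwise the negative of \<open>V ks y\<close> is a positive root that
        \<open>ks\<close> makes negative and \<open>i # js\<close> then turns into alpha_i, against
        the hypothesis.\<close>
      assume "\<not> posv (V ks y)"
      then have "posv (- V ks y)" using R_neg_iff[of "V ks y"] w yR by simp
      moreover have e: "act ks (- V ks y) = - y" using w by simp
      moreover have "\<not> posv (- y)" using i(3) R_neg_iff[OF yR] y_def by simp
      moreover have "- V ks y \<in> R" using w yR by simp
      ultimately have "\<not> posv (act (i # js) (act ks (- V ks y)))" using Cons.prems(2) by metis
      moreover have "act (i # js) (- y) = unitv i" using w i by (simp add: y_def)
      ultimately show False using e posv_unitv by metis
    qed
    ultimately show ?case using i w by (simp add: red_Cons y_def)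
  qed (use ks in simp)
  then have "TW (act (js @ ks)) = tp (js @ ks)" by (rule TW_red)
  then show ?thesis using TW_red[OF js(1)] TW_red[OF ks(1)] js ks by (simp add: act_comp)
qed

lemma TW_s [simp]: "i \<le> n \<Longrightarrow> TW (s i) = T i"
proof -
  assume "i \<le> n"
  moreover have "s i = act [i]" by (rule ext) simp
  moreover have "red []" by (simp add: red_def)
  ultimately show ?thesis using TW_red[of "[i]"] by (simp add: red_Cons)
qed

text \<open>Here \<open>y\<close> is the preimage of alpha_i under \<open>g\<close>, and its
  positivity is the length criterion for s_i g. As a witness it avoids naming the inverse
  map.\<close>

lemma TW_left:
  assumes "g \<in> Wg" "i \<le> n" "y \<in> R" "posv y" "g y = unitv i"
  shows "TW (s i \<circ> g) = T i \<otimes> TW g"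
proof -
  have "TW (s i \<circ> g) = TW (s i) \<otimes> TW g"
  proof (rule TW_mult)
    fix x assume x: "x \<in> R" "posv x" "\<not> posv (g x)"
    show "\<not> posv (s i (g x))"
    proof
      assume "posv (s i (g x))"
      then have "s i (g x) = unitv i"
        using pos_to_neg[of i "s i (g x)"] x assms by simp
      then have "g x = - unitv i" using assms(2) by (metis s_s s_unitv_same)
      then have "g (x + y) = 0" using assms(5) by (simp add: Wg_lin[OF assms(1)])
      then have "x + y = 0" using Wg_inverse[OF assms(1)] Wg_lin(5) by metis
      then have "y = - x" by (simp add: eq_neg_iff_add_eq_0 add.commute)
      then have "negv x" using assms(4) by simp
      then show False using x R_neg_iff by blast
    qed
  qed (use assms in auto)
  then show ?thesis using assms by simp
qed

lemma TW_right:
  assumes "f \<in> Wg" "i \<le> n" "posv (f (unitv i))"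
  shows "TW (f \<circ> s i) = TW f \<otimes> T i"
proof -
  have "TW (f \<circ> s i) = TW f \<otimes> TW (s i)"
  proof (rule TW_mult)
    fix x assume x: "x \<in> R" "posv x" "\<not> posv (s i x)"
    then have "x = unitv i" using pos_to_neg assms by blast
    then have "f (s i x) = - f (unitv i)" using assms(2) by (simp add: Wg_lin[OF assms(1)])
    moreover have "f (unitv i) \<in> R" using assms by simp
    ultimately show "\<not> posv (f (s i x))" using assms(3) R_neg_iff by auto
  qed (use assms in auto)
  then show ?thesis using assms by simp
qed

end

lemma (in group) cancel_left [simp]:
  assumes "x \<in> carrier G" "y \<in> carrier G"
  shows "inv x \<otimes> (x \<otimes> y) = y" "x \<otimes> (inv x \<otimes> y) = y"
  using assms by (simp_all add: m_assoc[symmetric])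

lemma (in group) comm_inv:
  assumes "x \<in> carrier G" "y \<in> carrier G" "x \<otimes> y = y \<otimes> x"
  shows "x \<otimes> inv y = inv y \<otimes> x"
proof -
  have "x \<otimes> inv y = inv y \<otimes> (y \<otimes> x) \<otimes> inv y" using assms(1,2) by (simp add: m_assoc)
  also have "\<dots> = inv y \<otimes> x" using assms(1,2) by (simp add: assms(3)[symmetric] m_assoc)
  finally show ?thesis .
qed

lemma (in group) comm_mult:
  assumes "x \<in> carrier G" "y \<in> carrier G" "z \<in> carrier G" "x \<otimes> y = y \<otimes> x" "x \<otimes> z = z \<otimes> x"
  shows "x \<otimes> (y \<otimes> z) = y \<otimes> z \<otimes> x"
  using assms by (metis m_assoc)

section \<open>Induction over the finite lattice\<close>

context affine_data
begin

lemma pr_s: "i \<le> n \<Longrightarrow> pr (s i x) j = pr x j - c j i * pr x i"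
  by (simp add: s_def)

lemma fin_span:
  assumes add: "\<And>x y. x \<in> fin \<Longrightarrow> P x \<Longrightarrow> y \<in> fin \<Longrightarrow> P y \<Longrightarrow> P (x + y)"
    and neg: "\<And>x. x \<in> fin \<Longrightarrow> P x \<Longrightarrow> P (- x)"
    and unit: "\<And>k. k \<in> {1..n} \<Longrightarrow> P (unitv k)"
    and x: "x \<in> fin"
  shows "P x"
proof -
  have P0: "P 0" using add[of "unitv n" "- unitv n"] neg[of "unitv n"] unit[of n] n_pos by simp
  have nsc: "P (sc (int m) y)" if "y \<in> fin" "P y" for m y
  proof (induction m)
    case 0
    then show ?case using P0 by (metis of_nat_0 sc_simps(1))
  next
    case (Suc m)
    have "sc (int (Suc m)) y = sc (int m) y + y" by (simp add: fun_eq_iff algebra_simps)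
    moreover have "P (sc (int m) y + y)" using add Suc that fin_closed(5) by blast
    ultimately show ?case by metis
  qed
  have scl: "P (sc k y)" if "y \<in> fin" "P y" for k y
  proof (cases "0 \<le> k")
    case True
    then show ?thesis using nsc[OF that, of "nat k"] by simp
  next
    case False
    then have "sc k y = - sc (int (nat (- k))) y" by (simp add: fun_eq_iff)
    then show ?thesis using nsc[OF that, of "nat (- k)"] neg that by simp
  qed
  define tr where "tr m = (\<lambda>j. if j \<le> m then x j else 0)" for m :: nat
  have "P (tr m) \<and> tr m \<in> fin" if "m \<le> n" for m
    using that
  proof (induction m)
    case 0
    have "tr 0 = 0" using x by (auto simp: tr_def fun_eq_iff fin_def)
    then show ?case using P0 fin_closed(1) by metis
  next
    case (Suc m)
    have "tr (Suc m) = tr m + sc (x (Suc m)) (unitv (Suc m))"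
      by (auto simp: tr_def fun_eq_iff unitv_apply le_Suc_eq)
    moreover have "P (sc (x (Suc m)) (unitv (Suc m)))" "sc (x (Suc m)) (unitv (Suc m)) \<in> fin"
      using scl[of "unitv (Suc m)"] unit[of "Suc m"] Suc.prems by simp_all
    moreover have "P (tr m)" "tr m \<in> fin" using Suc by simp_all
    ultimately show ?case using add fin_closed(2) by metis
  qed
  moreover have "tr n = x" using x by (auto simp: tr_def fun_eq_iff fin_def lat_def)
  ultimately show ?thesis by auto
qed

text \<open>An induction that starts from \<open>phi\<close> alone, where the Bernstein elements and
  the translations are explicit. At pairing -1 a reflection adds alpha_k, so the difference of a
  vector and its reflection contributes alpha_k; this leads from -phi to the neighbours of 0 and on
  along \<open>par\<close>.\<close>

lemma closure:
  assumes add: "\<And>x y. x \<in> fin \<Longrightarrow> P x \<Longrightarrow> y \<in> fin \<Longrightarrow> P y \<Longrightarrow> P (x + y)"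
    and neg: "\<And>x. x \<in> fin \<Longrightarrow> P x \<Longrightarrow> P (- x)"
    and phi: "P phi"
    and refl: "\<And>x k. k \<in> {1..n} \<Longrightarrow> x \<in> fin \<Longrightarrow> P x \<Longrightarrow> pr x k = -1 \<Longrightarrow> P (s k x)"
    and x: "x \<in> fin"
  shows "P x"
proof -
  have P0: "P 0" using add[of phi "- phi"] neg[of phi] phi by simp
  have diff: "P (x - y)" if "x \<in> fin" "P x" "y \<in> fin" "P y" for x y
    using add[of x "- y"] neg[of y] that by simp
  have from_nbr: "P (unitv k)" if k: "k \<in> {1..n}" and y: "y \<in> fin" "P y" "pr y k = -1" for k y
  proof -
    have "P (s k y)" using refl k y by blast
    then have "P (s k y - y)" using diff k y by simp
    then show ?thesis using y by (simp add: s_prm1)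
  qed
  have from_phi: "P (unitv k)" if "k \<in> {1..n}" "c k 0 = -1" for k
    using from_nbr[of k "- phi"] neg[of phi] phi that by simp
  have unit: "P (unitv k)" if "k \<in> {1..n}" for k
    using shape
  proof
    assume I: "\<forall>k\<in>{1..n}. c k (par k) = -1 \<and> c 0 k \<in> {0, -1}"
    show ?thesis using that
    proof (induction "rk k" arbitrary: k rule: less_induct)
      case less
      show ?case
      proof (cases "par k = 0")
        case True
        then show ?thesis using from_phi[OF less.prems] I less.prems by metis
      next
        case False
        then have p: "par k \<in> {1..n}" "rk (par k) < rk k" using par[OF less.prems] by auto
        have "pr (unitv (par k)) k = -1" using p I less.prems by simp
        show ?thesis
          by (rule from_nbr[OF less.prems unitv_fin[OF p(1)] less.hyps[OF p(2,1)] \<open>pr (unitv (par k)) k = -1\<close>])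
      qed
    qed
  next
    assume II: "(\<forall>k\<le>n. a k = 1) \<and> (\<forall>k\<in>{1..<n}. c k (k - 1) = -1) \<and> c 0 1 = -2 \<and> c n (n - 1) = -2 \<and>
       (\<forall>i\<le>n. \<forall>j\<le>n. i + 2 \<le> j \<longrightarrow> c i j = 0 \<and> c j i = 0)"
    have low: "P (unitv k)" if "1 \<le> k" "k < n" for k
      using that
    proof (induction k rule: nat_induct_at_least)
      case base
      then show ?case using from_phi[of 1] II by force
    next
      case (Suc k)
      have "c (Suc k) k = -1" using II Suc by (metis Suc_eq_plus1 Suc_leD add_diff_cancel_right' atLeastLessThan_iff le_SucI)
      then show ?case using from_nbr[of "Suc k" "unitv k"] Suc by simp
    qed
    define chi where "chi m = (\<lambda>j. if 1 \<le> j \<and> j \<le> m then 1 else 0 :: int)" for m :: nat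
    have chi: "P (chi m) \<and> chi m \<in> fin" if "m < n" for m
      using that
    proof (induction m)
      case 0
      have "chi 0 = 0" by (auto simp: chi_def fun_eq_iff)
      then show ?case using P0 by (simp only: fin_closed simp_thms)
    next
      case (Suc m)
      have "chi (Suc m) = chi m + unitv (Suc m)" by (auto simp: chi_def fun_eq_iff unitv_apply)
      moreover have "P (chi m + unitv (Suc m)) \<and> chi m + unitv (Suc m) \<in> fin"
        using Suc low[of "Suc m"] add[of "chi m" "unitv (Suc m)"] by simp
      ultimately show ?case by metis
    qed
    \<comment> \<open>The walk stops before \<open>n\<close>, where the pairing with the previous
      node is -2. Since all labels are 1, alpha_n is what remains of \<open>phi\<close> after
      removing the other simple roots.\<close>
    have "unitv n = phi - chi (n - 1)"
      using II n_pos by (auto simp: chi_def fun_eq_iff unitv_apply phi_def dl_def)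
    then have "P (unitv n)" using chi[of "n - 1"] diff phi n_pos by simp
    then show ?thesis using low[of k] that by (cases "k = n") auto
  qed
  show ?thesis by (rule fin_span[of P, OF add neg unit x])
qed

section \<open>Short roots\<close>

lemma short_step:
  assumes "b \<in> fin" "B b b = 2" "posv b" "m \<in> {1..n}" "pr b m = 1"
  shows "b - unitv m \<in> fin" "B (b - unitv m) (b - unitv m) = 2" "posv (b - unitv m)"
    "s m (b - unitv m) = b"
proof -
  have m: "m \<le> n" using assms by simp
  have sb: "s m b = b - unitv m" using assms by (simp add: s_pr1)
  have "b \<noteq> unitv m" using assms(5) c_diag[OF m] m by auto
  moreover have "b \<in> R" using assms by (simp add: R_def fin_lat)
  ultimately have "posv (s m b)" using posv_s[OF m] assms by simp
  then show "posv (b - unitv m)" using sb by simp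
  show "b - unitv m \<in> fin" using assms by simp
  show "B (b - unitv m) (b - unitv m) = 2" unfolding sb[symmetric] using m assms by simp
  show "s m (b - unitv m) = b" unfolding sb[symmetric] using m by simp
qed

text \<open>As the norm is positive, some node has a positive coordinate and a positive pairing. A
  pairing of at least 2 makes the norm of \<open>b - unitv i\<close> nonpositive, so this vector is
  a multiple of \<open>dl\<close>, hence zero in \<open>fin\<close>.\<close>

lemma short_exists:
  assumes "b \<in> fin" "B b b = 2" "posv b"
  shows "(\<exists>k\<in>{1..n}. e k = 1 \<and> b = unitv k) \<or> (\<exists>m\<in>{1..n}. pr b m = 1)"
proof -
  have "\<not> (\<forall>i\<in>{..n}. e i * b i * pr b i \<le> 0)"
    using sum_nonpos[of "{..n}" "\<lambda>i. e i * b i * pr b i"] assms(2) unfolding B_def by fastforce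
  then obtain i where i: "i \<le> n" "0 < e i * b i * pr b i" by (auto simp: not_le)
  then have bi: "b i \<noteq> 0" by auto
  then have "0 < b i" using assms(3) by (simp add: posv_def order_less_le)
  then have "0 < e i * b i" using e_pos[OF i(1)] by simp
  then have p: "0 < pr b i" using i by (simp only: zero_less_mult_pos)
  have i1: "i \<in> {1..n}" using i bi assms(1) by (cases i) (auto simp: fin_def)
  show ?thesis
  proof (cases "pr b i = 1")
    case True
    then show ?thesis using i1 by blast
  next
    case False
    then have "2 \<le> pr b i" using p by simp
    then have "2 * e i \<le> e i * pr b i" using e_pos[OF i(1)] by simp
    moreover have N: "B (b - unitv i) (b - unitv i) = 2 - 2 * (e i * pr b i) + 2 * e i"
      using i by (simp add: assms c_diag)
    ultimately have "B (b - unitv i) (b - unitv i) = 0"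
      using B_semidefinite[of "b - unitv i"] e_pos[OF i(1)] by linarith
    then have "b - unitv i = sc ((b - unitv i) 0) dl"
      using B_zero_imp[of "b - unitv i"] assms i by (simp add: fin_lat)
    moreover have "(b - unitv i) 0 = 0" using assms(1) i1 by (auto simp: fin_def)
    ultimately have "b = unitv i" by simp
    moreover from this have "e i = 1" using assms(2) i by (simp add: c_diag)
    ultimately show ?thesis using i1 by blast
  qed
qed

definition ht :: "ivec \<Rightarrow> nat" where "ht x = nat (\<Sum>j\<le>n. x j)"

lemma ht_less:
  assumes "posv (b - unitv m)" "m \<le> n"
  shows "ht (b - unitv m) < ht b"
proof -
  have "(\<Sum>j\<le>n. (b - unitv m) j) = (\<Sum>j\<le>n. b j) - 1"
    using assms(2) by (simp add: sum_subtractf unitv_def)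
  moreover have "0 \<le> (\<Sum>j\<le>n. (b - unitv m) j)" using assms(1) by (simp add: posv_def sum_nonneg)
  ultimately show ?thesis by (simp add: ht_def)
qed

lemma short_induct [consumes 3, case_names simple step]:
  assumes "b \<in> fin" "B b b = 2" "posv b"
    and "\<And>k. k \<in> {1..n} \<Longrightarrow> e k = 1 \<Longrightarrow> P (unitv k)"
    and "\<And>b m. b \<in> fin \<Longrightarrow> B b b = 2 \<Longrightarrow> posv b \<Longrightarrow> m \<in> {1..n} \<Longrightarrow> pr b m = 1 \<Longrightarrow>
      P (b - unitv m) \<Longrightarrow> P b"
  shows "P b"
  using assms(1-3)
proof (induction "ht b" arbitrary: b rule: less_induct)
  case less
  from short_exists[OF less.prems] show ?case
  proof (elim disjE bexE)
    fix m assume m: "m \<in> {1..n}" "pr b m = 1"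
    note st = short_step[OF less.prems m]
    then have "P (b - unitv m)" using less.hyps[OF ht_less[OF st(3)]] m by simp
    then show ?thesis using assms(5) less.prems m by blast
  qed (use assms(4) in blast)
qed

text \<open>For a vector of norm 2 this is the reflection in it; the form itself then gives the
  pairing with the coroot.\<close>

definition rf :: "ivec \<Rightarrow> ivec \<Rightarrow> ivec" where "rf b x = x - sc (B b x) b"

lemma rf_unitv: "k \<le> n \<Longrightarrow> e k = 1 \<Longrightarrow> rf (unitv k) = s k"
  by (rule ext) (simp add: rf_def s_def)

lemma rf_s: assumes "m \<le> n" shows "rf (s m b) = s m \<circ> rf b \<circ> s m"
proof
  fix x show "rf (s m b) x = (s m \<circ> rf b \<circ> s m) x"
    using assms by (simp add: rf_def B_s_left)
qed

lemma rf_minus: "rf (- b) = rf b" by (rule ext) (simp add: rf_def fun_eq_iff)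

lemma rf_rf: "B b b = 2 \<Longrightarrow> rf b (rf b x) = x" by (simp add: rf_def fun_eq_iff)

lemma rf_Wg: assumes "b \<in> fin" "B b b = 2" shows "rf b \<in> Wg"
proof -
  have pos: "rf b \<in> Wg" if "b \<in> fin" "B b b = 2" "posv b" for b
    using that
  proof (induction rule: short_induct)
    case (simple k)
    then show ?case by (simp add: rf_unitv)
  next
    case (step b m)
    note st = short_step[OF step(1-5)]
    have "rf b = s m \<circ> rf (b - unitv m) \<circ> s m" using rf_s[of m "b - unitv m"] st step(4) by simp
    then show ?case using step(4,6) by (simp only: Wg_comp Wg_s atLeastAtMost_iff)
  qed
  have "b \<in> R" using assms by (simp add: R_def fin_lat)
  then show ?thesis using R_dichotomy pos[of b] pos[of "- b"] assms rf_minus[of b] by fastforce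
qed

section \<open>Translations\<close>

text \<open>The translation by \<open>l\<close> as an element of the affine Weyl group, acting on
  the root lattice, where it only shifts the multiple of \<open>dl\<close>.\<close>

definition tr :: "ivec \<Rightarrow> ivec \<Rightarrow> ivec" where "tr l x = x - sc (B l x) dl"

lemma tr_add: "tr l \<circ> tr m = tr (l + m)"
  by (rule ext) (simp add: tr_def fun_eq_iff algebra_simps)
lemma tr_zero: "tr 0 = (\<lambda>x. x)" by (rule ext) (simp add: tr_def)
lemma tr_s: assumes "k \<le> n" shows "s k \<circ> tr l = tr (s k l) \<circ> s k"
  by (rule ext) (use assms in \<open>simp add: tr_def\<close>)

lemma phi_posv: "posv phi"
  using a_pos by (auto simp: posv_def phi_def dl_def unitv_apply a_0 less_imp_le)

text \<open>Translation by \<open>phi\<close> is s_0 s_theta; the value of the Bernstein elements at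
  \<open>phi\<close> comes from this identity.\<close>

lemma tr_phi: "tr phi = s 0 \<circ> rf phi"
proof
  fix x
  have "pr (rf phi x) 0 = B phi x" by (simp add: rf_def c_diag)
  then have "(s 0 \<circ> rf phi) x = x - sc (B phi x) phi - sc (B phi x) (unitv 0)"
    by (simp only: comp_apply s_def) (simp only: rf_def)
  moreover have "B phi x = B (dl - unitv 0) x" by (simp only: phi_def)
  ultimately show "tr phi x = (s 0 \<circ> rf phi) x"
    by (simp add: tr_def phi_def fun_eq_iff right_diff_distrib del: B_phi)
qed

lemma tr_Wg: assumes "l \<in> fin" shows "tr l \<in> Wg"
  using _ _ _ _ assms
proof (rule closure)
  show "tr phi \<in> Wg" using rf_Wg[OF phi_fin B_phi_phi] by (simp add: tr_phi)
next
  fix x y assume "tr x \<in> Wg" "tr y \<in> Wg"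
  then show "tr (x + y) \<in> Wg" by (simp flip: tr_add)
next
  fix x assume "tr x \<in> Wg"
  then obtain g where g: "g \<in> Wg" "\<And>y. g (tr x y) = y" using Wg_inverse by metis
  have "g = tr (- x)"
  proof
    fix y
    have "tr x (tr (- x) y) = y" using fun_cong[OF tr_add[of x "- x"], of y] by (simp add: tr_zero)
    then show "g y = tr (- x) y" using g(2) by metis
  qed
  then show "tr (- x) \<in> Wg" using g by simp
next
  fix x k assume "k \<in> {1..n}" "tr x \<in> Wg"
  moreover have "tr (s k x) = s k \<circ> tr x \<circ> s k" if "k \<le> n"
    using tr_s[OF that, of x] that by (auto simp: fun_eq_iff)
  ultimately show "tr (s k x) \<in> Wg" by simp
qed

section \<open>Dominant vectors and lengths of translations\<close>

definition dom :: "ivec \<Rightarrow> bool" where "dom l \<longleftrightarrow> l \<in> fin \<and> (\<forall>i\<in>{1..n}. 0 \<le> pr l i)"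

lemma dom_fin [simp]: "dom l \<Longrightarrow> l \<in> fin" by (simp add: dom_def)
lemma dom_add [simp]: "dom l \<Longrightarrow> dom m \<Longrightarrow> dom (l + m)" by (simp add: dom_def)
lemma dom_sc [simp]: "dom l \<Longrightarrow> 0 \<le> k \<Longrightarrow> dom (sc k l)" by (simp add: dom_def)
lemma dom_phi [simp]: "dom phi" using c_off by (auto simp: dom_def)
lemma dom_zero [simp]: "dom 0" by (simp add: dom_def)

text \<open>Adding a multiple of a simple root at which the vector is already regular makes all its
  neighbours regular, so regularity spreads along the diagram.\<close>
lemma regular_exists: "\<exists>x. dom x \<and> (\<forall>i\<in>{1..n}. 0 < pr x i)"
proof -
  have "\<exists>y. dom y \<and> (\<forall>i\<in>{1..n}. 0 < pr y i)" if "dom x" for x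
    using that
  proof (induction "card {i\<in>{1..n}. pr x i = 0}" arbitrary: x rule: less_induct)
    case less
    define Z where "Z = {i\<in>{1..n}. pr x i = 0}"
    have finZ: "finite Z" by (simp add: Z_def)
    show ?case
    proof (cases "Z = {}")
      case True
      then show ?thesis using less.prems by (intro exI[of _ x]) (force simp: Z_def dom_def order_less_le)
    next
      case False
      then obtain k where k: "k \<in> Z" "\<And>j. j \<in> Z \<Longrightarrow> rk k \<le> rk j"
        using ex_has_least_nat[of "\<lambda>k. k \<in> Z" _ rk] by blast
      have kn: "k \<in> {1..n}" using k(1) by (simp add: Z_def)
      note pk = par[OF kn]
      have step: "?thesis" if y: "dom y" "\<And>i. i \<in> {1..n} \<Longrightarrow> 0 < pr x i \<Longrightarrow> 0 < pr y i" "0 < pr y k" for y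
      proof -
        have "{i\<in>{1..n}. pr y i = 0} \<subset> Z"
        proof
          show "{i\<in>{1..n}. pr y i = 0} \<subseteq> Z"
            using y(2) less.prems by (force simp: Z_def dom_def order_less_le)
          show "{i\<in>{1..n}. pr y i = 0} \<noteq> Z" using k(1) y(3) by auto
        qed
        then have "card {i\<in>{1..n}. pr y i = 0} < card Z" using finZ by (rule psubset_card_mono[rotated])
        then show ?thesis using less.hyps[of y] y(1) by (simp add: Z_def)
      qed
      show ?thesis
      proof (cases "par k = 0")
        case True
        show ?thesis
        proof (rule step[of "x + phi"])
          show "dom (x + phi)" using less.prems by simp
          show "0 < pr (x + phi) k" using less.prems kn pk True by (force simp: dom_def)
          show "0 < pr (x + phi) i" if "i \<in> {1..n}" "0 < pr x i" for i
            using that c_off[of i 0] by simp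
        qed
      next
        case False
        then have p: "par k \<in> {1..n}" using pk by auto
        then have px: "0 < pr x (par k)" using k(2)[of "par k"] pk less.prems
          by (force simp: Z_def dom_def order_less_le)
        \<comment> \<open>At \<open>par k\<close> the pairing p becomes 3 p - 2, which is at least p
          because p is at least 1; with the factor 2 it could vanish.\<close>
        define y where "y = sc 3 x - unitv (par k)"
        have py: "pr y i = 3 * pr x i - c i (par k)" if "i \<le> n" for i using p by (simp add: y_def)
        have py0: "3 * pr x i - c i (par k) \<ge> pr x i" if "i \<in> {1..n}" for i
        proof (cases "i = par k")
          case True
          then show ?thesis using px c_diag[of i] that by simp
        next
          case False
          then show ?thesis using c_off[of i "par k"] that p less.prems by (force simp: dom_def)
        qed
        show ?thesis
        proof (rule step[of y])
          show "dom y" using less.prems p py py0 by (force simp: dom_def y_def)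
          show "0 < pr y k" using py[of k] kn pk less.prems by (force simp: dom_def)
          show "0 < pr y i" if "i \<in> {1..n}" "0 < pr x i" for i using py[of i] py0[of i] that by simp
        qed
      qed
    qed
  qed
  then show ?thesis using dom_zero by blast
qed

lemma dom_sign:
  assumes "dom l" "p \<in> fin"
  shows "posv p \<Longrightarrow> 0 \<le> B l p" "negv p \<Longrightarrow> B l p \<le> 0"
proof -
  have l: "0 \<le> pr l i" if "i \<le> n" "i \<noteq> 0" for i using assms(1) that by (simp add: dom_def)
  have p0: "p 0 = 0" using assms(2) by (simp add: fin_def)
  have eq: "B l p = (\<Sum>i\<le>n. e i * p i * pr l i)" by (subst B_sym) (rule B_def)
  show "0 \<le> B l p" if "posv p"
    unfolding eq
  proof (rule sum_nonneg)
    fix i assume "i \<in> {..n}"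
    then show "0 \<le> e i * p i * pr l i" using that l[of i] p0 e_pos[of i]
      by (cases "i = 0") (simp_all add: posv_def)
  qed
  show "B l p \<le> 0" if "negv p"
    unfolding eq
  proof (rule sum_nonpos)
    fix i assume "i \<in> {..n}"
    then show "e i * p i * pr l i \<le> 0" using that l[of i] p0 e_pos[of i]
      by (cases "i = 0") (simp_all add: negv_def mult_nonneg_nonpos mult_nonpos_nonneg)
  qed
qed

text \<open>Since \<open>dl\<close> has zeroth coordinate 1, \<open>x 0\<close> is the level of
  \<open>x\<close>, its multiple of \<open>dl\<close>, and \<open>fp x\<close> is its finite part.
  For roots, a nonzero level decides the sign.\<close>

definition fp :: "ivec \<Rightarrow> ivec" where "fp x = x - sc (x 0) dl"

lemma fp_R: assumes "x \<in> R" shows "fp x \<in> R" "fp x \<in> fin"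
proof -
  have l: "fp x \<in> lat" using R_lat[OF assms] by (simp add: fp_def)
  have N: "B (fp x) (fp x) = B x x" by (simp add: fp_def)
  have "\<forall>k\<le>n. e k = 1 \<longrightarrow> r dvd fp x k" if "\<forall>k\<le>n. e k = 1 \<longrightarrow> r dvd x k"
  proof -
    have "r dvd x 0" using that e_0 by blast
    then show ?thesis using that by (simp add: fp_def)
  qed
  then show "fp x \<in> R" using l N assms unfolding R_def by auto
  show "fp x \<in> fin" using l by (simp add: fin_def fp_def)
qed

lemma B_fp [simp]: "B l (fp x) = B l x" by (simp add: fp_def)

lemma R_level: assumes "x \<in> R"
  shows "0 < x 0 \<Longrightarrow> posv x" "x 0 < 0 \<Longrightarrow> \<not> posv x" "x 0 = 0 \<Longrightarrow> x = fp x"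
proof -
  show "0 < x 0 \<Longrightarrow> posv x" using R_dichotomy[OF assms] unfolding negv_def by (meson not_le)
  show "x 0 < 0 \<Longrightarrow> \<not> posv x" unfolding posv_def by (meson not_le)
qed (simp add: fp_def)

lemma tr_0: "tr l x 0 = x 0 - B l x" by (simp add: tr_def)
lemma fp_tr: "fp (tr l x) = fp x" by (simp add: fp_def tr_def fun_eq_iff algebra_simps)

text \<open>Additivity of lengths for dominant translations, which lower the level of a root by its
  pairing with the translation vector. If the level has dropped below zero, the finite part is
  positive and a dominant \<open>l\<close> cannot raise the level again. If it has dropped exactly
  to zero, the finite part is negative, and dominance of \<open>m\<close> means that the root has
  not moved at all, against its positivity.\<close>

lemma tr_dom_sign:
  assumes "dom l" "dom m" "x \<in> R" "posv x" "\<not> posv (tr m x)"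
  shows "\<not> posv (tr l (tr m x))"
proof -
  have W: "tr m \<in> Wg" "tr l \<in> Wg" using tr_Wg assms by auto
  have R: "tr m x \<in> R" "tr l (tr m x) \<in> R" using W assms(3) by auto
  have k: "0 \<le> x 0" using assms(4) by (simp add: posv_def)
  have p: "fp x \<in> R" "fp x \<in> fin" using fp_R[OF assms(3)] by auto
  have le: "x 0 \<le> B m x" using R_level(1)[OF R(1)] assms(5) by (force simp: tr_0)
  show ?thesis
  proof (cases "x 0 = B m x")
    case True
    then have "tr m x = fp x" using R_level(3)[OF R(1)] by (simp add: tr_0 fp_tr)
    then have "negv (fp x)" using assms(5) R_neg_iff[OF p(1)] by simp
    then have "x 0 = 0" using dom_sign(2)[OF assms(2) p(2)] True k by simp
    then have "x = fp x" using R_level(3)[OF assms(3)] by simp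
    then have "tr m x = x" using \<open>tr m x = fp x\<close> by simp
    then show ?thesis using assms by simp
  next
    case False
    then have "0 < B m (fp x)" using le k by simp
    then have "\<not> negv (fp x)" using dom_sign(2)[OF assms(2) p(2)] by linarith
    then have "posv (fp x)" using R_neg_iff[OF p(1)] by simp
    then have "0 \<le> B l x" using dom_sign(1)[OF assms(1) p(2)] by simp
    moreover have "B l (tr m x) = B l x" by (simp add: tr_def)
    ultimately have "tr l (tr m x) 0 < 0" using False le by (simp add: tr_0)
    then show ?thesis using R_level(2)[OF R(2)] by blast
  qed
qed

text \<open>Additivity of lengths for the square of t_l s_i when \<open>l\<close> pairs to 1 with
  alpha_i. The delicate case is a root whose finite part is -alpha_i.\<close>

lemma tr_half_sign:
  assumes "dom l" "i \<in> {1..n}" "pr l i = 1" "x \<in> R" "posv x" "\<not> posv (tr l (s i x))"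
  shows "\<not> posv (tr l (s i (tr l (s i x))))"
proof
  assume pos: "posv (tr l (s i (tr l (s i x))))"
  have i: "i \<le> n" using assms by simp
  have W: "tr l \<in> Wg" using tr_Wg assms by auto
  have R: "s i x \<in> R" "tr l (s i x) \<in> R" "tr l (s i (tr l (s i x))) \<in> R" using W i assms(4) by auto
  define p q where "p = fp x" and "q = s i p"
  have pR: "p \<in> R" "p \<in> fin" unfolding p_def using fp_R[OF assms(4)] by auto
  have qR: "q \<in> R" "q \<in> fin" unfolding q_def using pR assms(2) i by auto
  have fq: "fp (s i x) = q" using assms(2) i by (simp add: q_def p_def fp_def)
  have Bq: "B l (s i x) = B l q" using B_fp[of l "s i x"] fq by simp
  have x0: "s i x 0 = x 0" using assms(2) by simp
  have k: "0 \<le> x 0" using assms(5) by (simp add: posv_def)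
  have lvl: "tr l (s i x) 0 = x 0 - B l q" by (simp add: tr_0 Bq x0)
  have le: "x 0 \<le> B l q" using R_level(1)[OF R(2)] assms(6) lvl by force
  have "fp (s i (tr l (s i x))) = p"
    using assms(2) i by (simp add: p_def fp_def tr_def fun_eq_iff algebra_simps)
  then have Bp: "B l (s i (tr l (s i x))) = B l p" using B_fp[of l "s i (tr l (s i x))"] by simp
  have lvl2: "tr l (s i (tr l (s i x))) 0 = x 0 - B l q - B l p"
    unfolding tr_0[of l "s i (tr l (s i x))"] Bp using lvl assms(2) by simp
  have sp: "s i q = p" using i by (simp add: q_def)
  show False
  proof (cases "x 0 = B l q")
    case True
    then have "tr l (s i x) = q" using R_level(3)[OF R(2)] lvl fq by (simp add: fp_tr)
    then have nq: "negv q" using assms(6) R_neg_iff[OF qR(1)] by simp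
    then have z: "x 0 = 0" "B l q = 0" using dom_sign(2)[OF assms(1) qR(2)] True k by auto
    then have "posv p" using R_level(3)[OF assms(4)] assms(5) by (simp add: p_def)
    then have "p = unitv i" using pos_to_neg[OF i pR(1)] nq R_neg_iff[OF qR(1)] q_def by blast
    then have "B l q = - e i" using i assms(3) by (simp add: q_def)
    then show False using z e_pos[OF i] by simp
  next
    case False
    then have b: "x 0 < B l q" using le by simp
    then have "\<not> negv q" using dom_sign(2)[OF assms(1) qR(2)] k by linarith
    then have pq: "posv q" using R_neg_iff[OF qR(1)] by simp
    show False
    proof (cases "posv p")
      case True
      then have "0 \<le> B l p" using dom_sign(1)[OF assms(1) pR(2)] by simp
      then show False using R_level(2)[OF R(3)] lvl2 b pos by simp
    next
      case np: False
      then have q: "q = unitv i" using pos_to_neg[OF i qR(1) pq] sp by simp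
      then have p: "p = - unitv i" using sp i by simp
      have Bi: "B l q = e i" using q i assms(3) by simp
      \<comment> \<open>The level lies between 0 and \<open>e i - 1\<close>, and a long root has
        level divisible by \<open>r\<close> because node 0 is short.\<close>
      have "x 0 = 0"
      proof (cases "e i = 1")
        case True
        then show ?thesis using b Bi k by simp
      next
        case False
        then have ei: "e i = r" "r \<noteq> 1" using e_cases[OF i] by auto
        have "B x x = B p p" by (simp add: p_def fp_def)
        then have "B x x = 2 * r" using p i ei by (simp add: c_diag)
        then have "r dvd x 0" using assms(4) ei e_0 by (auto simp: R_def)
        then show ?thesis using b Bi ei k zdvd_imp_le by fastforce
      qed
      then have "x = p" using R_level(3)[OF assms(4)] by (simp add: p_def)
      then show False using np assms(5) by simp
    qed
  qed
qed

text \<open>The relations of the X_beta among themselves and with T_1, ..., T_n. \<open>T 0\<close>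
  does not occur, so the same family can be kept when \<open>T 0\<close> is replaced.\<close>

definition bern :: "('g, 'h) monoid_scheme \<Rightarrow> (nat \<Rightarrow> 'g) \<Rightarrow> (ivec \<Rightarrow> 'g) \<Rightarrow> bool" where
  "bern H T X \<longleftrightarrow> (\<forall>b\<in>fin. X b \<in> carrier H) \<and>
    (\<forall>b\<in>fin. \<forall>b'\<in>fin. X (b + b') = X b \<otimes>\<^bsub>H\<^esub> X b') \<and>
    (\<forall>i\<in>{1..n}. \<forall>b\<in>fin. pr b i = 0 \<longrightarrow> T i \<otimes>\<^bsub>H\<^esub> X b = X b \<otimes>\<^bsub>H\<^esub> T i) \<and>
    (\<forall>i\<in>{1..n}. \<forall>b\<in>fin. pr b i = -1 \<longrightarrow> T i \<otimes>\<^bsub>H\<^esub> X b \<otimes>\<^bsub>H\<^esub> T i = X (s i b))"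

end

section \<open>Bernstein's commuting elements\<close>

context affine_braid
begin

definition D :: "ivec \<Rightarrow> 'b" where "D l = TW (tr l)"

lemma D_closed [simp]: "D l \<in> carrier G" by (simp add: D_def)

lemma D_add: assumes "dom l" "dom m" shows "D (l + m) = D l \<otimes> D m"
proof -
  have "TW (tr l \<circ> tr m) = TW (tr l) \<otimes> TW (tr m)"
    by (rule TW_mult) (use tr_dom_sign assms tr_Wg in auto)
  then show ?thesis by (simp add: D_def tr_add)
qed

lemma D_comm: "dom l \<Longrightarrow> dom m \<Longrightarrow> D l \<otimes> D m = D m \<otimes> D l"
  using D_add[of l m] D_add[of m l] by (simp add: add.commute)

lemma TW_id: "TW (\<lambda>x. x) = \<one>"
proof -
  have "red []" by (simp add: red_def)
  moreover have "act [] = (\<lambda>x. x)" by (rule ext) simp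
  ultimately show ?thesis using TW_red[of "[]"] by simp
qed

lemma D_phi: "D phi = T 0 \<otimes> TW (rf phi)"
  unfolding D_def tr_phi
proof (rule TW_left)
  show W: "rf phi \<in> Wg" by (rule rf_Wg[OF phi_fin B_phi_phi])
  show "rf phi (rf phi (unitv 0)) = unitv 0" by (rule rf_rf[OF B_phi_phi])
  show "rf phi (unitv 0) \<in> R" using W by simp
  have "rf phi (unitv 0) = unitv 0 + sc 2 phi" by (simp add: rf_def fun_eq_iff c_diag)
  then show "posv (rf phi (unitv 0))" using phi_posv by (simp add: posv_add posv_sc)
qed simp

lemma D_simple_comm:
  assumes "dom l" "i \<in> {1..n}" "pr l i = 0"
  shows "T i \<otimes> D l = D l \<otimes> T i"
proof -
  have i: "i \<le> n" using assms by simp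
  have u: "tr l (unitv i) = unitv i" using i assms by (simp add: tr_def)
  have W: "tr l \<in> Wg" using tr_Wg assms by simp
  have "T i \<otimes> D l = TW (s i \<circ> tr l)" unfolding D_def
    by (rule TW_left[OF W i, symmetric]) (use u i in auto)
  also have "\<dots> = TW (tr l \<circ> s i)" using tr_s[OF i, of l] assms(3) by (simp add: s_pr0)
  also have "\<dots> = D l \<otimes> T i" unfolding D_def by (rule TW_right[OF W i]) (simp add: u)
  finally show ?thesis .
qed

text \<open>With u = t_l s_i the lengths give T_{t_l} = T_u T_i, and u u is the translation by
  \<open>l + s i l\<close> with lift T_u T_u. Eliminating T_u yields the reflection relation in a
  form that involves dominant translations only.\<close>

lemma D_simple_refl:
  assumes "dom l" "i \<in> {1..n}" "pr l i = 1"
  shows "D (l + s i l) = D l \<otimes> (inv T i \<otimes> D l \<otimes> inv T i)" "dom (l + s i l)"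
proof -
  have i: "i \<le> n" using assms by simp
  have W: "tr l \<in> Wg" using tr_Wg assms by simp
  define u where "u = tr l \<circ> s i"
  have uW: "u \<in> Wg" using W i by (simp add: u_def)
  have "u (unitv i) = sc (e i) dl - unitv i" using i assms by (simp add: u_def tr_def fun_eq_iff)
  moreover have "posv (sc (e i) dl - unitv i)"
  proof -
    have "1 \<le> e i * a i" using e_pos[OF i] a_pos[OF i] by (simp add: int_one_le_iff_zero_less)
    moreover have "0 \<le> e i * a j" if "j \<le> n" for j using e_pos[OF i] a_pos[OF that] by simp
    ultimately show ?thesis using i by (auto simp: posv_def dl_def unitv_apply)
  qed
  ultimately have "TW (u \<circ> s i) = TW u \<otimes> T i" using TW_right[OF uW i] by simp
  moreover have "u \<circ> s i = tr l" using i by (auto simp: u_def fun_eq_iff)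
  ultimately have Du: "D l = TW u \<otimes> T i" by (simp add: D_def)
  have "TW (u \<circ> u) = TW u \<otimes> TW u"
  proof (rule TW_mult[OF uW uW])
    fix x assume "x \<in> R" "posv x" "\<not> posv (u x)"
    then show "\<not> posv (u (u x))" using tr_half_sign[OF assms] by (simp add: u_def)
  qed
  moreover have "u \<circ> u = tr (l + s i l)"
  proof -
    have "u \<circ> u = tr l \<circ> (s i \<circ> tr l) \<circ> s i" by (auto simp: u_def fun_eq_iff)
    also have "\<dots> = tr l \<circ> tr (s i l) \<circ> (s i \<circ> s i)" unfolding tr_s[OF i] by (simp add: comp_assoc)
    also have "s i \<circ> s i = id" using i by (auto simp: fun_eq_iff)
    finally show ?thesis by (simp only: tr_add comp_id)
  qed
  ultimately show "D (l + s i l) = D l \<otimes> (inv T i \<otimes> D l \<otimes> inv T i)"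
    unfolding Du by (simp add: D_def G.m_assoc)
  have "0 \<le> pr (l + s i l) j" if "j \<in> {1..n}" for j
  proof (cases "j = i")
    case True
    then show ?thesis using i by (simp add: pr_s_same)
  next
    case False
    then show ?thesis using assms that i c_off[of j i] by (simp only: pr_add pr_s) (force simp: dom_def)
  qed
  then show "dom (l + s i l)" using assms by (simp add: dom_def)
qed

text \<open>The dominant translations have additive lengths, so that \<open>TW\<close> is multiplicative on them.\<close>
theorem bernstein: "\<exists>Y. bern G T Y \<and> Y phi = T 0 \<otimes> TW (rf phi)"
proof -
  obtain w where w: "dom w" "\<And>i. i \<in> {1..n} \<Longrightarrow> 0 < pr w i" using regular_exists by blast
  \<comment> \<open>\<open>N b\<close> bounds all pairings of \<open>b\<close>, so
    \<open>b + sc (N b) w\<close> is dominant for the regular vector \<open>w\<close>, and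
    \<open>b\<close> is a difference of dominant vectors.\<close>
  define N where "N b = (\<Sum>i\<in>{1..n}. \<bar>pr b i\<bar>)" for b
  have Nle: "\<bar>pr b i\<bar> \<le> N b" if "i \<in> {1..n}" for b i
    unfolding N_def using that by (intro member_le_sum) auto
  have N0: "0 \<le> N b" for b by (simp add: N_def sum_nonneg)
  have big: "dom (b + sc (N b) v)" if b: "b \<in> fin" and v: "dom v"
    and pv: "\<And>i. i \<in> {1..n} \<Longrightarrow> 0 < pr v i \<or> 0 \<le> pr b i" for b v
  proof -
    have "0 \<le> pr b i + N b * pr v i" if i: "i \<in> {1..n}" for i
    proof (cases "0 \<le> pr b i")
      case True
      then show ?thesis using v i N0 by (simp add: dom_def)
    next
      case False
      then have "N b * 1 \<le> N b * pr v i" using pv[OF i] N0 by (intro mult_left_mono) auto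
      then show ?thesis using Nle[OF i, of b] by linarith
    qed
    then show ?thesis using b v by (simp add: dom_def)
  qed
  define Y where "Y b = D (b + sc (N b) w) \<otimes> inv D (sc (N b) w)" for b
  have Yc: "Y b \<in> carrier G" for b by (simp add: Y_def)
  have Ydiff: "Y b = D l \<otimes> inv D m" if "dom l" "dom m" "b = l - m" for b l m
  proof -
    have b: "b \<in> fin" using that by simp
    define p q where "p = b + sc (N b) w" and "q = sc (N b) w"
    have pq: "dom p" "dom q" unfolding p_def q_def using big[OF b w(1)] w N0 by auto
    have "p + m = q + l" by (simp add: p_def q_def that(3) algebra_simps)
    then have "D p \<otimes> D m = D q \<otimes> D l" using D_add pq that by metis
    then have "D p = D q \<otimes> D l \<otimes> inv D m" by (simp add: G.inv_solve_right)
    then have "D p \<otimes> inv D q = D q \<otimes> (D l \<otimes> inv D m) \<otimes> inv D q" by (simp add: G.m_assoc)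
    moreover have "D q \<otimes> (D l \<otimes> inv D m) = D l \<otimes> inv D m \<otimes> D q"
      using pq that by (intro G.comm_mult G.comm_inv D_comm) auto
    moreover have "Y b = D p \<otimes> inv D q" by (simp add: Y_def p_def q_def)
    ultimately show ?thesis by (simp add: G.m_assoc)
  qed
  have YD: "Y l = D l" if "dom l" for l
    using Ydiff[OF that dom_zero, of l] by (simp add: D_def[of 0] tr_zero TW_id)
  have Yadd: "Y (b + b') = Y b \<otimes> Y b'" if "b \<in> fin" "b' \<in> fin" for b b'
  proof -
    define p q p' q' where "p = b + sc (N b) w" and "q = sc (N b) w"
      and "p' = b' + sc (N b') w" and "q' = sc (N b') w"
    have d: "dom p" "dom q" "dom p'" "dom q'"
      unfolding p_def q_def p'_def q'_def using big[OF that(1) w(1)] big[OF that(2) w(1)] w N0 by auto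
    have "Y (b + b') = D (p + p') \<otimes> inv D (q + q')"
      by (rule Ydiff) (use d in \<open>auto simp: p_def q_def p'_def q'_def\<close>)
    also have "\<dots> = D p \<otimes> (D p' \<otimes> inv D q') \<otimes> inv D q"
      using d by (simp add: D_add G.inv_mult_group G.m_assoc)
    finally have "Y (b + b') = D p \<otimes> (D p' \<otimes> inv D q') \<otimes> inv D q" .
    moreover have "D p \<otimes> (D p' \<otimes> inv D q') \<otimes> inv D q = D p \<otimes> (inv D q \<otimes> (D p' \<otimes> inv D q'))"
    proof -
      have "inv D q \<otimes> (D p' \<otimes> inv D q') = D p' \<otimes> inv D q' \<otimes> inv D q"
        using d by (intro G.comm_mult G.comm_inv) (simp_all add: D_comm G.comm_inv[symmetric])
      then show ?thesis by (simp add: G.m_assoc)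
    qed
    moreover have "Y b = D p \<otimes> inv D q" "Y b' = D p' \<otimes> inv D q'"
      by (simp_all add: Y_def p_def q_def p'_def q'_def)
    ultimately show ?thesis by (simp add: G.m_assoc)
  qed
  have dec: "\<exists>m v. dom m \<and> dom v \<and> pr v i = 0 \<and> b = m - v \<and> pr m i = pr b i"
    if "b \<in> fin" "i \<in> {1..n}" "0 \<le> pr b i" for b i
  proof -
    have i: "i \<le> n" using that by simp
    \<comment> \<open>This vector pairs to zero with alpha_i and positively with the other nodes.
      Adding a multiple of it to \<open>b\<close> gives a dominant vector with the same pairing at
      \<open>i\<close>, so \<open>b\<close> is a difference of dominant vectors whose second term is
      orthogonal to alpha_i.\<close>
    define v where "v = w + s i w"
    have vi: "pr v i = 0" using i by (simp add: v_def pr_s_same)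
    have vj: "0 < pr v j" if "j \<in> {1..n}" "j \<noteq> i" for j
    proof -
      have "c j i * pr w i \<le> 0" using c_off[of j i] w(2)[OF \<open>i \<in> {1..n}\<close>] that i
        by (simp add: mult_nonpos_nonneg)
      moreover have "pr v j = 2 * pr w j - c j i * pr w i" using i by (simp only: v_def pr_add pr_s)
      ultimately show ?thesis using w(2)[OF that(1)] by linarith
    qed
    have "0 \<le> pr v j" if "j \<in> {1..n}" for j
      using vi vj[OF that] by (cases "j = i") auto
    moreover have "v \<in> fin" using w(1) that by (simp add: v_def)
    ultimately have dv: "dom v" by (simp add: dom_def)
    have "dom (b + sc (N b) v)" using big[OF that(1) dv] vj that(3) by metis
    then show ?thesis using dv vi N0
      by (intro exI[of _ "b + sc (N b) v"] exI[of _ "sc (N b) v"]) simp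
  qed
  have comm: "T i \<otimes> Y b = Y b \<otimes> T i" if b: "b \<in> fin" "i \<in> {1..n}" "pr b i = 0" for b i
  proof -
    obtain m v where mv: "dom m" "dom v" "pr v i = 0" "b = m - v" "pr m i = 0"
      using dec[OF b(1,2)] b(3) by auto
    show ?thesis unfolding Ydiff[OF mv(1,2,4)]
      using mv D_simple_comm b by (intro G.comm_mult G.comm_inv) auto
  qed
  have refl: "T i \<otimes> Y b \<otimes> T i = Y (s i b)" if b: "b \<in> fin" "i \<in> {1..n}" "pr b i = -1" for b i
  proof -
    have i: "i \<le> n" using b by simp
    have p1: "pr (s i b) i = 1" using i b by (simp add: pr_s_same)
    obtain m v where mv: "dom m" "dom v" "pr v i = 0" "s i b = m - v" "pr m i = 1"
      using dec[of "s i b" i] b p1 by auto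
    have "b = s i (m - v)" using mv(4) i by (metis s_s)
    \<comment> \<open>\<open>b\<close> equals \<open>s i m - v\<close>; adding \<open>m\<close> to
      both terms makes them dominant, and \<open>D\<close> is known at
      \<open>m + s i m\<close>.\<close>
    then have be: "b = (m + s i m) - (m + v)" using mv(3) by (simp add: s_pr0[of v])
    note R = D_simple_refl[OF mv(1) b(2) mv(5)]
    have cv: "T i \<otimes> D v = D v \<otimes> T i" using D_simple_comm mv b by blast
    have "Y b = D (m + s i m) \<otimes> inv D (m + v)" using Ydiff[OF R(2) _ be] mv by simp
    also have "\<dots> = D (m + s i m) \<otimes> inv D m \<otimes> inv D v"
      using mv D_comm[of m v] by (simp add: D_add G.inv_mult_group G.m_assoc)
    also have "D (m + s i m) \<otimes> inv D m = inv D m \<otimes> D (m + s i m)"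
      using D_comm[OF R(2) mv(1)] by (intro G.comm_inv) auto
    also have "\<dots> = inv T i \<otimes> D m \<otimes> inv T i" unfolding R(1) by simp
    finally have "T i \<otimes> Y b \<otimes> T i = D m \<otimes> (inv T i \<otimes> (inv D v \<otimes> T i))" by (simp add: G.m_assoc)
    also have "inv D v \<otimes> T i = T i \<otimes> inv D v" using G.comm_inv[of "T i" "D v"] cv by simp
    finally show ?thesis using Ydiff[OF mv(1,2,4)] by simp
  qed
  show ?thesis
    by (rule exI[of _ Y]) (use Yc Yadd comm refl YD[OF dom_phi] D_phi in \<open>auto simp: bern_def\<close>)
qed

end

section \<open>The automorphism fixing the lattice\<close>

context group
begin

definition br3 :: "'a \<Rightarrow> 'a \<Rightarrow> bool" where "br3 x y \<longleftrightarrow> x \<otimes> y \<otimes> x = y \<otimes> x \<otimes> y"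

lemma br3_conj:
  assumes "x \<in> carrier G" "y \<in> carrier G" "g \<in> carrier G"
  shows "br3 (g \<otimes> x \<otimes> inv g) (g \<otimes> y \<otimes> inv g) \<longleftrightarrow> br3 x y"
proof -
  have e: "(g \<otimes> u \<otimes> inv g) \<otimes> (g \<otimes> v \<otimes> inv g) \<otimes> (g \<otimes> u \<otimes> inv g) = g \<otimes> (u \<otimes> v \<otimes> u) \<otimes> inv g"
    if "u \<in> carrier G" "v \<in> carrier G" for u v
    using that assms(3) by (simp add: m_assoc)
  show ?thesis unfolding br3_def e[OF assms(1,2)] e[OF assms(2,1)] using assms by simp
qed

text \<open>The model case is \<open>A\<close> = T_j, \<open>F\<close> = T_0, \<open>g\<close> =
  X_{alpha_j} and \<open>Y\<close> = X_{-phi} C, where the conclusion is the braid relation of T_j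
  with W. The proof moves \<open>A\<close> past \<open>Y\<close> and uses the braid relation as A
  F^-1 A^-1 = F^-1 A^-1 F.\<close>

lemma br3_twist:
  assumes c: "A \<in> carrier G" "F \<in> carrier G" "g \<in> carrier G" "Y \<in> carrier G"
    and br: "A \<otimes> F \<otimes> A = F \<otimes> A \<otimes> F" and AY: "A \<otimes> Y \<otimes> A = g \<otimes> Y" and Fg: "F \<otimes> g \<otimes> F = g \<otimes> Y"
  shows "br3 A (inv F \<otimes> Y)"
proof -
  have YA: "Y \<otimes> A = inv A \<otimes> (g \<otimes> Y)" using c AY by (metis cancel_left(1) m_assoc m_closed)
  have gF: "g \<otimes> Y \<otimes> inv F = F \<otimes> g" using c Fg by (metis inv_solve_right m_closed)
  have b: "A \<otimes> inv F \<otimes> inv A = inv F \<otimes> inv A \<otimes> F"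
  proof -
    have "A \<otimes> F \<otimes> (A \<otimes> inv F \<otimes> inv A) = A \<otimes> F \<otimes> A \<otimes> inv F \<otimes> inv A" using c by (simp add: m_assoc)
    also have "\<dots> = F" unfolding br using c by (simp add: m_assoc)
    finally show ?thesis using c by (metis inv_mult_group inv_solve_left m_assoc m_closed inv_closed)
  qed
  have "A \<otimes> (inv F \<otimes> Y) \<otimes> A = A \<otimes> inv F \<otimes> inv A \<otimes> (g \<otimes> Y)"
    using c by (simp add: m_assoc YA)
  also have "\<dots> = inv F \<otimes> inv A \<otimes> (F \<otimes> g) \<otimes> Y" unfolding b using c by (simp add: m_assoc)
  also have "\<dots> = inv F \<otimes> (inv A \<otimes> (g \<otimes> Y)) \<otimes> inv F \<otimes> Y" unfolding gF[symmetric] using c by (simp add: m_assoc)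
  also have "\<dots> = inv F \<otimes> Y \<otimes> A \<otimes> (inv F \<otimes> Y)" unfolding YA[symmetric] using c by (simp add: m_assoc)
  finally show ?thesis by (simp add: br3_def)
qed

text \<open>The reverse direction: from a braid relation for the twisted element back to a relation
  between \<open>F\<close> and \<open>g\<close>. It is used with \<open>F\<close> = T_0,
  \<open>g\<close> = Y_{alpha_j} and \<open>p\<close> = Y_{-phi} C, where p F^-1 is Z_phi.\<close>

lemma twist_br3:
  assumes c: "A \<in> carrier G" "F \<in> carrier G" "g \<in> carrier G" "p \<in> carrier G"
    and br: "A \<otimes> F \<otimes> A = F \<otimes> A \<otimes> F" and Ap: "A \<otimes> p \<otimes> A = p \<otimes> g" and z: "br3 A (p \<otimes> inv F)"
    and gp: "g \<otimes> p = p \<otimes> g"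
  shows "F \<otimes> g \<otimes> F = p \<otimes> g"
proof -
  have pA: "A \<otimes> p = p \<otimes> g \<otimes> inv A" using c Ap by (metis inv_solve_right m_closed)
  have b: "inv A \<otimes> inv F \<otimes> A = F \<otimes> inv A \<otimes> inv F"
  proof -
    have "(F \<otimes> A) \<otimes> (F \<otimes> inv A \<otimes> inv F) = A \<otimes> F \<otimes> A \<otimes> inv A \<otimes> inv F" unfolding br using c by (simp add: m_assoc)
    also have "\<dots> = A" using c by (simp add: m_assoc)
    finally show ?thesis using c by (metis inv_mult_group inv_solve_left m_closed inv_closed)
  qed
  have "A \<otimes> (p \<otimes> inv F) \<otimes> A = p \<otimes> g \<otimes> (inv A \<otimes> inv F \<otimes> A)" using c pA by (metis inv_closed m_assoc m_closed)
  then have l: "A \<otimes> (p \<otimes> inv F) \<otimes> A = p \<otimes> g \<otimes> F \<otimes> (inv A \<otimes> inv F)" unfolding b using c by (simp add: m_assoc)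
  have "p \<otimes> inv F \<otimes> A \<otimes> (p \<otimes> inv F) = p \<otimes> inv F \<otimes> (A \<otimes> p) \<otimes> inv F" using c by (simp add: m_assoc)
  then have r: "p \<otimes> inv F \<otimes> A \<otimes> (p \<otimes> inv F) = p \<otimes> inv F \<otimes> p \<otimes> g \<otimes> (inv A \<otimes> inv F)"
    unfolding pA using c by (simp add: m_assoc)
  have "p \<otimes> g \<otimes> F = p \<otimes> inv F \<otimes> p \<otimes> g"
    using l r z c unfolding br3_def by (metis inv_closed m_closed right_cancel)
  then have "g \<otimes> F = inv F \<otimes> (p \<otimes> g)" using c by (simp add: m_assoc)
  then show ?thesis using c by (simp add: m_assoc)
qed

text \<open>The analogue for a double bond. The element \<open>Z\<close> commutes with
  \<open>F\<close>, and the product Z Y commutes with \<open>A\<close>; moving them to the right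
  reduces both sides to the same word in \<open>A\<close> and \<open>F\<close>, times Z Y.\<close>

lemma br4_twist:
  assumes c: "A \<in> carrier G" "F \<in> carrier G" "Z \<in> carrier G" "Y \<in> carrier G"
    and br: "A \<otimes> (F \<otimes> (A \<otimes> F)) = F \<otimes> (A \<otimes> (F \<otimes> A))" and AY: "A \<otimes> Y \<otimes> A = Z" and FZ: "F \<otimes> Z = Z \<otimes> F"
    and AZY: "A \<otimes> (Z \<otimes> Y) = Z \<otimes> Y \<otimes> A"
  shows "A \<otimes> (inv F \<otimes> Y \<otimes> (A \<otimes> (inv F \<otimes> Y))) = inv F \<otimes> Y \<otimes> (A \<otimes> (inv F \<otimes> Y \<otimes> A))"
proof -
  have YA: "Y \<otimes> A = inv A \<otimes> Z" using c AY by (metis cancel_left(1) m_assoc m_closed)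
  have ZF: "Z \<otimes> inv F = inv F \<otimes> Z" using comm_inv[of Z F] c FZ by simp
  have FAF: "inv F \<otimes> inv A \<otimes> inv F \<otimes> A = A \<otimes> (inv F \<otimes> inv A \<otimes> inv F)"
  proof -
    have "A \<otimes> (F \<otimes> A \<otimes> F) = F \<otimes> A \<otimes> F \<otimes> A" using c br by (simp add: m_assoc)
    then have "A \<otimes> inv (F \<otimes> A \<otimes> F) = inv (F \<otimes> A \<otimes> F) \<otimes> A" using c by (intro comm_inv) auto
    then show ?thesis using c by (simp add: inv_mult_group m_assoc)
  qed
  have 1: "inv F \<otimes> Y \<otimes> (A \<otimes> (inv F \<otimes> Y \<otimes> A)) = inv F \<otimes> inv A \<otimes> inv F \<otimes> A \<otimes> (Z \<otimes> Y)"
  proof -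
    have "inv F \<otimes> Y \<otimes> (A \<otimes> (inv F \<otimes> Y \<otimes> A)) = inv F \<otimes> (Y \<otimes> A) \<otimes> inv F \<otimes> (Y \<otimes> A)" using c by (simp add: m_assoc)
    also have "\<dots> = inv F \<otimes> inv A \<otimes> (Z \<otimes> inv F) \<otimes> (Y \<otimes> A)" unfolding YA using c by (simp add: m_assoc)
    also have "\<dots> = inv F \<otimes> inv A \<otimes> inv F \<otimes> (Z \<otimes> Y \<otimes> A)" unfolding ZF using c by (simp add: m_assoc)
    finally show ?thesis unfolding AZY[symmetric] using c by (simp add: m_assoc)
  qed
  have "A \<otimes> (inv F \<otimes> Y \<otimes> (A \<otimes> (inv F \<otimes> Y))) = A \<otimes> (inv F \<otimes> Y \<otimes> (A \<otimes> (inv F \<otimes> Y \<otimes> A))) \<otimes> inv A"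
    using c by (simp add: m_assoc)
  also have "\<dots> = A \<otimes> (inv F \<otimes> inv A \<otimes> inv F) \<otimes> (A \<otimes> (Z \<otimes> Y)) \<otimes> inv A" unfolding 1 using c by (simp add: m_assoc)
  also have "\<dots> = A \<otimes> (inv F \<otimes> inv A \<otimes> inv F) \<otimes> (Z \<otimes> Y)" unfolding AZY using c by (simp add: m_assoc)
  also have "\<dots> = inv F \<otimes> inv A \<otimes> inv F \<otimes> A \<otimes> (Z \<otimes> Y)" unfolding FAF using c by (simp add: m_assoc)
  finally show ?thesis using 1 by simp
qed

lemma comm_conj:
  assumes "z \<in> carrier G" "w \<in> carrier G" "w \<otimes> z = z \<otimes> w"
  shows "inv w \<otimes> z \<otimes> w = z"
  using assms by (metis cancel_left(1) m_assoc inv_closed)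

text \<open>Conjugation by A^-1 fixes \<open>Z\<close> and turns \<open>M\<close> into M A M^-1, by
  the braid relation; conjugation by M^-1 then leaves \<open>A\<close>.\<close>

lemma br3_step3:
  assumes c: "A \<in> carrier G" "M \<in> carrier G" "Z \<in> carrier G"
    and AM: "A \<otimes> M \<otimes> A = M \<otimes> A \<otimes> M" and AZ: "A \<otimes> Z = Z \<otimes> A" and MZ: "br3 M Z"
  shows "br3 A (inv M \<otimes> Z \<otimes> M)"
proof -
  have "br3 (inv A \<otimes> M \<otimes> inv (inv A)) (inv A \<otimes> Z \<otimes> inv (inv A))" using MZ c by (subst br3_conj) auto
  moreover have "inv A \<otimes> Z \<otimes> A = Z" using comm_conj c AZ by simp
  moreover have "inv A \<otimes> M \<otimes> A = M \<otimes> A \<otimes> inv M"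
  proof -
    have "inv A \<otimes> M \<otimes> A = inv A \<otimes> (M \<otimes> A \<otimes> M) \<otimes> inv M" using c by (simp add: m_assoc)
    then show ?thesis unfolding AM[symmetric] using c by (simp add: m_assoc)
  qed
  ultimately have "br3 (M \<otimes> A \<otimes> inv M) Z" using c by simp
  then have "br3 (inv M \<otimes> (M \<otimes> A \<otimes> inv M) \<otimes> inv (inv M)) (inv M \<otimes> Z \<otimes> inv (inv M))"
    using c by (subst br3_conj) auto
  then show ?thesis using c by (simp add: m_assoc)
qed

text \<open>For a double bond and two lowering steps: conjugation by M^-1 fixes \<open>Z\<close>,
  and conjugation by the inverse of A M returns M^-1 A M to \<open>A\<close>, by the four-term braid
  relation.\<close>

lemma br3_step4:
  assumes c: "A \<in> carrier G" "M \<in> carrier G" "Z \<in> carrier G"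
    and AM: "A \<otimes> (M \<otimes> (A \<otimes> M)) = M \<otimes> (A \<otimes> (M \<otimes> A))" and MZ: "M \<otimes> Z = Z \<otimes> M" and AZ: "br3 A Z"
  shows "br3 A (inv M \<otimes> (inv A \<otimes> Z \<otimes> A) \<otimes> M)"
proof -
  have "br3 (inv M \<otimes> A \<otimes> inv (inv M)) (inv M \<otimes> Z \<otimes> inv (inv M))" using AZ c by (subst br3_conj) auto
  moreover have "inv M \<otimes> Z \<otimes> M = Z" using comm_conj c MZ by simp
  ultimately have *: "br3 (inv M \<otimes> A \<otimes> M) Z" using c by simp
  define g where "g = inv (A \<otimes> M)"
  have g: "g \<in> carrier G" using c by (simp add: g_def)
  have "br3 (g \<otimes> (inv M \<otimes> A \<otimes> M) \<otimes> inv g) (g \<otimes> Z \<otimes> inv g)" using * br3_conj g c by simp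
  moreover have "g \<otimes> (inv M \<otimes> A \<otimes> M) \<otimes> inv g = A"
  proof -
    have "g \<otimes> (inv M \<otimes> A \<otimes> M) \<otimes> inv g = g \<otimes> (inv M \<otimes> (A \<otimes> (M \<otimes> (A \<otimes> M))))"
      using c by (simp add: g_def m_assoc)
    also have "\<dots> = A" unfolding AM using c by (simp add: g_def inv_mult_group m_assoc)
    finally show ?thesis .
  qed
  moreover have "g \<otimes> Z \<otimes> inv g = inv M \<otimes> (inv A \<otimes> Z \<otimes> A) \<otimes> M"
    using c by (simp add: g_def inv_mult_group m_assoc)
  ultimately show ?thesis by simp
qed

text \<open>A direct computation for the triple bond. In the application \<open>y\<close>,
  \<open>x\<close>, \<open>f\<close> are the X-elements of alpha_i, alpha_i + alpha_m and 2 alpha_i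
  + alpha_m. They are pushed to the right until both sides end in \<open>f\<close>, and the six-term
  braid relation remains.\<close>

lemma br3_step6:
  assumes c: "A \<in> carrier G" "M \<in> carrier G" "x \<in> carrier G" "y \<in> carrier G" "f \<in> carrier G"
    and AM: "A \<otimes> (M \<otimes> (A \<otimes> (M \<otimes> (A \<otimes> M)))) = M \<otimes> (A \<otimes> (M \<otimes> (A \<otimes> (M \<otimes> A))))"
    and AxA: "A \<otimes> x \<otimes> A = f" and Mf: "M \<otimes> f = f \<otimes> M" and MyM: "M \<otimes> y \<otimes> M = x"
    and yx: "y \<otimes> x = f"
  shows "br3 A (inv M \<otimes> (inv A \<otimes> y) \<otimes> M)"
proof -
  define Z where "Z = inv M \<otimes> inv A \<otimes> inv M \<otimes> x"
  have yM: "y \<otimes> M = inv M \<otimes> x" using c MyM by (metis cancel_left(1) m_assoc m_closed)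
  have xM: "x \<otimes> inv M = M \<otimes> y" using c MyM by (metis inv_solve_right m_closed)
  have xA: "x \<otimes> A = inv A \<otimes> f" using c AxA by (metis cancel_left(1) m_assoc m_closed)
  have fA: "f \<otimes> inv A = A \<otimes> x" using c AxA by (metis inv_solve_right m_closed)
  have fM: "f \<otimes> inv M = inv M \<otimes> f" using comm_inv[of f M] c Mf by simp
  have Z: "inv M \<otimes> (inv A \<otimes> y) \<otimes> M = Z" using c yM by (simp add: Z_def m_assoc)
  define E where "E = inv M \<otimes> inv A \<otimes> inv M \<otimes> inv A"
  have E: "E \<in> carrier G" using c by (simp add: E_def)
  have "Z \<otimes> A \<otimes> Z = inv M \<otimes> inv A \<otimes> inv M \<otimes> (x \<otimes> A) \<otimes> inv M \<otimes> inv A \<otimes> inv M \<otimes> x"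
    using c by (simp add: Z_def m_assoc)
  also have "\<dots> = E \<otimes> (f \<otimes> inv M) \<otimes> inv A \<otimes> inv M \<otimes> x" unfolding xA using c by (simp add: E_def m_assoc)
  also have "\<dots> = E \<otimes> inv M \<otimes> (f \<otimes> inv A) \<otimes> inv M \<otimes> x" unfolding fM using c E by (simp add: m_assoc)
  also have "\<dots> = E \<otimes> inv M \<otimes> A \<otimes> (x \<otimes> inv M) \<otimes> x" unfolding fA using c E by (simp add: m_assoc)
  also have "\<dots> = E \<otimes> inv M \<otimes> A \<otimes> M \<otimes> (y \<otimes> x)" unfolding xM using c E by (simp add: m_assoc)
  finally have l: "Z \<otimes> A \<otimes> Z = E \<otimes> inv M \<otimes> A \<otimes> M \<otimes> f" unfolding yx .
  have "A \<otimes> Z \<otimes> A = A \<otimes> inv M \<otimes> inv A \<otimes> inv M \<otimes> (x \<otimes> A)" using c by (simp add: Z_def m_assoc)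
  also have "\<dots> = A \<otimes> E \<otimes> f" unfolding xA using c by (simp add: E_def m_assoc)
  finally have r: "A \<otimes> Z \<otimes> A = A \<otimes> E \<otimes> f" .
  have "E \<otimes> inv M \<otimes> A \<otimes> M = A \<otimes> E"
  proof -
    define E5 where "E5 = M \<otimes> (A \<otimes> (M \<otimes> (A \<otimes> M)))"
    have E5: "E5 \<in> carrier G" "E \<otimes> inv M = inv E5" using c by (simp_all add: E5_def E_def inv_mult_group m_assoc)
    define E4 where "E4 = A \<otimes> (M \<otimes> (A \<otimes> M))"
    have E4: "E4 \<in> carrier G" "E = inv E4" using c by (simp_all add: E4_def E_def inv_mult_group m_assoc)
    have "E5 \<otimes> A = A \<otimes> (M \<otimes> E4)" using AM c by (simp add: E5_def E4_def m_assoc)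
    then have "E5 \<otimes> (A \<otimes> inv E4) = A \<otimes> M" using c E4 E5 by (simp add: m_assoc[symmetric]) (simp add: m_assoc)
    then have "inv E5 \<otimes> (A \<otimes> M) = A \<otimes> inv E4" using c E4 E5 by (metis cancel_left(1) inv_closed m_closed)
    then show ?thesis using E5 E4 c by (simp add: m_assoc)
  qed
  then show ?thesis unfolding Z br3_def l r by simp
qed

end

text \<open>All relations are invariant under reversal of products, so every construction also applies to
  the opposite group; there it gives the inverse endomorphisms.\<close>
definition opg :: "('a, 'm) monoid_scheme \<Rightarrow> ('a, 'm) monoid_scheme" where
  "opg G = G\<lparr>monoid.mult := (\<lambda>x y. y \<otimes>\<^bsub>G\<^esub> x)\<rparr>"

lemma opg_simps [simp]: "carrier (opg G) = carrier G" "\<one>\<^bsub>opg G\<^esub> = \<one>\<^bsub>G\<^esub>" "x \<otimes>\<^bsub>opg G\<^esub> y = y \<otimes>\<^bsub>G\<^esub> x"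
  by (simp_all add: opg_def)

lemma (in group) group_opg: "group (opg G)"
  by (rule groupI) (auto simp: m_assoc intro: r_inv_ex)

lemma (in group) inv_opg [simp]: "x \<in> carrier G \<Longrightarrow> inv\<^bsub>opg G\<^esub> x = inv x"
  using group.inv_equality[OF group_opg, of "inv x" x] by simp

lemma opg_opg [simp]: "opg (opg G) = G" by (simp add: opg_def)

lemma rev_alt: "rev (alt m i j) = (if even m then alt m j i else alt m i j)"
proof (induction m arbitrary: i j)
  case (Suc m)
  have "alt (m + 1) i j = alt m i j @ [if even m then i else j]" for i j :: 'a
    using alt_add[of m 1 i j] by (simp split: if_splits)
  then show ?case using Suc by simp
qed simp

text \<open>The defining relations of the double affine Artin group for elements of any group, with
  \<open>C\<close> in the role of X_{delta / a_0}. In \<open>T0_refl\<close> the right-hand side is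
  X at s_0(b), since s_0(b) = b + alpha_0 = (b - phi) + delta / a_0.\<close>

locale double_sys = affine_braid n c a e r par rk G T
  for n c a e r par rk and G :: "('b, 'm) monoid_scheme" (structure) and T +
  fixes X :: "ivec \<Rightarrow> 'b" and C :: 'b
  assumes bern: "bern G T X"
    and C_closed [simp]: "C \<in> carrier G"
    and C_T: "C \<otimes> T i = T i \<otimes> C"
    and C_X: "b \<in> fin \<Longrightarrow> C \<otimes> X b = X b \<otimes> C"
    and T0_comm: "b \<in> fin \<Longrightarrow> pr b 0 = 0 \<Longrightarrow> T 0 \<otimes> X b = X b \<otimes> T 0"
    and T0_refl: "b \<in> fin \<Longrightarrow> pr b 0 = -1 \<Longrightarrow> T 0 \<otimes> X b \<otimes> T 0 = X (b - phi) \<otimes> C"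
begin

lemma X_closed [simp]: "b \<in> fin \<Longrightarrow> X b \<in> carrier G" using bern by (simp add: bern_def)
lemma X_add: "b \<in> fin \<Longrightarrow> b' \<in> fin \<Longrightarrow> X (b + b') = X b \<otimes> X b'" using bern by (simp add: bern_def)
lemma X_comm: "b \<in> fin \<Longrightarrow> b' \<in> fin \<Longrightarrow> X b \<otimes> X b' = X b' \<otimes> X b"
  using X_add[of b b'] X_add[of b' b] by (simp add: add.commute)
lemma X_0: "X 0 = \<one>"
  using X_add[of 0 0] by simp
lemma X_minus: "b \<in> fin \<Longrightarrow> X (- b) = inv (X b)"
  using X_add[of "- b" b] by (simp add: X_0 G.inv_equality)
lemma T_X_comm: "i \<in> {1..n} \<Longrightarrow> b \<in> fin \<Longrightarrow> pr b i = 0 \<Longrightarrow> T i \<otimes> X b = X b \<otimes> T i"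
  using bern by (simp add: bern_def)
lemma T_X_refl: "i \<in> {1..n} \<Longrightarrow> b \<in> fin \<Longrightarrow> pr b i = -1 \<Longrightarrow> T i \<otimes> X b \<otimes> T i = X (b + unitv i)"
  using bern by (simp add: bern_def s_prm1)

text \<open>This is T_0^-1 X_{alpha_0}, because alpha_0 = \<open>dl - phi\<close>.\<close>

definition W :: 'b where "W = inv (T 0) \<otimes> (X (- phi) \<otimes> C)"

lemma W_closed [simp]: "W \<in> carrier G" by (simp add: W_def)

lemma C_tp: "C \<otimes> tp js = tp js \<otimes> C"
proof (induction js)
  case (Cons i js)
  then show ?case using G.comm_mult[of C "T i" "tp js"] C_T by simp
qed simp

lemma c0_cases:
  assumes "j \<in> {1..n}"
  shows "c 0 j = 0 \<and> c j 0 = 0 \<or> c 0 j = -1 \<and> c j 0 = -1 \<or> c 0 j = -2"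
proof -
  have j: "j \<le> n" using assms by simp
  have eq: "c 0 j = e j * c j 0" using c_sym[of 0 j] e_0 j by simp
  have "c 0 j \<in> {0, -1, -2}"
    using shape
  proof
    assume II: "(\<forall>k\<le>n. a k = 1) \<and> (\<forall>k\<in>{1..<n}. c k (k - 1) = -1) \<and> c 0 1 = -2 \<and> c n (n - 1) = -2 \<and>
       (\<forall>i\<le>n. \<forall>j\<le>n. i + 2 \<le> j \<longrightarrow> c i j = 0 \<and> c j i = 0)"
    show ?thesis
    proof (cases "j = 1")
      case False
      then have "0 + 2 \<le> j" using assms by simp
      then show ?thesis using II j by blast
    qed (use II in simp)
  qed (use assms in auto)
  moreover have "c j 0 = 0" if "c 0 j = 0" using c_zero_iff[of 0 j] j that by simp
  moreover have "c j 0 = -1" if "c 0 j = -1"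
  proof -
    have "e j * (- c j 0) = 1" using eq that by simp
    then show ?thesis using e_pos[OF j] zmult_eq_1_iff[of "e j" "- c j 0"] by auto
  qed
  ultimately show ?thesis by auto
qed

text \<open>The bond between 0 and \<open>j\<close> is absent, simple or double, and the last two
  cases are the twist lemmas. With four laces \<open>bm\<close> fails, and there is nothing to
  show.\<close>

lemma W_braid:
  assumes j: "j \<in> {1..n}" and bm: "bm 0 j m"
  shows "foldr (\<lambda>k g. (T(0 := W)) k \<otimes> g) (alt m 0 j) \<one> = foldr (\<lambda>k g. (T(0 := W)) k \<otimes> g) (alt m j 0) \<one>"
proof -
  have jn: "j \<le> n" "0 \<noteq> j" "j \<noteq> 0" using j by auto
  note b = braid[OF _ jn(1) jn(2) bm, simplified]
  note rk2 = bm_rank2[OF _ jn(1,2) bm, simplified]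
  define Y where "Y = X (- phi) \<otimes> C"
  have Yc: "Y \<in> carrier G" by (simp add: Y_def)
  have pr1: "pr (- phi) j = c j 0" using jn by simp
  have CT: "C \<otimes> (T i \<otimes> z) = T i \<otimes> (C \<otimes> z)" if "z \<in> carrier G" for i z
    using C_T that by (simp add: G.m_assoc[symmetric])
  have AYA: "T j \<otimes> Y \<otimes> T j = (T j \<otimes> X (- phi) \<otimes> T j) \<otimes> C"
    by (simp add: Y_def G.m_assoc C_T)
  from c0_cases[OF j] consider "c 0 j = 0" "c j 0 = 0" | "c 0 j = -1" "c j 0 = -1" | "c 0 j = -2" by blast
  then show ?thesis
  proof cases
    case 1
    then have m: "m = 2" using bm by (simp add: bm_def)
    have "T j \<otimes> Y = Y \<otimes> T j"
      unfolding Y_def by (rule G.comm_mult) (use T_X_comm[OF j, of "- phi"] pr1 1 C_T in auto)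
    moreover have "T j \<otimes> inv T 0 = inv T 0 \<otimes> T j"
      using b m by (intro G.comm_inv) (auto simp: eval_nat_numeral)
    ultimately have "T j \<otimes> W = W \<otimes> T j"
      unfolding W_def Y_def[symmetric] using Yc by (intro G.comm_mult) auto
    then show ?thesis using jn m by (simp add: eval_nat_numeral)
  next
    case 2
    then have m: "m = 3" using bm by (simp add: bm_def)
    have "G.br3 (T j) (inv T 0 \<otimes> Y)"
    proof (rule G.br3_twist[where g = "X (unitv j)"])
      show "T j \<otimes> T 0 \<otimes> T j = T 0 \<otimes> T j \<otimes> T 0"
        using b m by (simp add: eval_nat_numeral G.m_assoc)
      show "T j \<otimes> Y \<otimes> T j = X (unitv j) \<otimes> Y"
        unfolding AYA using T_X_refl[OF j, of "- phi"] pr1 2 j X_add[of "unitv j" "- phi"]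
        by (simp add: Y_def G.m_assoc)
      show "T 0 \<otimes> X (unitv j) \<otimes> T 0 = X (unitv j) \<otimes> Y"
        using T0_refl[of "unitv j"] 2 j X_add[of "unitv j" "- phi"] by (simp add: Y_def G.m_assoc)
    qed (use j Yc in auto)
    then have "T j \<otimes> W \<otimes> T j = W \<otimes> T j \<otimes> W" by (simp add: G.br3_def W_def Y_def)
    then show ?thesis using jn m by (simp add: eval_nat_numeral G.m_assoc)
  next
    case 3
    then have m: "m = 4" "c j 0 = -1" using rk2 by auto
    define Z where "Z = X (unitv j - phi) \<otimes> C"
    have zf: "unitv j - phi \<in> fin" using j by simp
    have Zc: "Z \<in> carrier G" using zf by (simp add: Z_def)
    have "T j \<otimes> (inv T 0 \<otimes> Y \<otimes> (T j \<otimes> (inv T 0 \<otimes> Y))) = inv T 0 \<otimes> Y \<otimes> (T j \<otimes> (inv T 0 \<otimes> Y \<otimes> T j))"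
    proof (rule G.br4_twist[where Z = Z])
      show "T j \<otimes> (T 0 \<otimes> (T j \<otimes> T 0)) = T 0 \<otimes> (T j \<otimes> (T 0 \<otimes> T j))"
        using b m by (simp add: eval_nat_numeral)
      show "T j \<otimes> Y \<otimes> T j = Z"
        unfolding AYA Z_def using T_X_refl[OF j, of "- phi"] pr1 m(2) by (simp add: add.commute)
      show "T 0 \<otimes> Z = Z \<otimes> T 0" unfolding Z_def
        by (rule G.comm_mult) (use T0_comm[OF zf] 3 jn zf C_T c_diag in auto)
      have ZY: "Z \<otimes> Y = X (unitv j - phi - phi) \<otimes> (C \<otimes> C)"
        using X_add[OF zf, of "- phi"] zf C_X[of "- phi"]
        by (simp add: Z_def Y_def G.m_assoc) (simp add: G.m_assoc[symmetric])
      show "T j \<otimes> (Z \<otimes> Y) = Z \<otimes> Y \<otimes> T j" unfolding ZY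
      proof (rule G.comm_mult)
        show "T j \<otimes> X (unitv j - phi - phi) = X (unitv j - phi - phi) \<otimes> T j"
        proof (rule T_X_comm[OF j])
          show "unitv j - phi - phi \<in> fin" using zf by (rule fin_closed(3)) simp
          show "pr (unitv j - phi - phi) j = 0" using jn m(2) c_diag[of j] by (simp only: pr_diff pr_unitv pr_phi)
        qed
        show "T j \<otimes> (C \<otimes> C) = C \<otimes> C \<otimes> T j" using C_T by (intro G.comm_mult) auto
      qed (use fin_closed(3)[OF zf phi_fin] in auto)
    qed (use Yc Zc in auto)
    then show ?thesis using jn m unfolding W_def[symmetric] Y_def[symmetric]
      by (simp add: eval_nat_numeral G.m_assoc W_def Y_def)
  qed
qed

lemma W_affine_braid: "affine_braid n c a e r par rk G (T(0 := W))"
proof unfold_locales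
  fix i j m assume ij: "i \<le> n" "j \<le> n" "i \<noteq> j" "bm i j m"
  show "foldr (\<lambda>k g. (T(0 := W)) k \<otimes> g) (alt m i j) \<one> = foldr (\<lambda>k g. (T(0 := W)) k \<otimes> g) (alt m j i) \<one>"
  proof (cases "i = 0 \<or> j = 0")
    case True
    then show ?thesis using W_braid[of j m] W_braid[of i m] ij bm_sym by auto
  next
    case False
    have "foldr (\<lambda>k g. (T(0 := W)) k \<otimes> g) js \<one> = foldr (\<lambda>k g. T k \<otimes> g) js \<one>" if "0 \<notin> set js" for js
      using that by (induction js) auto
    moreover have "0 \<notin> set (alt m i j)" "0 \<notin> set (alt m j i)" using set_alt False by fastforce+
    ultimately show ?thesis using braid[OF ij] by metis
  qed
qed auto

lemma bern_upd: "bern G (T(0 := t)) X' \<longleftrightarrow> bern G T X'"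
  unfolding bern_def by auto

theorem double_sys_a: "double_sys n c a e r par rk G (T(0 := W)) X C"
proof -
  interpret Tw: affine_braid n c a e r par rk G "T(0 := W)" by (rule W_affine_braid)
  have CW: "C \<otimes> W = W \<otimes> C"
    unfolding W_def by (intro G.comm_mult G.comm_inv) (auto simp: C_T C_X)
  show ?thesis
  proof unfold_locales
    show "bern G (T(0 := W)) X" using bern by (simp add: bern_upd)
    show "C \<otimes> (T(0 := W)) i = (T(0 := W)) i \<otimes> C" for i using CW C_T by simp
  next
    fix b assume b: "b \<in> fin" "pr b 0 = 0"
    have "X b \<otimes> W = W \<otimes> X b" unfolding W_def
      by (intro G.comm_mult G.comm_inv) (use b in \<open>auto simp: T0_comm C_X X_comm[of b]\<close>)
    then show "(T(0 := W)) 0 \<otimes> X b = X b \<otimes> (T(0 := W)) 0" by simp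
  next
    fix b assume b: "b \<in> fin" "pr b 0 = -1"
    have "X (- phi) \<otimes> C \<otimes> X b = T 0 \<otimes> X b \<otimes> T 0"
      using T0_refl[OF b] X_add[OF b(1), of "- phi"] b C_X[of b] X_comm[of b "- phi"]
      by (simp add: G.m_assoc[symmetric]) (simp add: G.m_assoc)?
    \<comment> \<open>As X_{alpha_0} X_b equals T_0 X_b T_0, moving W past X_b turns it into T_0;
      the reflection relation for W then follows from T_0 W = X_{alpha_0}.\<close>
    then have "W \<otimes> X b = X b \<otimes> T 0" using b by (simp add: W_def G.m_assoc)
    then have "W \<otimes> X b \<otimes> W = X b \<otimes> (X (- phi) \<otimes> C)" using b by (simp add: W_def G.m_assoc)
    then show "(T(0 := W)) 0 \<otimes> X b \<otimes> (T(0 := W)) 0 = X (b - phi) \<otimes> C"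
      using X_add[OF b(1), of "- phi"] b by (simp add: G.m_assoc)
  qed (auto simp: C_X)
qed

lemma op_foldr: "foldr (\<lambda>k g. T k \<otimes>\<^bsub>opg G\<^esub> g) js \<one>\<^bsub>opg G\<^esub> = tp (rev js)"
  by (induction js) auto

text \<open>Reading an alternating word backwards gives one of the two alternating words of the same
  length; the other relations are palindromic up to commuting factors.\<close>

theorem double_sys_op: "double_sys n c a e r par rk (opg G) T X C"
proof -
  interpret O: group "opg G" by (rule G.group_opg)
  show ?thesis
  proof unfold_locales
    fix i j m assume "i \<le> n" "j \<le> n" "i \<noteq> j" "bm i j m"
    then show "foldr (\<lambda>k g. T k \<otimes>\<^bsub>opg G\<^esub> g) (alt m i j) \<one>\<^bsub>opg G\<^esub> = foldr (\<lambda>k g. T k \<otimes>\<^bsub>opg G\<^esub> g) (alt m j i) \<one>\<^bsub>opg G\<^esub>"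
      using braid[of i j m] unfolding op_foldr by (simp add: rev_alt tp_def)
  next
    show "bern (opg G) T X"
      using bern unfolding bern_def by (auto simp: X_comm G.m_assoc)
  qed (auto simp: C_T C_X T0_comm T0_refl G.m_assoc[symmetric])
qed

end

section \<open>The automorphism fixing the affine braid group\<close>

context affine_braid
begin

lemma TW_rf_comm:
  assumes "b \<in> fin" "B b b = 2" "i \<le> n" "pr b i = 0"
  shows "T i \<otimes> TW (rf b) = TW (rf b) \<otimes> T i"
proof -
  have W: "rf b \<in> Wg" using rf_Wg assms by blast
  have u: "rf b (unitv i) = unitv i" using assms by (simp add: rf_def)
  have "T i \<otimes> TW (rf b) = TW (s i \<circ> rf b)"
    by (rule TW_left[OF W assms(3), symmetric]) (use u assms in auto)
  also have "s i \<circ> rf b = rf b \<circ> s i"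
  proof
    fix x
    have "rf b x = s i (rf b (s i x))" using fun_cong[OF rf_s[OF assms(3), of b], of x] assms(4) by (simp add: s_pr0)
    then show "(s i \<circ> rf b) x = (rf b \<circ> s i) x" using assms(3) by simp
  qed
  also have "TW (rf b \<circ> s i) = TW (rf b) \<otimes> T i" by (rule TW_right[OF W assms(3)]) (simp add: u)
  finally show ?thesis .
qed

text \<open>Lowering \<open>b\<close> by alpha_m shortens its reflection by two letters: both
  positivity tests concern nonnegative combinations of \<open>b - unitv m\<close> and
  alpha_m.\<close>

lemma TW_rf_step:
  assumes "b \<in> fin" "B b b = 2" "posv b" "m \<in> {1..n}" "pr b m = 1"
  shows "TW (rf b) = T m \<otimes> (TW (rf (b - unitv m)) \<otimes> T m)"
proof -
  define b' where "b' = b - unitv m"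
  have m: "m \<le> n" using assms by simp
  have st: "b' \<in> fin" "B b' b' = 2" "posv b'" "s m b' = b"
    unfolding b'_def using short_step[OF assms] by auto
  have W: "rf b' \<in> Wg" using rf_Wg st by blast
  have eq: "rf b = s m \<circ> (rf b' \<circ> s m)" using rf_s[OF m, of b'] st(4) by (simp add: comp_assoc)
  have "B b' (unitv m) = - e m" using m assms(5) by (simp add: b'_def c_diag)
  then have u: "rf b' (unitv m) = unitv m + sc (e m) b'" by (simp add: rf_def fun_eq_iff)
  have 1: "TW (rf b' \<circ> s m) = TW (rf b') \<otimes> T m"
    by (rule TW_right[OF W m]) (use e_pos[OF m] st in \<open>simp add: u posv_add posv_sc\<close>)
  have "TW (s m \<circ> (rf b' \<circ> s m)) = T m \<otimes> TW (rf b' \<circ> s m)"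
  proof (rule TW_left[OF _ m])
    show W2: "rf b' \<circ> s m \<in> Wg" using W m by (simp only: Wg_comp Wg_s)
    define y where "y = s m (rf b' (unitv m))"
    show "y \<in> R" unfolding y_def using W m by simp
    show "(rf b' \<circ> s m) y = unitv m" using m rf_rf[OF st(2)] by (simp add: y_def)
    have "y = sc (e m) b' + sc (e m - 1) (unitv m)"
      unfolding y_def u using m st(4) by (simp add: b'_def fun_eq_iff algebra_simps)
    then show "posv y" using e_pos[OF m] st by (simp add: posv_add posv_sc)
  qed
  then show ?thesis using eq 1 by (simp add: b'_def)
qed

lemma TW_rf_simple: "k \<le> n \<Longrightarrow> e k = 1 \<Longrightarrow> TW (rf (unitv k)) = T k"
  by (simp add: rf_unitv)

text \<open>The lift of a finite short reflection is built from T_1, ..., T_n alone, so replacing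
  T_0 by W does not change it. This identifies the Bernstein element at \<open>phi\<close> for the
  new generators as W times the old T_{s_theta}.\<close>

lemma TW_rf_agree:
  assumes "affine_braid n c a e r par rk G T'" "\<And>i. i \<in> {1..n} \<Longrightarrow> T' i = T i"
    and "b \<in> fin" "B b b = 2" "posv b"
  shows "affine_braid.TW n c G T' (rf b) = TW (rf b)"
proof -
  interpret T': affine_braid n c a e r par rk G T' by (rule assms(1))
  from assms(3-5) show ?thesis
  proof (induction rule: short_induct)
    case (simple k)
    then show ?case using assms(2) TW_rf_simple T'.TW_rf_simple by simp
  next
    case (step b m)
    show ?case unfolding TW_rf_step[OF step(1-5)] T'.TW_rf_step[OF step(1-5)]
      by (simp only: step(6) assms(2)[OF step(4)])
  qed
qed

end

section \<open>Elements attached to short roots and the new lattice elements\<close>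

context double_sys
begin

definition Z :: "ivec \<Rightarrow> 'b" where "Z b = inv (TW (rf b)) \<otimes> X b"

lemma Z_closed [simp]: "b \<in> fin \<Longrightarrow> Z b \<in> carrier G" by (simp add: Z_def)

lemma Z_step:
  assumes "b \<in> fin" "B b b = 2" "posv b" "m \<in> {1..n}" "pr b m = 1"
  shows "Z b = inv (T m) \<otimes> Z (b - unitv m) \<otimes> T m"
proof -
  note st = short_step[OF assms]
  have "pr (b - unitv m) m = -1" using assms by (simp add: c_diag)
  then have "X b = T m \<otimes> (X (b - unitv m) \<otimes> T m)"
    using T_X_refl[OF assms(4) st(1)] st(1) by (simp add: G.m_assoc)
  then show ?thesis using st(1)
    by (simp add: Z_def TW_rf_step[OF assms] G.inv_mult_group G.m_assoc)
qed

lemma Z_comm: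
  assumes "b \<in> fin" "B b b = 2" "i \<in> {1..n}" "pr b i = 0"
  shows "T i \<otimes> Z b = Z b \<otimes> T i"
  unfolding Z_def using assms TW_rf_comm[of b i] T_X_comm[of i b]
  by (intro G.comm_mult G.comm_inv) auto

lemma braid3: assumes "i \<le> n" "j \<le> n" "i \<noteq> j" "c i j = -1" "c j i = -1"
  shows "T i \<otimes> T j \<otimes> T i = T j \<otimes> T i \<otimes> T j"
  using braid[OF assms(1-3), of 3] assms by (simp add: bm_def eval_nat_numeral G.m_assoc)

lemma braid2: assumes "i \<le> n" "j \<le> n" "i \<noteq> j" "c i j = 0"
  shows "T i \<otimes> T j = T j \<otimes> T i"
  using braid[OF assms(1-3), of 2] assms by (simp add: bm_def eval_nat_numeral)

text \<open>For a short positive root \<open>b\<close> the element \<open>Z b\<close> plays the role of the affine generator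
  attached to \<open>\<delta> - b\<close>; lowering \<open>b\<close> to a simple root shows that it braids with \<open>T i\<close>.\<close>
lemma Z_braid:
  assumes "b \<in> fin" "B b b = 2" "posv b" "i \<in> {1..n}" "e i = 1" "pr b i = -1"
  shows "G.br3 (T i) (Z b)"
  using assms
proof (induction "ht b" arbitrary: b i rule: less_induct)
  case less
  note b = less.prems(1-3) and i = less.prems(4-6)
  have inn: "i \<le> n" using i by simp
  from short_exists[OF b] show ?case
  proof (elim disjE bexE conjE)
    fix k assume k: "k \<in> {1..n}" "e k = 1" "b = unitv k"
    have kn: "k \<le> n" "i \<noteq> k" using k i c_diag[of i] by auto
    have c: "c i k = -1" "c k i = -1" using i k kn c_sym[OF inn kn(1)] by auto
    have "G.br3 (T i) (inv T k \<otimes> X (unitv k))"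
    proof (rule G.br3_twist[where g = "X (unitv i)"])
      show "T i \<otimes> T k \<otimes> T i = T k \<otimes> T i \<otimes> T k" using braid3 inn kn c by blast
      show "T i \<otimes> X (unitv k) \<otimes> T i = X (unitv i) \<otimes> X (unitv k)"
        using T_X_refl[OF i(1), of "unitv k"] k kn c i(1) X_add[of "unitv i" "unitv k"] by (simp add: add.commute)
      show "T k \<otimes> X (unitv i) \<otimes> T k = X (unitv i) \<otimes> X (unitv k)"
        using T_X_refl[OF k(1), of "unitv i"] i kn inn c k(1) X_add[of "unitv i" "unitv k"] by simp
    qed (use i k in auto)
    then show ?thesis using k kn by (simp add: Z_def TW_rf_simple)
  next
    fix m assume m: "m \<in> {1..n}" "pr b m = 1"
    have mn: "m \<le> n" "i \<noteq> m" using m i by auto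
    have n2: "2 \<le> n" using i(1) m(1) mn by auto
    define b' where "b' = b - unitv m"
    have st: "b' \<in> fin" "B b' b' = 2" "posv b'" "ht b' < ht b"
      unfolding b'_def using short_step[OF b m] ht_less[of b m] mn by auto
    have Zb: "Z b = inv (T m) \<otimes> Z b' \<otimes> T m" unfolding b'_def by (rule Z_step[OF b m])
    have pi: "pr b' i = -1 - c i m" using mn i by (simp add: b'_def)
    have pm: "pr b' m = -1" using mn m by (simp add: b'_def c_diag)
    have sy: "c i m = e m * c m i" using c_sym[OF inn mn(1)] i by simp
    note rk2 = c_rank2[OF inn mn c_prod[OF inn mn n2]]
    \<comment> \<open>Since alpha_i is short, \<open>c i m = e m * c m i\<close>, which rules out
      the bonds where alpha_i is the longer root.\<close>
    consider "c i m = 0" | "e m = 1" "c i m = -1" "c m i = -1"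
      | "c i m = -2" "c m i = -1" | "c i m = -3" "c m i = -1"
    proof -
      from rk2 consider "c i m = 0" "c m i = 0" | "c i m = -1" "c m i = -1" | "c i m = -1" "c m i = -2"
        | "c i m = -2" "c m i = -1" | "c i m = -1" "c m i = -3" | "c i m = -3" "c m i = -1"
        by (simp only: insert_iff empty_iff prod.inject simp_thms) blast
      then show ?thesis using sy e_pos[OF mn(1)] that by cases auto
    qed
    then show ?thesis
    proof cases
      case 1
      have IH: "G.br3 (T i) (Z b')" using less.hyps[OF st(4,1-3)] i pi 1 by simp
      have "G.br3 (inv T m \<otimes> T i \<otimes> inv (inv T m)) (inv T m \<otimes> Z b' \<otimes> inv (inv T m))"
        using IH st by (subst G.br3_conj) auto
      moreover have "inv T m \<otimes> T i \<otimes> T m = T i"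
        using braid2[OF inn mn 1] by (intro G.comm_conj) auto
      ultimately show ?thesis by (simp add: Zb)
    next
      case 2
      have IH: "G.br3 (T m) (Z b')" using less.hyps[OF st(4,1-3)] m 2 pm by simp
      have "T i \<otimes> Z b' = Z b' \<otimes> T i" using Z_comm[OF st(1,2) i(1)] pi 2 by simp
      then show ?thesis unfolding Zb using IH braid3[OF inn mn 2(2,3)] st
        by (intro G.br3_step3) auto
    next
      case 3
      \<comment> \<open>Across a double bond \<open>b'\<close> can be lowered once more, by alpha_i;
        the result is orthogonal to alpha_m and pairs to -1 with alpha_i, so the induction
        hypothesis applies to it.\<close>
      have p1: "pr b' i = 1" using pi 3 by simp
      define b2 where "b2 = b' - unitv i"
      have st2: "b2 \<in> fin" "B b2 b2 = 2" "posv b2" "ht b2 < ht b'"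
        unfolding b2_def using short_step[OF st(1-3) i(1) p1] ht_less[of b' i] inn by auto
      have Zb': "Z b' = inv (T i) \<otimes> Z b2 \<otimes> T i" unfolding b2_def by (rule Z_step[OF st(1-3) i(1) p1])
      have "pr b2 i = -1" using inn p1 by (simp add: b2_def c_diag)
      then have IH: "G.br3 (T i) (Z b2)" using less.hyps[OF less_trans[OF st2(4) st(4)] st2(1-3)] i by simp
      have "pr b2 m = 0" using inn pm 3 by (simp add: b2_def)
      then have cm: "T m \<otimes> Z b2 = Z b2 \<otimes> T m" using Z_comm[OF st2(1,2) m(1)] by simp
      have "T i \<otimes> (T m \<otimes> (T i \<otimes> T m)) = T m \<otimes> (T i \<otimes> (T m \<otimes> T i))"
        using braid[OF inn mn, of 4] 3 by (simp add: bm_def eval_nat_numeral)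
      then show ?thesis unfolding Zb Zb' using IH cm st2 by (intro G.br3_step4) auto
    next
      case 4
      \<comment> \<open>Across a triple bond the pairing 2 forces \<open>b'\<close> to be alpha_i
        itself, so that \<open>b\<close> is explicit.\<close>
      have p2: "pr b' i = 2" using pi 4 by simp
      have "B (b' - unitv i) (b' - unitv i) = 0" using inn st p2 i by (simp add: c_diag)
      then have "b' - unitv i = sc ((b' - unitv i) 0) dl"
        using B_zero_imp[of "b' - unitv i"] st inn by (simp add: fin_lat)
      moreover have "(b' - unitv i) 0 = 0" using st(1) i by (auto simp: fin_def)
      ultimately have b'i: "b' = unitv i" by simp
      then have bb: "b = unitv i + unitv m" by (simp add: b'_def algebra_simps)
      have bf: "b \<in> fin" using b by simp
      have "G.br3 (T i) (inv T m \<otimes> (inv T i \<otimes> X (unitv i)) \<otimes> T m)"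
      proof (rule G.br3_step6[where x = "X b" and f = "X (b + unitv i)"])
        show "T i \<otimes> (T m \<otimes> (T i \<otimes> (T m \<otimes> (T i \<otimes> T m)))) = T m \<otimes> (T i \<otimes> (T m \<otimes> (T i \<otimes> (T m \<otimes> T i))))"
          using braid[OF inn mn, of 6] 4 by (simp add: bm_def eval_nat_numeral)
        show "T i \<otimes> X b \<otimes> T i = X (b + unitv i)" using T_X_refl[OF i(1) bf i(3)] .
        show "T m \<otimes> X (b + unitv i) = X (b + unitv i) \<otimes> T m"
          by (rule T_X_comm[OF m(1)]) (use bf i m inn 4 in auto)
        show "T m \<otimes> X (unitv i) \<otimes> T m = X b"
          using T_X_refl[OF m(1), of "unitv i"] inn i 4 by (simp add: bb)
        show "X (unitv i) \<otimes> X b = X (b + unitv i)" using X_add[of "unitv i" b] bf i by (simp add: add.commute)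
      qed (use bf i in auto)
      then show ?thesis using Zb b'i i inn by (simp add: Z_def TW_rf_simple)
    qed
  qed
qed

theorem double_sys_b: "\<exists>Y. double_sys n c a e r par rk G T Y C \<and> Y phi = W \<otimes> TW (rf phi)"
proof -
  interpret Tw: affine_braid n c a e r par rk G "T(0 := W)" by (rule W_affine_braid)
  obtain Y where Y: "bern G (T(0 := W)) Y" "Y phi = (T(0 := W)) 0 \<otimes> Tw.TW (rf phi)"
    using Tw.bernstein by blast
  define U where "U = TW (rf phi)"
  have Uc [simp]: "U \<in> carrier G" by (simp add: U_def)
  have "Tw.TW (rf phi) = U" unfolding U_def
    by (rule TW_rf_agree[OF W_affine_braid _ phi_fin B_phi_phi phi_posv]) auto
  then have Yphi: "Y phi = W \<otimes> U" using Y(2) by simp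
  have bY: "bern G T Y" using Y(1) by (simp add: bern_upd)
  have Yc [simp]: "b \<in> fin \<Longrightarrow> Y b \<in> carrier G" for b using bY by (simp add: bern_def)
  have Y_add: "b \<in> fin \<Longrightarrow> b' \<in> fin \<Longrightarrow> Y (b + b') = Y b \<otimes> Y b'" for b b' using bY by (simp add: bern_def)
  have Y_comm: "b \<in> fin \<Longrightarrow> b' \<in> fin \<Longrightarrow> Y b \<otimes> Y b' = Y b' \<otimes> Y b" for b b'
    using Y_add[of b b'] Y_add[of b' b] by (simp add: add.commute)
  have Y_0: "Y 0 = \<one>" using Y_add[of 0 0] by simp
  have Y_minus: "b \<in> fin \<Longrightarrow> Y (- b) = inv (Y b)" for b
    using Y_add[of "- b" b] by (simp add: Y_0 G.inv_equality)
  have Y_diff: "b \<in> fin \<Longrightarrow> b' \<in> fin \<Longrightarrow> Y (b - b') = Y b \<otimes> inv Y b'" for b b'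
    using Y_add[of b "- b'"] Y_minus[of b'] by simp
  have Y_refl: "i \<in> {1..n} \<Longrightarrow> b \<in> fin \<Longrightarrow> pr b i = -1 \<Longrightarrow> T i \<otimes> Y b \<otimes> T i = Y (b + unitv i)" for b i
    using bY by (simp add: bern_def s_prm1)
  have CW: "C \<otimes> W = W \<otimes> C"
    unfolding W_def by (intro G.comm_mult G.comm_inv) (auto simp: C_T C_X)
  have CU: "C \<otimes> U = U \<otimes> C" by (simp add: U_def TW_def C_tp)
  have CY: "C \<otimes> Y b = Y b \<otimes> C" if "b \<in> fin" for b
    using _ _ _ _ that
  proof (rule closure)
    show "C \<otimes> Y phi = Y phi \<otimes> C" unfolding Yphi by (rule G.comm_mult) (use CW CU in auto)
  next
    fix x y assume "x \<in> fin" "C \<otimes> Y x = Y x \<otimes> C" "y \<in> fin" "C \<otimes> Y y = Y y \<otimes> C"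
    then show "C \<otimes> Y (x + y) = Y (x + y) \<otimes> C" by (subst (1 2) Y_add) (auto intro!: G.comm_mult)
  next
    fix x assume "x \<in> fin" "C \<otimes> Y x = Y x \<otimes> C"
    then show "C \<otimes> Y (- x) = Y (- x) \<otimes> C" by (simp add: Y_minus G.comm_inv)
  next
    fix x k assume k: "k \<in> {1..n}" "x \<in> fin" "C \<otimes> Y x = Y x \<otimes> C" "pr x k = -1"
    have "C \<otimes> (T k \<otimes> Y x \<otimes> T k) = T k \<otimes> Y x \<otimes> T k \<otimes> C"
      using k C_T by (intro G.comm_mult) auto
    then show "C \<otimes> Y (s k x) = Y (s k x) \<otimes> C" using Y_refl[OF k(1,2,4)] k(4) by (simp add: s_prm1)
  qed
  \<comment> \<open>The bridge between the two lattices: W^-1 contains X_phi, so Y_{-phi} is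
    expressed through \<open>Z phi\<close> and T_0, and the braid relation of \<open>Z phi\<close>
    gives relations of Y with T_0.\<close>
  have YmC: "Y (- phi) \<otimes> C = Z phi \<otimes> T 0"
  proof -
    have "inv W = inv C \<otimes> (X phi \<otimes> T 0)"
      by (simp add: W_def X_minus G.inv_mult_group G.m_assoc)
    then have "Y (- phi) = inv U \<otimes> (inv C \<otimes> (X phi \<otimes> T 0))"
      by (simp add: Y_minus Yphi G.inv_mult_group)
    moreover have "C \<otimes> (X phi \<otimes> T 0) = X phi \<otimes> T 0 \<otimes> C"
      by (intro G.comm_mult) (auto simp: C_X C_T)
    then have "inv C \<otimes> (X phi \<otimes> T 0) \<otimes> C = X phi \<otimes> T 0" by (intro G.comm_conj) auto
    ultimately show ?thesis by (simp add: Z_def U_def[symmetric] G.m_assoc)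
  qed
  \<comment> \<open>\<open>S\<close> is a sublattice, so commutation with T_0 need only be found on
    generators of the vectors orthogonal to alpha_0.\<close>
  define S where "S = {b \<in> fin. T 0 \<otimes> Y b = Y b \<otimes> T 0}"
  have S_add: "x \<in> S \<Longrightarrow> y \<in> S \<Longrightarrow> x + y \<in> S" for x y
    by (auto simp: S_def Y_add intro!: G.comm_mult)
  have S_minus: "x \<in> S \<Longrightarrow> - x \<in> S" for x by (auto simp: S_def Y_minus intro!: G.comm_inv)
  have S_diff: "x \<in> S \<Longrightarrow> y \<in> S \<Longrightarrow> x - y \<in> S" for x y using S_add[of x "- y"] S_minus[of y] by simp
  have S_sc0: "0 \<in> S" by (simp add: S_def Y_0)
  have main: "(\<forall>b\<in>fin. pr b 0 = 0 \<longrightarrow> b \<in> S) \<and>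
      (\<forall>b\<in>fin. pr b 0 = -1 \<longrightarrow> T 0 \<otimes> Y b \<otimes> T 0 = Y (b - phi) \<otimes> C)"
    using shape
  proof
    assume I: "\<forall>k\<in>{1..n}. c k (par k) = -1 \<and> c 0 k \<in> {0, -1}"
    have c0: "c 0 k = 0 \<and> c k 0 = 0 \<or> c 0 k = -1 \<and> c k 0 = -1" if "k \<in> {1..n}" for k
      using c0_cases[OF that] I that by force
    have adj: "T 0 \<otimes> Y (unitv j) \<otimes> T 0 = Y (unitv j - phi) \<otimes> C"
      if j: "j \<in> {1..n}" "c 0 j = -1" for j
    proof -
      have jn: "j \<le> n" "0 \<noteq> j" and cj: "c j 0 = -1" using j c0[OF j(1)] by auto
      have ej: "e j = 1" using c_sym[of 0 j] e_0 jn j(2) cj by simp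
      have pj: "pr phi j = 1" using jn cj by simp
      note st = short_step[OF phi_fin B_phi_phi phi_posv j(1) pj]
      have "G.br3 (T j) (Z (phi - unitv j))"
        by (rule Z_braid[OF st(1-3) j(1) ej]) (use jn cj in \<open>simp add: c_diag\<close>)
      then have "G.br3 (inv T j \<otimes> T j \<otimes> inv (inv T j)) (inv T j \<otimes> Z (phi - unitv j) \<otimes> inv (inv T j))"
        using st by (subst G.br3_conj) auto
      then have zz: "G.br3 (T j) (Z phi)"
        using Z_step[OF phi_fin B_phi_phi phi_posv j(1) pj] by simp
      have gp: "Y (unitv j - phi) = Y (- phi) \<otimes> Y (unitv j)"
        using Y_add[of "- phi" "unitv j"] j by (simp add: add.commute)
      define p where "p = Y (- phi) \<otimes> C"
      have pc: "p \<in> carrier G" by (simp add: p_def)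
      have cp: "C \<otimes> Y (unitv j) = Y (unitv j) \<otimes> C" using CY j by simp
      have "T 0 \<otimes> Y (unitv j) \<otimes> T 0 = p \<otimes> Y (unitv j)"
      proof (rule G.twist_br3[where A = "T j"])
        show "T j \<otimes> T 0 \<otimes> T j = T 0 \<otimes> T j \<otimes> T 0" using braid3[of j 0] jn j cj by simp
        have "T j \<otimes> p \<otimes> T j = T j \<otimes> Y (- phi) \<otimes> T j \<otimes> C" by (simp add: p_def G.m_assoc C_T)
        also have "T j \<otimes> Y (- phi) \<otimes> T j = Y (- phi) \<otimes> Y (unitv j)"
          using Y_refl[OF j(1), of "- phi"] pj jn Y_add[of "- phi" "unitv j"] j by simp
        finally show "T j \<otimes> p \<otimes> T j = p \<otimes> Y (unitv j)" using cp j by (simp add: p_def G.m_assoc)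
        show "G.br3 (T j) (p \<otimes> inv T 0)" using zz YmC by (simp add: p_def G.m_assoc)
        show "Y (unitv j) \<otimes> p = p \<otimes> Y (unitv j)" unfolding p_def
          by (intro G.comm_mult) (use j Y_comm[of "unitv j" "- phi"] cp in auto)
      qed (use j pc in auto)
      then show ?thesis using cp j by (simp add: gp p_def G.m_assoc)
    qed
    \<comment> \<open>Nodes not joined to 0 are reached along \<open>par\<close>. Either the parent
      commutes with T_0 as well, or it is a neighbour of 0, and its relation with T_0 is compared
      with the one conjugated by T_k, which commutes with T_0.\<close>
    have far: "unitv k \<in> S" if "k \<in> {1..n}" "c 0 k = 0" for k
      using that
    proof (induction "rk k" arbitrary: k rule: less_induct)
      case less
      have kn: "k \<le> n" "0 \<noteq> k" "c k 0 = 0" using less.prems c0[OF less.prems(1)] by auto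
      have cp: "c k (par k) = -1" using I less.prems by blast
      have "par k \<noteq> 0" using cp kn(3) by (metis neg_equal_zero zero_neq_one neg_0_equal_iff_equal)
      then have p: "par k \<in> {1..n}" "rk (par k) < rk k" "par k \<le> n" using par[OF less.prems(1)] by auto
      define y where "y = unitv (par k)"
      have y: "y \<in> fin" "pr y k = -1" using p cp by (auto simp: y_def)
      have uk: "unitv k \<in> fin" using less.prems by simp
      have yk: "y + unitv k \<in> fin" using y uk by simp
      have T0k: "T 0 \<otimes> T k = T k \<otimes> T 0" using braid2[of 0 k] kn less.prems by simp
      have refl: "T k \<otimes> Y y \<otimes> T k = Y (y + unitv k)" using Y_refl[OF less.prems(1) y] .
      have split: "Y (y + unitv k) = Y (unitv k) \<otimes> Y y" using Y_add[OF uk y(1)] by (simp add: add.commute)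
      from c0[OF p(1)] show ?case
      proof
        assume "c 0 (par k) = 0 \<and> c (par k) 0 = 0"
        then have "y \<in> S" using less.hyps[OF p(2,1)] by (simp add: y_def)
        then have "T 0 \<otimes> (T k \<otimes> Y y \<otimes> T k) = T k \<otimes> Y y \<otimes> T k \<otimes> T 0"
          using T0k y by (intro G.comm_mult) (auto simp: S_def)
        then have "y + unitv k \<in> S" using refl yk by (simp add: S_def)
        then show ?thesis using S_diff[of "y + unitv k" y] \<open>y \<in> S\<close> by simp
      next
        assume "c 0 (par k) = -1 \<and> c (par k) 0 = -1"
        then have yM: "T 0 \<otimes> Y y \<otimes> T 0 = Y (y - phi) \<otimes> C" using adj[OF p(1)] by (simp add: y_def)
        have ypf: "y - phi \<in> fin" "pr (y - phi) k = -1" using y kn by auto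
        have "T 0 \<otimes> Y (y + unitv k) \<otimes> T 0 = T 0 \<otimes> T k \<otimes> Y y \<otimes> (T k \<otimes> T 0)"
          using y by (simp add: refl[symmetric] G.m_assoc)
        also have "\<dots> = T k \<otimes> (T 0 \<otimes> Y y \<otimes> T 0) \<otimes> T k"
          unfolding T0k[symmetric] using y by (simp add: T0k G.m_assoc)
            (simp add: T0k[symmetric] G.m_assoc[symmetric])?
        also have "\<dots> = T k \<otimes> Y (y - phi) \<otimes> T k \<otimes> C" unfolding yM using ypf by (simp add: G.m_assoc C_T)
        also have "\<dots> = Y (unitv k) \<otimes> Y (y - phi) \<otimes> C"
          using Y_refl[OF less.prems(1) ypf] Y_add[OF uk ypf(1)] by (simp add: add.commute)
        also have "\<dots> = Y (unitv k) \<otimes> (T 0 \<otimes> Y y \<otimes> T 0)" unfolding yM using uk ypf by (simp add: G.m_assoc)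
        finally have "T 0 \<otimes> Y (unitv k) \<otimes> (Y y \<otimes> T 0) = Y (unitv k) \<otimes> T 0 \<otimes> (Y y \<otimes> T 0)"
          using uk y by (simp add: split G.m_assoc)
        then have "T 0 \<otimes> Y (unitv k) = Y (unitv k) \<otimes> T 0" using uk y by (simp add: G.right_cancel)
        then show ?thesis using uk by (simp add: S_def)
      qed
    qed
    obtain j where j: "j \<in> {1..n}" "c 0 j = -1"
    proof -
      obtain k where k: "k \<in> {1..n}" "\<And>i. i \<in> {1..n} \<Longrightarrow> rk k \<le> rk i"
        using ex_has_least_nat[of "\<lambda>k. k \<in> {1..n}" 1 rk] n_pos by auto
      have "par k = 0" using par[OF k(1)] k(2)[of "par k"] by (cases "par k") auto
      then have "c k 0 = -1" using I k(1) by metis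
      then show ?thesis using that[OF k(1)] c0[OF k(1)] by auto
    qed
    \<comment> \<open>One neighbour \<open>j\<close> of 0 serves as reference: every
      \<open>b\<close> becomes orthogonal to alpha_0 after adding \<open>pr b 0\<close> copies of
      alpha_j, which reduces both relations to membership in \<open>S\<close> and the relation at
      alpha_j.\<close>
    define u where "u = unitv j"
    have uf: "u \<in> fin" "pr u 0 = -1" using j by (auto simp: u_def)
    have uM: "T 0 \<otimes> Y u \<otimes> T 0 = Y (u - phi) \<otimes> C" using adj[OF j] by (simp add: u_def)
    have near: "unitv k - u \<in> S" if k: "k \<in> {1..n}" "c 0 k = -1" for k
    proof -
      have kf: "unitv k \<in> fin" using k by simp
      have "T 0 \<otimes> Y (unitv k) \<otimes> T 0 = Y (unitv k - u) \<otimes> (Y (u - phi) \<otimes> C)"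
        using adj[OF k] Y_add[of "unitv k - u" "u - phi"] uf kf by (simp add: G.m_assoc)
      also have "\<dots> = Y (unitv k - u) \<otimes> (T 0 \<otimes> Y u \<otimes> T 0)" using uM by simp
      finally have "T 0 \<otimes> Y (unitv k - u) \<otimes> (Y u \<otimes> T 0) = Y (unitv k - u) \<otimes> T 0 \<otimes> (Y u \<otimes> T 0)"
        using Y_add[of "unitv k - u" u] uf kf by (simp add: G.m_assoc)
      then show ?thesis using uf kf by (simp add: G.right_cancel S_def)
    qed
    have all: "b + sc (pr b 0) u \<in> S" if "b \<in> fin" for b
      using _ _ _ that
    proof (rule fin_span)
      fix x y assume "x + sc (pr x 0) u \<in> S" "y + sc (pr y 0) u \<in> S"
      moreover have "x + y + sc (pr (x + y) 0) u = (x + sc (pr x 0) u) + (y + sc (pr y 0) u)"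
        by (simp add: fun_eq_iff algebra_simps)
      ultimately show "x + y + sc (pr (x + y) 0) u \<in> S" using S_add by metis
    next
      fix x assume "x + sc (pr x 0) u \<in> S"
      moreover have "- x + sc (pr (- x) 0) u = - (x + sc (pr x 0) u)" by (simp add: fun_eq_iff)
      ultimately show "- x + sc (pr (- x) 0) u \<in> S" using S_minus by metis
    next
      fix k assume k: "k \<in> {1..n}"
      have "pr (unitv k) 0 = c 0 k" using k by simp
      then show "unitv k + sc (pr (unitv k) 0) u \<in> S" using c0[OF k] far[OF k] near[OF k] by auto
    qed
    show ?thesis
    proof (intro conjI ballI impI)
      fix b assume b: "b \<in> fin" "pr b 0 = 0"
      then show "b \<in> S" using all[OF b(1)] by simp
    next
      fix b assume b: "b \<in> fin" "pr b 0 = -1"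
      then have "b - u \<in> S" using all[OF b(1)] by simp
      then have q: "T 0 \<otimes> Y (b - u) = Y (b - u) \<otimes> T 0" by (simp add: S_def)
      have "T 0 \<otimes> Y b \<otimes> T 0 = T 0 \<otimes> Y (b - u) \<otimes> Y u \<otimes> T 0"
        using Y_add[of "b - u" u] b uf by (simp add: G.m_assoc)
      also have "\<dots> = Y (b - u) \<otimes> (T 0 \<otimes> Y u \<otimes> T 0)" unfolding q using b uf by (simp add: G.m_assoc)
      also have "\<dots> = Y (b - phi) \<otimes> C" unfolding uM
        using Y_add[of "b - u" "u - phi"] b uf by (simp add: G.m_assoc)
      finally show "T 0 \<otimes> Y b \<otimes> T 0 = Y (b - phi) \<otimes> C" .
    qed
  next
    assume II: "(\<forall>k\<le>n. a k = 1) \<and> (\<forall>k\<in>{1..<n}. c k (k - 1) = -1) \<and> c 0 1 = -2 \<and> c n (n - 1) = -2 \<and>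
       (\<forall>i\<le>n. \<forall>j\<le>n. i + 2 \<le> j \<longrightarrow> c i j = 0 \<and> c j i = 0)"
    \<comment> \<open>In the double-laced chain the pairing with node 0 is even on the finite
      lattice. No vector pairs to -1, and only commutation has to be shown.\<close>
    have p0: "pr b 0 = -2 * b 1" if "b \<in> fin" for b
    proof -
      have "pr b 0 = (\<Sum>j\<in>{1}. c 0 j * b j)" unfolding pr_def
      proof (rule sum.mono_neutral_right)
        show "\<forall>i\<in>{..n} - {1}. c 0 i * b i = 0"
        proof
          fix i assume i: "i \<in> {..n} - {1}"
          show "c 0 i * b i = 0"
          proof (cases "i = 0")
            case False
            then have "0 + 2 \<le> i" using i by auto
            then show ?thesis using II i by simp
          qed (use that in \<open>simp add: fin_def\<close>)
        qed
      qed (use n_pos in auto)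
      then show ?thesis using II by simp
    qed
    \<comment> \<open>The tail sums alpha_k + ... + alpha_n, with \<open>psi 1 = phi\<close>.
      Consecutive ones are related by a reflection at pairing -1, and those with \<open>k\<close> at
      least 2 span the vectors with vanishing coordinate at 1.\<close>
    define psi where "psi k = (\<lambda>j. if k \<le> j \<and> j \<le> n then 1 else 0 :: int)" for k :: nat
    have psif: "psi k \<in> fin" if "1 \<le> k" for k using that by (auto simp: psi_def fin_def lat_def)
    have psi_step: "psi k = psi (Suc k) + unitv k" if "k \<le> n" for k
      using that by (auto simp: psi_def fun_eq_iff unitv_apply)
    have psi1: "psi 1 = phi" using II by (auto simp: psi_def phi_def dl_def fun_eq_iff unitv_apply)
    have psin: "psi (Suc n) = 0" by (auto simp: psi_def fun_eq_iff)
    have prpsi: "pr (psi (Suc k)) k = -1" if "k \<in> {1..<n}" for k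
    proof -
      have "psi (Suc k) = dl - (\<lambda>j. if j \<le> k then 1 else 0)"
        using II that by (auto simp: psi_def dl_def fun_eq_iff)
      then have "pr (psi (Suc k)) k = - pr (\<lambda>j. if j \<le> k then 1 else 0) k" using that by simp
      also have "pr (\<lambda>j. if j \<le> k then 1 else 0) k = (\<Sum>j\<in>{k - 1, k}. c k j * (if j \<le> k then 1 else 0))"
        unfolding pr_def
      proof (rule sum.mono_neutral_right)
        show "\<forall>i\<in>{..n} - {k - 1, k}. c k i * (if i \<le> k then 1 else 0) = 0"
        proof
          fix i assume i: "i \<in> {..n} - {k - 1, k}"
          show "c k i * (if i \<le> k then 1 else 0) = 0"
          proof (cases "i \<le> k")
            case True
            then have "i + 2 \<le> k" using i by auto
            then show ?thesis using II i that by auto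
          qed simp
        qed
      qed (use that in auto)
      also have "\<dots> = 1" using that II c_diag[of k] by auto
      finally show ?thesis by simp
    qed
    have T0k: "T 0 \<otimes> T k = T k \<otimes> T 0" if "k \<in> {2..n}" for k
      by (rule braid2) (use that II in auto)
    have psiS: "psi k \<in> S" if "2 \<le> k" "k \<le> Suc n" for k
      using that
    proof (induction k rule: nat_induct_at_least)
      case base
      show ?case
      proof (cases "n = 1")
        case True
        then show ?thesis using psin S_sc0 by (metis One_nat_def Suc_1)
      next
        case False
        then have n2: "2 \<le> n" using n_pos by simp
        have one: "1 \<in> {1..n}" "1 \<in> {1..<n}" "1 \<le> n" using n2 by auto
        have c10: "c 1 0 = -1" using II one by force
        have c01: "c 0 1 = -2" using II by simp
        have pp: "pr phi 1 = 1" using one c10 by simp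
        have ps: "psi 2 = phi - unitv 1" using psi_step[of 1] psi1 one by (simp add: numeral_2_eq_2 algebra_simps)
        note st = short_step[OF phi_fin B_phi_phi phi_posv one(1) pp]
        define V where "V = TW (rf (psi 2))"
        have Vc [simp]: "V \<in> carrier G" by (simp add: V_def)
        have UV: "U = T 1 \<otimes> (V \<otimes> T 1)"
          unfolding U_def V_def ps by (rule TW_rf_step[OF phi_fin B_phi_phi phi_posv one(1) pp])
        have pf: "psi 2 \<in> fin" using psif by simp
        have "pr (psi 2) 1 = -1" using prpsi[of 1] one by (simp add: numeral_2_eq_2)
        then have e1: "T 1 \<otimes> Y (psi 2) \<otimes> T 1 = W \<otimes> U"
          using Y_refl[OF one(1) pf] Yphi by (simp add: ps)
        have "T 1 \<otimes> X (- phi) \<otimes> T 1 = X (- psi 2)"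
          using T_X_refl[OF one(1), of "- phi"] pp by (simp add: ps)
        then have e2: "X (- phi) \<otimes> T 1 = inv T 1 \<otimes> X (- psi 2)"
          using pf by (metis G.cancel_left(1) G.m_assoc G.m_closed T_closed X_closed fin_closed(4) phi_fin)
        have "Y (psi 2) = inv T 1 \<otimes> (T 1 \<otimes> Y (psi 2) \<otimes> T 1) \<otimes> inv T 1" using pf by (simp add: G.m_assoc)
        also have "\<dots> = inv T 1 \<otimes> W \<otimes> T 1 \<otimes> V" unfolding e1 UV by (simp add: G.m_assoc)
        also have "\<dots> = inv T 1 \<otimes> inv T 0 \<otimes> (X (- phi) \<otimes> T 1) \<otimes> (C \<otimes> V)"
          by (simp add: W_def G.m_assoc) (simp add: G.m_assoc[symmetric] C_T)
        also have "\<dots> = (inv T 1 \<otimes> (inv T 0 \<otimes> inv T 1)) \<otimes> (X (- psi 2) \<otimes> (C \<otimes> V))"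
          unfolding e2 using pf by (simp add: G.m_assoc)
        \<comment> \<open>Each factor commutes with T_0: the inverse by the four-term braid
          relation, C because it is central, and the other two because \<open>psi 2\<close> is
          orthogonal to alpha_0.\<close>
        finally have Yp: "Y (psi 2) = inv (T 1 \<otimes> T 0 \<otimes> T 1) \<otimes> (X (- psi 2) \<otimes> (C \<otimes> V))"
          by (simp add: G.inv_mult_group G.m_assoc)
        have b4: "T 0 \<otimes> (T 1 \<otimes> T 0 \<otimes> T 1) = T 1 \<otimes> T 0 \<otimes> T 1 \<otimes> T 0"
          using braid[of 0 1 4] one c10 c01 by (simp add: bm_def eval_nat_numeral G.m_assoc)
        have pz: "pr (psi 2) 0 = 0" using p0[OF pf] by (simp add: psi_def)
        have V0: "T 0 \<otimes> V = V \<otimes> T 0"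
          unfolding V_def using TW_rf_comm[OF pf _ _ pz] st(2) by (simp add: ps)
        have "T 0 \<otimes> inv (T 1 \<otimes> T 0 \<otimes> T 1) = inv (T 1 \<otimes> T 0 \<otimes> T 1) \<otimes> T 0"
          by (rule G.comm_inv[OF _ _ b4]) simp_all
        moreover have "T 0 \<otimes> (X (- psi 2) \<otimes> (C \<otimes> V)) = X (- psi 2) \<otimes> (C \<otimes> V) \<otimes> T 0"
          using T0_comm[of "- psi 2"] pf pz V0 C_T by (intro G.comm_mult) auto
        ultimately have "T 0 \<otimes> Y (psi 2) = Y (psi 2) \<otimes> T 0"
          unfolding Yp using pf by (intro G.comm_mult[of "T 0" _ "X (- psi 2) \<otimes> (C \<otimes> V)"]) simp_all
        then show ?thesis using pf by (simp add: S_def)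
      qed
    next
      case (Suc k)
      have kr: "k \<in> {1..n}" "k \<in> {2..n}" using Suc by auto
      show ?case
      proof (cases "k = n")
        case True
        then show ?thesis using psin S_sc0 by metis
      next
        case False
        then have k: "k \<in> {1..<n}" using kr by auto
        have f: "psi k \<in> fin" "psi (Suc k) \<in> fin" using psif kr by auto
        have yk: "T k \<otimes> Y (psi (Suc k)) \<otimes> T k = Y (psi k)"
          using Y_refl[OF kr(1) f(2) prpsi[OF k]] psi_step[of k] kr by simp
        have "Y (psi (Suc k)) = inv T k \<otimes> (T k \<otimes> Y (psi (Suc k)) \<otimes> T k) \<otimes> inv T k"
          using f by (simp add: G.m_assoc)
        moreover have "T 0 \<otimes> (inv T k \<otimes> Y (psi k) \<otimes> inv T k) = inv T k \<otimes> Y (psi k) \<otimes> inv T k \<otimes> T 0"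
          using Suc T0k[OF kr(2)] f by (intro G.comm_mult G.comm_inv) (auto simp: S_def)
        ultimately show ?thesis using f unfolding yk by (simp add: S_def)
      qed
    qed
    have far: "unitv k \<in> S" if "k \<in> {2..n}" for k
    proof -
      have "unitv k = psi k - psi (Suc k)" using psi_step[of k] that by (simp add: algebra_simps)
      then show ?thesis using S_diff[OF psiS[of k] psiS[of "Suc k"]] that by simp
    qed
    have all: "b - sc (b 1) (unitv 1) \<in> S" if "b \<in> fin" for b
      using _ _ _ that
    proof (rule fin_span)
      fix x y :: ivec assume "x - sc (x 1) (unitv 1) \<in> S" "y - sc (y 1) (unitv 1) \<in> S"
      moreover have "x + y - sc ((x + y) 1) (unitv 1) = (x - sc (x 1) (unitv 1)) + (y - sc (y 1) (unitv 1))"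
        by (simp add: fun_eq_iff algebra_simps)
      ultimately show "x + y - sc ((x + y) 1) (unitv 1) \<in> S" using S_add by metis
    next
      fix x :: ivec assume "x - sc (x 1) (unitv 1) \<in> S"
      moreover have "- x - sc ((- x) 1) (unitv 1) = - (x - sc (x 1) (unitv 1))" by (simp add: fun_eq_iff)
      ultimately show "- x - sc ((- x) 1) (unitv 1) \<in> S" using S_minus by metis
    next
      fix k assume k: "k \<in> {1..n}"
      show "unitv k - sc (unitv k 1) (unitv 1) \<in> S"
      proof (cases "k = 1")
        case True
        then show ?thesis using S_sc0 by simp
      next
        case False
        then have "k \<in> {2..n}" "unitv k 1 = 0" using k by auto
        then show ?thesis using far by simp
      qed
    qed
    show ?thesis
    proof (intro conjI ballI impI)
      fix b assume b: "b \<in> fin" "pr b 0 = 0"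
      then have "b 1 = 0" using p0[OF b(1)] by simp
      then show "b \<in> S" using all[OF b(1)] by simp
    next
      fix b assume b: "b \<in> fin" "pr b 0 = -1"
      then have "2 * b 1 = 1" using p0[OF b(1)] by simp
      then have False by presburger
      then show "T 0 \<otimes> Y b \<otimes> T 0 = Y (b - phi) \<otimes> C" by simp
    qed
  qed
  have "double_sys n c a e r par rk G T Y C"
    by unfold_locales (use bY CY main C_T in \<open>auto simp: S_def\<close>)
  then show ?thesis using Yphi by (auto simp: U_def)
qed

end

section \<open>Presented groups\<close>

lemma pres_eq_valid: "pres_eq S R u v \<Longrightarrow> u \<in> lists (S \<times> UNIV) \<and> v \<in> lists (S \<times> UNIV)"
  by (induction rule: pres_eq.induct) auto

lemma mem_pres_class: "v \<in> pres_class S R u \<longleftrightarrow> pres_eq S R u v" by (simp add: pres_class_def)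

lemma pres_class_eq: "pres_eq S R u v \<Longrightarrow> pres_class S R u = pres_class S R v"
  unfolding pres_class_def by (blast intro: pres_eq.sym pres_eq.trans)

abbreviation valid_words :: "'g set \<Rightarrow> 'g word set" where "valid_words S \<equiv> lists (S \<times> UNIV)"

lemma presented_mult:
  assumes "u \<in> valid_words S" "v \<in> valid_words S"
  shows "pres_class S R u \<otimes>\<^bsub>presented_group S R\<^esub> pres_class S R v = pres_class S R (u @ v)"
proof -
  have "pres_eq S R (u' @ v') w \<Longrightarrow> pres_eq S R (u @ v) w" if "pres_eq S R u u'" "pres_eq S R v v'" for u' v' w
    using pres_eq.append[OF that] pres_eq.trans by blast
  moreover have "pres_eq S R u u" "pres_eq S R v v" using assms pres_eq.refl by blast+
  ultimately show ?thesis unfolding presented_group_def pres_class_def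
    by (simp del: in_lists_conv_set) blast
qed

lemma presented_one: "\<one>\<^bsub>presented_group S R\<^esub> = pres_class S R []" by (simp add: presented_group_def)

lemma presented_carrier: "carrier (presented_group S R) = pres_class S R ` valid_words S"
  by (simp add: presented_group_def)

definition word_inv :: "'g word \<Rightarrow> 'g word" where "word_inv u = rev (map (\<lambda>(g, e). (g, \<not> e)) u)"

lemma word_inv_valid: "u \<in> valid_words S \<Longrightarrow> word_inv u \<in> valid_words S"
  by (auto simp: word_inv_def)

lemma word_inv_left: "u \<in> valid_words S \<Longrightarrow> pres_eq S R (word_inv u @ u) []"
proof (induction u)
  case Nil
  then show ?case by (simp add: word_inv_def pres_eq.refl)
next
  case (Cons x u)
  obtain g e where x: "x = (g, e)" by force
  have g: "g \<in> S" and u: "u \<in> valid_words S" using Cons.prems x by auto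
  have w: "word_inv u \<in> valid_words S" using word_inv_valid u by blast
  have "pres_eq S R ([(g, \<not> e), (g, e)] @ u) ([] @ u)"
    using pres_eq.cancel[OF g, of R "\<not> e"] pres_eq.refl[OF u] by (intro pres_eq.append) auto
  then have "pres_eq S R (word_inv u @ ([(g, \<not> e), (g, e)] @ u)) (word_inv u @ ([] @ u))"
    using pres_eq.refl[OF w] by (rule pres_eq.append[rotated])
  then show ?case using Cons.IH[OF u] pres_eq.trans by (fastforce simp: word_inv_def x)
qed

lemma presented_group: "group (presented_group S R)"
proof (rule groupI)
  fix x y assume "x \<in> carrier (presented_group S R)" "y \<in> carrier (presented_group S R)"
  then obtain u v where "x = pres_class S R u" "u \<in> valid_words S" "y = pres_class S R v" "v \<in> valid_words S"
    by (auto simp: presented_carrier)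
  then show "x \<otimes>\<^bsub>presented_group S R\<^esub> y \<in> carrier (presented_group S R)"
    by (simp add: presented_mult presented_carrier)
next
  fix x y z assume "x \<in> carrier (presented_group S R)" "y \<in> carrier (presented_group S R)" "z \<in> carrier (presented_group S R)"
  then obtain u v w where "x = pres_class S R u" "u \<in> valid_words S" "y = pres_class S R v" "v \<in> valid_words S"
    "z = pres_class S R w" "w \<in> valid_words S"
    by (auto simp: presented_carrier)
  then show "x \<otimes>\<^bsub>presented_group S R\<^esub> y \<otimes>\<^bsub>presented_group S R\<^esub> z = x \<otimes>\<^bsub>presented_group S R\<^esub> (y \<otimes>\<^bsub>presented_group S R\<^esub> z)"
    by (simp add: presented_mult)
next
  fix x assume "x \<in> carrier (presented_group S R)"
  then obtain u where u: "x = pres_class S R u" "u \<in> valid_words S" by (auto simp: presented_carrier)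
  then show "\<one>\<^bsub>presented_group S R\<^esub> \<otimes>\<^bsub>presented_group S R\<^esub> x = x"
    by (simp add: presented_one presented_mult)
  show "\<exists>y\<in>carrier (presented_group S R). y \<otimes>\<^bsub>presented_group S R\<^esub> x = \<one>\<^bsub>presented_group S R\<^esub>"
    using u word_inv_valid[OF u(2)] pres_class_eq[OF word_inv_left[OF u(2)]]
    by (intro bexI[of _ "pres_class S R (word_inv u)"]) (auto simp: presented_one presented_mult presented_carrier)
qed (auto simp: presented_one presented_carrier)

lemma word_eval_simps [simp]: "word_eval H f [] = \<one>\<^bsub>H\<^esub>"
  "word_eval H f ((g, e) # w) = (if e then f g else inv\<^bsub>H\<^esub> (f g)) \<otimes>\<^bsub>H\<^esub> word_eval H f w"
  by (simp_all add: word_eval_def)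

context group
begin

lemma word_eval_closed: "f ` S \<subseteq> carrier G \<Longrightarrow> u \<in> valid_words S \<Longrightarrow> word_eval G f u \<in> carrier G"
  by (induction u) auto

lemma word_eval_append:
  "f ` S \<subseteq> carrier G \<Longrightarrow> u \<in> valid_words S \<Longrightarrow> v \<in> valid_words S \<Longrightarrow>
    word_eval G f (u @ v) = word_eval G f u \<otimes> word_eval G f v"
proof (induction u)
  case (Cons x u)
  obtain g e where x: "x = (g, e)" by force
  have g: "g \<in> S" and u: "u \<in> valid_words S" using Cons.prems(2) by (auto simp: x)
  have "word_eval G f u \<in> carrier G" "word_eval G f v \<in> carrier G"
    using word_eval_closed[OF Cons.prems(1)] u Cons.prems(3) by blast+
  moreover have "f g \<in> carrier G" using Cons.prems(1) g by auto
  ultimately show ?case using Cons.IH[OF Cons.prems(1) u Cons.prems(3)] by (simp add: x m_assoc)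
next
  case Nil
  then show ?case using word_eval_closed[OF Nil(1,3)] by simp
qed

lemma word_eval_pres_eq:
  assumes "f ` S \<subseteq> carrier G"
    and "\<And>u v. (u, v) \<in> R \<Longrightarrow> u \<in> valid_words S \<Longrightarrow> v \<in> valid_words S \<Longrightarrow> word_eval G f u = word_eval G f v"
    and "pres_eq S R u v"
  shows "word_eval G f u = word_eval G f v"
  using assms(3)
proof (induction rule: pres_eq.induct)
  case (cancel g e)
  then have "f g \<in> carrier G" using assms(1) by auto
  then show ?case by auto
next
  case (append u u' v v')
  then show ?case using word_eval_append[OF assms(1)] pres_eq_valid by metis
qed (use assms(2) in auto)

lemma pres_lift_class:
  assumes "f ` S \<subseteq> carrier G" "u \<in> valid_words S"
    and "\<And>u v. (u, v) \<in> R \<Longrightarrow> u \<in> valid_words S \<Longrightarrow> v \<in> valid_words S \<Longrightarrow> word_eval G f u = word_eval G f v"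
  shows "pres_lift G f (pres_class S R u) = word_eval G f u"
proof -
  have "word_eval G f v = word_eval G f u" if "pres_eq S R u v" for v
    using word_eval_pres_eq[OF assms(1,3) that] by simp
  then have "word_eval G f ` pres_class S R u = {word_eval G f u}"
    using pres_eq.refl[OF assms(2), of R] unfolding pres_class_def by blast
  then show ?thesis by (simp add: pres_lift_def)
qed

lemma pres_lift_hom:
  assumes "f ` S \<subseteq> carrier G"
    and "\<And>u v. (u, v) \<in> R \<Longrightarrow> u \<in> valid_words S \<Longrightarrow> v \<in> valid_words S \<Longrightarrow> word_eval G f u = word_eval G f v"
  shows "pres_lift G f \<in> hom (presented_group S R) G"
proof (rule homI)
  fix x assume "x \<in> carrier (presented_group S R)"
  then obtain u where "x = pres_class S R u" "u \<in> valid_words S" unfolding presented_carrier by blast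
  then show "pres_lift G f x \<in> carrier G"
    using pres_lift_class[OF assms(1) _ assms(2)] word_eval_closed[OF assms(1)] by metis
next
  fix x y assume "x \<in> carrier (presented_group S R)" "y \<in> carrier (presented_group S R)"
  then obtain u v where "x = pres_class S R u" "u \<in> valid_words S" "y = pres_class S R v" "v \<in> valid_words S"
    by (auto simp: presented_carrier)
  moreover from this have "u @ v \<in> valid_words S" by simp
  ultimately show "pres_lift G f (x \<otimes>\<^bsub>presented_group S R\<^esub> y) = pres_lift G f x \<otimes> pres_lift G f y"
    using pres_lift_class[OF assms(1) _ assms(2)] word_eval_append[OF assms(1)] presented_mult by metis
qed

lemma hom_word_eval:
  assumes "h \<in> hom (presented_group S R) G" "u \<in> valid_words S"
  shows "h (pres_class S R u) = word_eval G (\<lambda>g. h (pres_class S R [(g, True)])) u"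
  using assms(2)
proof (induction u rule: list.induct)
  case Nil
  then show ?case using hom_one[OF assms(1) presented_group group_axioms] by (simp add: presented_one)
next
  case (Cons x u)
  obtain g e where x: "x = (g, e)" by force
  have g: "g \<in> S" and u: "u \<in> valid_words S" using Cons.prems x by auto
  interpret P: group "presented_group S R" by (rule presented_group)
  have c: "pres_class S R [(g, e)] \<in> carrier (presented_group S R)" for e using g by (auto simp: presented_carrier)
  have "pres_class S R [(g, False)] \<otimes>\<^bsub>presented_group S R\<^esub> pres_class S R [(g, True)] = \<one>\<^bsub>presented_group S R\<^esub>"
    using g pres_class_eq[OF pres_eq.cancel[OF g, of R False]] by (simp add: presented_mult presented_one)
  then have "pres_class S R [(g, False)] = inv\<^bsub>presented_group S R\<^esub> pres_class S R [(g, True)]"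
    using c by (simp add: P.inv_equality)
  moreover have "h (inv\<^bsub>presented_group S R\<^esub> y) = inv (h y)" if "y \<in> carrier (presented_group S R)" for y
    using group_hom.hom_inv[of "presented_group S R" G h y] assms(1) that presented_group group_axioms
    by (auto simp: group_hom_def group_hom_axioms_def)
  ultimately have e: "h (pres_class S R [(g, e)]) = (if e then h (pres_class S R [(g, True)]) else inv (h (pres_class S R [(g, True)])))"
    using c by (cases e) auto
  have "pres_class S R (x # u) = pres_class S R [(g, e)] \<otimes>\<^bsub>presented_group S R\<^esub> pres_class S R u"
    using g u by (simp add: presented_mult x)
  then have "h (pres_class S R (x # u)) = h (pres_class S R [(g, e)]) \<otimes> h (pres_class S R u)"
    using assms(1) c u by (simp add: hom_mult presented_carrier)
  then show ?case using Cons.IH[OF u] e by (simp add: x)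
qed

lemma presented_hom_eq:
  assumes "h \<in> hom (presented_group S R) G" "h' \<in> hom (presented_group S R) G"
    and "\<And>g. g \<in> S \<Longrightarrow> h (pres_class S R [(g, True)]) = h' (pres_class S R [(g, True)])"
    and "x \<in> carrier (presented_group S R)"
  shows "h x = h' x"
proof -
  obtain u where u: "x = pres_class S R u" "u \<in> valid_words S" using assms(4) by (auto simp: presented_carrier)
  have "word_eval G (\<lambda>g. h (pres_class S R [(g, True)])) u = word_eval G (\<lambda>g. h' (pres_class S R [(g, True)])) u"
    using u(2) by (induction u) (auto simp: assms(3))
  then show ?thesis using hom_word_eval[OF assms(1) u(2)] hom_word_eval[OF assms(2) u(2)] u(1) by simp
qed

end

section \<open>The double affine Weyl group in coordinates\<close>

context affine_braid
begin

text \<open>For involutions the length condition disappears: when s_i shortens the element,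
  \<open>TW_left\<close> is applied to the shorter one and the square of T_i cancels. So the lift
  becomes a homomorphism.\<close>

lemma TW_tp:
  assumes "\<And>i. i \<le> n \<Longrightarrow> T i \<otimes> T i = \<one>" "wd js"
  shows "TW (act js) = tp js"
  using assms(2)
proof (induction js)
  case Nil
  then show ?case using TW_red[of "[]"] by (simp add: red_def del: act.simps)
next
  case (Cons i js)
  have i: "i \<le> n" and w: "wd js" using Cons.prems by auto
  have e: "act (i # js) = s i \<circ> act js" by (rule ext) simp
  have "TW (s i \<circ> act js) = T i \<otimes> TW (act js)"
  proof (cases "posv (V js (unitv i))")
    case True
    then show ?thesis using i w by (intro TW_left[where y = "V js (unitv i)"]) auto
  next
    case False
    have W: "s i \<circ> act js \<in> Wg" using i w by (simp only: Wg_comp Wg_s Wg_act)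
    have y: "V js (unitv i) \<in> R" using i w by simp
    have "TW (s i \<circ> (s i \<circ> act js)) = T i \<otimes> TW (s i \<circ> act js)"
    proof (rule TW_left[OF W i])
      show "- V js (unitv i) \<in> R" using y by simp
      show "posv (- V js (unitv i))" using False R_neg_iff[OF y] by simp
      have "act js (- V js (unitv i)) = - unitv i" using w by simp
      then show "(s i \<circ> act js) (- V js (unitv i)) = unitv i" using i by (metis comp_apply s_s s_unitv_same)
    qed
    moreover have "s i \<circ> (s i \<circ> act js) = act js" using i by (auto simp: fun_eq_iff)
    ultimately show ?thesis using assms(1)[OF i] by (simp add: G.m_assoc[symmetric])
  qed
  then show ?case using Cons.IH[OF w] by (simp only: e tp_simps)
qed

lemma TW_hom:
  assumes "\<And>i. i \<le> n \<Longrightarrow> T i \<otimes> T i = \<one>" "f \<in> Wg" "g \<in> Wg"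
  shows "TW (f \<circ> g) = TW f \<otimes> TW g"
proof -
  obtain js ks where "f = act js" "wd js" "g = act ks" "wd ks" using assms by (auto simp: Wg_def)
  then show ?thesis using TW_tp[OF assms(1), of "js @ ks"] TW_tp[OF assms(1), of js] TW_tp[OF assms(1), of ks]
    by (simp add: act_comp)
qed

end

context affine_data
begin

definition Wt :: "(ivec \<times> (ivec \<Rightarrow> ivec)) monoid" where
  "Wt = \<lparr>carrier = lat \<times> Wg, monoid.mult = (\<lambda>(x, f) (y, g). (x + f y, f \<circ> g)), one = (0, (\<lambda>x. x))\<rparr>"

lemma Wt_simps [simp]: "carrier Wt = lat \<times> Wg" "\<one>\<^bsub>Wt\<^esub> = (0, (\<lambda>x. x))"
  "(x, f) \<otimes>\<^bsub>Wt\<^esub> (y, g) = (x + f y, f \<circ> g)"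
  by (simp_all add: Wt_def)

lemma Wt_group: "group Wt"
proof (rule groupI)
  fix x y assume "x \<in> carrier Wt" "y \<in> carrier Wt"
  then show "x \<otimes>\<^bsub>Wt\<^esub> y \<in> carrier Wt" by (auto simp: Wg_lat)
next
  fix x y z assume "x \<in> carrier Wt" "y \<in> carrier Wt" "z \<in> carrier Wt"
  then show "x \<otimes>\<^bsub>Wt\<^esub> y \<otimes>\<^bsub>Wt\<^esub> z = x \<otimes>\<^bsub>Wt\<^esub> (y \<otimes>\<^bsub>Wt\<^esub> z)"
  proof (cases x; cases y; cases z)
    fix x1 f y1 g z1 h assume "x = (x1, f)" "y = (y1, g)" "z = (z1, h)"
    then show ?thesis using \<open>x \<in> carrier Wt\<close> Wg_lin(1)[of f y1 "g z1"] by (simp add: comp_assoc add.assoc)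
  qed
next
  fix x assume "x \<in> carrier Wt"
  then obtain v f where x: "x = (v, f)" "v \<in> lat" "f \<in> Wg" by auto
  show "\<one>\<^bsub>Wt\<^esub> \<otimes>\<^bsub>Wt\<^esub> x = x" using x by (auto simp: fun_eq_iff)
  obtain g where g: "g \<in> Wg" "\<And>x. g (f x) = x" using Wg_inverse[OF x(3)] by metis
  have "(- g v, g) \<otimes>\<^bsub>Wt\<^esub> x = \<one>\<^bsub>Wt\<^esub>" using g x by (auto simp: fun_eq_iff)
  moreover have "(- g v, g) \<in> carrier Wt" using g x by (simp add: Wg_lat)
  ultimately show "\<exists>y\<in>carrier Wt. y \<otimes>\<^bsub>Wt\<^esub> x = \<one>\<^bsub>Wt\<^esub>" by blast
qed simp

text \<open>The value beyond \<open>n\<close> is a default that keeps every \<open>sT i\<close> in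
  the group, since the locale speaks of all indices.\<close>

definition sT :: "nat \<Rightarrow> ivec \<times> (ivec \<Rightarrow> ivec)" where "sT i = (if i \<le> n then (0, s i) else (0, (\<lambda>x. x)))"
definition sX :: "ivec \<Rightarrow> ivec \<times> (ivec \<Rightarrow> ivec)" where "sX b = (b, (\<lambda>x. x))"

lemma sT_foldr: "wd js \<Longrightarrow> foldr (\<lambda>k g. sT k \<otimes>\<^bsub>Wt\<^esub> g) js \<one>\<^bsub>Wt\<^esub> = (0, act js)"
proof (induction js)
  case Nil
  have "act [] = (\<lambda>x. x)" by (rule ext) simp
  then show ?case by (simp only: foldr.simps id_apply Wt_simps)
next
  case (Cons i js)
  have "s i \<circ> act js = act (i # js)" by (rule ext) simp
  moreover have "i \<le> n" "wd js" using Cons.prems by auto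
  moreover have "sT i = (0, s i)" using \<open>i \<le> n\<close> by (simp add: sT_def)
  moreover have "(0, s i) \<otimes>\<^bsub>Wt\<^esub> (0, act js) = (0, s i \<circ> act js)" using s_zero[of i]
    by (simp only: Wt_simps add_0)
  ultimately show ?case using Cons.IH by (simp only: foldr.simps comp_apply)
qed

lemma comp_id_fun: "(\<lambda>x. x) \<circ> f = f" "f \<circ> (\<lambda>x. x) = f" by (auto simp: fun_eq_iff)

lemma Wt_double_sys: "double_sys n c a e r par rk Wt sT sX (dl, (\<lambda>x. x))"
proof -
  interpret Wt: group Wt by (rule Wt_group)
  show ?thesis
  proof unfold_locales
    show "sT i \<in> carrier Wt" for i by (simp add: sT_def)
  next
    fix i j m assume ij: "i \<le> n" "j \<le> n" "i \<noteq> j" "bm i j m"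
    have "wd (alt m i j)" "wd (alt m j i)" using set_alt[of m i j] set_alt[of m j i] ij by (auto simp: wd_def)
    then show "foldr (\<lambda>k g. sT k \<otimes>\<^bsub>Wt\<^esub> g) (alt m i j) \<one>\<^bsub>Wt\<^esub> = foldr (\<lambda>k g. sT k \<otimes>\<^bsub>Wt\<^esub> g) (alt m j i) \<one>\<^bsub>Wt\<^esub>"
      using act_alt[OF ij] sT_foldr by metis
  next
    have ss: "s i \<circ> s i = (\<lambda>x. x)" if "i \<le> n" for i using that by (auto simp: fun_eq_iff)
    show "bern Wt sT sX"
      unfolding bern_def by (auto simp: sT_def sX_def fin_lat comp_id_fun s_pr0 ss)
    show "(dl, \<lambda>x. x) \<otimes>\<^bsub>Wt\<^esub> sT i = sT i \<otimes>\<^bsub>Wt\<^esub> (dl, \<lambda>x. x)" for i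
      by (simp add: sT_def comp_id_fun)
    fix b assume b: "b \<in> fin"
    show "(dl, \<lambda>x. x) \<otimes>\<^bsub>Wt\<^esub> sX b = sX b \<otimes>\<^bsub>Wt\<^esub> (dl, \<lambda>x. x)" by (simp add: sX_def add.commute)
    show "sT 0 \<otimes>\<^bsub>Wt\<^esub> sX b = sX b \<otimes>\<^bsub>Wt\<^esub> sT 0" if "pr b 0 = 0"
      using that by (simp add: sT_def sX_def comp_id_fun s_pr0)
    show "sT 0 \<otimes>\<^bsub>Wt\<^esub> sX b \<otimes>\<^bsub>Wt\<^esub> sT 0 = sX (b - phi) \<otimes>\<^bsub>Wt\<^esub> (dl, \<lambda>x. x)" if "pr b 0 = -1"
      using that by (simp add: sT_def sX_def comp_id_fun s_prm1 ss phi_def)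
  qed simp
qed

text \<open>The effect of the second automorphism on the double affine Weyl group: it fixes \<open>W\<close> and sends
  $\tau_x$ to $\tau_x$ times the translation \<open>tr (- x)\<close> in \<open>W\<close>, up to a multiple of $\delta$.\<close>
definition gb :: "ivec \<times> (ivec \<Rightarrow> ivec) \<Rightarrow> ivec \<times> (ivec \<Rightarrow> ivec)" where
  "gb = (\<lambda>(x, f). (x + sc (B x x div 2) dl, tr (- x) \<circ> f))"

lemma tr_lat_Wg: assumes "x \<in> lat" shows "tr x \<in> Wg"
proof -
  have "tr x = tr (fp x)" by (rule ext) (simp add: tr_def fp_def)
  moreover have "fp x \<in> fin" using assms by (simp add: fin_def fp_def)
  ultimately show ?thesis using tr_Wg by metis
qed

lemma Wg_tr: assumes "f \<in> Wg" shows "f \<circ> tr x = tr (f x) \<circ> f"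
  by (rule ext) (simp add: tr_def Wg_lin[OF assms] Wg_dl[OF assms] Wg_B[OF assms])

text \<open>The map \<open>tr (- v)\<close> moves a vector \<open>w\<close> by \<open>B v w\<close>
  times \<open>dl\<close>. Half the norm is the quadratic function with this polarisation, and it is
  integral because norms are even; so the correction term makes the map multiplicative.\<close>

lemma gb_hom: "gb \<in> hom Wt Wt"
proof (rule homI)
  fix x assume "x \<in> carrier Wt"
  then show "gb x \<in> carrier Wt" using tr_lat_Wg by (auto simp: gb_def)
next
  fix x y assume xy: "x \<in> carrier Wt" "y \<in> carrier Wt"
  then obtain v f w g where v: "x = (v, f)" "v \<in> lat" "f \<in> Wg" "y = (w, g)" "w \<in> lat" "g \<in> Wg" by auto
  have B2: "B (v + f w) (v + f w) div 2 = B v v div 2 + B w w div 2 + B v (f w)"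
  proof -
    have "B (v + f w) (v + f w) = B v v + B w w + 2 * B v (f w)"
      using Wg_B[OF v(3), of w w] by (simp add: B_sym[of "f w" v])
    then show ?thesis using B_even[of v] B_even[of w] by auto
  qed
  have 1: "tr (- v) \<circ> f \<circ> (tr (- w) \<circ> g) = tr (- (v + f w)) \<circ> (f \<circ> g)"
  proof -
    have "tr (- v) \<circ> f \<circ> (tr (- w) \<circ> g) = tr (- v) \<circ> (f \<circ> tr (- w)) \<circ> g" by (simp add: comp_assoc)
    also have "\<dots> = (tr (- v) \<circ> tr (- f w)) \<circ> (f \<circ> g)"
      unfolding Wg_tr[OF v(3)] Wg_lin(3)[OF v(3)] by (simp add: comp_assoc)
    finally show ?thesis by (simp add: tr_add)
  qed
  have 2: "v + sc (B v v div 2) dl + (tr (- v) \<circ> f) (w + sc (B w w div 2) dl)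
      = v + f w + sc (B (v + f w) (v + f w) div 2) dl"
    unfolding B2 by (simp add: Wg_lin[OF v(3)] Wg_dl[OF v(3)] tr_def fun_eq_iff algebra_simps)
  show "gb (x \<otimes>\<^bsub>Wt\<^esub> y) = gb x \<otimes>\<^bsub>Wt\<^esub> gb y" using 1 2 by (simp add: gb_def v)
qed

lemma gb_bij: "bij_betw gb (carrier Wt) (carrier Wt)"
proof -
  define gi :: "ivec \<times> (ivec \<Rightarrow> ivec) \<Rightarrow> ivec \<times> (ivec \<Rightarrow> ivec)"
    where "gi = (\<lambda>(x, f). (x - sc (B x x div 2) dl, tr x \<circ> f))"
  have B1: "B (x + sc k dl) (x + sc k dl) = B x x" "B (x - sc k dl) (x - sc k dl) = B x x" for x k by simp_all
  have t: "tr (x + sc k dl) = tr x" "tr (- (x - sc k dl)) = tr (- x)" for x k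
    by (rule ext, simp add: tr_def)+
  have ti: "tr x \<circ> (tr (- x) \<circ> f) = f" "tr (- x) \<circ> (tr x \<circ> f) = f" for x f
    by (simp_all add: comp_assoc[symmetric] tr_add tr_zero comp_id_fun)
  have 1: "gi (gb p) = p" for p
    by (cases p) (simp only: gi_def gb_def prod.case B1 t ti add_diff_cancel)
  have 2: "gb (gi p) = p" for p
    by (cases p) (simp only: gi_def gb_def prod.case B1 t ti diff_add_cancel)
  show ?thesis
  proof (rule bij_betw_byWitness[where f' = gi])
    show "gb ` carrier Wt \<subseteq> carrier Wt" using gb_hom unfolding hom_def by blast
    show "gi ` carrier Wt \<subseteq> carrier Wt" using tr_lat_Wg by (auto simp: gi_def)
  qed (use 1 2 in auto)
qed

text \<open>In the Weyl group W becomes s_0 followed by the translation by -alpha_0, again an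
  involution. Lifting with this element in place of s_0 is a homomorphism on all of
  \<open>Wg\<close>; its lattice component \<open>z\<close> is a cocycle, and shifting by
  \<open>z\<close> is the required automorphism.\<close>

lemma ga_exists:
  "\<exists>g. g \<in> hom Wt Wt \<and> bij_betw g (carrier Wt) (carrier Wt) \<and> (\<forall>i\<in>{1..n}. g (sT i) = sT i) \<and>
    g (sT 0) = (- unitv 0, s 0) \<and> (\<forall>x\<in>lat. g (x, (\<lambda>x. x)) = (x, (\<lambda>x. x)))"
proof -
  interpret D: double_sys n c a e r par rk Wt sT sX "(dl, (\<lambda>x. x))" by (rule Wt_double_sys)
  have ss: "s i \<circ> s i = (\<lambda>x. x)" if "i \<le> n" for i using that by (auto simp: fun_eq_iff)
  have "inv\<^bsub>Wt\<^esub> (sT 0) = sT 0"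
    by (rule D.G.inv_equality) (auto simp: sT_def ss)
  then have W: "D.W = (- unitv 0, s 0)"
    unfolding D.W_def by (simp add: sT_def sX_def comp_id_fun) (simp add: phi_def)
  define T' where "T' = sT(0 := D.W)"
  have T'0: "T' 0 = (- unitv 0, s 0)" and T': "T' i = (0, s i)" if "i \<in> {1..n}" for i
    using that by (simp_all add: T'_def W sT_def)
  interpret E: double_sys n c a e r par rk Wt T' sX "(dl, (\<lambda>x. x))"
    unfolding T'_def by (rule D.double_sys_a)
  have T'2: "\<exists>u. T' i = (u, s i)" if "i \<le> n" for i
    using T'0 T'[of i] n_pos that by (cases "i = 0") auto
  have T0: "T' 0 = (- unitv 0, s 0)" using T'0[of 1] n_pos by simp
  have sq: "T' i \<otimes>\<^bsub>Wt\<^esub> T' i = \<one>\<^bsub>Wt\<^esub>" if "i \<le> n" for i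
    using that T0 T'[of i] by (cases "i = 0") (simp_all add: ss)
  define z where "z f = fst (E.TW f)" for f
  have snd: "E.TW f = (z f, f)" if f: "f \<in> Wg" for f
  proof -
    obtain js where js: "f = act js" "wd js" using f by (auto simp: Wg_def)
    have "snd (E.tp js) = act js" using js(2)
    proof (induction js)
      case Nil
      have "act [] = (\<lambda>x. x)" by (rule ext) simp
      then show ?case by (simp only: E.tp_simps Wt_simps snd_conv)
    next
      case (Cons i js)
      obtain u h where h: "E.tp js = (u, h)" by force
      obtain w where w: "T' i = (w, s i)" using T'2[of i] Cons.prems by auto
      have "snd (E.tp (i # js)) = s i \<circ> act js" using Cons h by (simp add: w)
      then show ?case by (simp only: act_Cons comp_def)
    qed
    then show ?thesis using E.TW_tp[OF sq js(2)] js(1) by (simp add: z_def prod_eq_iff)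
  qed
  have zl: "z f \<in> lat" if "f \<in> Wg" for f
    using E.TW_closed[of f] snd[OF that] by simp
  have zc: "z (f \<circ> g) = z f + f (z g)" if "f \<in> Wg" "g \<in> Wg" for f g
    using E.TW_hom[OF sq that] snd that Wg_comp[OF that] by simp
  define ga where "ga = (\<lambda>(x, f). (x + z f, f) :: ivec \<times> (ivec \<Rightarrow> ivec))"
  have "ga \<in> hom Wt Wt"
  proof (rule homI)
    fix x assume "x \<in> carrier Wt"
    then show "ga x \<in> carrier Wt" using zl by (auto simp: ga_def)
  next
    fix x y assume "x \<in> carrier Wt" "y \<in> carrier Wt"
    then obtain v f w g where v: "x = (v, f)" "f \<in> Wg" "y = (w, g)" "g \<in> Wg" by auto
    show "ga (x \<otimes>\<^bsub>Wt\<^esub> y) = ga x \<otimes>\<^bsub>Wt\<^esub> ga y"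
      by (simp add: v ga_def zc Wg_lin[OF v(2)] algebra_simps)
  qed
  moreover have "bij_betw ga (carrier Wt) (carrier Wt)"
  proof (rule bij_betw_byWitness[where f' = "\<lambda>(x, f). (x - z f, f)"])
    show "ga ` carrier Wt \<subseteq> carrier Wt" using zl by (auto simp: ga_def)
    show "(\<lambda>(x, f). (x - z f, f)) ` carrier Wt \<subseteq> carrier Wt" using zl by auto
  qed (auto simp: ga_def)
  moreover have zs: "(z (s i), s i) = T' i" if "i \<le> n" for i
    using snd[of "s i"] E.TW_s[OF that] that by simp
  have "ga (sT i) = sT i" if "i \<in> {1..n}" for i
    using zs[of i] that T'[of i] by (simp add: sT_def ga_def)
  moreover have "ga (sT 0) = (- unitv 0, s 0)" using zs[of 0] T0 by (simp add: sT_def ga_def)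
  moreover have "z (\<lambda>x. x) = 0" using snd[of "\<lambda>x. x"] E.TW_id by simp
  then have "ga (x, (\<lambda>x. x)) = (x, (\<lambda>x. x))" for x by (simp add: ga_def)
  ultimately show ?thesis by blast
qed

end

section \<open>Coordinates on the root space\<close>

text \<open>The lattice has the basis \<open>g j * \<alpha>\<^sub>j\<close>: for $A_{2n}^{(2)}$, which is the case \<open>h\<close>, the last basis
  vector is $\frac12\alpha_n$. With respect to this basis the pairings with the hat coroots form the
  matrix of type $D_{n+1}^{(2)}$, and all its labels are 1.\<close>
locale hat_data = affine_data n c a e r par rk
  for n :: nat and c :: "nat \<Rightarrow> nat \<Rightarrow> int" and a e :: "nat \<Rightarrow> int" and r :: int and par rk :: "nat \<Rightarrow> nat" +
  fixes A :: "nat \<Rightarrow> nat \<Rightarrow> int" and h :: bool and g :: "nat \<Rightarrow> real"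
  assumes g: "g j = (if h \<and> j = n then 1 / 2 else 1)"
    and h_iff: "h \<longleftrightarrow> is_A2n_twisted n A"
    and cA: "i \<le> n \<Longrightarrow> j \<le> n \<Longrightarrow> real_of_int (c i j) = real_of_int (A i j) * g j / g i"
    and labels: "j \<le> n \<Longrightarrow> real (num_labels n A j) = (if h then 2 else 1) * g j * real_of_int (a j)"
    and labels_out: "n < j \<Longrightarrow> num_labels n A j = 0"
    and labels_dual: "j \<le> n \<Longrightarrow> real (dual_labels n A j) = real_of_int (e j * a j) / g j"
begin

text \<open>The label a_0: it is 2 for A_{2n}^(2) and 1 otherwise.\<close>

definition kap :: real where "kap = (if h then 2 else 1)"

lemma g_pos [simp]: "0 < g j" "g j \<noteq> 0" by (simp_all add: g)
lemma g_0 [simp]: "g 0 = 1" using n_pos by (simp add: g)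
lemma kap_pos [simp]: "0 < kap" "kap \<noteq> 0" by (simp_all add: kap_def)

definition io :: "ivec \<Rightarrow> vec" where "io x = (\<lambda>j. real_of_int (x j) * g j)"

lemma io_apply: "io x j = real_of_int (x j) * g j" by (simp add: io_def)
lemma io_add: "vadd (io x) (io y) = io (x + y)" by (simp add: vadd_def io_def algebra_simps)
lemma io_sc: "vscale (real_of_int k) (io x) = io (sc k x)" by (simp add: vscale_def io_def algebra_simps)
lemma io_inj: "io x = io y \<Longrightarrow> x = y"
proof
  fix j assume "io x = io y"
  then have "io x j = io y j" by simp
  then show "x j = y j" by (simp add: io_apply)
qed
lemma io_root_space: "x \<in> lat \<Longrightarrow> io x \<in> root_space n" by (simp add: lat_def root_space_def io_apply)

lemma Q_fin_io: "Q_fin n A = io ` fin"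
proof
  show "io ` fin \<subseteq> Q_fin n A"
    by (auto simp: Q_fin_def fin_def lat_def root_space_def io_apply g h_iff)
  show "Q_fin n A \<subseteq> io ` fin"
  proof
    fix y assume y: "y \<in> Q_fin n A"
    define x where "x j = \<lfloor>y j / g j\<rfloor>" for j
    have "y j / g j \<in> \<int>" for j
    proof (cases "j \<in> {1..n}")
      case True
      then show ?thesis using y by (auto simp: Q_fin_def g h_iff mult.commute split: if_splits)
    next
      case False
      then have "y j = 0" using y by (cases "j = 0") (auto simp: Q_fin_def root_space_def)
      then show ?thesis by simp
    qed
    then have xj: "real_of_int (x j) = y j / g j" for j by (simp add: x_def)
    have y_io: "y = io x" by (rule ext) (simp add: io_apply xj)
    have "x j = 0" if "j = 0 \<or> n < j" for j
      using that y xj[of j] by (auto simp: Q_fin_def root_space_def)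
    then have "x \<in> fin" by (simp add: fin_def lat_def)
    then show "y \<in> io ` fin" using y_io by blast
  qed
qed

lemma simple_root_io: "simple_root 0 = io (unitv 0)"
  using n_pos by (auto simp: simple_root_def io_def g unitv_apply)

lemma num0: "real (num_labels n A 0) = kap" using labels[of 0] by (simp add: a_0 kap_def)

lemma delta_io: "delta_scaled n A = io dl"
proof
  fix j show "delta_scaled n A j = io dl j"
    unfolding delta_scaled_def num0
    by (cases "j \<le> n") (simp_all add: labels labels_out io_apply dl_def kap_def)
qed

lemma theta_io: "theta n A = vscale kap (io phi)"
proof
  fix j show "theta n A j = vscale kap (io phi) j"
    unfolding theta_def num0
    by (cases "j \<le> n") (auto simp: labels labels_out io_apply dl_def kap_def phi_def vscale_def simple_root_def unitv_apply a_0 algebra_simps)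
qed

lemma phi_io: "vscale (1 / real (num_labels n A 0)) (theta n A) = io phi"
  unfolding num0 theta_io by (simp add: vscale_def)

definition prR :: "vec \<Rightarrow> nat \<Rightarrow> real" where "prR x i = (\<Sum>j\<le>n. real_of_int (c i j) * (x j / g j))"

lemma prR_io: "prR (io x) i = real_of_int (pr x i)"
  by (simp add: prR_def pr_def io_apply)

lemma d_coeff: assumes "j \<le> n" shows "d_coeff n A j = kap * (g j)\<^sup>2 / real_of_int (e j)"
  unfolding d_coeff_def labels[OF assms] labels_dual[OF assms]
  using a_pos[OF assms] e_pos[OF assms] by (simp add: kap_def field_simps power2_eq_square)

lemma A_c: "i \<le> n \<Longrightarrow> j \<le> n \<Longrightarrow> real_of_int (A i j) = real_of_int (c i j) * g i / g j"
  using cA[of i j] by (simp add: field_simps)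

lemma form_entry:
  assumes "j \<le> n" "k \<le> n"
  shows "inverse (d_coeff n A j) * real_of_int (A j k) = real_of_int (e k) * real_of_int (c k j) / (kap * g j * g k)"
proof -
  have "real_of_int (e j * c j k) = real_of_int (e k * c k j)" using c_sym[OF assms] by simp
  then have *: "real_of_int (e j) * real_of_int (c j k) = real_of_int (e k) * real_of_int (c k j)" by simp
  have "inverse (d_coeff n A j) * real_of_int (A j k) = (real_of_int (e j) * real_of_int (c j k)) / (kap * g j * g k)"
    using e_pos[OF assms(1)] by (simp add: d_coeff[OF assms(1)] A_c[OF assms] field_simps power2_eq_square)
  then show ?thesis unfolding * .
qed

lemma form_prR: "form n A x y = (\<Sum>k\<le>n. y k * real_of_int (e k) * prR x k / (kap * g k))"
proof -
  have "form n A x y = (\<Sum>k\<le>n. \<Sum>j\<le>n. x j * y k * (inverse (d_coeff n A j) * real_of_int (A j k)))"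
    unfolding form_def by (rule sum.swap)
  also have "\<dots> = (\<Sum>k\<le>n. \<Sum>j\<le>n. y k * real_of_int (e k) / (kap * g k) * (real_of_int (c k j) * (x j / g j)))"
  proof (rule sum.cong[OF HOL.refl], rule sum.cong[OF HOL.refl])
    fix k j assume "k \<in> {..n}" "j \<in> {..n}"
    then have kj: "j \<le> n" "k \<le> n" by auto
    show "x j * y k * (inverse (d_coeff n A j) * real_of_int (A j k))
        = y k * real_of_int (e k) / (kap * g k) * (real_of_int (c k j) * (x j / g j))"
      unfolding form_entry[OF kj] by (simp add: field_simps)
  qed
  also have "\<dots> = (\<Sum>k\<le>n. y k * real_of_int (e k) / (kap * g k) * prR x k)"
    by (simp add: prR_def sum_distrib_left)
  finally show ?thesis by (simp add: field_simps)
qed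

lemma form_coroot: assumes "i \<le> n" shows "form n A x (simple_coroot n A i) = g i * prR x i"
proof -
  have "form n A x (simple_coroot n A i)
      = (\<Sum>k\<le>n. if k = i then d_coeff n A i * real_of_int (e i) * prR x i / (kap * g i) else 0)"
    unfolding form_prR by (rule sum.cong[OF HOL.refl]) (auto simp: simple_coroot_def vscale_def simple_root_def)
  also have "\<dots> = d_coeff n A i * real_of_int (e i) * prR x i / (kap * g i)" using assms by simp
  also have "\<dots> = g i * prR x i" using e_pos[OF assms] by (simp add: d_coeff[OF assms] field_simps power2_eq_square)
  finally show ?thesis .
qed

text \<open>The plain coroot pairs to \<open>g i\<close> times the integral pairing. At the rescaled
  node this factor is one half, and the doubled hat coroot restores the integer.\<close>

lemma form_hat: assumes "i \<le> n" shows "form n A (io x) (hat_coroot n A i) = real_of_int (pr x i)"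
proof (cases "h \<and> i = n")
  case True
  then have "hat_coroot n A i = vscale 2 (simple_coroot n A i)" using h_iff by (simp add: hat_coroot_def)
  moreover have "form n A (io x) (vscale 2 y) = 2 * form n A (io x) y" for y
    by (simp add: form_def vscale_def sum_distrib_left mult_ac)
  ultimately show ?thesis using form_coroot[OF assms, of "io x"] True by (simp add: prR_io g)
next
  case False
  then have "hat_coroot n A i = simple_coroot n A i" using h_iff by (auto simp: hat_coroot_def)
  then show ?thesis using form_coroot[OF assms, of "io x"] False by (auto simp: prR_io g)
qed

lemma s_refl_apply:
  assumes "i \<le> n" "x \<in> root_space n"
  shows "s_refl n A i x = (\<lambda>j. x j - g i * prR x i * simple_root i j)"
  using assms by (simp add: s_refl_def form_coroot vadd_def vscale_def)

lemma s_refl_io: assumes "i \<le> n" "x \<in> lat" shows "s_refl n A i (io x) = io (s i x)"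
  unfolding s_refl_apply[OF assms(1) io_root_space[OF assms(2)]] prR_io
  by (rule ext) (simp add: io_apply s_def simple_root_def unitv_apply algebra_simps)

text \<open>With these, linear maps of the root space are compared on a basis.\<close>
definition lc :: "(nat \<Rightarrow> real) \<Rightarrow> (nat \<Rightarrow> ivec) \<Rightarrow> vec" where
  "lc t v = (\<lambda>j. \<Sum>k\<le>n. t k * io (v k) j)"

lemma lc_root_space: "(\<And>k. k \<le> n \<Longrightarrow> v k \<in> lat) \<Longrightarrow> lc t v \<in> root_space n"
  using io_root_space by (auto simp: root_space_def lc_def)

lemma lc_unitv: assumes "x \<in> root_space n" shows "lc (\<lambda>k. x k / g k) unitv = x"
proof
  fix j
  have "lc (\<lambda>k. x k / g k) unitv j = (\<Sum>k\<le>n. if j = k then x j else 0)"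
    unfolding lc_def by (rule sum.cong[OF HOL.refl]) (auto simp: io_apply unitv_apply)
  then show "lc (\<lambda>k. x k / g k) unitv j = x j" using assms by (simp add: root_space_def)
qed

lemma prR_lc: "prR (lc t v) i = (\<Sum>k\<le>n. t k * real_of_int (pr (v k) i))"
proof -
  have "prR (lc t v) i = (\<Sum>j\<le>n. \<Sum>k\<le>n. t k * (real_of_int (c i j) * (io (v k) j / g j)))"
    unfolding prR_def lc_def by (simp add: sum_divide_distrib sum_distrib_left mult_ac)
  also have "\<dots> = (\<Sum>k\<le>n. t k * prR (io (v k)) i)"
    unfolding prR_def sum_distrib_left by (rule sum.swap)
  finally show ?thesis by (simp add: prR_io)
qed

lemma s_refl_lc:
  assumes "i \<le> n" "\<And>k. k \<le> n \<Longrightarrow> v k \<in> lat"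
  shows "s_refl n A i (lc t v) = lc t (\<lambda>k. s i (v k))"
proof
  fix j
  have L: "lc t v \<in> root_space n" using lc_root_space assms(2) by blast
  have "s_refl n A i (lc t v) j = (\<Sum>k\<le>n. t k * io (v k) j - g i * (t k * real_of_int (pr (v k) i)) * simple_root i j)"
    unfolding s_refl_apply[OF assms(1) L] prR_lc
    by (simp add: lc_def sum_subtractf sum_distrib_left sum_distrib_right)
  also have "\<dots> = lc t (\<lambda>k. s i (v k)) j"
    unfolding lc_def by (rule sum.cong[OF HOL.refl]) (auto simp: io_apply s_def simple_root_def unitv_apply algebra_simps)
  finally show "s_refl n A i (lc t v) j = lc t (\<lambda>k. s i (v k)) j" .
qed

text \<open>As theta = kap phi pairs with any vector to minus its pairing at node 0 and has norm
  \<open>2 * kap\<close>, the scalar cancels and the reflection adds \<open>prR x 0\<close> copies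
  of phi.\<close>

lemma s_theta_apply: assumes "x \<in> root_space n"
  shows "s_theta n A x = (\<lambda>j. x j + prR x 0 * io phi j)"
proof -
  have f: "form n A y (theta n A) = - prR y 0" for y
  proof -
    have "form n A y (theta n A) = (\<Sum>k\<le>n. real_of_int (phi k * e k) * prR y k)"
      unfolding form_prR theta_io by (rule sum.cong[OF HOL.refl]) (simp add: vscale_def io_apply field_simps)
    also have "\<dots> = (\<Sum>k\<le>n. \<Sum>j\<le>n. real_of_int (phi k * e k * c k j) * (y j / g j))"
      unfolding prR_def by (simp add: sum_distrib_left mult_ac)
    also have "\<dots> = (\<Sum>j\<le>n. \<Sum>k\<le>n. real_of_int (phi k * e k * c k j) * (y j / g j))" by (rule sum.swap)
    also have "\<dots> = (\<Sum>j\<le>n. real_of_int (- c 0 j) * (y j / g j))"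
    proof (rule sum.cong[OF HOL.refl])
      fix j assume "j \<in> {..n}"
      then have j: "j \<le> n" by simp
      have "B phi (unitv j) = - c 0 j" using j by simp
      moreover have "B phi (unitv j) = (\<Sum>k\<le>n. phi k * e k * c k j)"
        using j by (simp add: B_def mult_ac del: B_unitv2 B_phi)
      ultimately have "(\<Sum>k\<le>n. phi k * e k * c k j) = - c 0 j" by simp
      then have "(\<Sum>k\<le>n. real_of_int (phi k * e k * c k j)) = real_of_int (- c 0 j)"
        by (simp only: of_int_sum[symmetric])
      then show "(\<Sum>k\<le>n. real_of_int (phi k * e k * c k j) * (y j / g j)) = real_of_int (- c 0 j) * (y j / g j)"
        by (simp only: sum_distrib_right[symmetric])
    qed
    finally show ?thesis by (simp add: prR_def sum_negf)
  qed
  have "prR (theta n A) 0 = kap * prR (io phi) 0"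
    by (simp add: theta_io prR_def vscale_def sum_distrib_left mult_ac)
  then have "form n A (theta n A) (theta n A) = 2 * kap" unfolding f by (simp add: prR_io pr_phi_0 del: pr_phi)
  then have r: "- (2 * form n A x (theta n A) / form n A (theta n A) (theta n A)) = prR x 0 / kap"
    unfolding f[of x] by (simp add: field_simps)
  have "s_theta n A x = vadd x (vscale (prR x 0 / kap) (theta n A))"
    using assms unfolding s_theta_def by (simp only: restrict_apply' r)
  then show ?thesis by (simp add: theta_io vadd_def vscale_def)
qed

lemma s_theta_lc: "s_theta n A (lc t unitv) = lc t (\<lambda>k. rf phi (unitv k))"
proof
  fix j
  have L: "lc t unitv \<in> root_space n" by (rule lc_root_space) simp
  have "s_theta n A (lc t unitv) j = (\<Sum>k\<le>n. t k * (io (unitv k) j + real_of_int (pr (unitv k) 0) * io phi j))"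
    unfolding s_theta_apply[OF L] prR_lc
    by (simp add: lc_def sum.distrib sum_distrib_left distrib_left mult_ac)
  also have "\<dots> = lc t (\<lambda>k. rf phi (unitv k)) j"
    unfolding lc_def by (rule sum.cong[OF HOL.refl]) (simp add: io_apply rf_def algebra_simps)
  finally show "s_theta n A (lc t unitv) j = lc t (\<lambda>k. rf phi (unitv k)) j" .
qed

section \<open>The affine Weyl group\<close>

text \<open>The linear extension of a lattice map to the real root space, restricted there because
  \<open>BijGroup\<close> consists of extensional maps.\<close>

definition rext :: "(ivec \<Rightarrow> ivec) \<Rightarrow> vec \<Rightarrow> vec" where
  "rext f = (\<lambda>x\<in>root_space n. lc (\<lambda>k. x k / g k) (\<lambda>k. f (unitv k)))"

lemma s_refl_Bij: assumes "i \<le> n" shows "s_refl n A i \<in> Bij (root_space n)"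
proof -
  have map: "s_refl n A i x \<in> root_space n" if "x \<in> root_space n" for x
    unfolding s_refl_apply[OF assms that] using assms that by (auto simp: root_space_def simple_root_def)
  have inv: "s_refl n A i (s_refl n A i x) = x" if "x \<in> root_space n" for x
  proof -
    have "s_refl n A i (s_refl n A i (lc (\<lambda>k. x k / g k) unitv)) = lc (\<lambda>k. x k / g k) (\<lambda>k. s i (s i (unitv k)))"
      using assms by (simp add: s_refl_lc)
    then show ?thesis using assms by (simp add: lc_unitv[OF that])
  qed
  have "bij_betw (s_refl n A i) (root_space n) (root_space n)"
    by (rule bij_betw_byWitness[where f' = "s_refl n A i"]) (use map inv in auto)
  then show ?thesis by (simp add: Bij_def s_refl_def)
qed

lemma aff_mult: "f \<in> Bij (root_space n) \<Longrightarrow> f' \<in> Bij (root_space n) \<Longrightarrow>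
    f \<otimes>\<^bsub>affine_weyl n A\<^esub> f' = compose (root_space n) f f'"
  by (simp add: affine_weyl_def subgroup_generated_def BijGroup_def)

lemma aff_one: "\<one>\<^bsub>affine_weyl n A\<^esub> = (\<lambda>x\<in>root_space n. x)"
  by (simp add: affine_weyl_def subgroup_generated_def BijGroup_def)

lemma aff_group: "group (affine_weyl n A)"
  unfolding affine_weyl_def by (rule group.group_subgroup_generated) (rule group_BijGroup)

lemma aff_carrier: "carrier (affine_weyl n A) = generate (BijGroup (root_space n)) (s_refl n A ` {0..n})"
proof -
  have "s_refl n A ` {0..n} \<subseteq> carrier (BijGroup (root_space n))"
    using s_refl_Bij by (auto simp: BijGroup_def)
  then show ?thesis by (simp add: affine_weyl_def carrier_subgroup_generated Int_absorb1)
qed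

lemma aff_Bij: "w \<in> carrier (affine_weyl n A) \<Longrightarrow> w \<in> Bij (root_space n)"
proof -
  have "carrier (affine_weyl n A) \<subseteq> carrier (BijGroup (root_space n))"
    unfolding aff_carrier
    by (rule group.generate_incl[OF group_BijGroup]) (use s_refl_Bij in \<open>auto simp: BijGroup_def\<close>)
  then show "w \<in> carrier (affine_weyl n A) \<Longrightarrow> w \<in> Bij (root_space n)" by (auto simp: BijGroup_def)
qed

lemma s_refl_carrier: "i \<le> n \<Longrightarrow> s_refl n A i \<in> carrier (affine_weyl n A)"
  unfolding aff_carrier by (rule generate.incl) auto

lemma s_prod_carrier: "wd js \<Longrightarrow> s_prod n A js \<in> carrier (affine_weyl n A)"
proof (induction js)
  case Nil
  then show ?case using group.is_monoid[OF aff_group] by (simp add: s_prod_def monoid.one_closed)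
next
  case (Cons i js)
  then show ?case using group.is_monoid[OF aff_group] s_refl_carrier by (simp add: s_prod_def monoid.m_closed)
qed

lemma s_prod_rext: "wd js \<Longrightarrow> s_prod n A js = rext (act js)"
proof (induction js)
  case Nil
  show ?case unfolding s_prod_def rext_def aff_one foldr.simps id_apply
    by (rule restrict_ext) (simp add: lc_unitv)
next
  case (Cons i js)
  then have i: "i \<le> n" and w: "wd js" by auto
  have "s_prod n A (i # js) = s_refl n A i \<otimes>\<^bsub>affine_weyl n A\<^esub> s_prod n A js" by (simp add: s_prod_def)
  also have "\<dots> = compose (root_space n) (s_refl n A i) (s_prod n A js)"
    by (rule aff_mult[OF s_refl_Bij[OF i] aff_Bij[OF s_prod_carrier[OF w]]])
  also have "\<dots> = rext (act (i # js))"
    unfolding Cons.IH[OF w] compose_def rext_def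
    by (rule restrict_ext) (use i w in \<open>simp add: s_refl_lc\<close>)
  finally show ?case .
qed

lemma rext_io: assumes "f \<in> Wg" "x \<in> lat" shows "rext f (io x) = io (f x)"
proof -
  obtain js where js: "f = act js" "wd js" using assms by (auto simp: Wg_def)
  have "s_prod n A js (io x) = io (act js x)"
    using js(2)
  proof (induction js)
    case Nil
    then show ?case using assms io_root_space by (simp add: s_prod_def aff_one)
  next
    case (Cons i js)
    then have i: "i \<le> n" and w: "wd js" by auto
    have "s_prod n A (i # js) = s_refl n A i \<otimes>\<^bsub>affine_weyl n A\<^esub> s_prod n A js" by (simp add: s_prod_def)
    then have "s_prod n A (i # js) = compose (root_space n) (s_refl n A i) (s_prod n A js)"
      using aff_mult[OF s_refl_Bij[OF i] aff_Bij[OF s_prod_carrier[OF w]]] by simp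
    then show ?case using Cons.IH[OF w] assms(2) io_root_space s_refl_io[OF i, of "act js x"] w
      by (simp add: compose_eq)
  qed
  then show ?thesis using s_prod_rext[OF js(2)] js(1) by simp
qed

lemma act_outside: assumes "wd js" "\<And>j. j \<le> n \<Longrightarrow> x j = 0" shows "act js x = x"
  using assms(1)
proof (induction js)
  case (Cons i js)
  have "pr x i = 0" using assms(2) by (simp add: pr_def)
  then show ?case using Cons by (simp add: s_pr0)
qed simp

text \<open>Elements of \<open>Wg\<close> are maps on all integer sequences. They fix every sequence
  supported beyond \<open>n\<close>, so agreement on \<open>lat\<close> is enough.\<close>

lemma Wg_eqI: assumes "f \<in> Wg" "f' \<in> Wg" "\<And>x. x \<in> lat \<Longrightarrow> f x = f' x" shows "f = f'"
proof
  fix x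
  define y z :: ivec where "y = (\<lambda>j. if j \<le> n then x j else 0)" and "z = (\<lambda>j. if j \<le> n then 0 else x j)"
  have x: "x = y + z" by (auto simp: y_def z_def fun_eq_iff)
  have z: "f z = z" "f' z = z" using assms(1,2) act_outside[of _ z] by (auto simp: Wg_def z_def)
  have "f y = f' y" using assms(3)[of y] by (simp add: lat_def y_def)
  then show "f x = f' x" unfolding x Wg_lin(1)[OF assms(1)] Wg_lin(1)[OF assms(2)] z by simp
qed

lemma rext_inj: assumes "f \<in> Wg" "f' \<in> Wg" "rext f = rext f'" shows "f = f'"
proof (rule Wg_eqI[OF assms(1,2)])
  fix x assume "x \<in> lat"
  then show "f x = f' x" using rext_io[OF assms(1)] rext_io[OF assms(2)] assms(3) io_inj by metis
qed

lemma rext_carrier: "f \<in> Wg \<Longrightarrow> rext f \<in> carrier (affine_weyl n A)"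
  unfolding Wg_def using s_prod_rext s_prod_carrier by auto

lemma rext_comp: assumes "f \<in> Wg" "f' \<in> Wg" shows "rext (f \<circ> f') = rext f \<otimes>\<^bsub>affine_weyl n A\<^esub> rext f'"
proof -
  obtain js ks where jk: "f = act js" "wd js" "f' = act ks" "wd ks" using assms by (auto simp: Wg_def)
  interpret AW: group "affine_weyl n A" by (rule aff_group)
  have "s_prod n A (js @ ks) = s_prod n A js \<otimes>\<^bsub>affine_weyl n A\<^esub> s_prod n A ks"
    using jk(2)
  proof (induction js)
    case Nil
    then show ?case using s_prod_carrier[OF jk(4)] by (simp add: s_prod_def)
  next
    case (Cons i js)
    then have w: "i \<le> n" "wd js" by auto
    have e: "s_prod n A (i # ls) = s_refl n A i \<otimes>\<^bsub>affine_weyl n A\<^esub> s_prod n A ls" for ls by (simp add: s_prod_def)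
    show ?case using Cons.IH[OF w(2)] s_refl_carrier[OF w(1)] s_prod_carrier[OF w(2)] s_prod_carrier[OF jk(4)]
      by (simp add: e AW.m_assoc)
  qed
  then show ?thesis using s_prod_rext jk by (simp add: act_comp del: act_append)
qed

lemma rext_surj: "w \<in> carrier (affine_weyl n A) \<Longrightarrow> \<exists>f\<in>Wg. w = rext f"
  unfolding aff_carrier
proof (induction rule: generate.induct)
  case one
  have "\<one>\<^bsub>BijGroup (root_space n)\<^esub> = s_prod n A []" by (simp add: s_prod_def aff_one BijGroup_def)
  then show ?case using s_prod_rext[of "[]"] Wg_act[of "[]"] by (metis wd_simps(1))
next
  case (incl w)
  then obtain i where i: "i \<le> n" "w = s_refl n A i" by auto
  have "s_prod n A [i] = s_refl n A i"
    using group.is_monoid[OF aff_group] s_refl_carrier[OF i(1)] by (simp add: s_prod_def monoid.r_one)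
  then show ?case using s_prod_rext[of "[i]"] Wg_act[of "[i]"] i by (metis wd_simps(1,2))
next
  case (inv w)
  then obtain i where i: "i \<le> n" "w = s_refl n A i" by auto
  interpret BG: group "BijGroup (root_space n)" by (rule group_BijGroup)
  have sp: "s_prod n A [i] = s_refl n A i"
    using group.is_monoid[OF aff_group] s_refl_carrier[OF i(1)] by (simp add: s_prod_def monoid.r_one)
  have "s_refl n A i \<otimes>\<^bsub>affine_weyl n A\<^esub> s_refl n A i = s_prod n A [i, i]"
    using sp by (simp add: s_prod_def)
  also have "\<dots> = rext (act [])"
  proof -
    have "act [i, i] = act []" using i by (simp add: fun_eq_iff)
    then show ?thesis using s_prod_rext[of "[i, i]"] i by simp
  qed
  also have "\<dots> = \<one>\<^bsub>BijGroup (root_space n)\<^esub>"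
    using s_prod_rext[of "[]"] by (simp add: s_prod_def aff_one BijGroup_def)
  finally have "inv\<^bsub>BijGroup (root_space n)\<^esub> s_refl n A i = s_refl n A i"
    using s_refl_Bij[OF i(1)] by (intro BG.inv_equality) (auto simp: affine_weyl_def subgroup_generated_def BijGroup_def)
  then show ?case using s_prod_rext[of "[i]"] Wg_act[of "[i]"] i sp by (metis wd_simps(1,2))
next
  case (eng w1 w2)
  then obtain f1 f2 where f: "f1 \<in> Wg" "w1 = rext f1" "f2 \<in> Wg" "w2 = rext f2" by blast
  have "w1 \<otimes>\<^bsub>BijGroup (root_space n)\<^esub> w2 = rext (f1 \<circ> f2)"
    using rext_comp[OF f(1,3)] f by (simp add: affine_weyl_def subgroup_generated_def)
  then show ?case using f by (meson Wg_comp)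
qed

lemma s_theta_rext: "s_theta n A = rext (rf phi)"
proof -
  have "s_theta n A = restrict (s_theta n A) (root_space n)" by (simp add: s_theta_def)
  also have "\<dots> = rext (rf phi)"
    unfolding rext_def
  proof (rule restrict_ext)
    fix x assume x: "x \<in> root_space n"
    show "s_theta n A x = lc (\<lambda>k. x k / g k) (\<lambda>k. rf phi (unitv k))"
      using s_theta_lc[of "\<lambda>k. x k / g k"] lc_unitv[OF x] by simp
  qed
  finally show ?thesis .
qed

text \<open>The given decomposition is minimal among words in the letters 1, ..., n;
  \<open>red_of_parabolic\<close> makes it reduced in the affine Weyl group, so that it computes the
  lift of s_theta.\<close>

lemma reduced_red:
  assumes "reduced_decomposition n A js (s_theta n A)"
  shows "red js" "act js = rf phi" "set js \<subseteq> {1..n}"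
proof -
  have rW: "rf phi \<in> Wg" by (rule rf_Wg[OF phi_fin B_phi_phi])
  show sj: "set js \<subseteq> {1..n}" using assms by (auto simp: reduced_decomposition_def)
  then have w: "wd js" by (auto simp: wd_def)
  have "rext (act js) = rext (rf phi)"
    using assms s_prod_rext[OF w] by (simp add: reduced_decomposition_def s_theta_rext)
  then show eq: "act js = rf phi" using rext_inj[OF _ rW] w by simp
  show "red js"
  proof (rule red_of_parabolic[OF sj])
    fix ks assume ks: "set ks \<subseteq> {1..n}" "act ks = act js"
    then have "wd ks" by (auto simp: wd_def)
    then have "s_prod n A ks = s_theta n A" using s_prod_rext ks(2) eq s_theta_rext by metis
    then show "length js \<le> length ks" using assms ks(1) by (auto simp: reduced_decomposition_def)
  qed auto
qed

definition ka :: "ivec \<times> (ivec \<Rightarrow> ivec) \<Rightarrow> vec \<times> (vec \<Rightarrow> vec)" where "ka = (\<lambda>(x, f). (io x, rext f))"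

lemma Q_aff_io: "Q_aff n A = io ` lat"
proof
  show "Q_aff n A \<subseteq> io ` lat"
  proof
    fix y assume "y \<in> Q_aff n A"
    then obtain b k where "b \<in> fin" "y = vadd (io b) (vscale (of_int k) (delta_scaled n A))"
      by (auto simp: Q_aff_def Q_fin_io)
    then show "y \<in> io ` lat" by (simp add: delta_io io_sc io_add fin_lat)
  qed
  show "io ` lat \<subseteq> Q_aff n A"
  proof
    fix y assume "y \<in> io ` lat"
    then obtain x where x: "x \<in> lat" "y = io x" by auto
    have "fp x \<in> fin" using x by (simp add: fp_def fin_def)
    moreover have "x = fp x + sc (x 0) dl" by (simp add: fp_def)
    then have "y = vadd (io (fp x)) (vscale (of_int (x 0)) (delta_scaled n A))"
      using x(2) by (simp only: delta_io io_sc io_add)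
    ultimately show "y \<in> Q_aff n A" unfolding Q_aff_def Q_fin_io by blast
  qed
qed

lemma ka_bij: "bij_betw ka (carrier Wt) (carrier (double_affine_weyl n A))"
  unfolding bij_betw_def
proof
  show "inj_on ka (carrier Wt)"
    by (auto simp: inj_on_def ka_def dest: io_inj intro: rext_inj)
  show "ka ` carrier Wt = carrier (double_affine_weyl n A)"
  proof
    show "ka ` carrier Wt \<subseteq> carrier (double_affine_weyl n A)"
      by (auto simp: ka_def double_affine_weyl_def Q_aff_io rext_carrier)
    show "carrier (double_affine_weyl n A) \<subseteq> ka ` carrier Wt"
    proof
      fix p assume "p \<in> carrier (double_affine_weyl n A)"
      then obtain x w where p: "p = (io x, w)" "x \<in> lat" "w \<in> carrier (affine_weyl n A)"
        by (auto simp: double_affine_weyl_def Q_aff_io)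
      obtain f where f: "f \<in> Wg" "w = rext f" using rext_surj[OF p(3)] by blast
      then show "p \<in> ka ` carrier Wt" using p by (auto simp: ka_def intro!: image_eqI[of _ _ "(x, f)"])
    qed
  qed
qed

lemma ka_hom: "ka \<in> hom Wt (double_affine_weyl n A)"
proof (rule homI)
  fix x assume "x \<in> carrier Wt"
  then show "ka x \<in> carrier (double_affine_weyl n A)" using ka_bij bij_betwE by blast
next
  fix x y assume "x \<in> carrier Wt" "y \<in> carrier Wt"
  then obtain v f w f' where "x = (v, f)" "v \<in> lat" "f \<in> Wg" "y = (w, f')" "w \<in> lat" "f' \<in> Wg" by auto
  then show "ka (x \<otimes>\<^bsub>Wt\<^esub> y) = ka x \<otimes>\<^bsub>double_affine_weyl n A\<^esub> ka y"
    by (simp add: ka_def double_affine_weyl_def rext_io io_add rext_comp)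
qed

lemma daw_group: "group (double_affine_weyl n A)"
proof -
  have one: "ka \<one>\<^bsub>Wt\<^esub> = \<one>\<^bsub>double_affine_weyl n A\<^esub>"
  proof -
    have "act [] = (\<lambda>x. x)" by (rule ext) simp
    then have "rext (\<lambda>x. x) = \<one>\<^bsub>affine_weyl n A\<^esub>" using s_prod_rext[of "[]"] by (simp add: s_prod_def)
    then show ?thesis by (simp add: ka_def double_affine_weyl_def io_def zero_fun_def)
  qed
  have "ka \<in> iso Wt (double_affine_weyl n A)" using ka_hom ka_bij by (simp add: iso_def)
  then have "group (double_affine_weyl n A\<lparr>one := ka \<one>\<^bsub>Wt\<^esub>\<rparr>)" by (rule group.iso_imp_img_group[OF Wt_group])
  then show ?thesis unfolding one by simp
qed

end

section \<open>The double affine Artin group\<close>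

context hat_data
begin

definition gens :: "daag_gen set" where "gens = daag_gens n A"
definition rels :: "(daag_gen word \<times> daag_gen word) set" where "rels = daag_rels n A"
definition G :: "daag_gen word set monoid" where "G = DAAG n A"
definition cl :: "daag_gen word \<Rightarrow> daag_gen word set" where "cl u = pres_class gens rels u"
text \<open>Beyond \<open>n\<close> the unit is a default value, so that \<open>Tt i\<close> is an
  element of the group for every \<open>i\<close>.\<close>

definition Tt :: "nat \<Rightarrow> daag_gen word set" where "Tt i = (if i \<le> n then T_elt n A i else \<one>\<^bsub>G\<^esub>)"
definition Xx :: "ivec \<Rightarrow> daag_gen word set" where "Xx b = cl [(GX (io b), True)]"
definition Cc :: "daag_gen word set" where "Cc = cl [(GD, True)]"

abbreviation valid :: "daag_gen word \<Rightarrow> bool" where "valid u \<equiv> u \<in> valid_words gens"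

lemma G_def': "G = presented_group gens rels" by (simp add: G_def DAAG_def gens_def rels_def)
lemma G_group: "group G" unfolding G_def' by (rule presented_group)

lemma gens_simps [simp]: "GT i \<in> gens \<longleftrightarrow> i \<le> n" "GD \<in> gens" "GX y \<in> gens \<longleftrightarrow> y \<in> io ` fin"
  by (auto simp: gens_def daag_gens_def Q_fin_io)

lemma cl_carrier [simp]: "valid u \<Longrightarrow> cl u \<in> carrier G"
  by (simp add: cl_def G_def' presented_carrier)
lemma cl_mult: "valid u \<Longrightarrow> valid v \<Longrightarrow> cl u \<otimes>\<^bsub>G\<^esub> cl v = cl (u @ v)"
  unfolding cl_def G_def' by (rule presented_mult)
lemma cl_one: "\<one>\<^bsub>G\<^esub> = cl []" by (simp add: cl_def G_def' presented_one)
lemma cl_rel: "(u, v) \<in> rels \<Longrightarrow> valid u \<Longrightarrow> valid v \<Longrightarrow> cl u = cl v"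
  unfolding cl_def by (rule pres_class_eq) (rule pres_eq.rel)

lemma Tt_cl: "i \<le> n \<Longrightarrow> Tt i = cl [(GT i, True)]"
  by (simp add: Tt_def T_elt_def cl_def gens_def rels_def)
lemma Tt_closed [simp]: "Tt i \<in> carrier G"
  using Tt_cl[of i] group.is_monoid[OF G_group] by (cases "i \<le> n") (auto simp: Tt_def monoid.one_closed)
lemma Xx_closed [simp]: "b \<in> fin \<Longrightarrow> Xx b \<in> carrier G" by (simp add: Xx_def)
lemma Cc_closed [simp]: "Cc \<in> carrier G" by (simp add: Cc_def)

lemma X_word_0: assumes "x \<in> fin" shows "X_word n A (io x) = [(GX (io x), True)]"
proof -
  have "io x 0 = 0" using assms by (simp add: fin_def io_apply)
  moreover have "vadd (io x) (vscale 0 y) = io x" for y by (simp add: vadd_def vscale_def)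
  ultimately show ?thesis by (simp add: X_word_def)
qed

lemma X_word_1: assumes "x 0 = 1" shows "X_word n A (io x) = [(GX (io (x - dl)), True), (GD, True)]"
proof -
  have "io x 0 = 1" using assms by (simp add: io_apply)
  moreover have "vadd (io x) (vscale (- 1) (delta_scaled n A)) = io (x - dl)"
    using io_sc[of "-1" dl] io_add[of x "- dl"] by (simp add: delta_io)
  ultimately show ?thesis by (simp add: X_word_def)
qed

lemma X_elt_0: "x \<in> fin \<Longrightarrow> X_elt n A (io x) = Xx x"
  by (simp add: X_elt_def X_word_0 Xx_def cl_def gens_def rels_def)

lemma X_elt_1: assumes "x - dl \<in> fin" shows "X_elt n A (io x) = Xx (x - dl) \<otimes>\<^bsub>G\<^esub> Cc"
proof -
  have "x 0 = 1" using assms by (simp add: fin_def)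
  then have "X_elt n A (io x) = cl ([(GX (io (x - dl)), True)] @ [(GD, True)])"
    by (simp add: X_elt_def X_word_1 cl_def gens_def rels_def)
  also have "\<dots> = Xx (x - dl) \<otimes>\<^bsub>G\<^esub> Cc" unfolding Xx_def Cc_def using assms by (subst cl_mult) auto
  finally show ?thesis .
qed

lemma alt_word_alt: "alt_word m i j = map (\<lambda>k. (GT k, True)) (alt m i j)"
  by (induction m arbitrary: i j) auto

lemma Tt_foldr: "wd js \<Longrightarrow> foldr (\<lambda>k y. Tt k \<otimes>\<^bsub>G\<^esub> y) js \<one>\<^bsub>G\<^esub> = cl (map (\<lambda>k. (GT k, True)) js)"
proof (induction js)
  case (Cons i js)
  then have "valid (map (\<lambda>k. (GT k, True)) js)" by (auto simp: wd_def subset_iff)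
  then show ?case using Cons cl_mult[of "[(GT i, True)]" "map (\<lambda>k. (GT k, True)) js"] by (simp add: Tt_cl)
qed (simp add: cl_one)

lemma c_prod_A: assumes "i \<le> n" "j \<le> n" shows "c i j * c j i = A i j * A j i"
proof -
  have "real_of_int (c i j * c j i) = real_of_int (A i j * A j i)"
    using assms by (simp add: A_c)
  then show ?thesis by (simp only: of_int_eq_iff)
qed

lemma bm_A: "i \<le> n \<Longrightarrow> j \<le> n \<Longrightarrow> bm i j m \<longleftrightarrow> (A i j * A j i, m) \<in> {(0, 2), (1, 3), (2, 4), (3, 6)}"
  by (simp add: bm_def c_prod_A)

lemma G_double_sys: "double_sys n c a e r par rk G Tt Xx Cc"
proof -
  interpret G: group G by (rule G_group)
  have cent: "Cc \<otimes>\<^bsub>G\<^esub> cl [(y, True)] = cl [(y, True)] \<otimes>\<^bsub>G\<^esub> Cc" if "y \<in> gens" for y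
  proof -
    have "cl [(GD, True), (y, True)] = cl [(y, True), (GD, True)]"
    proof (rule cl_rel)
      show "([(GD, True), (y, True)], [(y, True), (GD, True)]) \<in> rels"
        unfolding rels_def daag_rels_def using that[unfolded gens_def] by blast
    qed (use that in auto)
    then show ?thesis unfolding Cc_def using that by (simp add: cl_mult)
  qed
  have comm: "Tt i \<otimes>\<^bsub>G\<^esub> Xx b = Xx b \<otimes>\<^bsub>G\<^esub> Tt i" if i: "i \<le> n" and b: "b \<in> fin" "pr b i = 0" for i b
  proof -
    have "cl [(GT i, True), (GX (io b), True)] = cl [(GX (io b), True), (GT i, True)]"
      by (rule cl_rel) (use i b form_hat[OF i, of b] in \<open>auto simp: rels_def daag_rels_def Q_fin_io\<close>)
    then show ?thesis unfolding Tt_cl[OF i] Xx_def using i b by (simp add: cl_mult)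
  qed
  have refl: "Tt i \<otimes>\<^bsub>G\<^esub> Xx b \<otimes>\<^bsub>G\<^esub> Tt i = cl (X_word n A (io (s i b)))"
    if i: "i \<le> n" and b: "b \<in> fin" "pr b i = -1" and v: "valid (X_word n A (io (s i b)))" for i b
  proof -
    have "cl [(GT i, True), (GX (io b), True), (GT i, True)] = cl (X_word n A (io (s i b)))"
    proof (rule cl_rel)
      have "io b \<in> Q_fin n A" "form n A (io b) (hat_coroot n A i) = -1"
        using b form_hat[OF i, of b] by (auto simp: Q_fin_io)
      moreover have "s_refl n A i (io b) = io (s i b)" using s_refl_io[OF i] b fin_lat by simp
      ultimately show "([(GT i, True), (GX (io b), True), (GT i, True)], X_word n A (io (s i b))) \<in> rels"
        using i unfolding rels_def daag_rels_def by fastforce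
    qed (use i b v in auto)
    then show ?thesis unfolding Tt_cl[OF i] Xx_def using i b by (simp add: cl_mult)
  qed
  show ?thesis
  proof unfold_locales
    fix i j m assume ij: "i \<le> n" "j \<le> n" "i \<noteq> j" "bm i j m"
    have w: "wd (alt m i j)" "wd (alt m j i)" using set_alt[of m i j] set_alt[of m j i] ij by (auto simp: wd_def)
    have "cl (alt_word m i j) = cl (alt_word m j i)"
    proof (rule cl_rel)
      show "(alt_word m i j, alt_word m j i) \<in> rels"
        using ij bm_A[OF ij(1,2), of m] unfolding rels_def daag_rels_def braid_rels_def by blast
    qed (use w in \<open>auto simp: alt_word_alt wd_def subset_iff\<close>)
    then show "foldr (\<lambda>k y. Tt k \<otimes>\<^bsub>G\<^esub> y) (alt m i j) \<one>\<^bsub>G\<^esub> = foldr (\<lambda>k y. Tt k \<otimes>\<^bsub>G\<^esub> y) (alt m j i) \<one>\<^bsub>G\<^esub>"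
      using w by (simp add: Tt_foldr alt_word_alt)
  next
    have "Xx (b + b') = Xx b \<otimes>\<^bsub>G\<^esub> Xx b'" if "b \<in> fin" "b' \<in> fin" for b b'
    proof -
      have "cl [(GX (io b), True), (GX (io b'), True)] = cl [(GX (io (b + b')), True)]"
        by (rule cl_rel) (use that in \<open>auto simp: rels_def daag_rels_def Q_fin_io io_add[symmetric]\<close>, simp add: io_add)
      then show ?thesis unfolding Xx_def using that by (simp add: cl_mult)
    qed
    moreover have "Tt i \<otimes>\<^bsub>G\<^esub> Xx b \<otimes>\<^bsub>G\<^esub> Tt i = Xx (s i b)" if "i \<in> {1..n}" "b \<in> fin" "pr b i = -1" for i b
    proof -
      have f: "s i b \<in> fin" using that by simp
      show ?thesis using refl[of i b] that f by (simp add: X_word_0[OF f] Xx_def)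
    qed
    ultimately show "bern G Tt Xx" unfolding bern_def using comm by auto
  next
    show "Cc \<otimes>\<^bsub>G\<^esub> Tt i = Tt i \<otimes>\<^bsub>G\<^esub> Cc" for i
      using cent[of "GT i"] by (cases "i \<le> n") (simp_all add: Tt_cl, simp add: Tt_def)
    show "Cc \<otimes>\<^bsub>G\<^esub> Xx b = Xx b \<otimes>\<^bsub>G\<^esub> Cc" if "b \<in> fin" for b
      using cent[of "GX (io b)"] that by (simp add: Xx_def)
    show "Tt 0 \<otimes>\<^bsub>G\<^esub> Xx b = Xx b \<otimes>\<^bsub>G\<^esub> Tt 0" if "b \<in> fin" "pr b 0 = 0" for b using comm that by simp
    fix b assume b: "b \<in> fin" "pr b 0 = -1"
    have sb: "s 0 b - dl = b - phi" using b by (simp add: s_prm1 phi_def)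
    have s0: "s 0 b 0 = 1" using b by (simp add: s_prm1 fin_def)
    have f: "b - phi \<in> fin" using b by simp
    have xw: "X_word n A (io (s 0 b)) = [(GX (io (b - phi)), True), (GD, True)]"
      using X_word_1[of "s 0 b", OF s0] sb by simp
    have "Tt 0 \<otimes>\<^bsub>G\<^esub> Xx b \<otimes>\<^bsub>G\<^esub> Tt 0 = cl (X_word n A (io (s 0 b)))"
      by (rule refl) (use b f xw in auto)
    then show "Tt 0 \<otimes>\<^bsub>G\<^esub> Xx b \<otimes>\<^bsub>G\<^esub> Tt 0 = Xx (b - phi) \<otimes>\<^bsub>G\<^esub> Cc"
      unfolding xw Xx_def Cc_def using f by (simp add: cl_mult)
  qed simp_all
qed

text \<open>Each defining relation, evaluated in \<open>H\<close>, is an axiom or a direct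
  consequence of the axioms of \<open>double_sys\<close>. The lattice generators are indexed by real
  vectors and are read back through the injective map \<open>io\<close>.\<close>

lemma universal:
  fixes H :: "('h, 'm) monoid_scheme"
  assumes "double_sys n c a e r par rk H T' X' C'"
  shows "\<exists>f\<in>hom G H. (\<forall>i\<le>n. f (Tt i) = T' i) \<and> (\<forall>b\<in>fin. f (Xx b) = X' b) \<and> f Cc = C'"
proof -
  interpret D: double_sys n c a e r par rk H T' X' C' by (rule assms)
  define f where "f = (\<lambda>y. case y of GT i \<Rightarrow> T' i | GX v \<Rightarrow> X' (inv_into fin io v) | GD \<Rightarrow> C')"
  have inj: "inj_on io fin" using io_inj by (auto simp: inj_on_def)
  have fs: "f (GT i) = T' i" "f GD = C'" "b \<in> fin \<Longrightarrow> f (GX (io b)) = X' b" for i b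
    using inj by (auto simp: f_def inv_into_f_f)
  have fc: "f ` gens \<subseteq> carrier H"
  proof (rule image_subsetI)
    fix y assume "y \<in> gens"
    then show "f y \<in> carrier H" by (cases y) (auto simp: fs)
  qed
  have alt: "word_eval H f (map (\<lambda>k. (GT k, True)) js) = foldr (\<lambda>k y. T' k \<otimes>\<^bsub>H\<^esub> y) js \<one>\<^bsub>H\<^esub>" for js
    by (induction js) (auto simp: fs)
  have rel: "word_eval H f u = word_eval H f v" if uv: "(u, v) \<in> rels" "valid u" "valid v" for u v
    using uv(1) unfolding rels_def daag_rels_def
  proof (elim UnE)
    assume "(u, v) \<in> braid_rels n A"
    then obtain m i j where m: "u = alt_word m i j" "v = alt_word m j i" "i \<le> n" "j \<le> n" "i \<noteq> j"
      "(A i j * A j i, m) \<in> {(0, 2), (1, 3), (2, 4), (3, 6)}" unfolding braid_rels_def by blast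
    then show ?thesis using D.braid[OF m(3-5)] bm_A[OF m(3,4), of m] by (simp add: alt_word_alt alt)
  next
    assume "(u, v) \<in> {([(GX \<beta>, True), (GX \<gamma>, True)], [(GX (vadd \<beta> \<gamma>), True)]) | \<beta> \<gamma>. \<beta> \<in> Q_fin n A \<and> \<gamma> \<in> Q_fin n A}"
    then obtain b b' where "b \<in> fin" "b' \<in> fin" "u = [(GX (io b), True), (GX (io b'), True)]" "v = [(GX (io (b + b')), True)]"
      by (auto simp: Q_fin_io io_add)
    then show ?thesis by (simp add: fs D.X_add)
  next
    assume "(u, v) \<in> {([(GD, True), (y, True)], [(y, True), (GD, True)]) | y. y \<in> daag_gens n A}"
    then obtain y where y: "y \<in> gens" "u = [(GD, True), (y, True)]" "v = [(y, True), (GD, True)]" by (auto simp: gens_def)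
    then have "f y \<in> carrier H" using fc by blast
    then show ?thesis using y D.C_X by (cases y) (auto simp: fs D.C_T)
  next
    assume "(u, v) \<in> {([(GT i, True), (GX \<beta>, True)], [(GX \<beta>, True), (GT i, True)]) | i \<beta>.
         i \<le> n \<and> \<beta> \<in> Q_fin n A \<and> form n A \<beta> (hat_coroot n A i) = 0}"
    then obtain i b where ib: "i \<le> n" "b \<in> fin" "pr b i = 0" "u = [(GT i, True), (GX (io b), True)]"
      "v = [(GX (io b), True), (GT i, True)]"
      using form_hat by (auto simp: Q_fin_io)
    then have "T' i \<otimes>\<^bsub>H\<^esub> X' b = X' b \<otimes>\<^bsub>H\<^esub> T' i"
      using D.T_X_comm[of i b] D.T0_comm[of b] by (cases "i = 0") auto
    then show ?thesis using ib by (simp add: fs)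
  next
    assume "(u, v) \<in> {([(GT i, True), (GX \<beta>, True), (GT i, True)], X_word n A (s_refl n A i \<beta>)) | i \<beta>.
         i \<le> n \<and> \<beta> \<in> Q_fin n A \<and> form n A \<beta> (hat_coroot n A i) = - 1}"
    then obtain i y where iy: "i \<le> n" "y \<in> Q_fin n A" "form n A y (hat_coroot n A i) = -1"
      "u = [(GT i, True), (GX y, True), (GT i, True)]" "v = X_word n A (s_refl n A i y)" by blast
    then obtain b where b: "b \<in> fin" "y = io b" by (auto simp: Q_fin_io)
    have p: "pr b i = -1" using iy(3) form_hat[OF iy(1), of b] b by simp
    have v: "v = X_word n A (io (s i b))" using iy b s_refl_io fin_lat by simp
    show ?thesis
    proof (cases "i = 0")
      case True
      have sb: "s 0 b - dl = b - phi" using p True by (simp add: s_prm1 phi_def)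
      have s0: "s 0 b 0 = 1" using b p True by (simp add: s_prm1 fin_def)
      have "v = [(GX (io (b - phi)), True), (GD, True)]" unfolding v True X_word_1[of "s 0 b", OF s0] sb by simp
      then show ?thesis using iy b p True D.T0_refl[of b] by (simp add: fs D.G.m_assoc)
    next
      case False
      then have i: "i \<in> {1..n}" using iy by auto
      have f: "s i b \<in> fin" using i b by simp
      have "v = [(GX (io (s i b)), True)]" unfolding v X_word_0[OF f] by simp
      then show ?thesis using iy b p f D.T_X_refl[OF i b(1) p] by (simp add: fs D.G.m_assoc s_prm1)
    qed
  qed
  have hom: "pres_lift H f \<in> hom G H" unfolding G_def' by (rule D.G.pres_lift_hom[OF fc rel])
  have cls: "pres_lift H f (cl [(y, True)]) = f y" if "y \<in> gens" for y
  proof -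
    have "f y \<in> carrier H" using fc that by blast
    then show ?thesis unfolding cl_def using that by (subst D.G.pres_lift_class[OF fc _ rel]) auto
  qed
  show ?thesis
    by (rule bexI[OF _ hom]) (auto simp: Tt_cl Xx_def Cc_def cls fs)
qed

text \<open>One lattice element suffices for comparison: by \<open>closure\<close>, all X_beta arise
  from X_phi by products, inverses and the rule that T_k X_x T_k is X at s_k(x) when the pairing is
  -1.\<close>

lemma gens_hom_eq:
  fixes H :: "('h, 'm) monoid_scheme"
  assumes "group H" "f \<in> hom G H" "f' \<in> hom G H" "\<And>i. i \<le> n \<Longrightarrow> f (Tt i) = f' (Tt i)"
    and "f (Xx phi) = f' (Xx phi)" "f Cc = f' Cc" "x \<in> carrier G"
  shows "f x = f' x"
proof -
  interpret H: group H by (rule assms(1))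
  interpret D: double_sys n c a e r par rk G Tt Xx Cc by (rule G_double_sys)
  have gh: "group_hom G H f" "group_hom G H f'"
    using assms(1-3) G_group by (auto simp: group_hom_def group_hom_axioms_def)
  have X: "f (Xx b) = f' (Xx b)" if "b \<in> fin" for b
    using _ _ assms(5) _ that
  proof (rule closure)
    fix x y assume "x \<in> fin" "f (Xx x) = f' (Xx x)" "y \<in> fin" "f (Xx y) = f' (Xx y)"
    then show "f (Xx (x + y)) = f' (Xx (x + y))"
      using assms(2,3) by (subst (1 2) D.X_add) (auto simp: hom_mult)
  next
    fix x assume "x \<in> fin" "f (Xx x) = f' (Xx x)"
    then show "f (Xx (- x)) = f' (Xx (- x))"
      by (simp add: D.X_minus group_hom.hom_inv[OF gh(1)] group_hom.hom_inv[OF gh(2)])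
  next
    fix x k assume k: "k \<in> {1..n}" "x \<in> fin" "f (Xx x) = f' (Xx x)" "pr x k = -1"
    have "Xx (s k x) = Tt k \<otimes>\<^bsub>G\<^esub> Xx x \<otimes>\<^bsub>G\<^esub> Tt k" using D.T_X_refl[OF k(1,2,4)] k(4) by (simp add: s_prm1)
    then show "f (Xx (s k x)) = f' (Xx (s k x))" using k assms(2-4) by (simp add: hom_mult)
  qed
  have "f (cl [(y, True)]) = f' (cl [(y, True)])" if "y \<in> gens" for y
    using that assms(4) X assms(6) by (cases y) (auto simp: Tt_cl Xx_def Cc_def)
  then show ?thesis
    using H.presented_hom_eq[of f gens rels f' x] assms(2,3,7) unfolding G_def' cl_def by blast
qed

section \<open>The projection to the double affine Weyl group\<close>

definition pa :: "daag_gen word set \<Rightarrow> ivec \<times> (ivec \<Rightarrow> ivec)" where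
  "pa = (SOME f. f \<in> hom G Wt \<and> (\<forall>i\<le>n. f (Tt i) = sT i) \<and> (\<forall>b\<in>fin. f (Xx b) = sX b) \<and> f Cc = (dl, (\<lambda>x. x)))"

lemma pa: "pa \<in> hom G Wt" "i \<le> n \<Longrightarrow> pa (Tt i) = sT i" "b \<in> fin \<Longrightarrow> pa (Xx b) = sX b" "pa Cc = (dl, (\<lambda>x. x))"
proof -
  have "\<exists>f. f \<in> hom G Wt \<and> (\<forall>i\<le>n. f (Tt i) = sT i) \<and> (\<forall>b\<in>fin. f (Xx b) = sX b) \<and> f Cc = (dl, (\<lambda>x. x))"
    using universal[OF Wt_double_sys] by blast
  from someI_ex[OF this, folded pa_def]
  show "pa \<in> hom G Wt" "i \<le> n \<Longrightarrow> pa (Tt i) = sT i" "b \<in> fin \<Longrightarrow> pa (Xx b) = sX b" "pa Cc = (dl, (\<lambda>x. x))"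
    by blast+
qed

lemma rext_id: "rext (\<lambda>x. x) = \<one>\<^bsub>affine_weyl n A\<^esub>"
proof -
  have "act [] = (\<lambda>x. x)" by (rule ext) simp
  then show ?thesis using s_prod_rext[of "[]"] by (simp add: s_prod_def)
qed

lemma rext_s: assumes "i \<le> n" shows "rext (s i) = s_refl n A i"
proof -
  have "act [i] = s i" by (rule ext) simp
  moreover have "s_prod n A [i] = s_refl n A i"
    using group.is_monoid[OF aff_group] s_refl_carrier[OF assms] by (simp add: s_prod_def monoid.r_one)
  ultimately show ?thesis using s_prod_rext[of "[i]"] assms by (metis wd_simps(1,2))
qed

text \<open>Evaluating words in the double affine Weyl group agrees on generators with the
  homomorphism \<open>ka\<close> after \<open>pa\<close>, so it is constant on classes; the
  relations are verified once, in integer coordinates.\<close>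

lemma weyl_proj_pa: assumes "x \<in> carrier G" shows "weyl_proj n A x = ka (pa x)"
proof -
  interpret W: group "double_affine_weyl n A" by (rule daw_group)
  define h' where "h' x = ka (pa x)" for x
  have hh: "h' \<in> hom (presented_group gens rels) (double_affine_weyl n A)"
    using hom_compose[OF pa(1) ka_hom] unfolding G_def' h'_def comp_def by simp
  have gen: "h' (cl [(y, True)]) = weyl_image n A y" if yg: "y \<in> gens" for y
  proof (cases y)
    case (GT i)
    then have i: "i \<le> n" using yg by simp
    then show ?thesis using GT pa(2)[OF i] rext_s[OF i]
      by (simp add: h'_def Tt_cl[symmetric] sT_def ka_def io_def zero_fun_def)
  next
    case (GX v)
    then obtain b where b: "b \<in> fin" "v = io b" using yg by auto
    then show ?thesis using GX pa(3)[OF b(1)] rext_id by (simp add: h'_def Xx_def[symmetric] sX_def ka_def)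
  next
    case GD
    then show ?thesis using pa(4) rext_id by (simp add: h'_def Cc_def[symmetric] ka_def delta_io)
  qed
  obtain u where u: "x = pres_class gens rels u" "valid u" using assms by (auto simp: G_def' presented_carrier)
  have we: "h' (pres_class gens rels v) = word_eval (double_affine_weyl n A) (weyl_image n A) v" if "valid v" for v
  proof -
    have "h' (pres_class gens rels v) = word_eval (double_affine_weyl n A) (\<lambda>y. h' (pres_class gens rels [(y, True)])) v"
      using W.hom_word_eval[OF hh that] .
    also have "\<dots> = word_eval (double_affine_weyl n A) (weyl_image n A) v"
      using that by (induction v) (auto simp: gen[unfolded cl_def])
    finally show ?thesis .
  qed
  have "word_eval (double_affine_weyl n A) (weyl_image n A) ` x = {h' x}"
  proof -
    have "word_eval (double_affine_weyl n A) (weyl_image n A) v = h' x" if "v \<in> x" for v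
    proof -
      have "pres_eq gens rels u v" using that u(1) by (simp add: mem_pres_class)
      then show ?thesis using we[of v] pres_eq_valid pres_class_eq u(1) by metis
    qed
    moreover have "u \<in> x" using u pres_eq.refl[OF u(2)] by (simp add: mem_pres_class)
    ultimately show ?thesis by auto
  qed
  then show ?thesis by (simp add: weyl_proj_def pres_lift_def h'_def)
qed

lemma pa_surj: "pa ` carrier G = carrier Wt"
proof
  interpret D: double_sys n c a e r par rk G Tt Xx Cc by (rule G_double_sys)
  interpret Wt: group Wt by (rule Wt_group)
  have gh: "group_hom G Wt pa"
    using pa(1) G_group Wt_group by (auto simp: group_hom_def group_hom_axioms_def)
  show "pa ` carrier G \<subseteq> carrier Wt" using pa(1) unfolding hom_def by blast
  show "carrier Wt \<subseteq> pa ` carrier G"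
  proof
    fix p assume "p \<in> carrier Wt"
    then obtain x js where p: "p = (x, act js)" "x \<in> lat" "wd js" by (auto simp: Wg_def)
    have T: "pa (D.tp js) = (0, act js)"
      using p(3)
    proof (induction js)
      case Nil
      have "act [] = (\<lambda>x. x)" by (rule ext) simp
      then show ?case using group_hom.hom_one[OF gh] by (simp only: D.tp_simps Wt_simps)
    next
      case (Cons i js)
      have "pa (D.tp (i # js)) = pa (Tt i) \<otimes>\<^bsub>Wt\<^esub> pa (D.tp js)" by (simp add: group_hom.hom_mult[OF gh])
      moreover have "pa (Tt i) = sT i" "pa (D.tp js) = (0, act js)" using Cons pa(2)[of i] by auto
      moreover have "s i \<circ> act js = act (i # js)" by (rule ext) simp
      ultimately show ?case using Cons.prems s_zero[of i] by (simp only: sT_def Wt_simps wd_simps if_True add_0)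
    qed
    have f: "fp x \<in> fin" using p(2) by (simp add: fp_def fin_def)
    have C: "pa (Cc [^]\<^bsub>G\<^esub> k) = (sc (int k) dl, (\<lambda>x. x))" for k :: nat
    proof (induction k)
      case 0
      have "sc 0 dl = 0" by (rule sc_simps)
      then show ?case using group_hom.hom_one[OF gh] by (simp only: D.G.nat_pow_0 Wt_simps of_nat_0)
    next
      case (Suc k)
      have "sc (int k) dl + dl = sc (int (Suc k)) dl" by (simp add: fun_eq_iff algebra_simps)
      moreover have "pa (Cc [^]\<^bsub>G\<^esub> Suc k) = pa (Cc [^]\<^bsub>G\<^esub> k) \<otimes>\<^bsub>Wt\<^esub> pa Cc"
        by (simp add: group_hom.hom_mult[OF gh])
      ultimately show ?case by (simp only: Suc pa(4) Wt_simps comp_id_fun)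
    qed
    have Ci: "\<exists>y\<in>carrier G. pa y = (sc k dl, (\<lambda>x. x))" for k :: int
    proof (cases "0 \<le> k")
      case True
      then show ?thesis using C[of "nat k"] by (intro bexI[of _ "Cc [^]\<^bsub>G\<^esub> nat k"]) auto
    next
      case False
      then have k: "int (nat (- k)) = - k" by simp
      have "inv\<^bsub>Wt\<^esub> (sc (- k) dl, (\<lambda>x. x)) = (sc k dl, (\<lambda>x. x))"
      proof (rule Wt.inv_equality)
        have "sc k dl + sc (- k) dl = 0" by (simp add: fun_eq_iff)
        then show "(sc k dl, \<lambda>x. x) \<otimes>\<^bsub>Wt\<^esub> (sc (- k) dl, \<lambda>x. x) = \<one>\<^bsub>Wt\<^esub>"
          by (simp only: Wt_simps comp_id_fun)
      qed simp_all
      moreover have "pa (inv\<^bsub>G\<^esub> (Cc [^]\<^bsub>G\<^esub> nat (- k))) = inv\<^bsub>Wt\<^esub> (sc (- k) dl, (\<lambda>x. x))"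
        using C[of "nat (- k)"] unfolding k by (simp only: group_hom.hom_inv[OF gh] D.G.nat_pow_closed Cc_closed)
      ultimately show ?thesis
        by (intro bexI[of _ "inv\<^bsub>G\<^esub> (Cc [^]\<^bsub>G\<^esub> nat (- k))"]) (simp_all only: D.G.inv_closed D.G.nat_pow_closed Cc_closed)
    qed
    obtain y where y: "y \<in> carrier G" "pa y = (sc (x 0) dl, (\<lambda>x. x))" using Ci by blast
    have "pa (Xx (fp x) \<otimes>\<^bsub>G\<^esub> y \<otimes>\<^bsub>G\<^esub> D.tp js) = (fp x + sc (x 0) dl + 0, act js)"
      using f y T pa(3)[OF f]
      by (simp only: group_hom.hom_mult[OF gh] Xx_closed D.tp_closed D.G.m_closed sX_def Wt_simps comp_id_fun)
    moreover have "fp x + sc (x 0) dl + 0 = x" by (simp add: fp_def)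
    ultimately show "p \<in> pa ` carrier G" using f y p(1) by (intro image_eqI[of _ _ "Xx (fp x) \<otimes>\<^bsub>G\<^esub> y \<otimes>\<^bsub>G\<^esub> D.tp js"]) auto
  qed
qed

lemma descends:
  assumes "f \<in> auto (DAAG n A)" "g' \<in> hom Wt Wt" "bij_betw g' (carrier Wt) (carrier Wt)"
    and "\<And>x. x \<in> carrier G \<Longrightarrow> pa (f x) = g' (pa x)"
  shows "f \<in> Aut_descending n A"
proof -
  define ki where "ki = inv_into (carrier Wt) ka"
  have ki: "bij_betw ki (carrier (double_affine_weyl n A)) (carrier Wt)"
    unfolding ki_def by (rule bij_betw_inv_into[OF ka_bij])
  have kik: "ki (ka p) = p" if "p \<in> carrier Wt" for p
    unfolding ki_def using that ka_bij by (simp add: bij_betw_inv_into_left)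
  have kki: "ka (ki p) = p" if "p \<in> carrier (double_affine_weyl n A)" for p
    unfolding ki_def using that ka_bij by (simp add: bij_betw_inv_into_right)
  have kic: "ki p \<in> carrier Wt" if "p \<in> carrier (double_affine_weyl n A)" for p
    using ki that bij_betwE by blast
  interpret W: group "double_affine_weyl n A" by (rule daw_group)
  interpret Wt: group Wt by (rule Wt_group)
  have kih: "ki (p \<otimes>\<^bsub>double_affine_weyl n A\<^esub> q) = ki p \<otimes>\<^bsub>Wt\<^esub> ki q"
    if "p \<in> carrier (double_affine_weyl n A)" "q \<in> carrier (double_affine_weyl n A)" for p q
  proof -
    have "ka (ki p \<otimes>\<^bsub>Wt\<^esub> ki q) = p \<otimes>\<^bsub>double_affine_weyl n A\<^esub> q"
      using hom_mult[OF ka_hom kic[OF that(1)] kic[OF that(2)]] kki that by simp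
    then show ?thesis using kik[of "ki p \<otimes>\<^bsub>Wt\<^esub> ki q"] kic that Wt.m_closed by metis
  qed
  have g'c: "g' p \<in> carrier Wt" if "p \<in> carrier Wt" for p by (rule hom_in_carrier[OF assms(2) that])
  define g2 where "g2 = (\<lambda>p\<in>carrier (double_affine_weyl n A). ka (g' (ki p)))"
  have "g2 \<in> hom (double_affine_weyl n A) (double_affine_weyl n A)"
  proof (rule homI)
    fix p assume p: "p \<in> carrier (double_affine_weyl n A)"
    show "g2 p \<in> carrier (double_affine_weyl n A)"
      using p hom_in_carrier[OF ka_hom g'c[OF kic[OF p]]] by (simp add: g2_def)
  next
    fix p q assume "p \<in> carrier (double_affine_weyl n A)" "q \<in> carrier (double_affine_weyl n A)"
    then show "g2 (p \<otimes>\<^bsub>double_affine_weyl n A\<^esub> q) = g2 p \<otimes>\<^bsub>double_affine_weyl n A\<^esub> g2 q"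
      using hom_mult[OF assms(2) kic kic] hom_mult[OF ka_hom g'c[OF kic] g'c[OF kic]]
      by (simp add: g2_def kih)
  qed
  moreover have "bij_betw g2 (carrier (double_affine_weyl n A)) (carrier (double_affine_weyl n A))"
  proof -
    have "bij_betw (ka \<circ> (g' \<circ> ki)) (carrier (double_affine_weyl n A)) (carrier (double_affine_weyl n A))"
      using bij_betw_trans[OF bij_betw_trans[OF ki assms(3)] ka_bij] by (simp add: comp_assoc)
    then show ?thesis by (rule bij_betw_cong[THEN iffD1, rotated]) (simp add: g2_def)
  qed
  ultimately have "g2 \<in> auto (double_affine_weyl n A)"
    by (simp add: auto_def Bij_def g2_def)
  moreover have "weyl_proj n A (f x) = g2 (weyl_proj n A x)" if x: "x \<in> carrier (DAAG n A)" for x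
  proof -
    have xG: "x \<in> carrier G" using x by (simp add: G_def)
    have "f x \<in> carrier G" using assms(1) x by (auto simp: auto_def hom_def G_def)
    moreover have pc: "pa x \<in> carrier Wt" using pa_surj xG by blast
    moreover have "ka (pa x) \<in> carrier (double_affine_weyl n A)" using hom_in_carrier[OF ka_hom pc] .
    ultimately show ?thesis using weyl_proj_pa assms(4)[OF xG] xG kik[OF pc] by (simp add: g2_def)
  qed
  ultimately show ?thesis using assms(1) unfolding Aut_descending_def by blast
qed

end

section \<open>Automorphism groups\<close>

lemma auto_mult: "f \<in> auto H \<Longrightarrow> f' \<in> auto H \<Longrightarrow> f \<otimes>\<^bsub>AutoGroup H\<^esub> f' = compose (carrier H) f f'"
  by (simp add: AutoGroup_def BijGroup_def auto_def)

lemma auto_one: "\<one>\<^bsub>AutoGroup H\<^esub> = (\<lambda>x\<in>carrier H. x)"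
  by (simp add: AutoGroup_def BijGroup_def)

lemma auto_carrier: "carrier (AutoGroup H) = auto H" by (simp add: AutoGroup_def)

lemma auto_hom: "f \<in> auto H \<Longrightarrow> f \<in> hom H H" by (simp add: auto_def)

lemma auto_eqI:
  assumes "f \<in> auto H" "f' \<in> auto H" "\<And>x. x \<in> carrier H \<Longrightarrow> f x = f' x"
  shows "f = f'"
proof (rule extensionalityI)
  show "f \<in> extensional (carrier H)" "f' \<in> extensional (carrier H)"
    using assms(1,2) by (auto simp: auto_def Bij_def)
qed (rule assms(3))

lemma auto_of_inverse:
  assumes "group H" "f \<in> hom H H" "f' \<in> hom H H"
    and "\<And>x. x \<in> carrier H \<Longrightarrow> f' (f x) = x" "\<And>x. x \<in> carrier H \<Longrightarrow> f (f' x) = x"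
  shows "restrict f (carrier H) \<in> auto H"
proof -
  interpret group H by (rule assms(1))
  have c: "f x \<in> carrier H" "f' x \<in> carrier H" if "x \<in> carrier H" for x
    using assms(2,3) that by (auto simp: hom_in_carrier)
  have "restrict f (carrier H) \<in> hom H H"
    by (rule homI) (use c assms(2) in \<open>auto simp: hom_mult\<close>)
  moreover have "bij_betw (restrict f (carrier H)) (carrier H) (carrier H)"
    by (rule bij_betw_byWitness[where f' = f']) (use c assms(4,5) in auto)
  ultimately show ?thesis by (simp add: auto_def Bij_def)
qed

lemma auto_inverse_apply:
  assumes "group H" "f \<in> auto H"
  shows "inv\<^bsub>AutoGroup H\<^esub> f \<in> auto H"
    and "x \<in> carrier H \<Longrightarrow> f ((inv\<^bsub>AutoGroup H\<^esub> f) x) = x"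
    and "x \<in> carrier H \<Longrightarrow> (inv\<^bsub>AutoGroup H\<^esub> f) (f x) = x"
proof -
  interpret A: group "AutoGroup H" by (rule group.AutoGroup[OF assms(1)])
  have f: "f \<in> carrier (AutoGroup H)" using assms(2) by (simp add: auto_carrier)
  show i: "inv\<^bsub>AutoGroup H\<^esub> f \<in> auto H" using A.inv_closed[OF f] by (simp add: auto_carrier)
  have "compose (carrier H) f (inv\<^bsub>AutoGroup H\<^esub> f) = (\<lambda>x\<in>carrier H. x)"
    using A.r_inv[OF f] auto_mult[OF assms(2) i] by (simp add: auto_one)
  then show "x \<in> carrier H \<Longrightarrow> f ((inv\<^bsub>AutoGroup H\<^esub> f) x) = x" by (metis compose_eq restrict_apply')
  have "compose (carrier H) (inv\<^bsub>AutoGroup H\<^esub> f) f = (\<lambda>x\<in>carrier H. x)"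
    using A.l_inv[OF f] auto_mult[OF i assms(2)] by (simp add: auto_one)
  then show "x \<in> carrier H \<Longrightarrow> (inv\<^bsub>AutoGroup H\<^esub> f) (f x) = x" by (metis compose_eq restrict_apply')
qed

section \<open>The automorphism group and the braid group morphism\<close>

context hat_data
begin

lemma frakG_group: "group (frakG n A)"
proof -
  have gG: "group (DAAG n A)" using G_group by (simp add: G_def)
  interpret AG: group "AutoGroup (DAAG n A)" by (rule group.AutoGroup[OF gG])
  define K where "K = {f \<in> Aut_descending n A. (\<forall>i\<in>{1..n}. f (T_elt n A i) = T_elt n A i) \<and>
                   f (X_elt n A (delta_scaled n A)) = X_elt n A (delta_scaled n A)}"
  have TX: "T_elt n A i \<in> carrier (DAAG n A)" if "i \<in> {1..n}" for i
    using Tt_closed[of i] that by (simp add: Tt_def G_def)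
  have Xd: "X_elt n A (delta_scaled n A) \<in> carrier (DAAG n A)"
    using X_elt_1[of dl] group.is_monoid[OF G_group]
    by (simp add: delta_io G_def[symmetric] monoid.m_closed)
  have wp: "weyl_proj n A x \<in> carrier (double_affine_weyl n A)" if "x \<in> carrier (DAAG n A)" for x
    using that hom_in_carrier[OF ka_hom hom_in_carrier[OF pa(1)]] weyl_proj_pa[of x] by (simp add: G_def)
  note DW = daw_group
  have "subgroup K (AutoGroup (DAAG n A))"
  proof
    show "K \<subseteq> carrier (AutoGroup (DAAG n A))" by (auto simp: K_def Aut_descending_def auto_carrier)
    have "(\<lambda>x\<in>carrier (DAAG n A). x) \<in> auto (DAAG n A)"
      "(\<lambda>x\<in>carrier (double_affine_weyl n A). x) \<in> auto (double_affine_weyl n A)"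
      using group.id_in_auto[OF gG] group.id_in_auto[OF DW] by auto
    then have "(\<lambda>x\<in>carrier (DAAG n A). x) \<in> Aut_descending n A"
      unfolding Aut_descending_def using wp by (auto intro!: bexI[of _ "\<lambda>x\<in>carrier (double_affine_weyl n A). x"])
    then show "\<one>\<^bsub>AutoGroup (DAAG n A)\<^esub> \<in> K" using TX Xd by (simp add: K_def auto_one)
  next
    fix f f' assume ff: "f \<in> K" "f' \<in> K"
    then obtain u u' where f: "f \<in> auto (DAAG n A)" "f' \<in> auto (DAAG n A)"
      "u \<in> auto (double_affine_weyl n A)" "u' \<in> auto (double_affine_weyl n A)"
      "\<And>x. x \<in> carrier (DAAG n A) \<Longrightarrow> weyl_proj n A (f x) = u (weyl_proj n A x)"
      "\<And>x. x \<in> carrier (DAAG n A) \<Longrightarrow> weyl_proj n A (f' x) = u' (weyl_proj n A x)"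
      by (auto simp: K_def Aut_descending_def)
    have fc: "f' x \<in> carrier (DAAG n A)" if "x \<in> carrier (DAAG n A)" for x
      using hom_in_carrier[OF auto_hom[OF f(2)] that] .
    have "compose (carrier (DAAG n A)) f f' \<in> auto (DAAG n A)"
      using AG.m_closed[of f f'] f(1,2) auto_mult[OF f(1,2)] by (simp add: auto_carrier)
    moreover have "compose (carrier (double_affine_weyl n A)) u u' \<in> auto (double_affine_weyl n A)"
      using monoid.m_closed[OF group.is_monoid[OF group.AutoGroup[OF DW]], of u u'] f(3,4) auto_mult[OF f(3,4)]
      by (simp add: auto_carrier)
    ultimately have "compose (carrier (DAAG n A)) f f' \<in> Aut_descending n A"
      unfolding Aut_descending_def using f(5,6) fc wp
      by (auto simp: compose_eq intro!: bexI[of _ "compose (carrier (double_affine_weyl n A)) u u'"])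
    then show "f \<otimes>\<^bsub>AutoGroup (DAAG n A)\<^esub> f' \<in> K"
      using ff TX Xd by (simp add: auto_mult[OF f(1,2)] K_def compose_eq)
  next
    fix f assume ff: "f \<in> K"
    then obtain u where f: "f \<in> auto (DAAG n A)" "u \<in> auto (double_affine_weyl n A)"
      "\<And>x. x \<in> carrier (DAAG n A) \<Longrightarrow> weyl_proj n A (f x) = u (weyl_proj n A x)"
      by (auto simp: K_def Aut_descending_def)
    define f' where "f' = inv\<^bsub>AutoGroup (DAAG n A)\<^esub> f"
    define u' where "u' = inv\<^bsub>AutoGroup (double_affine_weyl n A)\<^esub> u"
    note fi = auto_inverse_apply[OF gG f(1), folded f'_def]
    note ui = auto_inverse_apply[OF DW f(2), folded u'_def]
    have "weyl_proj n A (f' x) = u' (weyl_proj n A x)" if x: "x \<in> carrier (DAAG n A)" for x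
    proof -
      have c: "f' x \<in> carrier (DAAG n A)" using hom_in_carrier[OF auto_hom[OF fi(1)] x] .
      have "weyl_proj n A x = u (weyl_proj n A (f' x))" using f(3)[OF c] fi(2)[OF x] by simp
      then show ?thesis using ui(3)[OF wp[OF c]] by simp
    qed
    then have "f' \<in> Aut_descending n A" unfolding Aut_descending_def using fi(1) ui(1) by auto
    moreover have "f' (T_elt n A i) = T_elt n A i" if "i \<in> {1..n}" for i
      using fi(3)[OF TX[OF that]] ff that by (simp add: K_def)
    moreover have "f' (X_elt n A (delta_scaled n A)) = X_elt n A (delta_scaled n A)"
      using fi(3)[OF Xd] ff by (simp add: K_def)
    ultimately show "inv\<^bsub>AutoGroup (DAAG n A)\<^esub> f \<in> K" unfolding f'_def[symmetric] by (simp add: K_def)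
  qed
  then have "group ((AutoGroup (DAAG n A))\<lparr>carrier := K\<rparr>)" using AG.subgroup_imp_group by blast
  then show ?thesis by (simp add: frakG_def K_def)
qed

theorem braid_group_action:
  assumes js: "reduced_decomposition n A js (s_theta n A)"
  shows "(\<exists>!f. is_aut_a n A js f) \<and> (\<exists>!f. is_aut_b n A js f) \<and>
    (\<forall>f f'. is_aut_a n A js f \<and> is_aut_b n A js f' \<longrightarrow>
      (\<exists>\<Upsilon>. group_hom B3 (frakG n A) \<Upsilon> \<and> \<Upsilon> B3_a = f \<and> \<Upsilon> B3_b = f'))"
proof -
  interpret D: double_sys n c a e r par rk G Tt Xx Cc by (rule G_double_sys)
  interpret O: double_sys n c a e r par rk "opg G" Tt Xx Cc by (rule D.double_sys_op)
  interpret Wt: group Wt by (rule Wt_group)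
  note rj = reduced_red[OF js]
  define U where "U = D.TW (rf phi)"
  have Uc [simp]: "U \<in> carrier G" by (simp add: U_def)
  have U_tp: "U = D.tp js" using D.TW_red[OF rj(1)] rj(2) by (simp add: U_def)
  have wj: "wd js" using rj(1) by (rule red_wd)
  have T_prod: "T_prod n A js = U"
  proof -
    have "foldr (\<lambda>j y. T_elt n A j \<otimes>\<^bsub>G\<^esub> y) ks \<one>\<^bsub>G\<^esub> = D.tp ks" if "wd ks" for ks
      using that by (induction ks) (auto simp: Tt_def)
    then show ?thesis using wj by (simp only: T_prod_def U_tp G_def[symmetric])
  qed
  have T1: "T01 n A = Tt 0" by (simp add: T01_def Tt_def)
  have T2: "T02 n A = D.W"
  proof -
    have "unitv 0 - dl = - phi" by (simp add: phi_def)
    then have "X_elt n A (simple_root 0) = Xx (- phi) \<otimes>\<^bsub>G\<^esub> Cc"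
      using X_elt_1[of "unitv 0"] fin_closed(4)[OF phi_fin] by (metis simple_root_io)
    then show ?thesis unfolding T02_def D.W_def by (simp add: Tt_def G_def[symmetric])
  qed
  have T3: "T03 n A js = Xx phi \<otimes>\<^bsub>G\<^esub> inv\<^bsub>G\<^esub> U"
    unfolding T03_def phi_io X_elt_0[OF phi_fin] T_prod by (simp add: G_def[symmetric])
  have TT: "T_elt n A i = Tt i" if "i \<in> {1..n}" for i using that by (simp add: Tt_def)
  have Xm: "Xx (- phi) = inv\<^bsub>G\<^esub> Xx phi" by (rule D.X_minus) simp
  have CX: "Cc \<otimes>\<^bsub>G\<^esub> Xx (- phi) = Xx (- phi) \<otimes>\<^bsub>G\<^esub> Cc" by (rule D.C_X) simp
  \<comment> \<open>\<open>X3\<close> and \<open>C12\<close> recover X_phi and the central element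
    from T_01, T_02, T_03 and T_{s_theta}. Hence a homomorphism is determined by its values on these
    elements and T_1, ..., T_n, which gives uniqueness.\<close>
  have X3: "Xx phi = T03 n A js \<otimes>\<^bsub>G\<^esub> U" by (simp add: T3 D.G.m_assoc)
  have C12: "Cc = Tt 0 \<otimes>\<^bsub>G\<^esub> D.W \<otimes>\<^bsub>G\<^esub> Xx phi"
    using D.C_X[of phi] by (simp add: D.W_def D.G.m_assoc Xm)
  have hU: "f U = U" if "f \<in> hom G G" "\<And>i. i \<in> {1..n} \<Longrightarrow> f (Tt i) = Tt i" for f
  proof -
    have "f (D.tp ks) = D.tp ks" if "set ks \<subseteq> {1..n}" for ks
      using that
    proof (induction ks)
      case Nil
      then show ?case using hom_one[OF \<open>f \<in> hom G G\<close> G_group G_group] by simp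
    next
      case (Cons i ks)
      then show ?case using hom_mult[OF \<open>f \<in> hom G G\<close>, of "Tt i" "D.tp ks"] \<open>\<And>i. i \<in> {1..n} \<Longrightarrow> f (Tt i) = Tt i\<close> by simp
    qed
    then show ?thesis using rj(3) U_tp by simp
  qed
  have hinv: "f (inv\<^bsub>G\<^esub> x) = inv\<^bsub>G\<^esub> f x" if "f \<in> hom G G" "x \<in> carrier G" for f x
    using group_hom.hom_inv[of G G f x] that G_group by (simp add: group_hom_def group_hom_axioms_def)
  have hom_ext: "f x = f' x"
    if f: "f \<in> hom G G" "f' \<in> hom G G" "\<And>i. i \<in> {1..n} \<Longrightarrow> f (Tt i) = Tt i" "\<And>i. i \<in> {1..n} \<Longrightarrow> f' (Tt i) = Tt i"
      "f (Tt 0) = f' (Tt 0)" "f D.W = f' D.W" "f (T03 n A js) = f' (T03 n A js)" "x \<in> carrier G" for f f' x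
  proof -
    have c: "T03 n A js \<in> carrier G" by (simp add: T3)
    have fU: "f U = U" "f' U = U" by (rule hU; use f(1-4) in simp)+
    have X: "f (Xx phi) = f' (Xx phi)"
      unfolding X3 hom_mult[OF f(1) c Uc] hom_mult[OF f(2) c Uc] f(7) fU ..
    have "f (Tt 0 \<otimes>\<^bsub>G\<^esub> D.W \<otimes>\<^bsub>G\<^esub> Xx phi) = f' (Tt 0 \<otimes>\<^bsub>G\<^esub> D.W \<otimes>\<^bsub>G\<^esub> Xx phi)"
      using f(5,6) X by (simp add: hom_mult[OF f(1)] hom_mult[OF f(2)])
    then have "f Cc = f' Cc" by (simp only: C12[symmetric])
    moreover have "f (Tt i) = f' (Tt i)" if "i \<le> n" for i
      using that f(3-5) by (cases "i = 0") auto
    ultimately show ?thesis using gens_hom_eq[OF G_group f(1,2) _ X _ f(8)] by blast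
  qed
  have idG: "(\<lambda>x. x) \<in> hom G G" by (auto simp: hom_def)
  have comp_hom: "(\<lambda>x. f (f' x)) \<in> hom G H" if "f' \<in> hom G G'" "f \<in> hom G' H" for f f' and G' :: "('q, 'u) monoid_scheme" and H :: "('v, 'w) monoid_scheme"
    using hom_compose[OF that] by (simp add: comp_def)
  obtain ha where ha: "ha \<in> hom G G" "\<And>i. i \<le> n \<Longrightarrow> ha (Tt i) = (Tt(0 := D.W)) i"
    "\<And>b. b \<in> fin \<Longrightarrow> ha (Xx b) = Xx b" "ha Cc = Cc"
    using universal[OF D.double_sys_a] by blast
  \<comment> \<open>W formed in the opposite group is X_{alpha_0} T_0^-1. Sending T_0 to it inverts
    the first map, since multiplying it by T_0 on the right gives X_{alpha_0}, just as multiplying W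
    by T_0 on the left does.\<close>
  have O_W: "O.W = Cc \<otimes>\<^bsub>G\<^esub> Xx (- phi) \<otimes>\<^bsub>G\<^esub> inv\<^bsub>G\<^esub> Tt 0" by (simp add: O.W_def)
  have "double_sys n c a e r par rk (opg (opg G)) (Tt(0 := O.W)) Xx Cc"
    by (rule double_sys.double_sys_op[OF O.double_sys_a])
  then have "double_sys n c a e r par rk G (Tt(0 := O.W)) Xx Cc" by simp
  from universal[OF this] obtain ha' where ha': "ha' \<in> hom G G" "\<And>i. i \<le> n \<Longrightarrow> ha' (Tt i) = (Tt(0 := O.W)) i"
    "\<And>b. b \<in> fin \<Longrightarrow> ha' (Xx b) = Xx b" "ha' Cc = Cc"
    by blast
  have aa: "ha' (ha x) = x" "ha (ha' x) = x" if "x \<in> carrier G" for x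
  proof -
    have h1: "ha' D.W = Tt 0"
    proof -
      have "ha' D.W = inv\<^bsub>G\<^esub> O.W \<otimes>\<^bsub>G\<^esub> (Xx (- phi) \<otimes>\<^bsub>G\<^esub> Cc)"
        using ha' by (simp add: D.W_def hom_mult[OF ha'(1)] hinv[OF ha'(1)])
      also have "\<dots> = Tt 0" by (simp add: O_W CX D.G.inv_mult_group D.G.m_assoc)
      finally show ?thesis .
    qed
    have h2: "ha O.W = Tt 0"
    proof -
      have "ha O.W = Cc \<otimes>\<^bsub>G\<^esub> Xx (- phi) \<otimes>\<^bsub>G\<^esub> inv\<^bsub>G\<^esub> D.W"
        using ha by (simp add: O_W hom_mult[OF ha(1)] hinv[OF ha(1)])
      also have "\<dots> = Tt 0" by (simp add: D.W_def CX D.G.inv_mult_group D.G.m_assoc)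
      finally show ?thesis .
    qed
    have "ha' (ha (Tt i)) = Tt i" "ha (ha' (Tt i)) = Tt i" if "i \<le> n" for i
      using that h1 h2 ha(2)[OF that] ha'(2)[OF that] by (cases "i = 0"; simp)+
    then show "ha' (ha x) = x" "ha (ha' x) = x"
      using gens_hom_eq[OF G_group comp_hom[OF ha(1) ha'(1)] idG _ _ _ that]
        gens_hom_eq[OF G_group comp_hom[OF ha'(1) ha(1)] idG _ _ _ that] ha ha' by auto
  qed
  define a0 where "a0 = restrict ha (carrier G)"
  have a0: "a0 \<in> auto G" unfolding a0_def by (rule auto_of_inverse[OF G_group ha(1) ha'(1)]) (use aa in auto)
  have a0_apply: "x \<in> carrier G \<Longrightarrow> a0 x = ha x" for x by (simp add: a0_def)
  have haT: "ha (Tt i) = Tt i" if "i \<in> {1..n}" for i using ha(2)[of i] that by simp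
  have haU: "ha U = U" by (rule hU[OF ha(1) haT])
  have ha0: "ha (Tt 0) = D.W" using ha(2)[of 0] by simp
  have haW: "ha D.W = inv\<^bsub>G\<^esub> D.W \<otimes>\<^bsub>G\<^esub> Tt 0 \<otimes>\<^bsub>G\<^esub> D.W"
  proof -
    have "ha D.W = inv\<^bsub>G\<^esub> D.W \<otimes>\<^bsub>G\<^esub> (Xx (- phi) \<otimes>\<^bsub>G\<^esub> Cc)"
      using ha by (simp add: D.W_def[of] hom_mult[OF ha(1)] hinv[OF ha(1)])
    also have "Xx (- phi) \<otimes>\<^bsub>G\<^esub> Cc = Tt 0 \<otimes>\<^bsub>G\<^esub> D.W" by (simp add: D.W_def)
    finally show ?thesis by (simp add: D.G.m_assoc)
  qed
  have ha3: "ha (T03 n A js) = T03 n A js"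
    by (simp add: T3 hom_mult[OF ha(1)] hinv[OF ha(1)] ha haU)
  have isa: "is_aut_a n A js a0"
    unfolding is_aut_a_def T1 T2 G_def[symmetric] using a0 haT ha0 haW ha3 TT
    by (simp add: a0_apply T3)
  have G3c: "T03 n A js \<in> carrier G" by (simp add: T3)
  have uniq_a: "f = a0" if "is_aut_a n A js f" for f
  proof (rule auto_eqI[of _ G])
    have f: "f \<in> auto G" "\<And>i. i \<in> {1..n} \<Longrightarrow> f (Tt i) = Tt i" "f (T03 n A js) = T03 n A js"
      "f (Tt 0) = D.W" "f D.W = inv\<^bsub>G\<^esub> D.W \<otimes>\<^bsub>G\<^esub> Tt 0 \<otimes>\<^bsub>G\<^esub> D.W"
      using that TT unfolding is_aut_a_def T1 T2 G_def[symmetric] by auto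
    show "f \<in> auto G" "a0 \<in> auto G" by (rule f(1), rule a0)
    fix x assume "x \<in> carrier G"
    then show "f x = a0 x"
      by (rule hom_ext[OF auto_hom[OF f(1)] auto_hom[OF a0], rotated -1])
        (use f haT ha0 haW ha3 G3c in \<open>simp_all add: a0_apply\<close>)
  qed
  obtain Y where Y: "double_sys n c a e r par rk G Tt Y Cc" "Y phi = D.W \<otimes>\<^bsub>G\<^esub> U"
    using D.double_sys_b unfolding U_def by blast
  from universal[OF Y(1)] obtain hb' where hb': "hb' \<in> hom G G" "\<And>i. i \<le> n \<Longrightarrow> hb' (Tt i) = Tt i"
    "hb' (Xx phi) = D.W \<otimes>\<^bsub>G\<^esub> U" "hb' Cc = Cc"
    using Y(2) phi_fin by metis
  \<comment> \<open>In the opposite group lifts are products along reversed words. As s_theta is an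
    involution, its reversed word is again a reduced word of it, so the lift is the same
    element.\<close>
  have O_U: "O.TW (rf phi) = U"
  proof -
    have "O.tp ks = D.tp (rev ks)" for ks by (induction ks) auto
    moreover have "act (rev js) = rf phi"
    proof
      fix x
      have "act js (rf phi x) = x" using rj(2) rf_rf[OF B_phi_phi] by simp
      then have "V js x = rf phi x" using V_act[OF wj] by metis
      then show "act (rev js) x = rf phi x" by (simp add: act_rev)
    qed
    ultimately show ?thesis
      using O.TW_red[OF rj(1)] D.TW_red[OF red_rev[OF rj(1)]] rj(2) by (simp add: U_def)
  qed
  obtain Y' where Y': "double_sys n c a e r par rk (opg G) Tt Y' Cc" "Y' phi = U \<otimes>\<^bsub>G\<^esub> O.W"
    using O.double_sys_b unfolding O_U by auto
  have "double_sys n c a e r par rk (opg (opg G)) Tt Y' Cc" by (rule double_sys.double_sys_op[OF Y'(1)])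
  then have "double_sys n c a e r par rk G Tt Y' Cc" by simp
  from universal[OF this] obtain hb where hb: "hb \<in> hom G G" "\<And>i. i \<le> n \<Longrightarrow> hb (Tt i) = Tt i"
    "hb (Xx phi) = U \<otimes>\<^bsub>G\<^esub> O.W" "hb Cc = Cc"
    using Y'(2) phi_fin by metis
  have hbU: "hb U = U" "hb' U = U" using hU[OF hb(1)] hU[OF hb'(1)] hb(2) hb'(2) by auto
  have hbW: "hb D.W = T03 n A js"
  proof -
    have "hb D.W = inv\<^bsub>G\<^esub> Tt 0 \<otimes>\<^bsub>G\<^esub> (inv\<^bsub>G\<^esub> (U \<otimes>\<^bsub>G\<^esub> O.W) \<otimes>\<^bsub>G\<^esub> Cc)"
      using hb by (simp add: D.W_def Xm hom_mult[OF hb(1)] hinv[OF hb(1)])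
    also have "\<dots> = Xx phi \<otimes>\<^bsub>G\<^esub> (inv\<^bsub>G\<^esub> Cc \<otimes>\<^bsub>G\<^esub> (inv\<^bsub>G\<^esub> U \<otimes>\<^bsub>G\<^esub> Cc))"
      by (simp add: O_W Xm D.G.inv_mult_group D.G.m_assoc)
    also have "inv\<^bsub>G\<^esub> U \<otimes>\<^bsub>G\<^esub> Cc = Cc \<otimes>\<^bsub>G\<^esub> inv\<^bsub>G\<^esub> U"
      using D.G.comm_inv[of Cc U] D.C_tp[of js] by (simp add: U_tp)
    finally show ?thesis by (simp add: T3)
  qed
  have hb3: "hb (T03 n A js) = inv\<^bsub>G\<^esub> T03 n A js \<otimes>\<^bsub>G\<^esub> D.W \<otimes>\<^bsub>G\<^esub> T03 n A js"
  proof -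
    have "hb (T03 n A js) = U \<otimes>\<^bsub>G\<^esub> (Cc \<otimes>\<^bsub>G\<^esub> (Xx (- phi) \<otimes>\<^bsub>G\<^esub> (inv\<^bsub>G\<^esub> Tt 0 \<otimes>\<^bsub>G\<^esub> inv\<^bsub>G\<^esub> U)))"
      by (simp add: T3 hom_mult[OF hb(1)] hinv[OF hb(1)] hb hbU O_W D.G.m_assoc)
    moreover have "inv\<^bsub>G\<^esub> T03 n A js \<otimes>\<^bsub>G\<^esub> D.W \<otimes>\<^bsub>G\<^esub> T03 n A js
      = U \<otimes>\<^bsub>G\<^esub> (Xx (- phi) \<otimes>\<^bsub>G\<^esub> (inv\<^bsub>G\<^esub> Tt 0 \<otimes>\<^bsub>G\<^esub> (Xx (- phi) \<otimes>\<^bsub>G\<^esub> (Cc \<otimes>\<^bsub>G\<^esub> Xx phi \<otimes>\<^bsub>G\<^esub> inv\<^bsub>G\<^esub> U))))"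
      by (simp add: T3 D.W_def Xm D.G.inv_mult_group D.G.m_assoc)
    moreover have "\<dots> = U \<otimes>\<^bsub>G\<^esub> (Xx (- phi) \<otimes>\<^bsub>G\<^esub> (inv\<^bsub>G\<^esub> Tt 0 \<otimes>\<^bsub>G\<^esub> Cc \<otimes>\<^bsub>G\<^esub> inv\<^bsub>G\<^esub> U))"
      unfolding D.C_X[OF phi_fin] by (simp add: Xm D.G.m_assoc)
    moreover have "inv\<^bsub>G\<^esub> Tt 0 \<otimes>\<^bsub>G\<^esub> Cc = Cc \<otimes>\<^bsub>G\<^esub> inv\<^bsub>G\<^esub> Tt 0"
      using D.G.comm_inv[of Cc "Tt 0"] D.C_T[of 0] by simp
    moreover have "Xx (- phi) \<otimes>\<^bsub>G\<^esub> (Cc \<otimes>\<^bsub>G\<^esub> inv\<^bsub>G\<^esub> Tt 0 \<otimes>\<^bsub>G\<^esub> inv\<^bsub>G\<^esub> U)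
        = Cc \<otimes>\<^bsub>G\<^esub> (Xx (- phi) \<otimes>\<^bsub>G\<^esub> (inv\<^bsub>G\<^esub> Tt 0 \<otimes>\<^bsub>G\<^esub> inv\<^bsub>G\<^esub> U))"
      using CX by (simp add: D.G.m_assoc[symmetric])
    ultimately show ?thesis by simp
  qed
  have bb: "hb' (hb x) = x" "hb (hb' x) = x" if "x \<in> carrier G" for x
  proof -
    have W': "hb' O.W = inv\<^bsub>G\<^esub> U \<otimes>\<^bsub>G\<^esub> Xx phi"
    proof -
      have "hb' O.W = Cc \<otimes>\<^bsub>G\<^esub> inv\<^bsub>G\<^esub> (D.W \<otimes>\<^bsub>G\<^esub> U) \<otimes>\<^bsub>G\<^esub> inv\<^bsub>G\<^esub> Tt 0"
        using hb' by (simp add: O_W Xm hom_mult[OF hb'(1)] hinv[OF hb'(1)])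
      also have "\<dots> = Cc \<otimes>\<^bsub>G\<^esub> inv\<^bsub>G\<^esub> U \<otimes>\<^bsub>G\<^esub> (inv\<^bsub>G\<^esub> Cc \<otimes>\<^bsub>G\<^esub> Xx phi)"
        by (simp add: D.W_def Xm D.G.inv_mult_group D.G.m_assoc)
      also have "Cc \<otimes>\<^bsub>G\<^esub> inv\<^bsub>G\<^esub> U = inv\<^bsub>G\<^esub> U \<otimes>\<^bsub>G\<^esub> Cc"
        using D.G.comm_inv[of Cc U] D.C_tp[of js] by (simp add: U_tp)
      finally show ?thesis by (simp add: D.G.m_assoc)
    qed
    have h1: "hb' (hb (Xx phi)) = Xx phi"
    proof -
      have "O.W \<in> carrier G" by (simp add: O_W)
      then show ?thesis
        by (simp only: hb(3) hom_mult[OF hb'(1) Uc] W' hbU) simp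
    qed
    have h2: "hb (hb' (Xx phi)) = Xx phi"
      by (simp add: hb' hom_mult[OF hb(1)] hbW hbU X3[symmetric])
    have "hb' (hb (Tt i)) = Tt i" "hb (hb' (Tt i)) = Tt i" if "i \<le> n" for i
      using that hb hb' by auto
    then show "hb' (hb x) = x" "hb (hb' x) = x"
      using gens_hom_eq[OF G_group comp_hom[OF hb(1) hb'(1)] idG _ h1 _ that]
        gens_hom_eq[OF G_group comp_hom[OF hb'(1) hb(1)] idG _ h2 _ that] hb(4) hb'(4) by auto
  qed
  define b0 where "b0 = restrict hb (carrier G)"
  have b0: "b0 \<in> auto G" unfolding b0_def by (rule auto_of_inverse[OF G_group hb(1) hb'(1)]) (use bb in auto)
  have b0_apply: "x \<in> carrier G \<Longrightarrow> b0 x = hb x" for x by (simp add: b0_def)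
  have isb: "is_aut_b n A js b0"
    unfolding is_aut_b_def T1 T2 G_def[symmetric] using b0 hb(2) hbW hb3 TT G3c
    by (simp add: b0_apply)
  have uniq_b: "f = b0" if "is_aut_b n A js f" for f
  proof (rule auto_eqI[of _ G])
    have f: "f \<in> auto G" "\<And>i. i \<in> {1..n} \<Longrightarrow> f (Tt i) = Tt i" "f (Tt 0) = Tt 0"
      "f D.W = T03 n A js" "f (T03 n A js) = inv\<^bsub>G\<^esub> T03 n A js \<otimes>\<^bsub>G\<^esub> D.W \<otimes>\<^bsub>G\<^esub> T03 n A js"
      using that TT unfolding is_aut_b_def T1 T2 G_def[symmetric] by auto
    show "f \<in> auto G" "b0 \<in> auto G" by (rule f(1), rule b0)
    fix x assume "x \<in> carrier G"
    then show "f x = b0 x"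
      by (rule hom_ext[OF auto_hom[OF f(1)] auto_hom[OF b0], rotated -1])
        (use f hb(2) hbW hb3 G3c in \<open>simp_all add: b0_apply\<close>)
  qed
  have fixX: "X_elt n A (delta_scaled n A) = Cc"
    using X_elt_1[of dl] by (simp only: delta_io diff_self fin_closed D.X_0 D.G.l_one Cc_closed)
  have ss: "s i \<circ> s i = (\<lambda>x. x)" if "i \<le> n" for i using that by (auto simp: fun_eq_iff)
  have is0: "inv\<^bsub>Wt\<^esub> (sT 0) = sT 0"
    by (rule Wt.inv_equality) (auto simp: sT_def ss)
  have pgh: "group_hom G Wt pa"
    using pa(1) G_group Wt_group by (auto simp: group_hom_def group_hom_axioms_def)
  have paU: "pa U = (0, rf phi)"
  proof -
    have "pa (D.tp ks) = (0, act ks)" if "wd ks" for ks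
      using that
    proof (induction ks)
      case Nil
      have "act [] = (\<lambda>x. x)" by (rule ext) simp
      then show ?case using group_hom.hom_one[OF pgh] by (simp only: D.tp_simps Wt_simps)
    next
      case (Cons i ks)
      have "pa (D.tp (i # ks)) = pa (Tt i) \<otimes>\<^bsub>Wt\<^esub> pa (D.tp ks)" by (simp add: group_hom.hom_mult[OF pgh])
      moreover have "pa (Tt i) = sT i" "pa (D.tp ks) = (0, act ks)" using Cons pa(2)[of i] by auto
      moreover have "s i \<circ> act ks = act (i # ks)" by (rule ext) simp
      ultimately show ?case using Cons.prems s_zero[of i] by (simp only: sT_def Wt_simps wd_simps if_True add_0)
    qed
    then show ?thesis using wj rj(2) U_tp by metis
  qed
  have a0_desc: "a0 \<in> Aut_descending n A"
  proof -
    obtain ga where ga: "ga \<in> hom Wt Wt" "bij_betw ga (carrier Wt) (carrier Wt)"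
      "\<And>i. i \<in> {1..n} \<Longrightarrow> ga (sT i) = sT i" "ga (sT 0) = (- unitv 0, s 0)"
      "\<And>x. x \<in> lat \<Longrightarrow> ga (x, (\<lambda>x. x)) = (x, (\<lambda>x. x))"
      using ga_exists by blast
    have paW: "pa D.W = (- unitv 0, s 0)"
    proof -
      have "pa D.W = sT 0 \<otimes>\<^bsub>Wt\<^esub> (sX (- phi) \<otimes>\<^bsub>Wt\<^esub> (dl, (\<lambda>x. x)))"
        unfolding D.W_def by (simp add: group_hom.hom_mult[OF pgh] group_hom.hom_inv[OF pgh] pa is0)
      also have "\<dots> = (s 0 (- phi + dl), s 0)" by (simp add: sT_def sX_def comp_id_fun)
      also have "- phi + dl = unitv 0" by (simp add: phi_def)
      also have "s 0 (unitv 0) = - unitv 0" by (simp add: s_def fun_eq_iff c_diag)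
      finally show ?thesis .
    qed
    have "pa (ha x) = ga (pa x)" if "x \<in> carrier G" for x
    proof (rule gens_hom_eq[OF Wt_group comp_hom[OF ha(1) pa(1)] comp_hom[OF pa(1) ga(1)] _ _ _ that])
      show "pa (ha (Tt i)) = ga (pa (Tt i))" if "i \<le> n" for i
        using that haT[of i] ha0 paW ga(3)[of i] ga(4) pa(2)[OF that] by (cases "i = 0") auto
      show "pa (ha (Xx phi)) = ga (pa (Xx phi))"
        using ga(5)[OF fin_lat[OF phi_fin]] by (simp add: ha pa sX_def)
      show "pa (ha Cc) = ga (pa Cc)" using ga(5)[of dl] by (simp add: ha pa)
    qed
    then show ?thesis
      by (intro descends[OF _ ga(1,2)]) (use a0 in \<open>auto simp: a0_apply G_def[symmetric]\<close>)
  qed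
  have b0_desc: "b0 \<in> Aut_descending n A"
  proof -
    have t0: "tr (- 0) = (\<lambda>x. x)" by (simp only: minus_zero tr_zero)
    have td: "tr (- dl) = (\<lambda>x. x)" by (rule ext) (simp add: tr_def)
    have gbT: "gb (0, f) = (0, f)" for f
      unfolding gb_def prod.case t0 comp_id_fun B_zero by (simp only: div_0 sc_simps add_0)
    have gbC: "gb (dl, (\<lambda>x. x)) = (dl, (\<lambda>x. x))"
      unfolding gb_def prod.case td comp_id_fun B_dl by (simp only: div_0 sc_simps add_0_right)
    have gbX: "gb (phi, (\<lambda>x. x)) = (phi + dl, tr (- phi))"
      unfolding gb_def prod.case comp_id_fun B_phi_phi by simp
    \<comment> \<open>The inverse of \<open>tr_phi\<close>, since s_0 and s_theta are involutions.
      It matches the second component of \<open>gb\<close> at phi with the projection of the image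
      of X_phi.\<close>
    have trm: "tr (- phi) = rf phi \<circ> s 0"
    proof -
      have "tr phi \<circ> (rf phi \<circ> s 0) = (\<lambda>x. x)"
        unfolding tr_phi by (rule ext) (simp only: comp_apply rf_rf[OF B_phi_phi] s_s le0)
      then have "tr (- phi) \<circ> (tr phi \<circ> (rf phi \<circ> s 0)) = tr (- phi)" by (simp only: comp_id_fun)
      then show ?thesis unfolding comp_assoc[symmetric] tr_add by (simp only: left_minus tr_zero comp_id_fun)
    qed
    have rfd: "rf phi (dl + (- phi)) = phi + dl" by (simp add: rf_def B_phi_phi pr_phi_0 fun_eq_iff)
    have paX: "pa (U \<otimes>\<^bsub>G\<^esub> O.W) = (phi + dl, tr (- phi))"
    proof -
      have "pa (U \<otimes>\<^bsub>G\<^esub> O.W) = (0, rf phi) \<otimes>\<^bsub>Wt\<^esub> ((dl, (\<lambda>x. x)) \<otimes>\<^bsub>Wt\<^esub> sX (- phi) \<otimes>\<^bsub>Wt\<^esub> sT 0)"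
        unfolding O_W by (simp add: group_hom.hom_mult[OF pgh] group_hom.hom_inv[OF pgh] pa is0 paU)
      also have "\<dots> = (0 + rf phi (dl + (- phi) + 0), rf phi \<circ> s 0)"
        by (simp only: sX_def sT_def Wt_simps comp_id_fun if_True le0)
      finally show ?thesis unfolding trm[symmetric] by (simp only: add_0 add_0_right rfd)
    qed
    have "pa (hb x) = gb (pa x)" if "x \<in> carrier G" for x
    proof (rule gens_hom_eq[OF Wt_group comp_hom[OF hb(1) pa(1)] comp_hom[OF pa(1) gb_hom] _ _ _ that])
      show "pa (hb (Tt i)) = gb (pa (Tt i))" if "i \<le> n" for i
        using that gbT hb(2)[OF that] pa(2)[OF that] by (simp add: sT_def)
      show "pa (hb (Xx phi)) = gb (pa (Xx phi))" using paX gbX by (simp add: hb pa sX_def)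
      show "pa (hb Cc) = gb (pa Cc)" using gbC by (simp add: hb pa)
    qed
    then show ?thesis
      by (intro descends[OF _ gb_hom gb_bij]) (use b0 in \<open>auto simp: b0_apply G_def[symmetric]\<close>)
  qed
  have a0_frak: "a0 \<in> carrier (frakG n A)"
    using a0_desc haT ha(4) TT fixX by (simp add: frakG_def a0_apply)
  have b0_frak: "b0 \<in> carrier (frakG n A)"
    using b0_desc hb(2,4) TT fixX by (simp add: frakG_def b0_apply)
  have fmult: "f \<otimes>\<^bsub>frakG n A\<^esub> f' = compose (carrier G) f f'" if "f \<in> auto G" "f' \<in> auto G" for f f'
    using auto_mult[OF that] by (simp add: frakG_def G_def)
  interpret AG: group "AutoGroup G" by (rule group.AutoGroup[OF G_group])
  have acomp: "compose (carrier G) f f' \<in> auto G" if "f \<in> auto G" "f' \<in> auto G" for f f'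
    using AG.m_closed[of f f'] that auto_mult[OF that] by (simp add: auto_carrier)
  interpret F: group "frakG n A" by (rule frakG_group)
  have br: "a0 \<otimes>\<^bsub>frakG n A\<^esub> (b0 \<otimes>\<^bsub>frakG n A\<^esub> a0) = b0 \<otimes>\<^bsub>frakG n A\<^esub> (a0 \<otimes>\<^bsub>frakG n A\<^esub> b0)"
  proof -
    define L R where "L = compose (carrier G) a0 (compose (carrier G) b0 a0)"
      and "R = compose (carrier G) b0 (compose (carrier G) a0 b0)"
    have LR: "L \<in> auto G" "R \<in> auto G" unfolding L_def R_def using acomp a0 b0 by blast+
    have hac: "ha x \<in> carrier G" "hb x \<in> carrier G" if "x \<in> carrier G" for x
      using hom_in_carrier[OF ha(1) that] hom_in_carrier[OF hb(1) that] by auto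
    have Lx: "L x = ha (hb (ha x))" "R x = hb (ha (hb x))" if "x \<in> carrier G" for x
      using that hac by (simp_all add: L_def R_def compose_eq a0_apply b0_apply)
    have "L = R"
    proof (rule auto_eqI[OF LR])
      fix x assume x: "x \<in> carrier G"
      \<comment> \<open>Both composites send T_01 to T_03, and T_02 to T_03^-1 T_02 T_03.\<close>
      have "ha (hb (ha x)) = hb (ha (hb x))"
      proof (rule hom_ext[OF comp_hom[OF comp_hom[OF ha(1) hb(1)] ha(1)] comp_hom[OF comp_hom[OF hb(1) ha(1)] hb(1)] _ _ _ _ _ x])
        show "ha (hb (ha (Tt i))) = Tt i" "hb (ha (hb (Tt i))) = Tt i" if "i \<in> {1..n}" for i
          using that haT hb(2) by auto
        show "ha (hb (ha (Tt 0))) = hb (ha (hb (Tt 0)))" using hb(2)[of 0] by (simp add: ha0 hbW ha3)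
        show "ha (hb (ha D.W)) = hb (ha (hb D.W))"
          using hb(2)[of 0] by (simp add: haW hbW hb3 ha3 ha0 G3c hom_mult[OF ha(1)] hom_mult[OF hb(1)] hinv[OF ha(1)] hinv[OF hb(1)])
        show "ha (hb (ha (T03 n A js))) = hb (ha (hb (T03 n A js)))"
          using hb(2)[of 0] G3c
          by (simp add: haW hbW hb3 ha3 ha0 hom_mult[OF ha(1)] hom_mult[OF hb(1)] hinv[OF ha(1)] hinv[OF hb(1)]
              D.G.inv_mult_group D.G.m_assoc)
      qed
      then show "L x = R x" using Lx[OF x] by simp
    qed
    then show ?thesis using a0 b0 acomp by (simp add: fmult L_def R_def)
  qed
  define f0 where "f0 = (\<lambda>y. case y of Gen_a \<Rightarrow> a0 | Gen_b \<Rightarrow> b0)"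
  have f0c: "f0 ` UNIV \<subseteq> carrier (frakG n A)" using a0_frak b0_frak by (auto simp: f0_def split: braid3_gen.splits)
  have rel: "word_eval (frakG n A) f0 u = word_eval (frakG n A) f0 v" if "(u, v) \<in> B3_rels" for u v
    using that a0_frak b0_frak br by (simp add: B3_rels_def f0_def)
  define Ups where "Ups = pres_lift (frakG n A) f0"
  have "Ups \<in> hom B3 (frakG n A)" unfolding Ups_def B3_def by (rule F.pres_lift_hom[OF f0c rel])
  then have gh: "group_hom B3 (frakG n A) Ups"
    using presented_group frakG_group by (simp add: group_hom_def group_hom_axioms_def B3_def)
  have "Ups B3_a = word_eval (frakG n A) f0 [(Gen_a, True)]" "Ups B3_b = word_eval (frakG n A) f0 [(Gen_b, True)]"
    unfolding Ups_def B3_a_def B3_b_def by (rule F.pres_lift_class[OF f0c _ rel]; simp)+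
  then have "Ups B3_a = a0" "Ups B3_b = b0" using a0_frak b0_frak by (simp_all add: f0_def)
  then show ?thesis using isa isb uniq_a uniq_b gh by blast
qed

end

section \<open>Numerical labels\<close>

text \<open>A node \<open>m\<close> with label 1 settles both points: it makes the gcd 1, and any
  other solution is then an integral multiple of \<open>N\<close>, by a factor that divides its own
  gcd.\<close>

lemma num_labels_eqI:
  fixes N :: "nat \<Rightarrow> nat"
  assumes pos: "\<And>j. j \<le> n \<Longrightarrow> 0 < N j" and out: "\<And>j. n < j \<Longrightarrow> N j = 0"
    and m: "m \<le> n" "N m = 1"
    and null: "\<And>i. i \<le> n \<Longrightarrow> (\<Sum>j\<le>n. A i j * int (N j)) = 0"
    and line: "\<And>b j. (\<And>i. i \<le> n \<Longrightarrow> (\<Sum>j\<le>n. A i j * int (b j)) = 0) \<Longrightarrow> j \<le> n \<Longrightarrow> b j = b m * N j"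
  shows "num_labels n A = N"
  unfolding num_labels_def
proof (rule the_equality)
  have "Gcd (N ` {..n}) dvd N m" using m(1) by (intro Gcd_dvd) auto
  then show "(\<forall>j\<le>n. N j > 0) \<and> (\<forall>j>n. N j = 0) \<and> Gcd (N ` {..n}) = 1 \<and> (\<forall>i\<le>n. (\<Sum>j\<le>n. A i j * int (N j)) = 0)"
    using pos out null m(2) by simp
next
  fix b :: "nat \<Rightarrow> nat"
  assume b: "(\<forall>j\<le>n. b j > 0) \<and> (\<forall>j>n. b j = 0) \<and> Gcd (b ` {..n}) = 1 \<and> (\<forall>i\<le>n. (\<Sum>j\<le>n. A i j * int (b j)) = 0)"
  then have l: "b j = b m * N j" if "j \<le> n" for j using line[of b j] that by blast
  have "b m dvd Gcd (b ` {..n})" by (rule Gcd_greatest) (auto simp: l)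
  then have "b m = 1" using b by simp
  then show "b = N" using l b out by (intro ext) (metis mult_1 not_le)
qed

context affine_data
begin

lemma kernel_line:
  assumes "\<And>i. i \<le> n \<Longrightarrow> (\<Sum>j\<le>n. c i j * x j) = 0" "j \<le> n"
  shows "x j = x 0 * a j"
proof -
  define y where "y = (\<lambda>j. if j \<le> n then x j else 0)"
  have "pr y i = 0" if "i \<le> n" for i using assms(1)[OF that] by (simp add: pr_def y_def)
  then have "B y y = 0" by (simp add: B_def)
  moreover have "y \<in> lat" by (simp add: lat_def y_def)
  ultimately have "y = sc (y 0) dl" by (rule B_zero_imp)
  then have "y j = y 0 * dl j" by (metis sc_apply)
  then show ?thesis using assms(2) by (simp add: y_def dl_def)
qed

text \<open>Kac's labels of \<open>A\<close> and of its transpose are found by rescaling the null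
  vector \<open>a\<close>: null vectors of \<open>A\<close> are those of \<open>c\<close> divided by
  \<open>u\<close>, null vectors of the transpose are those of \<open>c\<close> multiplied by
  \<open>e\<close> and \<open>u\<close>.\<close>

lemma hat_dataI:
  assumes g: "\<And>j. g j = (if h \<and> j = n then 1 / 2 else 1)"
    and h: "h \<longleftrightarrow> is_A2n_twisted n A" "h \<Longrightarrow> a n = 1"
    and cA: "\<And>i j. i \<le> n \<Longrightarrow> j \<le> n \<Longrightarrow> real_of_int (c i j) = real_of_int (A i j) * g j / g i"
  shows "hat_data n c a e r par rk A h g"
proof -
  \<comment> \<open>The integral inverse of \<open>g\<close>; with it the relation between
    \<open>c\<close> and \<open>A\<close> has no denominators.\<close>
  define u :: "nat \<Rightarrow> int" where "u j = (if h \<and> j = n then 2 else 1)" for j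
  have ug: "real_of_int (u j) * g j = 1" for j by (simp add: u_def g)
  have gne: "g j \<noteq> 0" "g 0 = 1" for j using n_pos by (simp_all add: g)
  have uc: "u j * c i j = u i * A i j" if "i \<le> n" "j \<le> n" for i j
  proof -
    have "real_of_int (u j) * (real_of_int (A i j) * g j / g i) = real_of_int (u i) * real_of_int (A i j)"
      using ug[of j] ug[of i] gne(1)[of i] by (simp add: field_simps)
    then have "real_of_int (u j * c i j) = real_of_int (u i * A i j)" using cA[OF that] by simp
    then show ?thesis by (simp only: of_int_eq_iff)
  qed
  have u_pos: "u j > 0" for j by (simp add: u_def)
  have u0: "u 0 = 1" using n_pos by (simp add: u_def)
  define N where "N j = (if j \<le> n then nat ((if h \<and> j \<noteq> n then 2 else 1) * a j) else 0)" for j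
  define q :: int where "q = (if h then 2 else 1)"
  have N: "int (N j) * u j = q * a j" if "j \<le> n" for j
    using a_pos[OF that] that by (simp add: N_def u_def q_def)
  have "num_labels n A = N"
  proof (rule num_labels_eqI)
    show "0 < N j" if "j \<le> n" for j using a_pos[OF that] that by (simp add: N_def)
    show "N j = 0" if "n < j" for j using that by (simp add: N_def)
    \<comment> \<open>A node with label 1: node 0, except in the twisted case, where a_0 is 2 and
      node \<open>n\<close> is taken.\<close>
    show "(if h then n else 0) \<le> n" "N (if h then n else 0) = 1" using a_0 h(2) n_pos by (auto simp: N_def)
  next
    fix i assume i: "i \<le> n"
    have "u i * (\<Sum>j\<le>n. A i j * int (N j)) = (\<Sum>j\<le>n. (u i * A i j) * int (N j))"
      by (simp add: sum_distrib_left mult.assoc)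
    also have "\<dots> = (\<Sum>j\<le>n. q * (c i j * a j))"
    proof (rule sum.cong[OF HOL.refl])
      fix j assume j: "j \<in> {..n}"
      have "u i * A i j * int (N j) = c i j * (int (N j) * u j)"
        using uc[OF i, of j, symmetric] j by (simp only: mult_ac atMost_iff)
      also have "int (N j) * u j = q * a j" using N j by simp
      finally show "u i * A i j * int (N j) = q * (c i j * a j)" by (simp only: mult_ac)
    qed
    also have "\<dots> = 0" unfolding sum_distrib_left[symmetric] a_null[OF i] by simp
    finally show "(\<Sum>j\<le>n. A i j * int (N j)) = 0" using u_pos[of i] by simp
  next
    fix b :: "nat \<Rightarrow> nat" and j
    assume b: "\<And>i. i \<le> n \<Longrightarrow> (\<Sum>j\<le>n. A i j * int (b j)) = 0" and j: "j \<le> n"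
    have k: "u j * int (b j) = int (b 0) * a j" if "j \<le> n" for j
    proof -
      have "u j * int (b j) = u 0 * int (b 0) * a j"
      proof (rule kernel_line[OF _ that])
        fix i assume i: "i \<le> n"
        have "(\<Sum>j\<le>n. c i j * (u j * int (b j))) = (\<Sum>j\<le>n. u i * (A i j * int (b j)))"
          by (rule sum.cong[OF HOL.refl]) (use uc[OF i] in \<open>simp add: mult_ac\<close>)
        then show "(\<Sum>j\<le>n. c i j * (u j * int (b j))) = 0" using b[OF i] by (simp flip: sum_distrib_left)
      qed
      then show ?thesis using u0 by simp
    qed
    show "b j = b (if h then n else 0) * N j"
    proof (cases h)
      case True
      have "2 * int (b n) = int (b 0)" using k[of n] True h(2) by (simp add: u_def)
      then have "u j * int (b j) = int (b n) * (int (N j) * u j)" using k[OF j] N[OF j] True by (simp add: q_def)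
      then have "int (b j) = int (b n * N j)" using u_pos[of j] by simp
      then show ?thesis using True by (simp only: of_nat_eq_iff if_True)
    next
      case False
      then have "int (b j) = int (b 0 * N j)" using k[OF j] N[OF j] by (simp add: u_def q_def)
      then show ?thesis using False by (simp only: of_nat_eq_iff if_False)
    qed
  qed
  note N_eq = this
  define M where "M j = (if j \<le> n then nat (e j * a j * u j) else 0)" for j
  have M: "int (M j) = e j * a j * u j" if "j \<le> n" for j
    using a_pos[OF that] e_pos[OF that] u_pos[of j] that by (simp add: M_def)
  have "num_labels n (\<lambda>i j. A j i) = M"
  proof (rule num_labels_eqI)
    show "0 < M j" if "j \<le> n" for j using a_pos[OF that] e_pos[OF that] u_pos[of j] that by (simp add: M_def)
    show "M j = 0" if "n < j" for j using that by (simp add: M_def)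
    show "0 \<le> n" "M 0 = 1" using a_0 e_0 u0 by (auto simp: M_def)
  next
    fix i assume i: "i \<le> n"
    have "(\<Sum>j\<le>n. A j i * int (M j)) = (\<Sum>j\<le>n. u i * e i * (c i j * a j))"
    proof (rule sum.cong[OF HOL.refl])
      fix j assume j: "j \<in> {..n}"
      have "A j i * int (M j) = e j * a j * (u j * A j i)" using j by (simp add: M mult_ac)
      also have "\<dots> = a j * u i * (e j * c j i)" using uc[of j i] i j by (simp add: mult_ac)
      also have "\<dots> = a j * u i * (e i * c i j)" using c_sym[of j i] i j by simp
      finally show "A j i * int (M j) = u i * e i * (c i j * a j)" by (simp add: mult_ac)
    qed
    then show "(\<Sum>j\<le>n. A j i * int (M j)) = 0" using a_null[OF i] by (simp flip: sum_distrib_left)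
  next
    fix b :: "nat \<Rightarrow> nat" and j
    assume b: "\<And>i. i \<le> n \<Longrightarrow> (\<Sum>j\<le>n. A j i * int (b j)) = 0" and j: "j \<le> n"
    \<comment> \<open>\<open>v\<close> and \<open>w\<close> are complementary factors,
      \<open>u j * v j = 2\<close> and \<open>e j * w j = r\<close>; they replace division by
      \<open>u\<close> and \<open>e\<close> in the integers.\<close>
    define v where "v j = (if u j = 2 then 1 else 2 :: int)" for j
    have uv: "u j * v j = 2" for j by (simp add: u_def v_def)
    define w where "w j = (if e j = 1 then r else 1)" for j
    have ew: "e j * w j = r" if "j \<le> n" for j using e_cases[OF that] by (auto simp: w_def)
    have "w j * v j * int (b j) = w 0 * v 0 * int (b 0) * a j"
    proof (rule kernel_line[OF _ j])
      fix i assume i: "i \<le> n"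
      have "u i * e i * (\<Sum>j\<le>n. c i j * (w j * v j * int (b j))) = (\<Sum>j\<le>n. 2 * r * (A j i * int (b j))) * 1"
        unfolding sum_distrib_left mult_1_right
      proof (rule sum.cong[OF HOL.refl])
        fix j assume j: "j \<in> {..n}"
        have "u i * e i * (c i j * (w j * v j * int (b j))) = (u i * c j i) * (e j * w j) * (v j * int (b j))"
          using c_sym[of i j] i j by (simp add: mult_ac)
        also have "\<dots> = (u j * v j) * r * (A j i * int (b j))" using uc[of j i] ew[of j] i j by (simp add: mult_ac)
        finally show "u i * e i * (c i j * (w j * v j * int (b j))) = 2 * r * (A j i * int (b j))" by (simp only: uv)
      qed
      also have "\<dots> = 0" using b[OF i] by (simp flip: sum_distrib_left)
      finally show "(\<Sum>j\<le>n. c i j * (w j * v j * int (b j))) = 0" using u_pos[of i] e_pos[OF i] by simp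
    qed
    then have "(u j * v j) * (e j * w j) * int (b j) = e j * u j * (w 0 * v 0 * int (b 0) * a j)" by (simp add: mult_ac)
    also have "\<dots> = 2 * r * (int (b 0) * int (M j))" using M[OF j] e_0 u0 by (simp add: w_def v_def mult_ac)
    finally have "int (b j) = int (b 0 * M j)" using ew[OF j] uv[of j] r_pos by simp
    then show "b j = b 0 * M j" by (simp only: of_nat_eq_iff)
  qed
  note M_eq = this
  show ?thesis
  proof unfold_locales
    fix j assume j: "j \<le> n"
    have "real (N j) * real_of_int (u j) = (if h then 2 else 1) * real_of_int (a j)"
      using arg_cong[OF N[OF j], of real_of_int] by (simp add: q_def split: if_splits)
    then have "real (N j) * (real_of_int (u j) * g j) = (if h then 2 else 1) * real_of_int (a j) * g j"
      by (simp only: mult.assoc[symmetric])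
    then show "real (num_labels n A j) = (if h then 2 else 1) * g j * real_of_int (a j)"
      unfolding N_eq ug by (simp add: mult_ac)
    have "real (M j) = real_of_int (e j * a j) * real_of_int (u j)" using arg_cong[OF M[OF j], of real_of_int] by simp
    then show "real (dual_labels n A j) = real_of_int (e j * a j) / g j"
      unfolding dual_labels_def M_eq using ug[of j] gne(1)[of j] by (simp add: field_simps)
  next
    show "num_labels n A j = 0" if "n < j" for j using that by (simp add: N_eq N_def)
  qed (use g h cA in blast)+
qed

lemma hat_data_untwisted:
  assumes "\<And>i j. i \<le> n \<Longrightarrow> j \<le> n \<Longrightarrow> A i j = c i j" "\<not> is_A2n_twisted n A"
  shows "hat_data n c a e r par rk A False (\<lambda>_. 1)"
  by (rule hat_dataI) (use assms in auto)

end

section \<open>The affine types\<close>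

text \<open>Reduces a row of a Cartan matrix to its few nonzero entries, at a node and its
  neighbours.\<close>

lemma sum_sparse:
  fixes f :: "nat \<Rightarrow> int"
  assumes "distinct ks" "set ks \<subseteq> {..n}" "\<And>j. j \<le> n \<Longrightarrow> j \<notin> set ks \<Longrightarrow> f j = 0"
  shows "(\<Sum>j\<le>n. f j) = sum_list (map f ks)"
proof -
  have "(\<Sum>j\<le>n. f j) = sum f (set ks)" by (rule sum.mono_neutral_right) (use assms in auto)
  then show ?thesis using assms(1) by (simp add: sum.distinct_set_conv_list)
qed

lemma chain_iff [simp]: "(i, j, p, q) \<in> chain k l \<longleftrightarrow> j = Suc i \<and> p = 1 \<and> q = 1 \<and> k \<le> i \<and> i < l"
  by (auto simp: chain_def)

lemma kac_labelled_bond: "kac_labelled X n A \<Longrightarrow> (i, j, p, q) \<in> bonds X \<Longrightarrow> A i j = - p \<and> A j i = - q"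
  unfolding kac_labelled_def by blast

lemma kac_labelled_diag: "kac_labelled X n A \<Longrightarrow> i \<le> n \<Longrightarrow> A i i = 2"
  unfolding kac_labelled_def by blast

lemma kac_labelled_zero:
  "kac_labelled X n A \<Longrightarrow> i \<le> n \<Longrightarrow> j \<le> n \<Longrightarrow> i \<noteq> j \<Longrightarrow>
    (\<And>p q. (i, j, p, q) \<notin> bonds X \<and> (j, i, p, q) \<notin> bonds X) \<Longrightarrow> A i j = 0"
  unfolding kac_labelled_def by blast

definition laced :: "affine_type \<Rightarrow> nat \<Rightarrow> nat \<Rightarrow> int" where
  "laced X i j = (if i = j then 2 else if (i, j, 1, 1) \<in> bonds X \<or> (j, i, 1, 1) \<in> bonds X then -1 else 0)"

lemma laced_eq:
  assumes "kac_labelled X n A" "\<And>i j p q. (i, j, p, q) \<in> bonds X \<Longrightarrow> p = 1 \<and> q = 1" "i \<le> n" "j \<le> n"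
  shows "A i j = laced X i j"
  using kac_labelled_bond[OF assms(1)] kac_labelled_diag[OF assms(1)] kac_labelled_zero[OF assms(1,3,4)] assms(2-4)
  by (auto simp: laced_def) metis+

lemma laced_affine_data:
  assumes "1 \<le> n" "\<And>i. i \<le> n \<Longrightarrow> 0 < a i" "a 0 = 1" "\<And>i. i \<le> n \<Longrightarrow> (\<Sum>j\<le>n. laced X i j * a j) = 0"
    and par: "\<And>k. k \<in> {1..n} \<Longrightarrow> par k \<le> n \<and> rk (par k) < rk k \<and> ((k, par k, 1, 1) \<in> bonds X \<or> (par k, k, 1, 1) \<in> bonds X)"
  shows "affine_data n (laced X) a (\<lambda>_. 1) 1 par rk"
proof
  have "par k \<le> n \<and> rk (par k) < rk k \<and> laced X k (par k) = -1" if "k \<in> {1..n}" for k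
    using par[OF that] by (auto simp: laced_def)
  then show "\<And>k. k \<in> {1..n} \<Longrightarrow> par k \<le> n \<and> rk (par k) < rk k \<and> laced X k (par k) < 0"
    "(\<forall>k\<in>{1..n}. laced X k (par k) = -1 \<and> laced X 0 k \<in> {0, -1}) \<or>
      ((\<forall>k\<le>n. a k = 1) \<and> (\<forall>k\<in>{1..<n}. laced X k (k - 1) = -1) \<and> laced X 0 1 = -2 \<and> laced X n (n - 1) = -2 \<and>
       (\<forall>i\<le>n. \<forall>j\<le>n. i + 2 \<le> j \<longrightarrow> laced X i j = 0 \<and> laced X j i = 0))"
    by (auto simp: laced_def)
qed (use assms in \<open>auto simp: laced_def\<close>)

lemma le_8: "(i::nat) \<le> 8 \<longleftrightarrow> i = 0 \<or> i = 1 \<or> i = 2 \<or> i = 3 \<or> i = 4 \<or> i = 5 \<or> i = 6 \<or> i = 7 \<or> i = 8"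
  by auto
lemma le_7: "(i::nat) \<le> 7 \<longleftrightarrow> i = 0 \<or> i = 1 \<or> i = 2 \<or> i = 3 \<or> i = 4 \<or> i = 5 \<or> i = 6 \<or> i = 7"
  by auto
lemma le_6: "(i::nat) \<le> 6 \<longleftrightarrow> i = 0 \<or> i = 1 \<or> i = 2 \<or> i = 3 \<or> i = 4 \<or> i = 5 \<or> i = 6"
  by auto
lemma le_2: "(i::nat) \<le> 2 \<longleftrightarrow> i = 0 \<or> i = 1 \<or> i = 2" by auto
lemma le_4: "(i::nat) \<le> 4 \<longleftrightarrow> i = 0 \<or> i = 1 \<or> i = 2 \<or> i = 3 \<or> i = 4"
  by auto
lemma atMost_numeral: "{..numeral k :: nat} = insert (numeral k) {..pred_numeral k}"
  by (simp add: numeral_eq_Suc atMost_Suc)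

lemma affine_data_E8:
  "affine_data 8 (laced (Aff1_E 8)) (\<lambda>k. [1, 2, 3, 4, 5, 6, 4, 2, 3] ! k) (\<lambda>_. 1) 1
    (\<lambda>k. if k = 8 then 5 else k - 1) (\<lambda>k. k)"
proof (rule laced_affine_data)
  fix i :: nat assume "i \<le> 8"
  then show "0 < [1, 2, 3, 4, 5, 6, 4, 2, 3 :: int] ! i"
    "(\<Sum>j\<le>8. laced (Aff1_E 8) i j * [1, 2, 3, 4, 5, 6, 4, 2, 3] ! j) = 0"
    unfolding le_8 by (elim disjE; simp add: atMost_numeral laced_def)+
qed (auto split: if_splits)

lemma affine_data_E7:
  "affine_data 7 (laced (Aff1_E 7)) (\<lambda>k. [1, 2, 3, 4, 3, 2, 1, 2] ! k) (\<lambda>_. 1) 1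
    (\<lambda>k. if k = 7 then 3 else k - 1) (\<lambda>k. k)"
proof (rule laced_affine_data)
  fix i :: nat assume "i \<le> 7"
  then show "0 < [1, 2, 3, 4, 3, 2, 1, 2 :: int] ! i"
    "(\<Sum>j\<le>7. laced (Aff1_E 7) i j * [1, 2, 3, 4, 3, 2, 1, 2] ! j) = 0"
    unfolding le_7 by (elim disjE; simp add: atMost_numeral laced_def)+
qed (auto split: if_splits)

text \<open>The list for \<open>par\<close> orients the tree towards 0 through the nodes 3 and 6,
  and \<open>rk\<close> is the distance from 0.\<close>

lemma affine_data_E6:
  "affine_data 6 (laced (Aff1_E 6)) (\<lambda>k. [1, 1, 2, 3, 2, 1, 2] ! k) (\<lambda>_. 1) 1
    (\<lambda>k. [0, 2, 3, 6, 3, 4, 0] ! k) (\<lambda>k. [0, 4, 3, 2, 3, 4, 1] ! k)"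
proof (rule laced_affine_data)
  fix i :: nat assume "i \<le> 6"
  then show "0 < [1, 1, 2, 3, 2, 1, 2 :: int] ! i"
    "(\<Sum>j\<le>6. laced (Aff1_E 6) i j * [1, 1, 2, 3, 2, 1, 2] ! j) = 0"
    unfolding le_6 by (elim disjE; simp add: atMost_numeral laced_def)+
next
  fix k :: nat assume "k \<in> {1..6}"
  then have "k \<le> 6" "k \<noteq> 0" by auto
  then show "[0, 2, 3, 6, 3, 4, 0] ! k \<le> (6::nat) \<and> [0, 4, 3, 2, 3, 4, 1] ! ([0, 2, 3, 6, 3, 4, 0] ! k) < ([0, 4, 3, 2, 3, 4, 1] ! k :: nat) \<and>
    ((k, [0, 2, 3, 6, 3, 4, 0] ! k, 1, 1) \<in> bonds (Aff1_E 6) \<or> ([0, 2, 3, 6, 3, 4, 0] ! k, k, 1, 1) \<in> bonds (Aff1_E 6))"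
    unfolding le_6 by (elim disjE; simp)
qed auto

lemma affine_data_cycle:
  assumes "2 \<le> n"
  shows "affine_data n (laced (Aff1_A n)) (\<lambda>_. 1) (\<lambda>_. 1) 1 (\<lambda>k. k - 1) (\<lambda>k. k)"
proof (rule laced_affine_data)
  fix i assume i: "i \<le> n"
  consider "i = 0" | "i = n" | "0 < i" "i < n" using i by linarith
  then show "(\<Sum>j\<le>n. laced (Aff1_A n) i j * 1) = 0"
  proof cases
    case 1
    show ?thesis
      by (subst sum_sparse[of "[0, 1, n]"]) (use 1 assms in \<open>auto simp: laced_def\<close>)
  next
    case 2
    show ?thesis
      by (subst sum_sparse[of "[0, n - 1, n]"]) (use 2 assms in \<open>auto simp: laced_def\<close>)
  next
    case 3
    show ?thesis
      by (subst sum_sparse[of "[i - 1, i, i + 1]"]) (use 3 assms in \<open>auto simp: laced_def\<close>)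
  qed
qed (use assms in auto)

lemma affine_data_D:
  assumes "4 \<le> n"
  shows "affine_data n (laced (Aff1_D n)) (\<lambda>k. if k \<in> {0, 1, n - 1, n} then 1 else 2) (\<lambda>_. 1) 1
    (\<lambda>k. if k = 1 then 2 else if k = 2 then 0 else if k = n then n - 2 else k - 1)
    (\<lambda>k. if k = 1 then 2 else if k = 2 then 1 else k)"
proof (rule laced_affine_data)
  fix i assume i: "i \<le> n"
  consider "i = 0" | "i = 1" | "i = 2" "n = 4" | "i = 2" "4 < n" | "2 < i" "i + 2 < n" | "2 < i" "i + 2 = n" | "i + 1 = n" | "i = n"
    using i assms by linarith
  then show "(\<Sum>j\<le>n. laced (Aff1_D n) i j * (if j \<in> {0, 1, n - 1, n} then 1 else 2)) = 0"
  proof cases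
    case 1
    show ?thesis by (subst sum_sparse[of "[0, 2]"]) (use 1 assms in \<open>auto simp: laced_def\<close>)
  next
    case 2
    show ?thesis by (subst sum_sparse[of "[1, 2]"]) (use 2 assms in \<open>auto simp: laced_def\<close>)
  next
    case 3
    show ?thesis by (subst sum_sparse[of "[0, 1, 2, 3, 4]"]) (use 3 assms in \<open>auto simp: laced_def\<close>)
  next
    case 4
    show ?thesis by (subst sum_sparse[of "[0, 1, 2, 3]"]) (use 4 assms in \<open>auto simp: laced_def\<close>)
  next
    case 5
    show ?thesis by (subst sum_sparse[of "[i - 1, i, i + 1]"]) (use 5 assms in \<open>auto simp: laced_def\<close>)
  next
    case 6
    show ?thesis by (subst sum_sparse[of "[i - 1, i, i + 1, i + 2]"]) (use 6 assms in \<open>auto simp: laced_def\<close>)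
  next
    case 7
    show ?thesis by (subst sum_sparse[of "[i - 1, i]"]) (use 7 assms in \<open>auto simp: laced_def\<close>)
  next
    case 8
    show ?thesis by (subst sum_sparse[of "[n - 2, n]"]) (use 8 assms in \<open>auto simp: laced_def\<close>)
  qed
next
  let ?p = "\<lambda>k. if k = 1 then 2 else if k = 2 then 0 else if k = n then n - 2 else k - 1"
  let ?rk = "\<lambda>k::nat. if k = 1 then 2 else if k = 2 then 1 else k"
  fix k assume "k \<in> {1..n}"
  then consider "k = 1" | "k = 2" | "k = n" "4 \<le> k" | "3 \<le> k" "k < n" using assms by fastforce
  then show "?p k \<le> n \<and> ?rk (?p k) < ?rk k \<and> ((k, ?p k, 1, 1) \<in> bonds (Aff1_D n) \<or> (?p k, k, 1, 1) \<in> bonds (Aff1_D n))"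
    by cases (use assms in \<open>simp_all, linarith?\<close>)
qed (use assms in simp_all)

text \<open>The Cartan matrix of A_{2n-1}^(2).\<close>

definition twoarm :: "nat \<Rightarrow> nat \<Rightarrow> nat \<Rightarrow> int" where
  "twoarm n i j = (if i = j then 2 else if Suc i = n \<and> j = n then -2
     else if (i = 0 \<and> j = 2) \<or> (i = 2 \<and> j = 0) \<or> (1 \<le> i \<and> j = Suc i) \<or> (1 \<le> j \<and> i = Suc j) then -1 else 0)"

lemma affine_data_twoarm:
  assumes "3 \<le> n"
  shows "affine_data n (twoarm n) (\<lambda>k. if k \<in> {0, 1, n} then 1 else 2) (\<lambda>k. if k = n then 2 else 1) 2
    (\<lambda>k. if k = 1 then 2 else if k = 2 then 0 else k - 1)
    (\<lambda>k. if k = 1 then 2 else if k = 2 then 1 else k)"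
proof
  fix i assume i: "i \<le> n"
  consider "i = 0" | "i = 1" | "i = 2" | "2 < i" "i < n" | "2 < i" "i = n"
    using i assms by linarith
  then show "(\<Sum>j\<le>n. twoarm n i j * (if j \<in> {0, 1, n} then 1 else 2)) = 0"
  proof cases
    case 1
    show ?thesis by (subst sum_sparse[of "[0, 2]"]) (use 1 assms in \<open>auto simp: twoarm_def\<close>)
  next
    case 2
    show ?thesis by (subst sum_sparse[of "[1, 2]"]) (use 2 assms in \<open>auto simp: twoarm_def\<close>)
  next
    case 3
    show ?thesis by (subst sum_sparse[of "[0, 1, 2, 3]"]) (use 3 assms in \<open>auto simp: twoarm_def\<close>)
  next
    case 4
    show ?thesis by (subst sum_sparse[of "[i - 1, i, i + 1]"]) (use 4 assms in \<open>auto simp: twoarm_def\<close>)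
  next
    case 5
    show ?thesis by (subst sum_sparse[of "[i - 1, i]"]) (use 5 assms in \<open>auto simp: twoarm_def\<close>)
  qed
qed (use assms in \<open>auto simp: twoarm_def split: if_splits\<close>)

text \<open>The Cartan matrix of D_{n+1}^(2), which for \<open>n = 1\<close> is that of A_1^(1).
  After rescaling it also serves A_{2n}^(2).\<close>

definition ladder :: "nat \<Rightarrow> nat \<Rightarrow> nat \<Rightarrow> int" where
  "ladder n i j = (if i = j then 2 else if (i = 0 \<and> j = 1) \<or> (i = n \<and> Suc j = n) then -2
     else if j = Suc i \<or> i = Suc j then -1 else 0)"

lemma affine_data_ladder:
  assumes "1 \<le> n"
  shows "affine_data n (ladder n) (\<lambda>_. 1) (\<lambda>k. if k \<in> {0, n} then 1 else 2) 2 (\<lambda>k. k - 1) (\<lambda>k. k)"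
proof
  fix i assume i: "i \<le> n"
  consider "i = 0" | "0 < i" "i < n" | "0 < i" "i = n" using i assms by linarith
  then show "(\<Sum>j\<le>n. ladder n i j * 1) = 0"
  proof cases
    case 1
    show ?thesis by (subst sum_sparse[of "[0, 1]"]) (use 1 assms in \<open>auto simp: ladder_def\<close>)
  next
    case 2
    show ?thesis by (subst sum_sparse[of "[i - 1, i, i + 1]"]) (use 2 assms in \<open>auto simp: ladder_def\<close>)
  next
    case 3
    show ?thesis by (subst sum_sparse[of "[i - 1, i]"]) (use 3 assms in \<open>auto simp: ladder_def\<close>)
  qed
qed (use assms in \<open>auto simp: ladder_def split: if_splits\<close>)

text \<open>A chain with one multiple bond: \<open>m = 2\<close>, \<open>p = 2\<close> on five nodes
  is E_6^(2), and \<open>m = 1\<close>, \<open>p = 3\<close> on three nodes is D_4^(3).\<close>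

definition onebond :: "nat \<Rightarrow> int \<Rightarrow> nat \<Rightarrow> nat \<Rightarrow> int" where
  "onebond m p i j = (if i = j then 2 else if i = m \<and> j = Suc m then - p
     else if j = Suc i \<or> i = Suc j then -1 else 0)"

lemma affine_data_E62:
  "affine_data 4 (onebond 2 2) (\<lambda>k. [1, 2, 3, 2, 1] ! k) (\<lambda>k. if k \<le> 2 then 1 else 2) 2 (\<lambda>k. k - 1) (\<lambda>k. k)"
proof
  fix i :: nat assume "i \<le> 4"
  then show "0 < [1, 2, 3, 2, 1 :: int] ! i" "(\<Sum>j\<le>4. onebond 2 2 i j * [1, 2, 3, 2, 1] ! j) = 0"
    unfolding le_4 by (elim disjE; simp add: atMost_numeral onebond_def)+
qed (auto simp: onebond_def split: if_splits)

lemma affine_data_D43: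
  "affine_data 2 (onebond 1 3) (\<lambda>k. if k = 1 then 2 else 1) (\<lambda>k. if k = 2 then 3 else 1) 3 (\<lambda>k. k - 1) (\<lambda>k. k)"
proof
  fix i :: nat assume "i \<le> 2"
  then have "i = 0 \<or> i = 1 \<or> i = 2" by auto
  then show "(\<Sum>j\<le>2. onebond 1 3 i j * (if j = 1 then 2 else 1)) = 0"
    by (elim disjE; simp add: atMost_numeral onebond_def)
qed (auto simp: onebond_def split: if_splits)

lemma kac_labelled_eqI:
  assumes K: "kac_labelled X n A" and ij: "i \<le> n" "j \<le> n" and d: "\<And>i. M i i = 2"
    and b: "\<And>i j p q. (i, j, p, q) \<in> bonds X \<Longrightarrow> M i j = - p \<and> M j i = - q"
    and z: "i \<noteq> j \<Longrightarrow> M i j \<noteq> 0 \<Longrightarrow>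
      (i, j, - M i j, - M j i) \<in> bonds X \<or> (j, i, - M j i, - M i j) \<in> bonds X"
  shows "A i j = M i j"
proof (cases "i = j")
  case True
  then show ?thesis using kac_labelled_diag[OF K] ij d by simp
next
  case False
  show ?thesis
  proof (cases "\<exists>p q. (i, j, p, q) \<in> bonds X \<or> (j, i, p, q) \<in> bonds X")
    case True
    then show ?thesis using kac_labelled_bond[OF K] b by metis
  next
    case f: False
    then show ?thesis using kac_labelled_zero[OF K ij False] z[OF False] by metis
  qed
qed

lemma A2n_entries:
  assumes "is_A2n_twisted n A"
  shows "1 \<le> n" "n = 1 \<and> A 0 1 = -4 \<or> 2 \<le> n \<and> A 0 1 = -2 \<and> A (n - 1) n = -2"
  using kac_labelled_bond[of "Aff2_A_even n" n A 0 1] kac_labelled_bond[of "Aff2_A_even n" n A "n - 1" n 2 1]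
    assms unfolding is_A2n_twisted_def by (cases "n = 1"; force simp: kac_labelled_def)+

lemma hat_data_laced:
  assumes "kac_labelled X n A" "affine_data n (laced X) a (\<lambda>_. 1) 1 par rk"
    and "\<And>i j p q. (i, j, p, q) \<in> bonds X \<Longrightarrow> p = 1 \<and> q = 1"
  shows "hat_data n (laced X) a (\<lambda>_. 1) 1 par rk A False (\<lambda>_. 1)"
proof (rule affine_data.hat_data_untwisted[OF assms(2)])
  show e: "A i j = laced X i j" if "i \<le> n" "j \<le> n" for i j by (rule laced_eq[OF assms(1,3) that])
  show "\<not> is_A2n_twisted n A"
  proof
    assume "is_A2n_twisted n A"
    then show False using A2n_entries[of n A] e[of 0 1] by (auto simp: laced_def split: if_splits)
  qed
qed

lemma hat_data_ladder:
  assumes "1 \<le> n" "\<And>i j. i \<le> n \<Longrightarrow> j \<le> n \<Longrightarrow> A i j = ladder n i j"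
  shows "hat_data n (ladder n) (\<lambda>_. 1) (\<lambda>k. if k \<in> {0, n} then 1 else 2) 2 (\<lambda>k. k - 1) (\<lambda>k. k) A False (\<lambda>_. 1)"
proof (rule affine_data.hat_data_untwisted[OF affine_data_ladder[OF assms(1)] assms(2)])
  show "\<not> is_A2n_twisted n A"
  proof
    assume "is_A2n_twisted n A"
    then show False using A2n_entries[of n A] assms(2)[of 0 1] assms(2)[of "n - 1" n] by (auto simp: ladder_def split: if_splits)
  qed
qed

lemma hat_data_exists:
  assumes K: "kac_labelled X n A" and X: "X \<notin> range Aff1_B \<union> range Aff1_C \<union> {Aff1_F, Aff1_G}"
  shows "\<exists>c a e r par rk h g. hat_data n c a e r par rk A h g"
proof -
  have v: "valid_type X" "n = type_rank X" using K by (auto simp: kac_labelled_def)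
  have ex: ?thesis if "hat_data n c a e r par rk A h g" for c a e r par rk h g
    by (intro exI) (rule that)
  show ?thesis
  proof (cases X)
    case (Aff1_A m)
    then have m: "m = n" using v(2) by simp
    show ?thesis
    proof (cases "n = 1")
      case True
      have "A i j = ladder n i j" if "i \<le> n" "j \<le> n" for i j
        by (rule kac_labelled_eqI[OF K that]) (use that True m Aff1_A in \<open>auto simp: ladder_def split: if_splits\<close>)
      then show ?thesis using True by (intro ex[OF hat_data_ladder]) simp_all
    next
      case False
      then have "2 \<le> n" using v(1) m Aff1_A by simp
      then have "hat_data n (laced X) (\<lambda>_. 1) (\<lambda>_. 1) 1 (\<lambda>k. k - 1) (\<lambda>k. k) A False (\<lambda>_. 1)"
        by (intro hat_data_laced[OF K])
          (use affine_data_cycle[of n] False Aff1_A m in \<open>auto simp del: One_nat_def split: if_splits\<close>)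
      then show ?thesis by (rule ex)
    qed
  next
    case (Aff1_D m)
    then have m: "m = n" "4 \<le> n" using v by auto
    have "hat_data n (laced X) (\<lambda>k. if k \<in> {0, 1, n - 1, n} then 1 else 2) (\<lambda>_. 1) 1
      (\<lambda>k. if k = 1 then 2 else if k = 2 then 0 else if k = n then n - 2 else k - 1)
      (\<lambda>k. if k = 1 then 2 else if k = 2 then 1 else k) A False (\<lambda>_. 1)"
      by (rule hat_data_laced[OF K]) (use affine_data_D[OF m(2)] Aff1_D m(1) in auto)
    then show ?thesis by (rule ex)
  next
    case (Aff1_E m)
    have E: ?thesis if "affine_data n (laced X) a (\<lambda>_. 1) 1 par rk" for a par rk
      by (rule ex[OF hat_data_laced[OF K that]]) (use Aff1_E in \<open>auto split: if_splits\<close>)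
    have n: "X = Aff1_E n" "n \<in> {6, 7, 8}" using v Aff1_E by simp_all
    from n(2) consider "n = 6" | "n = 7" | "n = 8" by blast
    then show ?thesis
    proof cases
      case 1
      show ?thesis by (rule E) (unfold n(1) 1, rule affine_data_E6)
    next
      case 2
      show ?thesis by (rule E) (unfold n(1) 2, rule affine_data_E7)
    next
      case 3
      show ?thesis by (rule E) (unfold n(1) 3, rule affine_data_E8)
    qed
  next
    case (Aff2_A_even m)
    define g :: "nat \<Rightarrow> real" where "g j = (if j = n then 1 / 2 else 1)" for j
    have m: "m = n" "1 \<le> n" using v Aff2_A_even by auto
    have K': "kac_labelled (Aff2_A_even n) n A" using K Aff2_A_even m by simp
    define M :: "nat \<Rightarrow> nat \<Rightarrow> int" where "M i j = (if i = j then 2 else if n = 1 \<and> i = 0 \<and> j = 1 then -4 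
      else if (i = 0 \<and> j = 1) \<or> (Suc i = n \<and> j = n) then -2 else if j = Suc i \<or> i = Suc j then -1 else 0)" for i j
    have A: "A i j = M i j" if "i \<le> n" "j \<le> n" for i j
    proof (rule kac_labelled_eqI[OF K' that])
      show "M i i = 2" for i by (simp add: M_def)
      show "M i j = - p \<and> M j i = - q" if "(i, j, p, q) \<in> bonds (Aff2_A_even n)" for i j p q
        by (cases "n = 1") (use m(2) that in \<open>auto simp: M_def\<close>)
      assume "i \<noteq> j" "M i j \<noteq> 0"
      then show "(i, j, - M i j, - M j i) \<in> bonds (Aff2_A_even n) \<or> (j, i, - M j i, - M i j) \<in> bonds (Aff2_A_even n)"
        by (cases "n = 1") (use m(2) that in \<open>auto simp: M_def split: if_splits\<close>)
    qed
    interpret affine_data n "ladder n" "\<lambda>_. 1" "\<lambda>k. if k \<in> {0, n} then 1 else 2" 2 "\<lambda>k. k - 1" "\<lambda>k. k"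
      by (rule affine_data_ladder[OF m(2)])
    have "hat_data n (ladder n) (\<lambda>_. 1) (\<lambda>k. if k \<in> {0, n} then 1 else 2) 2 (\<lambda>k. k - 1) (\<lambda>k. k) A True g"
    proof (rule hat_dataI)
      show "g j = (if True \<and> j = n then 1 / 2 else 1)" for j by (simp add: g_def)
      show "True \<longleftrightarrow> is_A2n_twisted n A" using K' by (simp add: is_A2n_twisted_def)
      \<comment> \<open>Halving alpha_n doubles the last row and halves the last column off the
        diagonal, which turns the matrix into that of D_{n+1}^(2).\<close>
      show "real_of_int (ladder n i j) = real_of_int (A i j) * g j / g i" if "i \<le> n" "j \<le> n" for i j
        using that m(2) by (auto simp: A M_def ladder_def g_def)
    qed simp
    then show ?thesis by (rule ex)
  next
    case (Aff2_A_odd m)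
    have m: "m = n" "3 \<le> n" using v Aff2_A_odd by auto
    obtain k where k: "n = Suc k" "2 \<le> k" using m(2) by (cases n) auto
    have X_eq: "X = Aff2_A_odd (Suc k)" using Aff2_A_odd m k by simp
    have "A i j = twoarm n i j" if "i \<le> n" "j \<le> n" for i j
    proof (rule kac_labelled_eqI[OF K that])
      show "twoarm n i i = 2" for i by (simp add: twoarm_def)
      show "twoarm n i j = - p \<and> twoarm n j i = - q" if "(i, j, p, q) \<in> bonds X" for i j p q
        using k(2) that unfolding k(1) X_eq by (auto simp: twoarm_def)
      assume "i \<noteq> j" "twoarm n i j \<noteq> 0"
      then show "(i, j, - twoarm n i j, - twoarm n j i) \<in> bonds X \<or> (j, i, - twoarm n j i, - twoarm n i j) \<in> bonds X"
        using k(2) that unfolding k(1) X_eq by (auto simp: twoarm_def split: if_splits)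
    qed
    moreover from this[of 0 1] have "\<not> is_A2n_twisted n A"
      using A2n_entries[of n A] m by (auto simp: twoarm_def)
    ultimately show ?thesis by (intro ex[OF affine_data.hat_data_untwisted[OF affine_data_twoarm[OF m(2)]]])
  next
    case (Aff2_D m)
    have m: "m = n" "2 \<le> n" using v Aff2_D by auto
    obtain k where k: "n = Suc k" "1 \<le> k" using m(2) by (cases n) auto
    have X_eq: "X = Aff2_D (Suc k)" using Aff2_D m k by simp
    have "A i j = ladder n i j" if "i \<le> n" "j \<le> n" for i j
    proof (rule kac_labelled_eqI[OF K that])
      show "ladder n i i = 2" for i by (simp add: ladder_def)
      show "ladder n i j = - p \<and> ladder n j i = - q" if "(i, j, p, q) \<in> bonds X" for i j p q
        using k(2) that unfolding k(1) X_eq by (auto simp: ladder_def)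
      assume "i \<noteq> j" "ladder n i j \<noteq> 0"
      then show "(i, j, - ladder n i j, - ladder n j i) \<in> bonds X \<or> (j, i, - ladder n j i, - ladder n i j) \<in> bonds X"
        using k(2) that unfolding k(1) X_eq by (auto simp: ladder_def split: if_splits)
    qed
    then show ?thesis using m by (intro ex[OF hat_data_ladder]) simp_all
  next
    case Aff2_E
    have n: "n = 4" using v Aff2_E by simp
    have "A i j = onebond 2 2 i j" if "i \<le> n" "j \<le> n" for i j
    proof (rule kac_labelled_eqI[OF K that])
      show "onebond 2 2 i i = 2" for i by (simp add: onebond_def)
      show "onebond 2 2 i j = - p \<and> onebond 2 2 j i = - q" if "(i, j, p, q) \<in> bonds X" for i j p q
        using that unfolding Aff2_E bonds.simps insert_iff empty_iff prod.inject
        by (elim disjE conjE FalseE; hypsubst; simp add: onebond_def)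
      assume "i \<noteq> j" "onebond 2 2 i j \<noteq> 0"
      then show "(i, j, - onebond 2 2 i j, - onebond 2 2 j i) \<in> bonds X \<or> (j, i, - onebond 2 2 j i, - onebond 2 2 i j) \<in> bonds X"
        using that unfolding Aff2_E n le_4 le_2 by (elim disjE; simp add: onebond_def)
    qed
    moreover from this[of 0 1] have "\<not> is_A2n_twisted n A"
      using A2n_entries[of n A] n by (auto simp: onebond_def)
    ultimately show ?thesis using n by (intro ex[OF affine_data.hat_data_untwisted[OF affine_data_E62, folded n]])
  next
    case Aff3_D
    have n: "n = 2" using v Aff3_D by simp
    have "A i j = onebond 1 3 i j" if "i \<le> n" "j \<le> n" for i j
    proof (rule kac_labelled_eqI[OF K that])
      show "onebond 1 3 i i = 2" for i by (simp add: onebond_def)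
      show "onebond 1 3 i j = - p \<and> onebond 1 3 j i = - q" if "(i, j, p, q) \<in> bonds X" for i j p q
        using that unfolding Aff3_D bonds.simps insert_iff empty_iff prod.inject
        by (elim disjE conjE FalseE; hypsubst; simp add: onebond_def)
      assume "i \<noteq> j" "onebond 1 3 i j \<noteq> 0"
      then show "(i, j, - onebond 1 3 i j, - onebond 1 3 j i) \<in> bonds X \<or> (j, i, - onebond 1 3 j i, - onebond 1 3 i j) \<in> bonds X"
        using that unfolding Aff3_D n le_4 le_2 by (elim disjE; simp add: onebond_def)
    qed
    moreover from this[of 0 1] have "\<not> is_A2n_twisted n A"
      using A2n_entries[of n A] n by (auto simp: onebond_def)
    ultimately show ?thesis using n by (intro ex[OF affine_data.hat_data_untwisted[OF affine_data_D43, folded n]])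
  qed (use X in auto)
qed

theorem theorem4p5:
  fixes n :: nat and A :: "nat \<Rightarrow> nat \<Rightarrow> int" and X :: affine_type and js :: "nat list"
  assumes "irreducible_affine_cartan n A"
    and "kac_labelled X n A"
    and "X \<notin> range Aff1_B \<union> range Aff1_C \<union> {Aff1_F, Aff1_G}"
    and "reduced_decomposition n A js (s_theta n A)"
  shows "(\<exists>!a. is_aut_a n A js a) \<and> (\<exists>!b. is_aut_b n A js b) \<and>
    (\<forall>a b. is_aut_a n A js a \<and> is_aut_b n A js b \<longrightarrow>
      (\<exists>\<Upsilon>. group_hom B3 (frakG n A) \<Upsilon> \<and> \<Upsilon> B3_a = a \<and> \<Upsilon> B3_b = b))"
proof -
  obtain c a e r par rk h g where H: "hat_data n c a e r par rk A h g"
    using hat_data_exists[OF assms(2,3)] by (elim exE)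
  show ?thesis by (rule hat_data.braid_group_action[OF H assms(4)])
qed

end
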